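(* Let $w\ge 5$ be an integer and set $v=w-1$, $u=w-2$, $q=w-3$. Let $\sum'$ denote the sum over $(a,b,c,d)\in\mathbb{N}^4$ with $a+b+c+d=w$ and $a\ge2$. Then \begin{align*} &\sum{}'2^{a+c}\big(2^{a-1}3^b-3^b-1\big)\zeta(a,b,c,d)=\Big(2+\frac{(w-3)(w+2)(w+7)}{12}\Big)\zeta(w),\\ &\sum{}'2^{a+c}\big(2^{a-1}3^b-3^b-1\big)T(a,b,c,d)=4\binom{v}{3}T(w),\\ &\sum{}'2^{a+c}\big(2^{a-1}3^b-3^b-1\big)\zeta(\bar a,b,c,d)=\frac{(w-1)(w^2-5w+18)}{12}\zeta(w)+w(w-3)\zeta(\bar w)+4\big(T(v,1)+T(u,2)\big)\\ &\qquad-\big(4\zeta(\bar1)^2+2\zeta(2)\big)T(u)+4q\big(\zeta(v,1)-\zeta(\bar v,\bar1)-\zeta(\bar1)T(v)\big)\\ &\qquad+8\Big(\zeta(\bar1)\big(\zeta(u,1)-\zeta(\bar u,\bar1)\big)-\zeta(u,1,\bar1)+\zeta(\bar u,\bar1,\bar1)\Big). \end{align*}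
   Context: Euler sums: for $(s_1,\dots,s_d)\in\mathbb{N}^d$, $(\mu_1,\dots,\mu_d)\in\{\pm1\}^d$ with $(s_1,\mu_1)\ne(1,1)$, $\zeta(s_1,\dots,s_d;\mu_1,\dots,\mu_d)=\sum_{k_1>\cdots>k_d>0}\frac{\mu_1^{k_1}\cdots\mu_d^{k_d}}{k_1^{s_1}\cdots k_d^{s_d}}$; a bar on an argument $\bar s_j$ means $\mu_j=-1$, no bar means $\mu_j=1$ (so unbarred values are multiple zeta values, and $\zeta(\bar1)=-\log2$). Multiple $T$-values: for $s_1\ge2$, $T(s_1,\dots,s_d)=\sum\frac{2^d}{k_1^{s_1}\cdots k_d^{s_d}}$ over $k_1>\cdots>k_d>0$ with $k_j\equiv d-j+1\pmod 2$ for all $j$. (The paper writes some terms as incomplete multiple mixed values: $M_2(\breve v,e_1)=\zeta(v,1)-\zeta(\bar v,\bar1)$, $M_2(\breve u,e_1)=\zeta(u,1)-\zeta(\bar u,\bar1)$, $M_{23}(\breve u,e_1,\bar1)=\zeta(u,1,\bar1)-\zeta(\bar u,\bar1,\bar1)$; these have been expanded above.) *)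

theory Defs
  imports "HOL-Analysis.Analysis"
begin

text \<open>Index tuples \<open>N \<ge> k\<^sub>1 > \<dots> > k\<^sub>d > 0\<close>, as lists; \<open>k\<^sub>j\<close> is \<open>k ! (j - 1)\<close>.\<close>

definition decr_tuples :: "nat \<Rightarrow> nat \<Rightarrow> nat list set" where
  "decr_tuples d N = {k. length k = d \<and> sorted_wrt (>) k \<and> set k \<subseteq> {1..N}}"

lemma finite_decr_tuples: "finite (decr_tuples d N)"
  by (rule finite_subset[OF _ finite_lists_length_eq[of "{1..N}" d]])
     (auto simp: decr_tuples_def)

text \<open>
  The series is read as the limit of the partial sums over \<open>k\<^sub>1 \<le> N\<close>, since it converges only
  conditionally when \<open>(s\<^sub>1, \<mu>\<^sub>1) = (1, -1)\<close>. The value is meaningful for lists of equal length,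
  \<open>s\<^sub>j \<ge> 1\<close>, \<open>\<mu>\<^sub>j \<in> {1, -1}\<close> and \<open>(s\<^sub>1, \<mu>\<^sub>1) \<noteq> (1, 1)\<close>. A barred argument of \<open>\<zeta>\<close> corresponds to the
  entry \<open>-1\<close> in the second list, an unbarred one to \<open>1\<close>.
\<close>

definition euler_sum :: "nat list \<Rightarrow> int list \<Rightarrow> real" where
  "euler_sum s \<mu> = lim (\<lambda>N. \<Sum>k\<in>decr_tuples (length s) N.
     \<Prod>i<length s. real_of_int (\<mu> ! i) ^ (k ! i) / real (k ! i) ^ (s ! i))"

text \<open>
  Multiple \<open>T\<close>-values, meaningful for \<open>s\<^sub>1 \<ge> 2\<close>. With \<open>i = j - 1\<close>, the condition
  \<open>k\<^sub>j \<equiv> d - j + 1 (mod 2)\<close> becomes \<open>k ! i \<equiv> d - i (mod 2)\<close>.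
\<close>

definition mtv :: "nat list \<Rightarrow> real" where
  "mtv s = lim (\<lambda>N. \<Sum>k | k \<in> decr_tuples (length s) N \<and>
       (\<forall>i<length s. (k ! i) mod 2 = (length s - i) mod 2).
     2 ^ length s / (\<Prod>i<length s. real (k ! i) ^ (s ! i)))"

definition weight_quads :: "nat \<Rightarrow> (nat \<times> nat \<times> nat \<times> nat) set" where
  "weight_quads w = {(a, b, c, d). 2 \<le> a \<and> 1 \<le> b \<and> 1 \<le> c \<and> 1 \<le> d \<and> a + b + c + d = w}"

lemma finite_weight_quads: "finite (weight_quads w)"
  by (rule finite_subset[of _ "{..w} \<times> {..w} \<times> {..w} \<times> {..w}"])
     (auto simp: weight_quads_def)

end

theory Submission
  imports Defs "HOL-Real_Asymp.Real_Asymp"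
begin

text \<open>
  The three left-hand sides are the coefficients of \<open>x ^ (w - 4)\<close> of one generating function \<open>K\<close> with three weights. In terms
  of the gaps of an index tuple its summand is a rational function, and averaging this function over the permutations of the
  four gaps gives \<open>K = K\<^sub>2\<^sup>2 / 2 + 2 R\<close>, where \<open>K\<^sub>2\<close> is the sum of \<open>2 x u\<^sub>k u\<^sub>l / (k + l)\<close> with \<open>u\<^sub>k = 1 / (k - x)\<close> and \<open>R\<close> is the
  same sum weighted by \<open>\<beta>\<^sub>l\<close>, a nested sum below \<open>l\<close>. Truncated to \<open>k, l \<le> N\<close>, both double sums collapse by partial fractions to
  sums over one pole, up to boundary terms; the boundary terms do not vanish, but their limits cancel in \<open>K(x) - K(0)\<close>, and
  \<open>K(0) = 0\<close>. Hence \<open>K(x)\<close> is the sum over \<open>p\<close> of the principal parts \<open>u\<^sub>p\<^sup>4 / 2 + 2 \<phi>\<^sub>p u\<^sub>p\<^sup>3 + d\<^sub>p u\<^sub>p\<^sup>2 + c\<^sub>p u\<^sub>p\<close>, each minus its value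
  at \<open>x = 0\<close>. The numbers \<open>c\<^sub>p, d\<^sub>p\<close> are limits of harmonic sums with closed forms (they are \<open>0\<close> for \<open>T\<close>-values), and comparing
  coefficients of \<open>x ^ (w - 4)\<close> gives the three formulas.
\<close>

section \<open>Finite double sums with the kernel \<open>1 / (k + l)\<close>\<close>

text \<open>The coefficient is a difference of three products of powers, so \<open>K\<close> is
  built from geometric series. The leading one has the factors k1 - 4x, k2 - 3x, k3 - 2x, k4 - x,
  each the sum of (gap - x) over the gaps it contains; hence the average of 1/((k1 - 4x)(k2 - 3x)(k3
  - 2x)(k4 - x)) over the orders of the gaps is 1/24 of the product of the 1/(gap - x). The obstacle
  comes afterwards: the kernel 1/(k + l) makes the sums converge, and partial fractions tear it into
  pieces that grow with log N. Therefore all identities are exact for finite sums, and limits are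
  taken only when one pole is left. Up to o(1), the boundary terms depend on x only through (a(x)^2
  - 2 rho(x)) P_N, where a(x) is the regularised sum of the u_k, rho(x) a correction, and P_N is
  free of x. For s = -1, P_N tends to 0. For s = 1, the expression that a(x)^2 - 2 rho(x)
  regularises has the same one-pole form as K2, so the two differ by a constant; this is exactly
  what completes the square of K2.\<close>

lemma sum_triangle_swap:
  fixes G :: "nat \<Rightarrow> nat \<Rightarrow> real"
  shows "(\<Sum>l=a..N. \<Sum>q=a..<l. G q l) = (\<Sum>q=a..N. \<Sum>l=Suc q..N. G q l)"
proof (induction N)
  case 0
  then show ?case by (cases "a = 0") auto
next
  case (Suc N)
  show ?case
  proof (cases "a \<le> Suc N")
    case True
    have "(\<Sum>l=a..Suc N. \<Sum>q=a..<l. G q l) = (\<Sum>q=a..N. \<Sum>l=Suc q..N. G q l) + (\<Sum>q=a..N. G q (Suc N))"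
      using True Suc by (simp add: sum.cl_ivl_Suc atLeastLessThanSuc_atLeastAtMost)
    also have "\<dots> = (\<Sum>q=a..N. \<Sum>l=Suc q..Suc N. G q l)"
      unfolding sum.distrib[symmetric] by (intro sum.cong) (auto simp: sum.cl_ivl_Suc)
    also have "\<dots> = (\<Sum>q=a..Suc N. \<Sum>l=Suc q..Suc N. G q l)"
      using True by (simp add: sum.cl_ivl_Suc)
    finally show ?thesis .
  qed auto
qed

text \<open>The pairs \<open>(g, s) = (1, 1), (1, -1), (2, 1)\<close> belong to the sums of \<open>\<zeta>(a, b, c, d)\<close>, of \<open>\<zeta>(a, b, c, d)\<close> with barred \<open>a\<close>,
  and of \<open>T(a, b, c, d)\<close>: a positive integer \<open>n\<close> carries the weight \<open>s ^ n\<close> and must be \<open>1\<close> modulo \<open>g\<close>.\<close>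

locale sgn_grading =
  fixes g :: nat and s :: real
  assumes gs: "(g = 1 \<and> (s = 1 \<or> s = -1)) \<or> (g = 2 \<and> s = 1)"
begin

text \<open>For \<open>g = 1\<close> both indicators are constantly 1. For \<open>g = 2\<close> the
  gaps, and with them the poles, are odd, while sums and differences of two of them are even:
  \<open>od\<close> guards the poles, and \<open>e\<close> everything that arises by combining two
  poles.\<close>

definition e :: "nat \<Rightarrow> real" where "e k = of_bool (k mod g = 0)"
definition od :: "nat \<Rightarrow> real" where "od k = of_bool (k mod g = 1 mod g)"
definition f :: "nat \<Rightarrow> real" where "f i = s ^ i * e i"
definition h :: "nat \<Rightarrow> real" where "h n = (\<Sum>i=1..n. f i / real i)"
definition vv :: "nat \<Rightarrow> real" where "vv q = e q / real q"
definition ph :: "nat \<Rightarrow> real" where "ph l = f l / real l"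
definition uu :: "real \<Rightarrow> nat \<Rightarrow> real" where "uu x k = od k / (real k - x)"
definition UU :: "real \<Rightarrow> nat \<Rightarrow> real" where "UU x n = (\<Sum>k=1..n. uu x k)"
definition bb :: "real \<Rightarrow> nat \<Rightarrow> real" where "bb x q = vv q * UU x (q - 1)"
text \<open>\<open>l\<close>, \<open>q\<close>, \<open>j\<close> play the roles of k2, k3, k4, and
  the other index \<open>k\<close> of the double sums that of the gap k1 - k2, so that
  \<open>k + l\<close> is k1.\<close>

definition be :: "real \<Rightarrow> nat \<Rightarrow> real" where "be x l = (\<Sum>q=1..<l. bb x q)"
text \<open>The defect at the upper end of the range: the kernels \<open>1 / (l - k)\<close> and
  \<open>1 / (l + k)\<close>, summed over \<open>l\<close> up to \<open>N\<close>, end at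
  \<open>h (N - k)\<close> and at \<open>h (N + k)\<close>.\<close>

definition th :: "nat \<Rightarrow> nat \<Rightarrow> real" where "th N k = h (N + k) - h (N - k)"
text \<open>The contribution of the lower end when \<open>1 / (l - k)\<close> is summed over
  \<open>l > q\<close> with \<open>l\<close> different from \<open>k\<close>: for
  \<open>k > q\<close> the terms below \<open>k\<close> are mirrored at \<open>k\<close> and count
  negatively.\<close>

definition hh :: "nat \<Rightarrow> nat \<Rightarrow> real" where "hh q k = (if k \<le> q then h (q - k) else h (k - q - 1))"

lemma ss [simp]: "s * s = 1" "s ^ 2 = 1" using gs by auto
lemma s_nz [simp]: "s \<noteq> 0" using gs by auto
lemma s_abs [simp]: "\<bar>s\<bar> = 1" using gs by auto

lemma s_pow_sq [simp]: "s ^ n * s ^ n = 1"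
  by (metis power_mult_distrib power_one ss(1))

lemma s_sub: "k \<le> l \<Longrightarrow> s ^ (l - k) = s ^ (k + l)"
proof -
  assume "k \<le> l"
  then have "s ^ (k + l) = s ^ (l - k) * (s ^ k * s ^ k)"
    by (metis add.commute le_add_diff_inverse2 mult.assoc power_add)
  then show ?thesis by simp
qed

lemma od_od_sub: "k \<le> m \<Longrightarrow> od k * od m = od k * e (m - k)"
  using gs by (auto simp: od_def e_def) presburger+
lemma od_od_sub': "k \<le> m \<Longrightarrow> od k * od m = od m * e (m - k)"
  using gs by (auto simp: od_def e_def) presburger+
lemma od_od_add: "od k * od l = od k * e (k + l)"
  using gs by (auto simp: od_def e_def) presburger+
lemma e_e_add: "e q * e r = e q * e (q + r)"
  using gs by (auto simp: e_def) presburger+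
lemma e_e_sub: "t \<le> q \<Longrightarrow> e q * e t = e q * e (q - t)"
  using gs by (auto simp: e_def) presburger+
lemma e_e_sub': "t \<le> q \<Longrightarrow> e q * e t = e t * e (q - t)"
  using gs by (auto simp: e_def) presburger+
lemma od_idem [simp]: "od k * od k = od k" by (auto simp: od_def)
lemma e_idem [simp]: "e k * e k = e k" by (auto simp: e_def)
lemma od_uu [simp]: "od k * uu x k = uu x k" by (auto simp: uu_def od_def)
lemma e_vv [simp]: "e k * vv k = vv k" by (auto simp: vv_def e_def)

lemma h_0 [simp]: "h 0 = 0" by (simp add: h_def)
lemma h_Suc: "h (Suc n) = h n + f (Suc n) / real (Suc n)" by (simp add: h_def)

lemma h_diff: "a \<le> b \<Longrightarrow> (\<Sum>l=Suc a..b. f l / real l) = h b - h a"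
  by (induction b rule: dec_induct) (auto simp: h_Suc)

lemma h_sub:
  assumes "k \<le> a" "a \<le> b"
  shows "(\<Sum>l=Suc a..b. f (l - k) / real (l - k)) = h (b - k) - h (a - k)"
  using assms(2)
proof (induction b rule: dec_induct)
  case (step n)
  then have "Suc n - k = Suc (n - k)" using assms by auto
  then show ?case using step by (simp add: h_Suc)
qed auto

lemma h_add:
  assumes "a \<le> b"
  shows "(\<Sum>l=Suc a..b. f (l + k) / real (l + k)) = h (b + k) - h (a + k)"
  using assms by (induction b rule: dec_induct) (auto simp: h_Suc)

lemma h_rev:
  assumes "a < k"
  shows "(\<Sum>l=Suc a..<k. f (k - l) / real (k - l)) = h (k - a - 1)"
proof -
  have "(\<Sum>l=Suc a..<k. f (k - l) / real (k - l)) = (\<Sum>i=1..k - a - 1. f i / real i)"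
    using assms by (intro sum.reindex_bij_witness[of _ "\<lambda>i. k - i" "\<lambda>l. k - l"]) auto
  then show ?thesis by (simp add: h_def)
qed

lemma h_rev':
  assumes "a \<le> k"
  shows "(\<Sum>l=a..<k. f (k - l) / real (k - l)) = h (k - a)"
proof -
  have "(\<Sum>l=a..<k. f (k - l) / real (k - l)) = (\<Sum>i=1..k - a. f i / real i)"
    using assms by (intro sum.reindex_bij_witness[of _ "\<lambda>i. k - i" "\<lambda>l. k - l"]) auto
  then show ?thesis by (simp add: h_def)
qed

lemma uu_pf:
  assumes "real k \<noteq> x" "real m \<noteq> x" "k \<noteq> m"
  shows "uu x k * uu x m = uu x m * od k / (real k - real m) + uu x k * od m / (real m - real k)"
proof -
  have "1 / (K * M) = 1 / M / (K - M) + 1 / K / (M - K)" if "K \<noteq> 0" "M \<noteq> 0" "K \<noteq> M" for K M :: real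
  proof -
    have "1 / M / (K - M) + 1 / K / (M - K) = (1 / M - 1 / K) / (K - M)"
      by (metis (no_types, opaque_lifting) add_uminus_conv_diff diff_divide_distrib minus_diff_eq minus_divide_right)
    also have "1 / M - 1 / K = (K - M) * (1 / (K * M))" using that by (simp add: field_simps)
    finally show ?thesis using that by simp
  qed
  from this[of "real k - x" "real m - x"] assms
  have *: "1 / ((real k - x) * (real m - x)) = 1 / (real m - x) / (real k - real m) + 1 / (real k - x) / (real m - real k)"
    by simp
  have "uu x k * uu x m = od k * od m * (1 / ((real k - x) * (real m - x)))" by (simp add: uu_def)
  also have "\<dots> = uu x m * od k / (real k - real m) + uu x k * od m / (real m - real k)"
    unfolding * by (simp add: uu_def algebra_simps)
  finally show ?thesis .
qed

text \<open>The factor \<open>uu x k\<close> supplies \<open>od k\<close>, which converts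
  \<open>od l\<close> into \<open>e (l - k)\<close>; only then is the sum over \<open>l\<close> a
  difference of values of \<open>h\<close>.\<close>

lemma uu_ker:
  assumes "1 \<le> k" "k \<le> N" "q \<le> N"
  shows "uu x k * (\<Sum>l\<in>{Suc q..N} - {k}. s ^ (k + l) * od l / (real l - real k)) = uu x k * (h (N - k) - hh q k)"
proof -
  have up: "uu x k * (s ^ (k + l) * od l / (real l - real k)) = uu x k * (f (l - k) / real (l - k))" if "k < l" for l
  proof -
    have "uu x k * od l = uu x k * e (l - k)"
      using od_od_sub[of k l] that by (simp add: uu_def)
    moreover have "f (l - k) / real (l - k) = s ^ (k + l) * e (l - k) / (real l - real k)"
      using that s_sub[of k l] by (simp add: f_def of_nat_diff)
    moreover have "uu x k * (s ^ (k + l) * od l / (real l - real k)) = s ^ (k + l) * (uu x k * od l) / (real l - real k)"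
      by (simp add: mult_ac)
    ultimately show ?thesis by (simp only:) (simp add: mult_ac)
  qed
  have dn: "uu x k * (s ^ (k + l) * od l / (real l - real k)) = - uu x k * (f (k - l) / real (k - l))" if "l < k" for l
  proof -
    have "uu x k * od l = uu x k * e (k - l)"
      using od_od_sub'[of l k] that by (simp add: uu_def mult.commute[of "od k" "od l"])
    moreover have "1 / (real l - real k) = - (1 / (real k - real l))"
      by (metis minus_diff_eq minus_divide_right)
    moreover have "f (k - l) / real (k - l) = s ^ (k + l) * e (k - l) * (1 / (real k - real l))"
      using that s_sub[of l k] by (simp add: f_def of_nat_diff add.commute)
    moreover have "uu x k * (s ^ (k + l) * od l / (real l - real k)) = s ^ (k + l) * (uu x k * od l) * (1 / (real l - real k))"
      by (simp add: mult_ac)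
    ultimately show ?thesis by (simp only:) (simp add: mult_ac)
  qed
  have upS: "uu x k * (\<Sum>l=Suc a..N. s ^ (k + l) * od l / (real l - real k)) = uu x k * (h (N - k) - h (a - k))"
    if "k \<le> a" "a \<le> N" for a
    unfolding h_sub[OF that, symmetric] sum_distrib_left using that by (intro sum.cong refl up) auto
  show ?thesis
  proof (cases "k \<le> q")
    case True
    then have "{Suc q..N} - {k} = {Suc q..N}" by auto
    then show ?thesis using upS[of q] True assms by (simp add: hh_def)
  next
    case False
    then have "{Suc q..N} - {k} = {Suc q..<k} \<union> {Suc k..N}" using assms by auto
    then have "uu x k * (\<Sum>l\<in>{Suc q..N} - {k}. s ^ (k + l) * od l / (real l - real k)) =
       uu x k * (\<Sum>l=Suc q..<k. s ^ (k + l) * od l / (real l - real k)) + uu x k * (\<Sum>l=Suc k..N. s ^ (k + l) * od l / (real l - real k))"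
      by (simp add: sum.union_disjoint distrib_left disjoint_iff)
    moreover have "uu x k * (\<Sum>l=Suc q..<k. s ^ (k + l) * od l / (real l - real k)) = - uu x k * h (k - q - 1)"
      unfolding h_rev[OF False[unfolded not_le], symmetric] sum_distrib_left by (intro sum.cong refl dn) auto
    ultimately show ?thesis using upS[of k] False assms by (simp add: hh_def algebra_simps)
  qed
qed

lemma uu_ker_add:
  assumes "a \<le> N"
  shows "uu x k * (\<Sum>l=Suc a..N. s ^ (k + l) * od l / (real k + real l)) = uu x k * (h (N + k) - h (a + k))"
proof -
  have "uu x k * (s ^ (k + l) * od l / (real k + real l)) = uu x k * (f (l + k) / real (l + k))" for l
  proof -
    have "uu x k * od l = uu x k * e (k + l)"
      using od_od_add[of k l] by (simp add: uu_def)
    moreover have "uu x k * (s ^ (k + l) * od l / (real k + real l)) = s ^ (k + l) * (uu x k * od l) / (real k + real l)"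
      by (simp add: mult_ac)
    ultimately show ?thesis by (simp only:) (simp add: f_def mult_ac add_ac)
  qed
  then show ?thesis unfolding h_add[OF assms, symmetric] sum_distrib_left by simp
qed

lemma be_swap: "(\<Sum>l=1..N. be x l * F l) = (\<Sum>q=1..N. bb x q * (\<Sum>l=Suc q..N. F l))"
  unfolding be_def sum_distrib_right sum_distrib_left by (rule sum_triangle_swap)

text \<open>Two partial fraction steps. \<open>A\<close> splits the kernel, because (k + l) - (k -
  x) - (l - x) = 2x; then a product of two different poles is split by \<open>uu_pf\<close>. In each
  term one index no longer carries a pole and sums to values of \<open>h\<close>. The last double
  sum is what still couples \<open>k\<close> with the inner index \<open>q\<close>;
  \<open>rotation\<close> treats it.\<close>

lemma double_kernel:
  assumes nz: "\<And>k. 1 \<le> k \<Longrightarrow> real k \<noteq> x"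
  shows "(\<Sum>k=1..N. \<Sum>l=1..N. be x l * (s ^ (k + l) * (2 * x) * uu x k * uu x l / (real k + real l)))
    = (\<Sum>l=1..N. be x l * (uu x l)\<^sup>2) + (\<Sum>l=1..N. be x l * uu x l * ph l)
      - (\<Sum>l=1..N. be x l * uu x l * th N l) - (\<Sum>q=1..N. bb x q) * (\<Sum>k=1..N. th N k * uu x k)
      + (\<Sum>k=1..N. \<Sum>q=1..N. uu x k * bb x q * (h (q + k) - hh q k))"
proof -
  have A: "s ^ (k + l) * (2 * x) * uu x k * uu x l / (real k + real l) =
      s ^ (k + l) * (uu x k * uu x l) - uu x k * (s ^ (k + l) * od l / (real k + real l)) - uu x l * (s ^ (l + k) * od k / (real l + real k))"
    if "1 \<le> k" "1 \<le> l" for k l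
  proof -
    have p: "real k + real l \<noteq> 0" using that by auto
    have n: "real k - x \<noteq> 0" "real l - x \<noteq> 0" using nz that by auto
    have "(2 * x) / ((real k - x) * (real l - x) * (real k + real l)) =
       1 / ((real k - x) * (real l - x)) - 1 / ((real k - x) * (real k + real l)) - 1 / ((real l - x) * (real k + real l))"
      using p n by (simp add: divide_simps)
    note pf = this
    have c: "s ^ (l + k) = s ^ (k + l)" "real l + real k = real k + real l" by (simp_all add: add.commute)
    have "s ^ (k + l) * (2 * x) * uu x k * uu x l / (real k + real l) =
        s ^ (k + l) * od k * od l * ((2 * x) / ((real k - x) * (real l - x) * (real k + real l)))" by (simp add: uu_def)
    also have "\<dots> = s ^ (k + l) * (uu x k * uu x l) - uu x k * (s ^ (k + l) * od l / (real k + real l)) - uu x l * (s ^ (k + l) * od k / (real k + real l))"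
      unfolding pf by (simp add: uu_def right_diff_distrib mult_ac)
    finally show ?thesis unfolding c .
  qed
  \<comment> \<open>The diagonal gives the squares. Off the diagonal, the pole at \<open>l\<close>
    leaves a free \<open>k\<close> (\<open>D\<close>), and the pole at \<open>k\<close> leaves a
    free \<open>l\<close>, which is tied to \<open>be x l\<close>; opening \<open>be\<close> by
    \<open>be_swap\<close> gives the sum over \<open>q\<close> (\<open>E\<close>).\<close>
  have B: "(\<Sum>k=1..N. \<Sum>l=1..N. be x l * (s ^ (k + l) * (uu x k * uu x l))) =
     (\<Sum>l=1..N. be x l * (uu x l)\<^sup>2) + (\<Sum>l=1..N. be x l * (uu x l * (h (N - l) - h (l - 1))))
      + (\<Sum>k=1..N. \<Sum>q=1..N. uu x k * bb x q * (h (N - k) - hh q k))"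
  proof -
    have C: "(\<Sum>l=1..N. be x l * (s ^ (k + l) * (uu x k * uu x l))) =
       be x k * (uu x k)\<^sup>2 + (\<Sum>l\<in>{1..N} - {k}. be x l * (uu x l * (s ^ (l + k) * od k / (real k - real l))))
        + uu x k * (\<Sum>l\<in>{1..N} - {k}. be x l * (s ^ (k + l) * od l / (real l - real k)))" if k: "k \<in> {1..N}" for k
    proof -
      have "(\<Sum>l=1..N. be x l * (s ^ (k + l) * (uu x k * uu x l))) =
         be x k * (s ^ (k + k) * (uu x k * uu x k)) + (\<Sum>l\<in>{1..N} - {k}. be x l * (s ^ (k + l) * (uu x k * uu x l)))"
        using k by (subst sum.remove[of _ k]) auto
      also have "(\<Sum>l\<in>{1..N} - {k}. be x l * (s ^ (k + l) * (uu x k * uu x l))) =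
         (\<Sum>l\<in>{1..N} - {k}. be x l * (uu x l * (s ^ (l + k) * od k / (real k - real l)))
           + uu x k * (be x l * (s ^ (k + l) * od l / (real l - real k))))"
      proof (intro sum.cong refl)
        fix l assume l: "l \<in> {1..N} - {k}"
        show "be x l * (s ^ (k + l) * (uu x k * uu x l)) = be x l * (uu x l * (s ^ (l + k) * od k / (real k - real l)))
           + uu x k * (be x l * (s ^ (k + l) * od l / (real l - real k)))"
          using uu_pf[of k x l] nz[of k] nz[of l] k l by (simp add: distrib_left mult_ac add.commute[of k l])
      qed
      also have "s ^ (k + k) = 1" by (simp add: power_add)
      finally show ?thesis by (simp add: sum.distrib sum_distrib_left power2_eq_square)
    qed
    have D: "(\<Sum>k=1..N. \<Sum>l\<in>{1..N} - {k}. be x l * (uu x l * (s ^ (l + k) * od k / (real k - real l)))) =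
      (\<Sum>l=1..N. be x l * (uu x l * (h (N - l) - h (l - 1))))"
    proof -
      have "(\<Sum>k=1..N. \<Sum>l\<in>{1..N} - {k}. be x l * (uu x l * (s ^ (l + k) * od k / (real k - real l)))) =
        (\<Sum>l=1..N. \<Sum>k\<in>{1..N} - {l}. be x l * (uu x l * (s ^ (l + k) * od k / (real k - real l))))"
      proof -
        have "(\<Sum>k=1..N. \<Sum>l\<in>{1..N} - {k}. G k l) = (\<Sum>l=1..N. \<Sum>k\<in>{1..N} - {l}. G k l)" for G :: "nat \<Rightarrow> nat \<Rightarrow> real"
        proof -
          have 1: "{1..N} - {k} = {l \<in> {1..N}. l \<noteq> k}" for k by auto
          have 2: "(\<Sum>l\<in>{1..N} - {k}. G k l) = (\<Sum>l=1..N. if l \<noteq> k then G k l else 0)" for k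
            unfolding 1 by (rule sum.inter_filter) auto
          have 3: "(\<Sum>k\<in>{1..N} - {l}. G k l) = (\<Sum>k=1..N. if k \<noteq> l then G k l else 0)" for l
            unfolding 1 by (rule sum.inter_filter) auto
          show ?thesis unfolding 2 3 by (subst sum.swap) (intro sum.cong refl, auto)
        qed
        then show ?thesis .
      qed
      also have "\<dots> = (\<Sum>l=1..N. be x l * (uu x l * (h (N - l) - h (l - 1))))"
      proof (intro sum.cong refl)
        fix l assume l: "l \<in> {1..N}"
        have "uu x l * (\<Sum>k\<in>{Suc 0..N} - {l}. s ^ (l + k) * od k / (real k - real l)) = uu x l * (h (N - l) - hh 0 l)"
          using uu_ker[of l N 0 x] l by auto
        moreover have "hh 0 l = h (l - 1)" using l by (auto simp: hh_def)
        moreover have "(\<Sum>k\<in>{1..N} - {l}. be x l * (uu x l * (s ^ (l + k) * od k / (real k - real l)))) =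
            be x l * (uu x l * (\<Sum>k\<in>{Suc 0..N} - {l}. s ^ (l + k) * od k / (real k - real l)))"
          by (simp only: sum_distrib_left One_nat_def)
        ultimately show "(\<Sum>k\<in>{1..N} - {l}. be x l * (uu x l * (s ^ (l + k) * od k / (real k - real l)))) = be x l * (uu x l * (h (N - l) - h (l - 1)))"
          by (simp only:)
      qed
      finally show ?thesis .
    qed
    have E: "uu x k * (\<Sum>l\<in>{1..N} - {k}. be x l * (s ^ (k + l) * od l / (real l - real k))) =
       (\<Sum>q=1..N. uu x k * bb x q * (h (N - k) - hh q k))" if k: "k \<in> {1..N}" for k
    proof -
      define F where "F l = (if l = k then 0 else s ^ (k + l) * od l / (real l - real k))" for l
      have "(\<Sum>l\<in>{1..N} - {k}. be x l * (s ^ (k + l) * od l / (real l - real k))) = (\<Sum>l=1..N. be x l * F l)"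
        using k by (intro sum.mono_neutral_cong_left) (auto simp: F_def)
      also have "\<dots> = (\<Sum>q=1..N. bb x q * (\<Sum>l=Suc q..N. F l))" by (rule be_swap)
      finally have "uu x k * (\<Sum>l\<in>{1..N} - {k}. be x l * (s ^ (k + l) * od l / (real l - real k))) =
        (\<Sum>q=1..N. uu x k * (bb x q * (\<Sum>l=Suc q..N. F l)))" by (simp only: sum_distrib_left)
      also have "\<dots> = (\<Sum>q=1..N. bb x q * (uu x k * (\<Sum>l=Suc q..N. F l)))"
        by (simp only: mult.left_commute)
      also have "\<dots> = (\<Sum>q=1..N. bb x q * (uu x k * (h (N - k) - hh q k)))"
      proof (intro sum.cong refl)
        fix q assume q: "q \<in> {1..N}"
        have "(\<Sum>l=Suc q..N. F l) = (\<Sum>l\<in>{Suc q..N} - {k}. s ^ (k + l) * od l / (real l - real k))"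
          by (intro sum.mono_neutral_cong_right) (auto simp: F_def)
        then show "bb x q * (uu x k * (\<Sum>l=Suc q..N. F l)) = bb x q * (uu x k * (h (N - k) - hh q k))"
          using uu_ker[of k N q x] k q by simp
      qed
      finally show ?thesis by (simp add: mult_ac)
    qed
    have "(\<Sum>k=1..N. \<Sum>l=1..N. be x l * (s ^ (k + l) * (uu x k * uu x l))) = (\<Sum>k=1..N.
        be x k * (uu x k)\<^sup>2 + (\<Sum>l\<in>{1..N} - {k}. be x l * (uu x l * (s ^ (l + k) * od k / (real k - real l))))
        + uu x k * (\<Sum>l\<in>{1..N} - {k}. be x l * (s ^ (k + l) * od l / (real l - real k))))"
      by (rule sum.cong[OF refl C])
    also have "\<dots> = (\<Sum>l=1..N. be x l * (uu x l)\<^sup>2) + (\<Sum>l=1..N. be x l * (uu x l * (h (N - l) - h (l - 1))))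
      + (\<Sum>k=1..N. uu x k * (\<Sum>l\<in>{1..N} - {k}. be x l * (s ^ (k + l) * od l / (real l - real k))))"
      by (simp only: sum.distrib D)
    also have "(\<Sum>k=1..N. uu x k * (\<Sum>l\<in>{1..N} - {k}. be x l * (s ^ (k + l) * od l / (real l - real k))))
      = (\<Sum>k=1..N. \<Sum>q=1..N. uu x k * bb x q * (h (N - k) - hh q k))"
      by (rule sum.cong[OF refl E])
    finally show ?thesis .
  qed
  have F1: "(\<Sum>k=1..N. \<Sum>l=1..N. be x l * (uu x k * (s ^ (k + l) * od l / (real k + real l)))) =
     (\<Sum>k=1..N. \<Sum>q=1..N. uu x k * bb x q * (h (N + k) - h (q + k)))"
  proof (rule sum.cong[OF refl])
    fix k
    have "(\<Sum>l=1..N. be x l * (uu x k * (s ^ (k + l) * od l / (real k + real l)))) =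
       (\<Sum>q=1..N. bb x q * (\<Sum>l=Suc q..N. uu x k * (s ^ (k + l) * od l / (real k + real l))))" by (rule be_swap)
    also have "\<dots> = (\<Sum>q=1..N. uu x k * bb x q * (h (N + k) - h (q + k)))"
    proof (intro sum.cong refl)
      fix q assume "q \<in> {1..N}"
      then have "(\<Sum>l=Suc q..N. uu x k * (s ^ (k + l) * od l / (real k + real l))) = uu x k * (h (N + k) - h (q + k))"
        using uu_ker_add[of q N x k] by (simp only: sum_distrib_left) simp
      then show "bb x q * (\<Sum>l=Suc q..N. uu x k * (s ^ (k + l) * od l / (real k + real l))) = uu x k * bb x q * (h (N + k) - h (q + k))"
        by (simp only: mult_ac)
    qed
    finally show "(\<Sum>l=1..N. be x l * (uu x k * (s ^ (k + l) * od l / (real k + real l)))) = (\<Sum>q=1..N. uu x k * bb x q * (h (N + k) - h (q + k)))" .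
  qed
  have F2: "(\<Sum>k=1..N. \<Sum>l=1..N. be x l * (uu x l * (s ^ (l + k) * od k / (real l + real k)))) =
     (\<Sum>l=1..N. be x l * (uu x l * (h (N + l) - h l)))"
  proof (subst sum.swap, intro sum.cong refl)
    fix l
    have "(\<Sum>k=1..N. be x l * (uu x l * (s ^ (l + k) * od k / (real l + real k)))) = be x l * (uu x l * (\<Sum>k=Suc 0..N. s ^ (l + k) * od k / (real l + real k)))"
      by (simp only: sum_distrib_left One_nat_def)
    then show "(\<Sum>k=1..N. be x l * (uu x l * (s ^ (l + k) * od k / (real l + real k)))) = be x l * (uu x l * (h (N + l) - h l))"
      unfolding uu_ker_add[OF le0[of N], of x l, unfolded add_0] .
  qed
  have G: "(\<Sum>k=1..N. \<Sum>l=1..N. be x l * (s ^ (k + l) * (2 * x) * uu x k * uu x l / (real k + real l)))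
     = (\<Sum>k=1..N. \<Sum>l=1..N. be x l * (s ^ (k + l) * (uu x k * uu x l)))
       - (\<Sum>k=1..N. \<Sum>l=1..N. be x l * (uu x k * (s ^ (k + l) * od l / (real k + real l))))
       - (\<Sum>k=1..N. \<Sum>l=1..N. be x l * (uu x l * (s ^ (l + k) * od k / (real l + real k))))"
    unfolding sum_subtractf[symmetric] by (intro sum.cong refl) (subst A, auto simp: right_diff_distrib)
  \<comment> \<open>The mirrored half of the minus kernel ends at \<open>h (l - 1)\<close>, while
    the plus kernel starts after \<open>h l\<close>; this mismatch of one term is the source of
    \<open>ph l\<close>.\<close>
  have I: "(\<Sum>l=1..N. be x l * (uu x l * (h (N - l) - h (l - 1)))) - (\<Sum>l=1..N. be x l * (uu x l * (h (N + l) - h l)))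
     = (\<Sum>l=1..N. be x l * uu x l * ph l) - (\<Sum>l=1..N. be x l * uu x l * th N l)"
    unfolding sum_subtractf[symmetric]
  proof (intro sum.cong refl)
    fix l assume "l \<in> {1..N}"
    then have "h l = h (l - 1) + ph l" using h_Suc[of "l - 1"] by (simp add: ph_def)
    then show "be x l * (uu x l * (h (N - l) - h (l - 1))) - be x l * (uu x l * (h (N + l) - h l)) = be x l * uu x l * ph l - be x l * uu x l * th N l"
      by (simp add: th_def algebra_simps)
  qed
  have J: "(\<Sum>k=1..N. \<Sum>q=1..N. uu x k * bb x q * (h (N - k) - hh q k)) - (\<Sum>k=1..N. \<Sum>q=1..N. uu x k * bb x q * (h (N + k) - h (q + k)))
    = (\<Sum>k=1..N. \<Sum>q=1..N. uu x k * bb x q * (h (q + k) - hh q k)) - (\<Sum>q=1..N. bb x q) * (\<Sum>k=1..N. th N k * uu x k)"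
  proof -
    have "(\<Sum>q=1..N. bb x q) * (\<Sum>k=1..N. th N k * uu x k) = (\<Sum>k=1..N. \<Sum>q=1..N. th N k * uu x k * bb x q)"
      unfolding sum_product by (subst sum.swap) (intro sum.cong refl, simp add: mult_ac)
    then show ?thesis unfolding sum_subtractf[symmetric]
      by (simp only: sum_subtractf[symmetric]) (intro sum.cong refl, simp add: th_def algebra_simps)
  qed
  have gen: "a = p + i1 - i2 - j2 + j1"
    if "a = b - c - d" "b = p + r + t" "c = c'" "d = d'" "r - d' = i1 - i2" "t - c' = j1 - j2"
    for a b c d p r t c' d' i1 i2 j1 j2 :: real
    using that by linarith
  show ?thesis by (rule gen[OF G B F1 F2 I J])
qed

end

section \<open>Rotation of the coupling term\<close>

lemma sum_triangle_swap':
  fixes G :: "nat \<Rightarrow> nat \<Rightarrow> real"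
  shows "(\<Sum>k=1..q. \<Sum>t=k..<q. G k t) = (\<Sum>t=1..<q. \<Sum>k=1..t. G k t)"
proof -
  have "(\<Sum>k=1..q. \<Sum>t=k..<q. G k t) = (\<Sum>(k,t)\<in>(SIGMA k:{1..q}. {k..<q}). G k t)"
    by (simp add: sum.Sigma)
  also have "\<dots> = (\<Sum>(t,k)\<in>(SIGMA t:{1..<q}. {1..t}). G k t)"
    by (rule sum.reindex_bij_witness[of _ "\<lambda>(t,k). (k,t)" "\<lambda>(k,t). (t,k)"]) auto
  also have "\<dots> = (\<Sum>t=1..<q. \<Sum>k=1..t. G k t)" by (simp add: sum.Sigma)
  finally show ?thesis .
qed

lemma sum_sq_expand:
  fixes c :: "nat \<Rightarrow> real"
  shows "(\<Sum>q=1..N. c q)\<^sup>2 = (\<Sum>q=1..N. (c q)\<^sup>2) + 2 * (\<Sum>t=1..N. c t * (\<Sum>q=Suc t..N. c q))"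
proof (induction N)
  case (Suc N)
  have "(\<Sum>t=1..N. c t * (\<Sum>q=Suc t..Suc N. c q)) = (\<Sum>t=1..N. c t * (\<Sum>q=Suc t..N. c q)) + (\<Sum>t=1..N. c t) * c (Suc N)"
    unfolding sum_distrib_right sum.distrib[symmetric]
    by (intro sum.cong refl) (simp add: distrib_left)
  then show ?case using Suc by (simp add: power2_eq_square algebra_simps)
qed auto

context sgn_grading
begin

definition Pk :: "real \<Rightarrow> nat \<Rightarrow> nat \<Rightarrow> real" where
  "Pk x N q = (\<Sum>k=Suc q..N. uu x k * h (k - q - 1))"
definition Zk :: "real \<Rightarrow> nat \<Rightarrow> nat \<Rightarrow> real" where
  "Zk x N t = (\<Sum>q=Suc t..N. s ^ q * bb x q)"
definition ab :: "real \<Rightarrow> nat \<Rightarrow> nat \<Rightarrow> real" where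
  "ab x N t = (\<Sum>j=Suc t..N. s ^ j * uu x j)"
text \<open>The part of the coupling term in which \<open>vv\<close> and \<open>uu\<close> meet at
  the same index \<open>t\<close>. It vanishes for \<open>g = 2\<close>, where \<open>t\<close>
  would have to be both even and odd.\<close>

definition Cc :: "real \<Rightarrow> nat \<Rightarrow> real" where
  "Cc x N = (\<Sum>t=1..N. vv t * uu x t * (s ^ t * UU x t * (h N - h t - ab x N t)
     + (\<Sum>j=Suc t..N. uu x j * (s ^ t * (h N - h j) - h (N - t) + h (j - t - 1)))))"

lemma UU_lt: "1 \<le> r \<Longrightarrow> UU x (r - 1) = (\<Sum>k=1..<r. uu x k)"
  by (cases r) (auto simp: UU_def atLeastLessThanSuc_atLeastAtMost)

lemma UU_step: "1 \<le> r \<Longrightarrow> UU x r = UU x (r - 1) + uu x r"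
  by (cases r) (auto simp: UU_def)

lemma UU_split: "t \<le> n \<Longrightarrow> UU x n = UU x t + (\<Sum>j=Suc t..n. uu x j)"
  by (induction n rule: dec_induct) (auto simp: UU_def)

lemma UU_split': "t < q \<Longrightarrow> UU x (q - 1) = UU x t + (\<Sum>j=Suc t..<q. uu x j)"
  using UU_split[of t "q - 1"] by (cases q) (auto simp: atLeastLessThanSuc_atLeastAtMost)

lemma UU_swap: "(\<Sum>r=1..N. UU x (r - 1) * F r) = (\<Sum>k=1..N. uu x k * (\<Sum>r=Suc k..N. F r))"
proof -
  have "(\<Sum>r=1..N. UU x (r - 1) * F r) = (\<Sum>r=1..N. \<Sum>k=1..<r. uu x k * F r)"
    by (intro sum.cong refl) (subst UU_lt, auto simp: sum_distrib_right)
  also have "\<dots> = (\<Sum>k=1..N. \<Sum>r=Suc k..N. uu x k * F r)" by (rule sum_triangle_swap)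
  finally show ?thesis by (simp only: sum_distrib_left)
qed

lemma vv_ker_add:
  assumes "a \<le> N"
  shows "vv q * (\<Sum>r=Suc a..N. s ^ (q + r) * e r / (real q + real r)) = vv q * (h (N + q) - h (a + q))"
proof -
  have "vv q * (s ^ (q + r) * e r / (real q + real r)) = vv q * (f (r + q) / real (r + q))" for r
  proof -
    have "vv q * e r = vv q * e (q + r)" using e_e_add[of q r] by (simp add: vv_def)
    moreover have "vv q * (s ^ (q + r) * e r / (real q + real r)) = s ^ (q + r) * (vv q * e r) / (real q + real r)"
      by (simp add: mult_ac)
    ultimately show ?thesis by (simp only:) (simp add: f_def mult_ac add_ac)
  qed
  then show ?thesis unfolding h_add[OF assms, symmetric] sum_distrib_left by simp
qed

lemma vv_ker_sub:
  assumes "t \<le> a" "a \<le> N" "1 \<le> t"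
  shows "vv t * (\<Sum>q=Suc a..N. e q * s ^ (q + t) * (1 / (real q - real t) - 1 / real q)) =
     vv t * (h (N - t) - h (a - t) - s ^ t * (h N - h a))"
proof -
  have "vv t * (e q * s ^ (q + t) * (1 / (real q - real t) - 1 / real q)) =
     vv t * (f (q - t) / real (q - t)) - vv t * (s ^ t * (f q / real q))" if "a < q" for q
  proof -
    have "vv t * e q = vv t * e (q - t)" using e_e_sub'[of t q] that assms by (simp add: vv_def mult.commute[of "e q" "e t"])
    moreover have "f (q - t) = s ^ (q + t) * e (q - t)" using that assms s_sub[of t q] by (simp add: f_def add.commute)
    moreover have "f q = s ^ q * e q" by (simp add: f_def)
    moreover have "real (q - t) = real q - real t" using that assms by (simp add: of_nat_diff)
    moreover have "vv t * (e q * s ^ (q + t) * (1 / (real q - real t) - 1 / real q)) =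
       s ^ (q + t) * (vv t * e q) / (real q - real t) - s ^ t * (s ^ q * (vv t * e q)) / real q"
      by (simp add: right_diff_distrib power_add mult_ac)
    ultimately show ?thesis by (simp add: mult_ac)
  qed
  then have "(\<Sum>q=Suc a..N. vv t * (e q * s ^ (q + t) * (1 / (real q - real t) - 1 / real q))) =
     (\<Sum>q=Suc a..N. vv t * (f (q - t) / real (q - t)) - vv t * (s ^ t * (f q / real q)))"
    by (intro sum.cong refl) auto
  also have "\<dots> = vv t * (h (N - t) - h (a - t)) - vv t * (s ^ t * (h N - h a))"
    unfolding sum_subtractf sum_distrib_left[symmetric] h_sub[OF assms(1,2)] h_diff[OF assms(2)] ..
  finally show ?thesis by (simp only: sum_distrib_left right_diff_distrib)
qed

text \<open>Since 1/(qr) = 1/(q(q + r)) + 1/(r(q + r)), the square is twice a sum with the kernel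
  1/(q + r). Opening the second \<open>UU\<close> leaves the sum of this kernel over
  \<open>r > k\<close>, which is \<open>h (N + q) - h (q + k)\<close>. In this way the inseparable
  \<open>h (q + k)\<close> is traded for a square.\<close>

lemma half_square:
  "(\<Sum>q=1..N. s ^ q * bb x q)\<^sup>2 / 2 = (\<Sum>k=1..N. \<Sum>q=1..N. uu x k * bb x q * (h (N + q) - h (q + k)))"
proof -
  have sp: "s ^ q * bb x q * (s ^ r * bb x r) =
      bb x q * (UU x (r - 1) * (s ^ (q + r) * e r / (real q + real r))) + bb x r * (UU x (q - 1) * (s ^ (r + q) * e q / (real r + real q)))"
    if "1 \<le> q" "1 \<le> r" for q r
  proof -
    have "1 / (real q * real r) = 1 / (real q * (real q + real r)) + 1 / (real r * (real q + real r))"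
      using that by (simp add: divide_simps)
    note pf = this
    have "vv q * vv r = e q * e r * (1 / (real q * real r))" by (simp add: vv_def)
    also have "\<dots> = vv q * e r / (real q + real r) + vv r * e q / (real r + real q)"
      unfolding pf by (simp add: vv_def distrib_left mult_ac add.commute[of "real r"])
    finally have "vv q * vv r = vv q * e r / (real q + real r) + vv r * e q / (real r + real q)" .
    then have "s ^ (q + r) * UU x (q - 1) * UU x (r - 1) * (vv q * vv r) =
      s ^ (q + r) * UU x (q - 1) * UU x (r - 1) * (vv q * e r / (real q + real r) + vv r * e q / (real r + real q))" by simp
    then show ?thesis by (simp add: bb_def power_add distrib_left mult_ac)
  qed
  have "(\<Sum>q=1..N. s ^ q * bb x q)\<^sup>2 = (\<Sum>q=1..N. \<Sum>r=1..N. s ^ q * bb x q * (s ^ r * bb x r))"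
    by (simp add: power2_eq_square sum_product)
  also have "\<dots> = (\<Sum>q=1..N. \<Sum>r=1..N. bb x q * (UU x (r - 1) * (s ^ (q + r) * e r / (real q + real r))))
     + (\<Sum>q=1..N. \<Sum>r=1..N. bb x r * (UU x (q - 1) * (s ^ (r + q) * e q / (real r + real q))))"
    unfolding sum.distrib[symmetric] by (intro sum.cong refl sp) auto
  also have "(\<Sum>q=1..N. \<Sum>r=1..N. bb x r * (UU x (q - 1) * (s ^ (r + q) * e q / (real r + real q)))) =
     (\<Sum>q=1..N. \<Sum>r=1..N. bb x q * (UU x (r - 1) * (s ^ (q + r) * e r / (real q + real r))))"
    by (rule sum.swap)
  also have "(\<Sum>q=1..N. \<Sum>r=1..N. bb x q * (UU x (r - 1) * (s ^ (q + r) * e r / (real q + real r)))) =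
     (\<Sum>q=1..N. \<Sum>k=1..N. uu x k * bb x q * (h (N + q) - h (q + k)))"
  proof (rule sum.cong[OF refl])
    fix q
    have "(\<Sum>r=1..N. bb x q * (UU x (r - 1) * (s ^ (q + r) * e r / (real q + real r)))) =
       bb x q * (\<Sum>k=1..N. uu x k * (\<Sum>r=Suc k..N. s ^ (q + r) * e r / (real q + real r)))"
      by (simp only: sum_distrib_left[symmetric] UU_swap)
    also have "\<dots> = (\<Sum>k=1..N. uu x k * UU x (q - 1) * (vv q * (\<Sum>r=Suc k..N. s ^ (q + r) * e r / (real q + real r))))"
      unfolding sum_distrib_left[of "bb x q"] by (intro sum.cong refl) (simp only: bb_def mult_ac)
    also have "\<dots> = (\<Sum>k=1..N. uu x k * bb x q * (h (N + q) - h (q + k)))"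
      by (intro sum.cong refl) (subst vv_ker_add, auto simp: bb_def mult_ac add.commute)
    finally show "(\<Sum>r=1..N. bb x q * (UU x (r - 1) * (s ^ (q + r) * e r / (real q + real r)))) =
       (\<Sum>k=1..N. uu x k * bb x q * (h (N + q) - h (q + k)))" .
  qed
  finally show ?thesis by (subst sum.swap) simp
qed

lemma Zk_alt:
  assumes "t \<le> N"
  shows "Zk x N t = UU x t * (h N - h t) + (\<Sum>j=Suc t..N. uu x j * (h N - h j))"
proof -
  have "Zk x N t = (\<Sum>q=Suc t..N. UU x t * (f q / real q) + (\<Sum>j=Suc t..<q. uu x j * (f q / real q)))"
    unfolding Zk_def
  proof (rule sum.cong[OF refl])
    fix q assume "q \<in> {Suc t..N}"
    then have u: "UU x (q - 1) = UU x t + (\<Sum>j=Suc t..<q. uu x j)" by (intro UU_split') auto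
    show "s ^ q * bb x q = UU x t * (f q / real q) + (\<Sum>j=Suc t..<q. uu x j * (f q / real q))"
      unfolding bb_def u sum_distrib_right[symmetric] by (simp add: f_def vv_def distrib_left mult_ac add_divide_distrib)
  qed
  also have "\<dots> = UU x t * (h N - h t) + (\<Sum>j=Suc t..N. \<Sum>q=Suc j..N. uu x j * (f q / real q))"
    unfolding sum.distrib sum_triangle_swap sum_distrib_left[symmetric] h_diff[OF assms] ..
  also have "(\<Sum>j=Suc t..N. \<Sum>q=Suc j..N. uu x j * (f q / real q)) = (\<Sum>j=Suc t..N. uu x j * (h N - h j))"
    by (intro sum.cong refl) (simp add: sum_distrib_left[symmetric] h_diff del: times_divide_eq_right)
  finally show ?thesis .
qed

text \<open>\<open>h (k - q - 1)\<close> is opened into a sum of the kernel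
  \<open>1 / (k - w)\<close> over the \<open>w\<close> strictly between \<open>q\<close> and
  \<open>k\<close>, and partial fractions move the pole from \<open>k\<close> to \<open>w\<close>.
  In the new form the terms do not depend on \<open>q\<close>, so that lowering \<open>q\<close> by
  one adds a single term.\<close>

lemma Pk_alt:
  assumes nz: "\<And>k. 1 \<le> k \<Longrightarrow> real k \<noteq> x" and "q \<le> N"
  shows "Pk x N q = (\<Sum>w=Suc q..N. uu x w * (h (N - w) - s ^ w * ab x N w))"
proof -
  have pf: "uu x j * (f (j - w) / real (j - w)) = uu x w * (s ^ (w + j) * od j / (real j - real w)) - uu x w * (s ^ w * (s ^ j * uu x j))"
    if "1 \<le> w" "w < j" for w j
  proof -
    have "uu x j * uu x w = uu x w * od j / (real j - real w) + uu x j * od w / (real w - real j)"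
      using uu_pf[of j x w] nz[of j] nz[of w] that by simp
    moreover have "uu x j * od w / (real w - real j) = - (uu x j * od w / (real j - real w))"
      by (metis minus_diff_eq minus_divide_right)
    ultimately have *: "uu x j * od w / (real j - real w) = uu x w * od j / (real j - real w) - uu x j * uu x w" by linarith
    have "uu x j * e (j - w) = uu x j * od w" using od_od_sub'[of w j] that
      by (auto simp: uu_def mult.commute[of "od j" "od w"])
    moreover have "uu x j * (f (j - w) / real (j - w)) = s ^ (w + j) * (uu x j * e (j - w)) / (real j - real w)"
      using that s_sub[of w j] by (simp add: f_def of_nat_diff mult_ac)
    ultimately have "uu x j * (f (j - w) / real (j - w)) = s ^ (w + j) * (uu x j * od w / (real j - real w))" by simp
    then show ?thesis unfolding * by (simp add: right_diff_distrib power_add mult_ac)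
  qed
  have "Pk x N q = (\<Sum>k=Suc q..N. \<Sum>w=Suc q..<k. uu x k * (f (k - w) / real (k - w)))"
    unfolding Pk_def by (intro sum.cong refl) (simp only: sum_distrib_left[symmetric], subst h_rev, auto)
  also have "\<dots> = (\<Sum>w=Suc q..N. \<Sum>k=Suc w..N. uu x k * (f (k - w) / real (k - w)))"
    by (rule sum_triangle_swap)
  also have "\<dots> = (\<Sum>w=Suc q..N. \<Sum>k=Suc w..N. uu x w * (s ^ (w + k) * od k / (real k - real w)) - uu x w * (s ^ w * (s ^ k * uu x k)))"
    by (intro sum.cong refl pf) auto
  also have "\<dots> = (\<Sum>w=Suc q..N. uu x w * (h (N - w) - s ^ w * ab x N w))"
  proof (rule sum.cong[OF refl])
    fix w assume w: "w \<in> {Suc q..N}"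
    have "uu x w * (\<Sum>k\<in>{Suc w..N} - {w}. s ^ (w + k) * od k / (real k - real w)) = uu x w * h (N - w)"
      using uu_ker[of w N w x] w by (simp add: hh_def)
    moreover have "{Suc w..N} - {w} = {Suc w..N}" by auto
    ultimately show "(\<Sum>k=Suc w..N. uu x w * (s ^ (w + k) * od k / (real k - real w)) - uu x w * (s ^ w * (s ^ k * uu x k))) =
      uu x w * (h (N - w) - s ^ w * ab x N w)"
      by (simp only: sum_subtractf sum_distrib_left[symmetric] ab_def right_diff_distrib)
  qed
  finally show ?thesis .
qed

text \<open>\<open>half_square\<close> turns the part with \<open>h (q + k)\<close> into a square
  plus a boundary sum. The part with \<open>hh\<close> is cut at \<open>k = q\<close>; below the
  cut, \<open>low\<close> passes the factor \<open>1 / q\<close> on to a smaller index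
  \<open>t\<close>, after which both parts are nested sums over the same \<open>t\<close> and can be
  compared term by term.\<close>

lemma rotation:
  assumes nz: "\<And>k. 1 \<le> k \<Longrightarrow> real k \<noteq> x"
  shows "(\<Sum>k=1..N. \<Sum>q=1..N. uu x k * bb x q * (h (q + k) - hh q k)) =
    - (\<Sum>q=1..N. (bb x q)\<^sup>2) / 2 + UU x N * (\<Sum>q=1..N. bb x q * th N q) + Cc x N"
proof -
  \<comment> \<open>The index \<open>t\<close> comes from writing \<open>h (q - k)\<close> as a sum
    over \<open>k \<le> t < q\<close>, and 1/(q(q - t)) = (1/(q - t) - 1/q)/t exchanges the factor
    \<open>1 / q\<close> for \<open>1 / t\<close>.\<close>
  have low: "vv q * (\<Sum>k=1..q. uu x k * h (q - k)) = (\<Sum>t=1..<q. vv t * UU x t * (e q * s ^ (q + t) * (1 / (real q - real t) - 1 / real q)))"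
    if "1 \<le> q" for q
  proof -
    have "(\<Sum>k=1..q. uu x k * h (q - k)) = (\<Sum>k=1..q. \<Sum>t=k..<q. uu x k * (f (q - t) / real (q - t)))"
      by (intro sum.cong refl) (simp only: sum_distrib_left[symmetric], subst h_rev', auto)
    also have "\<dots> = (\<Sum>t=1..<q. UU x t * (f (q - t) / real (q - t)))"
      unfolding sum_triangle_swap' UU_def sum_distrib_right ..
    finally have "vv q * (\<Sum>k=1..q. uu x k * h (q - k)) = (\<Sum>t=1..<q. vv q * (UU x t * (f (q - t) / real (q - t))))"
      by (simp only: sum_distrib_left)
    also have "\<dots> = (\<Sum>t=1..<q. vv t * UU x t * (e q * s ^ (q + t) * (1 / (real q - real t) - 1 / real q)))"
    proof (rule sum.cong[OF refl])
      fix t assume t: "t \<in> {1..<q}"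
      have "e q * e (q - t) = e q * e t" using e_e_sub[of t q] t by auto
      moreover have "1 / real q / (real q - real t) = 1 / real t * (1 / (real q - real t) - 1 / real q)"
        using t by (simp add: divide_simps)
      moreover have "f (q - t) / real (q - t) = s ^ (q + t) * e (q - t) / (real q - real t)"
        using t s_sub[of t q] by (simp add: f_def of_nat_diff add.commute)
      moreover have "e q / real q * (UU x t * (s ^ (q + t) * e (q - t) / (real q - real t))) =
         UU x t * s ^ (q + t) * (e q * e (q - t)) * (1 / real q / (real q - real t))" by (simp add: mult_ac)
      moreover have "UU x t * s ^ (q + t) * (e q * e t) * (1 / real t * (1 / (real q - real t) - 1 / real q)) =
         e t / real t * UU x t * (e q * s ^ (q + t) * (1 / (real q - real t) - 1 / real q))" by (simp add: mult_ac)
      ultimately show "vv q * (UU x t * (f (q - t) / real (q - t))) = vv t * UU x t * (e q * s ^ (q + t) * (1 / (real q - real t) - 1 / real q))"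
        unfolding vv_def by (simp only:)
    qed
    finally show ?thesis .
  qed
  define W where "W t q = e q * s ^ (q + t) * (1 / (real q - real t) - 1 / real q)" for t q
  have lowsum: "(\<Sum>q=1..N. bb x q * (\<Sum>k=1..q. uu x k * h (q - k))) =
     (\<Sum>t=1..N. vv t * UU x t * (UU x N * h (N - t) - s ^ t * Zk x N t - Pk x N (t - 1)))"
  proof -
    have "(\<Sum>q=1..N. bb x q * (\<Sum>k=1..q. uu x k * h (q - k))) = (\<Sum>q=1..N. \<Sum>t=1..<q. vv t * UU x t * (UU x (q - 1) * W t q))"
    proof (rule sum.cong[OF refl])
      fix q assume "q \<in> {1..N}"
      then have l: "vv q * (\<Sum>k=1..q. uu x k * h (q - k)) = (\<Sum>t=1..<q. vv t * UU x t * W t q)"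
        using low[of q] unfolding W_def by simp
      have "bb x q * (\<Sum>k=1..q. uu x k * h (q - k)) = UU x (q - 1) * (vv q * (\<Sum>k=1..q. uu x k * h (q - k)))"
        by (simp only: bb_def mult_ac)
      then show "bb x q * (\<Sum>k=1..q. uu x k * h (q - k)) = (\<Sum>t=1..<q. vv t * UU x t * (UU x (q - 1) * W t q))"
        unfolding l by (simp only: sum_distrib_left mult_ac)
    qed
    also have "\<dots> = (\<Sum>t=1..N. \<Sum>q=Suc t..N. vv t * UU x t * (UU x (q - 1) * W t q))" by (rule sum_triangle_swap)
    also have "\<dots> = (\<Sum>t=1..N. vv t * UU x t * (UU x N * h (N - t) - s ^ t * Zk x N t - Pk x N (t - 1)))"
    proof (rule sum.cong[OF refl])
      fix t assume t: "t \<in> {1..N}"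
      have ker: "vv t * (\<Sum>q=Suc a..N. W t q) = vv t * (h (N - t) - h (a - t) - s ^ t * (h N - h a))" if "t \<le> a" "a \<le> N" for a
        unfolding W_def using vv_ker_sub[of t a N] that t by simp
      have "(\<Sum>q=Suc t..N. UU x (q - 1) * W t q) = (\<Sum>q=Suc t..N. UU x t * W t q + (\<Sum>j=Suc t..<q. uu x j * W t q))"
      proof (rule sum.cong[OF refl])
        fix q assume "q \<in> {Suc t..N}"
        then have u: "UU x (q - 1) = UU x t + (\<Sum>j=Suc t..<q. uu x j)" by (intro UU_split') auto
        show "UU x (q - 1) * W t q = UU x t * W t q + (\<Sum>j=Suc t..<q. uu x j * W t q)"
          unfolding u by (simp add: distrib_right sum_distrib_right)
      qed
      also have "\<dots> = UU x t * (\<Sum>q=Suc t..N. W t q) + (\<Sum>j=Suc t..N. uu x j * (\<Sum>q=Suc j..N. W t q))"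
        unfolding sum.distrib sum_triangle_swap sum_distrib_left ..
      finally have "vv t * (\<Sum>q=Suc t..N. UU x (q - 1) * W t q) =
        UU x t * (vv t * (\<Sum>q=Suc t..N. W t q)) + (\<Sum>j=Suc t..N. uu x j * (vv t * (\<Sum>q=Suc j..N. W t q)))"
        by (simp only: distrib_left sum_distrib_left mult.left_commute)
      also have "(\<Sum>j=Suc t..N. uu x j * (vv t * (\<Sum>q=Suc j..N. W t q))) =
         (\<Sum>j=Suc t..N. vv t * (uu x j * h (N - t) - uu x j * h (j - t) - s ^ t * (uu x j * (h N - h j))))"
        by (intro sum.cong refl) (subst ker, use t in \<open>auto simp: algebra_simps\<close>)
      also have "\<dots> = vv t * ((\<Sum>j=Suc t..N. uu x j) * h (N - t) - (\<Sum>j=Suc t..N. uu x j * h (j - t)) - s ^ t * (\<Sum>j=Suc t..N. uu x j * (h N - h j)))"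
        by (simp only: sum_distrib_left[symmetric] sum_subtractf sum_distrib_right)
      also have "(\<Sum>j=Suc t..N. uu x j * h (j - t)) = Pk x N (t - 1)"
      proof -
        have "Pk x N (t - 1) = (\<Sum>k=t..N. uu x k * h (k - t))"
          unfolding Pk_def using t by (intro sum.cong) auto
        also have "\<dots> = uu x t * h (t - t) + (\<Sum>k=Suc t..N. uu x k * h (k - t))"
          using t by (intro sum.atLeast_Suc_atMost) auto
        finally show ?thesis by simp
      qed
      also have "vv t * (\<Sum>q=Suc t..N. W t q) = vv t * (h (N - t) - s ^ t * (h N - h t))"
        using ker[of t] t by simp
      finally have "vv t * (\<Sum>q=Suc t..N. UU x (q - 1) * W t q) =
         vv t * ((UU x t + (\<Sum>j=Suc t..N. uu x j)) * h (N - t) - s ^ t * (UU x t * (h N - h t) + (\<Sum>j=Suc t..N. uu x j * (h N - h j))) - Pk x N (t - 1))"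
        by (simp add: algebra_simps)
      also have "\<dots> = vv t * (UU x N * h (N - t) - s ^ t * Zk x N t - Pk x N (t - 1))"
        using t UU_split[of t N x] Zk_alt[of t N x] by simp
      finally show "(\<Sum>q=Suc t..N. vv t * UU x t * (UU x (q - 1) * W t q)) = vv t * UU x t * (UU x N * h (N - t) - s ^ t * Zk x N t - Pk x N (t - 1))"
        by (simp only: sum_distrib_left[symmetric] mult.assoc mult.left_commute[of _ "UU x t"])
    qed
    finally show ?thesis .
  qed
  have "(\<Sum>k=1..N. \<Sum>q=1..N. uu x k * bb x q * hh q k) = (\<Sum>q=1..N. bb x q * (\<Sum>k=1..q. uu x k * h (q - k))) + (\<Sum>q=1..N. bb x q * Pk x N q)"
  proof -
    have "(\<Sum>k=1..N. uu x k * bb x q * hh q k) = bb x q * (\<Sum>k=1..q. uu x k * h (q - k)) + bb x q * Pk x N q" if q: "q \<in> {1..N}" for q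
    proof -
      have "{1..N} = {1..q} \<union> {Suc q..N}" using q by auto
      then have "(\<Sum>k=1..N. uu x k * bb x q * hh q k) = (\<Sum>k=1..q. uu x k * bb x q * hh q k) + (\<Sum>k=Suc q..N. uu x k * bb x q * hh q k)"
        by (simp add: sum.union_disjoint disjoint_iff)
      also have "(\<Sum>k=1..q. uu x k * bb x q * hh q k) = bb x q * (\<Sum>k=1..q. uu x k * h (q - k))"
        unfolding sum_distrib_left by (intro sum.cong refl) (simp add: hh_def)
      also have "(\<Sum>k=Suc q..N. uu x k * bb x q * hh q k) = bb x q * Pk x N q"
        unfolding sum_distrib_left Pk_def by (intro sum.cong refl) (simp add: hh_def)
      finally show ?thesis .
    qed
    then show ?thesis by (subst sum.swap) (simp add: sum.distrib[symmetric])
  qed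
  moreover have "(\<Sum>k=1..N. \<Sum>q=1..N. uu x k * bb x q * h (q + k)) = UU x N * (\<Sum>q=1..N. bb x q * h (N + q)) - (\<Sum>q=1..N. s ^ q * bb x q)\<^sup>2 / 2"
  proof -
    have "UU x N * (\<Sum>q=1..N. bb x q * h (N + q)) = (\<Sum>k=1..N. \<Sum>q=1..N. uu x k * bb x q * h (N + q))"
      unfolding UU_def sum_product by (simp only: mult.assoc)
    then show ?thesis unfolding half_square by (simp add: sum_subtractf[symmetric] right_diff_distrib)
  qed
  moreover have "(\<Sum>q=1..N. s ^ q * bb x q)\<^sup>2 / 2 = (\<Sum>q=1..N. (bb x q)\<^sup>2) / 2 + (\<Sum>t=1..N. s ^ t * bb x t * Zk x N t)"
    unfolding sum_sq_expand Zk_def by (simp add: power_mult_distrib power2_eq_square[of "s ^ _"] add_divide_distrib)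
  moreover have "(\<Sum>k=1..N. \<Sum>q=1..N. uu x k * bb x q * (h (q + k) - hh q k)) =
     (\<Sum>k=1..N. \<Sum>q=1..N. uu x k * bb x q * h (q + k)) - (\<Sum>k=1..N. \<Sum>q=1..N. uu x k * bb x q * hh q k)"
    by (simp add: right_diff_distrib sum_subtractf)
  moreover have "y = - b2 / 2 + (c - z - l - p)" if "B = l + p" "A = c - sq" "sq = b2 / 2 + z" "y = A - B"
    for A B c sq b2 z l p y :: real using that by simp
  ultimately have Y: "(\<Sum>k=1..N. \<Sum>q=1..N. uu x k * bb x q * (h (q + k) - hh q k)) =
     - (\<Sum>q=1..N. (bb x q)\<^sup>2) / 2 + (UU x N * (\<Sum>q=1..N. bb x q * h (N + q)) - (\<Sum>t=1..N. s ^ t * bb x t * Zk x N t)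
       - (\<Sum>t=1..N. vv t * UU x t * (UU x N * h (N - t) - s ^ t * Zk x N t - Pk x N (t - 1))) - (\<Sum>q=1..N. bb x q * Pk x N q))"
    unfolding lowsum by blast
  \<comment> \<open>For fixed \<open>t\<close> the larger indices enter through \<open>Zk\<close>,
    \<open>Pk\<close> and the tail of \<open>UU\<close>. Replacing \<open>Pk x N (t - 1)\<close> by
    \<open>Pk x N t\<close> plus its term at \<open>t\<close>, and \<open>UU x t\<close> by
    \<open>UU x (t - 1) + uu x t\<close>, cancels everything without the product
    \<open>vv t * uu x t\<close>, except the term with \<open>th\<close>.\<close>
  have E: "UU x N * (\<Sum>q=1..N. bb x q * h (N + q)) - (\<Sum>t=1..N. s ^ t * bb x t * Zk x N t)
       - (\<Sum>t=1..N. vv t * UU x t * (UU x N * h (N - t) - s ^ t * Zk x N t - Pk x N (t - 1))) - (\<Sum>q=1..N. bb x q * Pk x N q)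
      = UU x N * (\<Sum>q=1..N. bb x q * th N q) + Cc x N"
    unfolding Cc_def sum_distrib_left[of "UU x N"] sum_subtractf[symmetric] sum.distrib[symmetric]
  proof (rule sum.cong[OF refl])
    fix t assume t: "t \<in> {1..N}"
    define V where "V = (\<Sum>j=Suc t..N. uu x j)"
    define L where "L = (\<Sum>j=Suc t..N. uu x j * (h N - h j))"
    define M where "M = Pk x N t"
    have sm: "(\<Sum>j=Suc t..N. uu x j * (s ^ t * (h N - h j) - h (N - t) + h (j - t - 1))) = s ^ t * L - V * h (N - t) + M"
      unfolding L_def V_def M_def Pk_def sum_distrib_left sum_distrib_right sum_subtractf[symmetric] sum.distrib[symmetric]
      by (intro sum.cong refl) (simp add: algebra_simps)
    have P1: "Pk x N (t - 1) = uu x t * (h (N - t) - s ^ t * ab x N t) + M"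
    proof -
      have "Pk x N (t - 1) = (\<Sum>w=t..N. uu x w * (h (N - w) - s ^ w * ab x N w))"
        using Pk_alt[OF nz, of "t - 1" N] t by auto
      also have "\<dots> = uu x t * (h (N - t) - s ^ t * ab x N t) + (\<Sum>w=Suc t..N. uu x w * (h (N - w) - s ^ w * ab x N w))"
        using t by (intro sum.atLeast_Suc_atMost) auto
      finally show ?thesis using Pk_alt[OF nz, of t N] t by (simp add: M_def)
    qed
    have Z: "Zk x N t = UU x t * (h N - h t) + L" using Zk_alt[of t N x] t by (simp add: L_def)
    have U: "UU x N = UU x t + V" using UU_split[of t N x] t by (simp add: V_def)
    have Ut: "UU x t = UU x (t - 1) + uu x t" using UU_step t by simp
    have key: "Vn * (b * hp) - st * b * Z - v * Ut * (Vn * hm - st * Z - P1) - b * M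
       = Vn * (b * (hp - hm)) + v * u * (st * Ut * (lt - a) + (st * L - V * hm + M))"
      if "P1 = u * (hm - st * a) + M" "Z = Ut * lt + L" "Vn = Ut + V" "Ut = Um + u" "b = v * Um"
      for Vn b hp st Z v Ut hm P1 M u lt a L V Um :: real
      unfolding that by algebra
    show "UU x N * (bb x t * h (N + t)) - s ^ t * bb x t * Zk x N t - vv t * UU x t * (UU x N * h (N - t) - s ^ t * Zk x N t - Pk x N (t - 1)) - bb x t * Pk x N t
      = UU x N * (bb x t * th N t) + vv t * uu x t * (s ^ t * UU x t * (h N - h t - ab x N t)
          + (\<Sum>j=Suc t..N. uu x j * (s ^ t * (h N - h j) - h (N - t) + h (j - t - 1))))"
      unfolding sm th_def M_def[symmetric] by (rule key[OF P1 Z U Ut]) (simp add: bb_def)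
  qed
  show ?thesis unfolding Y E by simp
qed

end

section \<open>Partial fractions\<close>

context sgn_grading
begin

definition H :: "nat \<Rightarrow> real" where "H n = (\<Sum>i=1..n. vv i)"
definition H2 :: "nat \<Rightarrow> real" where "H2 n = (\<Sum>i=1..n. (vv i)\<^sup>2)"
text \<open>The coefficient of \<open>uu x p\<close> when the sum of
  \<open>G j m * (uu x j * uu x m)\<close> over \<open>j < m \<le> N\<close> is resolved into
  partial fractions: \<open>p\<close> is the smaller index in the first sum and the larger one in
  the second (\<open>pf_pairs\<close>).\<close>

definition pfc :: "(nat \<Rightarrow> nat \<Rightarrow> real) \<Rightarrow> nat \<Rightarrow> nat \<Rightarrow> real" where
  "pfc G p N = (\<Sum>m=Suc p..N. od m * G p m / (real m - real p)) - (\<Sum>j=1..<p. od j * G j p / (real p - real j))"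
text \<open>One-pole form of the truncated K2, without its boundary term; see
  \<open>K2N_eq\<close>.\<close>

definition K2o :: "real \<Rightarrow> nat \<Rightarrow> real" where
  "K2o x N = (\<Sum>p=1..N. (uu x p)\<^sup>2 + 2 * ph p * uu x p)"
text \<open>The truncation of \<open>K\<close> after the collapse, boundary terms left out.
  Different poles are still multiplied with each other here; \<open>TN_pf\<close> separates
  them.\<close>

definition TN :: "real \<Rightarrow> nat \<Rightarrow> real" where
  "TN x N = (K2o x N)\<^sup>2 / 2 + 2 * ((\<Sum>l=1..N. be x l * (uu x l)\<^sup>2) + (\<Sum>l=1..N. be x l * uu x l * ph l))
     - (\<Sum>q=1..N. (bb x q)\<^sup>2) + 2 * Cc x N"
text \<open>\<open>GC\<close> and \<open>Gt\<close> are the coefficients of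
  \<open>uu x j * uu x m\<close> for \<open>j < m\<close> in \<open>Cc\<close> and in
  \<open>TN\<close>, once all mixed products of higher order have been reduced to this one;
  \<open>dd p\<close> is the resulting coefficient of \<open>(uu x p)\<^sup>2\<close>.\<close>

definition GC :: "nat \<Rightarrow> nat \<Rightarrow> nat \<Rightarrow> real" where
  "GC N j m = vv m * (s ^ m * (h N - h (j - 1)) - h (N - m) + h (m - j) - vv m)
     + vv j * (s ^ j * (h N - h m) - h (N - j) + h (m - j - 1))"
definition Gt :: "nat \<Rightarrow> nat \<Rightarrow> nat \<Rightarrow> real" where
  "Gt N j m = - 2 / (real m - real j)\<^sup>2 + 2 * (ph j - ph m) / (real m - real j) + 4 * ph j * ph m
     + 2 * (H (m - 1) - H j) / (real m - real j) + 2 * ph m * (H (m - 1) - H j) - 2 * (H2 N - H2 m) + 2 * GC N j m"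
definition dd :: "nat \<Rightarrow> nat \<Rightarrow> real" where
  "dd p N = 2 * (ph p)\<^sup>2 + (\<Sum>m=Suc p..N. od m / (real m - real p)\<^sup>2) + (\<Sum>j=1..<p. od j / (real p - real j)\<^sup>2)
     - 2 * (\<Sum>j=1..<p. od j * ph j / (real p - real j)) + 2 * (\<Sum>m=Suc p..N. od m * ph m / (real m - real p))
     - 2 * (\<Sum>j=1..<p. od j * (H (p - 1) - H j) / (real p - real j))
     - (H2 N - H2 p) - 2 * vv p * (h (N - p) - s ^ p * (h N - h p))"

lemma H_0 [simp]: "H 0 = 0" and H2_0 [simp]: "H2 0 = 0" by (simp_all add: H_def H2_def)
lemma H_Suc: "H (Suc n) = H n + vv (Suc n)" and H2_Suc: "H2 (Suc n) = H2 n + (vv (Suc n))\<^sup>2"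
  by (simp_all add: H_def H2_def)
lemma H_diff: "a \<le> b \<Longrightarrow> (\<Sum>q=Suc a..b. vv q) = H b - H a"
  by (induction b rule: dec_induct) (auto simp: H_Suc)
lemma H2_diff: "a \<le> b \<Longrightarrow> (\<Sum>q=Suc a..b. (vv q)\<^sup>2) = H2 b - H2 a"
  by (induction b rule: dec_induct) (auto simp: H2_Suc)

lemma pf_lt:
  assumes "real j \<noteq> x" "real m \<noteq> x" "j < m"
  shows "uu x j * uu x m = (uu x j * od m - uu x m * od j) / (real m - real j)"
proof -
  have "uu x m * od j / (real j - real m) = - (uu x m * od j / (real m - real j))"
    by (metis minus_diff_eq minus_divide_right)
  then show ?thesis using uu_pf[of j x m] assms by (simp add: diff_divide_distrib)
qed

text \<open>The mixed product is split one factor at a time, and the simple product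
  \<open>uu x j * uu x m\<close> is deliberately kept: all contributions to it are first gathered in
  \<open>Gt\<close> and then split only once.\<close>

lemma pf_lt_sq:
  assumes "real j \<noteq> x" "real m \<noteq> x" "j < m"
  shows "uu x j * (uu x m)\<^sup>2 = (uu x j * uu x m - (uu x m)\<^sup>2 * od j) / (real m - real j)"
    and "(uu x j)\<^sup>2 * uu x m = ((uu x j)\<^sup>2 * od m - uu x j * uu x m) / (real m - real j)"
    and "(uu x j)\<^sup>2 * (uu x m)\<^sup>2 = ((uu x j)\<^sup>2 * od m + (uu x m)\<^sup>2 * od j - 2 * (uu x j * uu x m)) / (real m - real j)\<^sup>2"
proof -
  have o: "uu x k * od k = uu x k" for k using od_uu[of k x] by (simp add: mult.commute)
  have g1: "(a * om - b * oj) / D * b = (a * (b * om) - b\<^sup>2 * oj) / D"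
    and g2: "(a * om - b * oj) / D * a = (a\<^sup>2 * om - (a * oj) * b) / D" for a b om oj D :: real
    by (simp_all add: power2_eq_square algebra_simps diff_divide_distrib)
  have "uu x j * (uu x m)\<^sup>2 = (uu x j * uu x m) * uu x m" by (simp add: power2_eq_square)
  also have "\<dots> = (uu x j * (uu x m * od m) - (uu x m)\<^sup>2 * od j) / (real m - real j)"
    unfolding pf_lt[OF assms] by (rule g1)
  finally show 1: "uu x j * (uu x m)\<^sup>2 = (uu x j * uu x m - (uu x m)\<^sup>2 * od j) / (real m - real j)" unfolding o .
  have "(uu x j)\<^sup>2 * uu x m = (uu x j * uu x m) * uu x j" by (simp add: power2_eq_square)
  also have "\<dots> = ((uu x j)\<^sup>2 * od m - (uu x j * od j) * uu x m) / (real m - real j)"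
    unfolding pf_lt[OF assms] by (rule g2)
  finally show 2: "(uu x j)\<^sup>2 * uu x m = ((uu x j)\<^sup>2 * od m - uu x j * uu x m) / (real m - real j)" unfolding o .
  have "(uu x j)\<^sup>2 * (uu x m)\<^sup>2 = (uu x j * uu x m)\<^sup>2" by (simp add: power_mult_distrib)
  also have "\<dots> = (uu x j * od m - uu x m * od j)\<^sup>2 / (real m - real j)\<^sup>2"
    unfolding pf_lt[OF assms] by (simp add: power_divide)
  also have "(uu x j * od m - uu x m * od j)\<^sup>2 = (uu x j)\<^sup>2 * (od m * od m) + (uu x m)\<^sup>2 * (od j * od j) - 2 * ((uu x j * od j) * (uu x m * od m))"
    by algebra
  finally show "(uu x j)\<^sup>2 * (uu x m)\<^sup>2 = ((uu x j)\<^sup>2 * od m + (uu x m)\<^sup>2 * od j - 2 * (uu x j * uu x m)) / (real m - real j)\<^sup>2"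
    by (simp only: o od_idem)
qed

lemma sum_pairs_swap: "(\<Sum>m=1..N. \<Sum>j=1..<m. G j m) = (\<Sum>p=1..N. \<Sum>m=Suc p..N. G p m :: real)"
  by (rule sum_triangle_swap)

context
  fixes x :: real
  assumes nz: "\<And>k. 1 \<le> k \<Longrightarrow> real k \<noteq> x"
begin

lemma pf_pairs: "(\<Sum>m=1..N. \<Sum>j=1..<m. G j m * (uu x j * uu x m)) = (\<Sum>p=1..N. uu x p * pfc G p N)"
proof -
  have "(\<Sum>m=1..N. \<Sum>j=1..<m. G j m * (uu x j * uu x m)) =
    (\<Sum>m=1..N. \<Sum>j=1..<m. uu x j * (od m * G j m / (real m - real j)) - uu x m * (od j * G j m / (real m - real j)))"
    by (intro sum.cong refl, subst pf_lt) (use nz in \<open>auto simp: diff_divide_distrib right_diff_distrib mult_ac\<close>)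
  also have "\<dots> = (\<Sum>m=1..N. \<Sum>j=1..<m. uu x j * (od m * G j m / (real m - real j))) - (\<Sum>m=1..N. \<Sum>j=1..<m. uu x m * (od j * G j m / (real m - real j)))"
    by (simp only: sum_subtractf)
  also have "(\<Sum>m=1..N. \<Sum>j=1..<m. uu x j * (od m * G j m / (real m - real j))) = (\<Sum>p=1..N. \<Sum>m=Suc p..N. uu x p * (od m * G p m / (real m - real p)))"
    by (rule sum_pairs_swap)
  finally show ?thesis by (simp only: pfc_def right_diff_distrib sum_subtractf sum_distrib_left)
qed

lemma pf_pairs_r: "(\<Sum>m=1..N. \<Sum>j=1..<m. G j m * (uu x j * (uu x m)\<^sup>2)) =
   (\<Sum>m=1..N. \<Sum>j=1..<m. G j m / (real m - real j) * (uu x j * uu x m)) - (\<Sum>p=1..N. (uu x p)\<^sup>2 * (\<Sum>j=1..<p. od j * G j p / (real p - real j)))"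
proof -
  have "(\<Sum>m=1..N. \<Sum>j=1..<m. G j m * (uu x j * (uu x m)\<^sup>2)) =
    (\<Sum>m=1..N. \<Sum>j=1..<m. G j m / (real m - real j) * (uu x j * uu x m) - (uu x m)\<^sup>2 * (od j * G j m / (real m - real j)))"
    by (intro sum.cong refl, subst pf_lt_sq(1)) (use nz in \<open>auto simp: diff_divide_distrib right_diff_distrib mult_ac\<close>)
  then show ?thesis by (simp only: sum_subtractf sum_distrib_left)
qed

lemma pf_pairs_l: "(\<Sum>m=1..N. \<Sum>j=1..<m. G j m * ((uu x j)\<^sup>2 * uu x m)) =
   (\<Sum>p=1..N. (uu x p)\<^sup>2 * (\<Sum>m=Suc p..N. od m * G p m / (real m - real p))) - (\<Sum>m=1..N. \<Sum>j=1..<m. G j m / (real m - real j) * (uu x j * uu x m))"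
proof -
  have "(\<Sum>m=1..N. \<Sum>j=1..<m. G j m * ((uu x j)\<^sup>2 * uu x m)) =
    (\<Sum>m=1..N. \<Sum>j=1..<m. (uu x j)\<^sup>2 * (od m * G j m / (real m - real j)) - G j m / (real m - real j) * (uu x j * uu x m))"
    by (intro sum.cong refl, subst pf_lt_sq(2)) (use nz in \<open>auto simp: diff_divide_distrib right_diff_distrib mult_ac\<close>)
  also have "\<dots> = (\<Sum>m=1..N. \<Sum>j=1..<m. (uu x j)\<^sup>2 * (od m * G j m / (real m - real j))) - (\<Sum>m=1..N. \<Sum>j=1..<m. G j m / (real m - real j) * (uu x j * uu x m))"
    by (simp only: sum_subtractf)
  also have "(\<Sum>m=1..N. \<Sum>j=1..<m. (uu x j)\<^sup>2 * (od m * G j m / (real m - real j))) = (\<Sum>p=1..N. \<Sum>m=Suc p..N. (uu x p)\<^sup>2 * (od m * G p m / (real m - real p)))"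
    by (rule sum_pairs_swap)
  finally show ?thesis by (simp only: sum_distrib_left)
qed

lemma pf_pairs_lr: "(\<Sum>m=1..N. \<Sum>j=1..<m. (uu x j)\<^sup>2 * (uu x m)\<^sup>2) =
   (\<Sum>p=1..N. (uu x p)\<^sup>2 * (\<Sum>m=Suc p..N. od m / (real m - real p)\<^sup>2)) + (\<Sum>p=1..N. (uu x p)\<^sup>2 * (\<Sum>j=1..<p. od j / (real p - real j)\<^sup>2))
   + (\<Sum>m=1..N. \<Sum>j=1..<m. - 2 / (real m - real j)\<^sup>2 * (uu x j * uu x m))"
proof -
  have "(\<Sum>m=1..N. \<Sum>j=1..<m. (uu x j)\<^sup>2 * (uu x m)\<^sup>2) =
    (\<Sum>m=1..N. \<Sum>j=1..<m. (uu x j)\<^sup>2 * (od m / (real m - real j)\<^sup>2) + (uu x m)\<^sup>2 * (od j / (real m - real j)\<^sup>2) + - 2 / (real m - real j)\<^sup>2 * (uu x j * uu x m))"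
    by (intro sum.cong refl, subst pf_lt_sq(3)) (use nz in \<open>auto simp: diff_divide_distrib add_divide_distrib\<close>)
  also have "\<dots> = (\<Sum>m=1..N. \<Sum>j=1..<m. (uu x j)\<^sup>2 * (od m / (real m - real j)\<^sup>2)) + (\<Sum>m=1..N. \<Sum>j=1..<m. (uu x m)\<^sup>2 * (od j / (real m - real j)\<^sup>2)) + (\<Sum>m=1..N. \<Sum>j=1..<m. - 2 / (real m - real j)\<^sup>2 * (uu x j * uu x m))"
    by (simp only: sum.distrib)
  also have "(\<Sum>m=1..N. \<Sum>j=1..<m. (uu x j)\<^sup>2 * (od m / (real m - real j)\<^sup>2)) = (\<Sum>p=1..N. \<Sum>m=Suc p..N. (uu x p)\<^sup>2 * (od m / (real m - real p)\<^sup>2))"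
    by (rule sum_pairs_swap)
  finally show ?thesis by (simp only: sum_distrib_left)
qed

lemma be_alt: "be x m = (\<Sum>j=1..<m. (H (m - 1) - H j) * uu x j)"
proof (cases m)
  case (Suc n)
  have "be x m = (\<Sum>q=1..n. UU x (q - 1) * vv q)"
    unfolding be_def bb_def Suc atLeastLessThanSuc_atLeastAtMost by (simp only: mult.commute)
  also have "\<dots> = (\<Sum>j=1..n. uu x j * (\<Sum>q=Suc j..n. vv q))" by (rule UU_swap)
  also have "\<dots> = (\<Sum>j=1..n. (H n - H j) * uu x j)" by (intro sum.cong refl) (simp add: H_diff mult.commute)
  finally show ?thesis by (simp add: Suc atLeastLessThanSuc_atLeastAtMost)
qed (simp add: be_def)

lemma W1: "(\<Sum>l=1..N. be x l * (uu x l)\<^sup>2) = (\<Sum>m=1..N. \<Sum>j=1..<m. (H (m - 1) - H j) / (real m - real j) * (uu x j * uu x m))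
   - (\<Sum>p=1..N. (uu x p)\<^sup>2 * (\<Sum>j=1..<p. od j * (H (p - 1) - H j) / (real p - real j)))"
  unfolding pf_pairs_r[symmetric] be_alt sum_distrib_right by (simp only: mult.assoc)

lemma W2: "(\<Sum>l=1..N. be x l * uu x l * ph l) = (\<Sum>m=1..N. \<Sum>j=1..<m. ph m * (H (m - 1) - H j) * (uu x j * uu x m))"
  unfolding be_alt sum_distrib_right by (intro sum.cong refl) (simp only: mult_ac)

lemma W3: "(\<Sum>q=1..N. (bb x q)\<^sup>2) = (\<Sum>p=1..N. (uu x p)\<^sup>2 * (H2 N - H2 p)) + (\<Sum>m=1..N. \<Sum>j=1..<m. 2 * (H2 N - H2 m) * (uu x j * uu x m))"
proof -
  have sq: "(UU x n)\<^sup>2 = (\<Sum>k=1..n. (uu x k)\<^sup>2 + 2 * UU x (k - 1) * uu x k)" for n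
  proof (induction n)
    case (Suc n)
    have "UU x (Suc n) = UU x n + uu x (Suc n)" using UU_step[of "Suc n"] by simp
    then show ?case using Suc by (simp add: power2_eq_square algebra_simps)
  qed (simp add: UU_def)
  have "(\<Sum>q=1..N. (bb x q)\<^sup>2) = (\<Sum>q=1..N. \<Sum>k=1..<q. ((uu x k)\<^sup>2 + 2 * UU x (k - 1) * uu x k) * (vv q)\<^sup>2)"
  proof (rule sum.cong[OF refl])
    fix q assume "q \<in> {1..N}"
    then have "{1..q - 1} = {1..<q}" by auto
    then show "(bb x q)\<^sup>2 = (\<Sum>k=1..<q. ((uu x k)\<^sup>2 + 2 * UU x (k - 1) * uu x k) * (vv q)\<^sup>2)"
      using sq[of "q - 1"] unfolding sum_distrib_right[symmetric] bb_def power_mult_distrib by simp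
  qed
  also have "\<dots> = (\<Sum>k=1..N. \<Sum>q=Suc k..N. ((uu x k)\<^sup>2 + 2 * UU x (k - 1) * uu x k) * (vv q)\<^sup>2)" by (rule sum_triangle_swap)
  also have "\<dots> = (\<Sum>k=1..N. ((uu x k)\<^sup>2 + 2 * UU x (k - 1) * uu x k) * (H2 N - H2 k))"
    by (intro sum.cong refl) (simp add: sum_distrib_left[symmetric] H2_diff)
  also have "\<dots> = (\<Sum>k=1..N. (uu x k)\<^sup>2 * (H2 N - H2 k) + (\<Sum>j=1..<k. 2 * (H2 N - H2 k) * (uu x j * uu x k)))"
  proof (rule sum.cong[OF refl])
    fix k assume "k \<in> {1..N}"
    then have u: "UU x (k - 1) = (\<Sum>j=1..<k. uu x j)" by (intro UU_lt) auto
    show "((uu x k)\<^sup>2 + 2 * UU x (k - 1) * uu x k) * (H2 N - H2 k) = (uu x k)\<^sup>2 * (H2 N - H2 k) + (\<Sum>j=1..<k. 2 * (H2 N - H2 k) * (uu x j * uu x k))"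
      unfolding u sum_distrib_left[symmetric] sum_distrib_right[symmetric] by (simp add: algebra_simps)
  qed
  finally show ?thesis by (simp only: sum.distrib)
qed

lemma K2o_sq: "(K2o x N)\<^sup>2 / 2 = (\<Sum>p=1..N. (uu x p) ^ 4 / 2 + 2 * ph p * (uu x p) ^ 3 + 2 * (ph p)\<^sup>2 * (uu x p)\<^sup>2)
    + (\<Sum>p=1..N. (uu x p)\<^sup>2 * ((\<Sum>m=Suc p..N. od m / (real m - real p)\<^sup>2) + (\<Sum>j=1..<p. od j / (real p - real j)\<^sup>2)
        - 2 * (\<Sum>j=1..<p. od j * ph j / (real p - real j)) + 2 * (\<Sum>m=Suc p..N. od m * ph m / (real m - real p))))
    + (\<Sum>m=1..N. \<Sum>j=1..<m. (- 2 / (real m - real j)\<^sup>2 + 2 * (ph j - ph m) / (real m - real j) + 4 * ph j * ph m) * (uu x j * uu x m))"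
proof -
  define a where "a p = (uu x p)\<^sup>2 + 2 * ph p * uu x p" for p
  have "(K2o x N)\<^sup>2 = (\<Sum>p=1..N. (a p)\<^sup>2) + 2 * (\<Sum>t=1..N. \<Sum>q=Suc t..N. a t * a q)"
    unfolding K2o_def a_def[symmetric] sum_sq_expand sum_distrib_left ..
  also have "(\<Sum>t=1..N. \<Sum>q=Suc t..N. a t * a q) = (\<Sum>m=1..N. \<Sum>j=1..<m. a j * a m)" by (rule sum_pairs_swap[symmetric])
  also have "\<dots> = (\<Sum>m=1..N. \<Sum>j=1..<m. (uu x j)\<^sup>2 * (uu x m)\<^sup>2) + (\<Sum>m=1..N. \<Sum>j=1..<m. 2 * ph j * (uu x j * (uu x m)\<^sup>2))
      + (\<Sum>m=1..N. \<Sum>j=1..<m. 2 * ph m * ((uu x j)\<^sup>2 * uu x m)) + (\<Sum>m=1..N. \<Sum>j=1..<m. 4 * ph j * ph m * (uu x j * uu x m))"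
    unfolding sum.distrib[symmetric] a_def by (intro sum.cong refl) (simp add: algebra_simps)
  also have "\<dots> = ((\<Sum>p=1..N. (uu x p)\<^sup>2 * (\<Sum>m=Suc p..N. od m / (real m - real p)\<^sup>2)) + (\<Sum>p=1..N. (uu x p)\<^sup>2 * (\<Sum>j=1..<p. od j / (real p - real j)\<^sup>2))
       - (\<Sum>p=1..N. (uu x p)\<^sup>2 * (\<Sum>j=1..<p. od j * (2 * ph j) / (real p - real j)))
       + (\<Sum>p=1..N. (uu x p)\<^sup>2 * (\<Sum>m=Suc p..N. od m * (2 * ph m) / (real m - real p))))
     + ((\<Sum>m=1..N. \<Sum>j=1..<m. - 2 / (real m - real j)\<^sup>2 * (uu x j * uu x m)) + (\<Sum>m=1..N. \<Sum>j=1..<m. 2 * ph j / (real m - real j) * (uu x j * uu x m))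
       - (\<Sum>m=1..N. \<Sum>j=1..<m. 2 * ph m / (real m - real j) * (uu x j * uu x m)) + (\<Sum>m=1..N. \<Sum>j=1..<m. 4 * ph j * ph m * (uu x j * uu x m)))"
    unfolding pf_pairs_lr pf_pairs_r pf_pairs_l by simp
  also have "(\<Sum>m=1..N. \<Sum>j=1..<m. - 2 / (real m - real j)\<^sup>2 * (uu x j * uu x m)) + (\<Sum>m=1..N. \<Sum>j=1..<m. 2 * ph j / (real m - real j) * (uu x j * uu x m))
       - (\<Sum>m=1..N. \<Sum>j=1..<m. 2 * ph m / (real m - real j) * (uu x j * uu x m)) + (\<Sum>m=1..N. \<Sum>j=1..<m. 4 * ph j * ph m * (uu x j * uu x m))
     = (\<Sum>m=1..N. \<Sum>j=1..<m. (- 2 / (real m - real j)\<^sup>2 + 2 * (ph j - ph m) / (real m - real j) + 4 * ph j * ph m) * (uu x j * uu x m))"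
    unfolding sum.distrib[symmetric] sum_subtractf[symmetric] by (intro sum.cong refl) (simp add: algebra_simps diff_divide_distrib)
  also have "(\<Sum>p=1..N. (uu x p)\<^sup>2 * (\<Sum>m=Suc p..N. od m / (real m - real p)\<^sup>2)) + (\<Sum>p=1..N. (uu x p)\<^sup>2 * (\<Sum>j=1..<p. od j / (real p - real j)\<^sup>2))
       - (\<Sum>p=1..N. (uu x p)\<^sup>2 * (\<Sum>j=1..<p. od j * (2 * ph j) / (real p - real j)))
       + (\<Sum>p=1..N. (uu x p)\<^sup>2 * (\<Sum>m=Suc p..N. od m * (2 * ph m) / (real m - real p)))
     = (\<Sum>p=1..N. (uu x p)\<^sup>2 * ((\<Sum>m=Suc p..N. od m / (real m - real p)\<^sup>2) + (\<Sum>j=1..<p. od j / (real p - real j)\<^sup>2)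
        - 2 * (\<Sum>j=1..<p. od j * ph j / (real p - real j)) + 2 * (\<Sum>m=Suc p..N. od m * ph m / (real m - real p))))"
    unfolding sum.distrib[symmetric] sum_subtractf[symmetric]
  proof (rule sum.cong[OF refl])
    fix p
    have "(\<Sum>j=1..<p. od j * (2 * ph j) / (real p - real j)) = 2 * (\<Sum>j=1..<p. od j * ph j / (real p - real j))"
      "(\<Sum>m=Suc p..N. od m * (2 * ph m) / (real m - real p)) = 2 * (\<Sum>m=Suc p..N. od m * ph m / (real m - real p))"
      unfolding sum_distrib_left by (simp_all add: mult_ac)
    then show "(uu x p)\<^sup>2 * (\<Sum>m=Suc p..N. od m / (real m - real p)\<^sup>2) + (uu x p)\<^sup>2 * (\<Sum>j=1..<p. od j / (real p - real j)\<^sup>2)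
       - (uu x p)\<^sup>2 * (\<Sum>j=1..<p. od j * (2 * ph j) / (real p - real j)) + (uu x p)\<^sup>2 * (\<Sum>m=Suc p..N. od m * (2 * ph m) / (real m - real p))
     = (uu x p)\<^sup>2 * ((\<Sum>m=Suc p..N. od m / (real m - real p)\<^sup>2) + (\<Sum>j=1..<p. od j / (real p - real j)\<^sup>2)
        - 2 * (\<Sum>j=1..<p. od j * ph j / (real p - real j)) + 2 * (\<Sum>m=Suc p..N. od m * ph m / (real m - real p)))"
      by (simp only: distrib_left right_diff_distrib)
  qed
  also have "(\<Sum>p=1..N. (a p)\<^sup>2) = 2 * (\<Sum>p=1..N. (uu x p) ^ 4 / 2 + 2 * ph p * (uu x p) ^ 3 + 2 * (ph p)\<^sup>2 * (uu x p)\<^sup>2)"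
    unfolding sum_distrib_left a_def by (intro sum.cong refl) (simp add: power2_eq_square power3_eq_cube power4_eq_xxxx algebra_simps)
  finally show ?thesis by simp
qed

text \<open>For \<open>g = 2\<close> no index can carry both \<open>vv\<close> and
  \<open>uu\<close>, so all sums vanish. For \<open>g = 1\<close> the definition of
  \<open>Cc\<close> still contains products of three poles, hidden in \<open>UU\<close> and
  \<open>ab\<close>; one pole is removed by a partial fraction, and the index freed in this way is
  summed out.\<close>

lemma Cc_pf: "Cc x N = - (\<Sum>p=1..N. (uu x p)\<^sup>2 * (vv p * (h (N - p) - s ^ p * (h N - h p)))) + (\<Sum>m=1..N. \<Sum>j=1..<m. GC N j m * (uu x j * uu x m))"
proof (cases "g = 2")
  case True
  have "e t * od t = 0" for t using True unfolding e_def od_def by auto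
  then have vu: "vv t * uu x t = 0" for t unfolding vv_def uu_def by auto
  then have z: "vv m = 0 \<or> uu x m = 0" for m using mult_eq_0_iff by blast
  have "(\<Sum>p=1..N. (uu x p)\<^sup>2 * (vv p * (h (N - p) - s ^ p * (h N - h p)))) = 0"
    by (intro sum.neutral ballI) (use z in auto)
  moreover have "(\<Sum>m=1..N. \<Sum>j=1..<m. GC N j m * (uu x j * uu x m)) = 0"
  proof (intro sum.neutral ballI)
    fix m j
    show "GC N j m * (uu x j * uu x m) = 0"
      using z[of j] z[of m] unfolding GC_def by (elim disjE) simp_all
  qed
  moreover have "Cc x N = 0" unfolding Cc_def by (simp add: vu)
  ultimately show ?thesis by simp
next
  case False
  then have g1: "g = 1" using gs by auto
  have [simp]: "od k = 1" "e k = 1" for k unfolding od_def e_def using g1 by auto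
  have vv1: "vv k = 1 / real k" for k by (simp add: vv_def)
  define D where "D t = h (N - t) - s ^ t * (h N - h t)" for t
  \<comment> \<open>\<open>uu x t\<close> times \<open>ab\<close> is a product of two poles. Its
    part with the pole at \<open>t\<close> combines with \<open>h N - h t\<close> to
    \<open>- (uu x t * D t)\<close>; its part with the pole at \<open>k\<close> remains as a
    sum.\<close>
  have t1: "s ^ t * uu x t * (h N - h t - ab x N t) = - (uu x t * D t) + (\<Sum>k=Suc t..N. s ^ (k + t) / (real k - real t) * uu x k)" if t: "t \<in> {1..N}" for t
  proof -
    have "s ^ t * uu x t * (h N - h t - ab x N t) = (\<Sum>k=Suc t..N. uu x t * (s ^ t * (f k / real k)) - s ^ (k + t) * (uu x t * uu x k))"
      using t h_diff[of t N] unfolding sum_subtractf sum_distrib_left[symmetric] ab_def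
      by (simp add: right_diff_distrib sum_distrib_left power_add mult_ac)
    also have "\<dots> = (\<Sum>k=Suc t..N. uu x t * (s ^ t * (f k / real k)) - uu x t * (f (k - t) / real (k - t)) + s ^ (k + t) / (real k - real t) * uu x k)"
    proof (rule sum.cong[OF refl])
      fix k assume k: "k \<in> {Suc t..N}"
      have "uu x t * uu x k = (uu x t - uu x k) / (real k - real t)"
        using pf_lt[of t x k] nz[of t] nz[of k] t k by simp
      moreover have "f (k - t) / real (k - t) = s ^ (k + t) / (real k - real t)"
        using k s_sub[of t k] by (simp add: f_def of_nat_diff add.commute)
      ultimately show "uu x t * (s ^ t * (f k / real k)) - s ^ (k + t) * (uu x t * uu x k) =
         uu x t * (s ^ t * (f k / real k)) - uu x t * (f (k - t) / real (k - t)) + s ^ (k + t) / (real k - real t) * uu x k"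
        by (simp add: diff_divide_distrib right_diff_distrib mult_ac)
    qed
    also have "\<dots> = uu x t * (s ^ t * (h N - h t)) - uu x t * h (N - t) + (\<Sum>k=Suc t..N. s ^ (k + t) / (real k - real t) * uu x k)"
      using h_diff[of t N] h_sub[of t t N] t unfolding sum.distrib sum_subtractf sum_distrib_left[symmetric] by simp
    finally show ?thesis by (simp add: D_def algebra_simps)
  qed
  have Ut: "UU x t = uu x t + (\<Sum>j=1..<t. uu x j)" if "t \<in> {1..N}" for t
    using UU_step[of t x] UU_lt[of t x] that by simp
  have "Cc x N = (\<Sum>t=1..N. vv t * (UU x t * (s ^ t * uu x t * (h N - h t - ab x N t))))
     + (\<Sum>t=1..N. \<Sum>m=Suc t..N. vv t * (s ^ t * (h N - h m) - h (N - t) + h (m - t - 1)) * (uu x t * uu x m))"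
    unfolding Cc_def sum.distrib[symmetric] by (intro sum.cong refl) (simp add: distrib_left sum_distrib_left mult_ac)
  also have "(\<Sum>t=1..N. \<Sum>m=Suc t..N. vv t * (s ^ t * (h N - h m) - h (N - t) + h (m - t - 1)) * (uu x t * uu x m)) =
     (\<Sum>m=1..N. \<Sum>j=1..<m. vv j * (s ^ j * (h N - h m) - h (N - j) + h (m - j - 1)) * (uu x j * uu x m))"
    by (rule sum_pairs_swap[symmetric])
  also have "(\<Sum>t=1..N. vv t * (UU x t * (s ^ t * uu x t * (h N - h t - ab x N t)))) =
     - (\<Sum>t=1..N. (uu x t)\<^sup>2 * (vv t * D t)) + (\<Sum>t=1..N. \<Sum>j=1..<t. - vv t * D t * (uu x j * uu x t))
      + (\<Sum>t=1..N. \<Sum>k=Suc t..N. UU x t * (vv t * s ^ (k + t) / (real k - real t) * uu x k))"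
    unfolding sum_negf[symmetric] sum.distrib[symmetric]
  proof (rule sum.cong[OF refl])
    fix t assume t: "t \<in> {1..N}"
    define S where "S = (\<Sum>k=Suc t..N. s ^ (k + t) / (real k - real t) * uu x k)"
    define B where "B = (\<Sum>j=1..<t. uu x j)"
    have a: "(\<Sum>j=1..<t. - vv t * D t * (uu x j * uu x t)) = - vv t * D t * (B * uu x t)"
      unfolding B_def sum_distrib_left sum_distrib_right ..
    have b: "(\<Sum>k=Suc t..N. UU x t * (vv t * s ^ (k + t) / (real k - real t) * uu x k)) = UU x t * (vv t * S)"
      unfolding S_def sum_distrib_left by (simp add: mult_ac)
    show "vv t * (UU x t * (s ^ t * uu x t * (h N - h t - ab x N t))) = - ((uu x t)\<^sup>2 * (vv t * D t)) + (\<Sum>j=1..<t. - vv t * D t * (uu x j * uu x t))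
      + (\<Sum>k=Suc t..N. UU x t * (vv t * s ^ (k + t) / (real k - real t) * uu x k))"
      unfolding a b t1[OF t] S_def[symmetric] using Ut[OF t] unfolding B_def[symmetric]
      by (simp add: power2_eq_square algebra_simps)
  qed
  also have "(\<Sum>t=1..N. \<Sum>k=Suc t..N. UU x t * (vv t * s ^ (k + t) / (real k - real t) * uu x k)) =
     (\<Sum>k=1..N. \<Sum>t=1..<k. UU x t * (vv t * s ^ (k + t) / (real k - real t) * uu x k))"
    by (rule sum_pairs_swap[symmetric])
  \<comment> \<open>\<open>UU x t\<close> is opened; in the exchanged order \<open>t\<close> runs
    through \<open>j \<le> t < m\<close> between the two poles, and 1/(t(m - t)) = (1/t + 1/(m -
    t))/m makes the sum over \<open>t\<close> a combination of values of \<open>h\<close>.\<close>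
  also have "\<dots> = (\<Sum>m=1..N. \<Sum>j=1..<m. vv m * (s ^ m * (h (m - 1) - h (j - 1)) + h (m - j)) * (uu x j * uu x m))"
  proof (rule sum.cong[OF refl])
    fix m assume m: "m \<in> {1..N}"
    define W where "W t = vv t * s ^ (m + t) / (real m - real t)" for t
    have "(\<Sum>t=1..<m. UU x t * (W t * uu x m)) = (\<Sum>t=1..<m. \<Sum>j=1..t. uu x j * (W t * uu x m))"
      unfolding UU_def sum_distrib_right ..
    also have "\<dots> = (\<Sum>j=1..m. \<Sum>t=j..<m. uu x j * (W t * uu x m))" by (rule sum_triangle_swap'[symmetric])
    also have "\<dots> = (\<Sum>j=1..<m. \<Sum>t=j..<m. uu x j * (W t * uu x m))"
      using m by (intro sum.mono_neutral_right) auto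
    also have "\<dots> = (\<Sum>j=1..<m. vv m * (s ^ m * (h (m - 1) - h (j - 1)) + h (m - j)) * (uu x j * uu x m))"
    proof (rule sum.cong[OF refl])
      fix j assume j: "j \<in> {1..<m}"
      have "W t = vv m * (s ^ m * (f t / real t) + f (m - t) / real (m - t))" if "t \<in> {j..<m}" for t
      proof -
        have "1 / real t / (real m - real t) = 1 / real m * (1 / real t + 1 / (real m - real t))"
          using that j by (simp add: divide_simps)
        then have "s ^ (m + t) * (1 / real t / (real m - real t)) = s ^ (m + t) * (1 / real m * (1 / real t + 1 / (real m - real t)))" by simp
        moreover have "f (m - t) / real (m - t) = s ^ (m + t) / (real m - real t)"
          using that s_sub[of t m] by (simp add: f_def of_nat_diff add.commute)
        ultimately show ?thesis unfolding W_def vv1 by (simp add: f_def power_add distrib_left mult_ac)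
      qed
      then have "(\<Sum>t=j..<m. W t) = (\<Sum>t=j..<m. vv m * (s ^ m * (f t / real t)) + vv m * (f (m - t) / real (m - t)))"
        by (intro sum.cong refl) (simp add: distrib_left)
      also have "\<dots> = vv m * (s ^ m * (\<Sum>t=j..<m. f t / real t)) + vv m * (\<Sum>t=j..<m. f (m - t) / real (m - t))"
        by (simp only: sum.distrib sum_distrib_left)
      also have "(\<Sum>t=j..<m. f t / real t) = h (m - 1) - h (j - 1)"
      proof -
        have "{j..<m} = {Suc (j - 1)..m - 1}" using j by auto
        then show ?thesis using h_diff[of "j - 1" "m - 1"] j by auto
      qed
      also have "(\<Sum>t=j..<m. f (m - t) / real (m - t)) = h (m - j)" using j by (intro h_rev') auto
      finally have w: "(\<Sum>t=j..<m. W t) = vv m * (s ^ m * (h (m - 1) - h (j - 1)) + h (m - j))" by (simp add: distrib_left)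
      show "(\<Sum>t=j..<m. uu x j * (W t * uu x m)) = vv m * (s ^ m * (h (m - 1) - h (j - 1)) + h (m - j)) * (uu x j * uu x m)"
        unfolding w[symmetric] sum_distrib_right by (intro sum.cong refl) (simp add: mult_ac)
    qed
    finally show "(\<Sum>t=1..<m. UU x t * (vv t * s ^ (m + t) / (real m - real t) * uu x m)) = (\<Sum>j=1..<m. vv m * (s ^ m * (h (m - 1) - h (j - 1)) + h (m - j)) * (uu x j * uu x m))"
      unfolding W_def .
  qed
  finally have C: "Cc x N = - (\<Sum>t=1..N. (uu x t)\<^sup>2 * (vv t * D t)) + ((\<Sum>t=1..N. \<Sum>j=1..<t. - vv t * D t * (uu x j * uu x t))
     + (\<Sum>m=1..N. \<Sum>j=1..<m. vv m * (s ^ m * (h (m - 1) - h (j - 1)) + h (m - j)) * (uu x j * uu x m))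
     + (\<Sum>m=1..N. \<Sum>j=1..<m. vv j * (s ^ j * (h N - h m) - h (N - j) + h (m - j - 1)) * (uu x j * uu x m)))"
    by simp
  have "(\<Sum>t=1..N. \<Sum>j=1..<t. - vv t * D t * (uu x j * uu x t))
     + (\<Sum>m=1..N. \<Sum>j=1..<m. vv m * (s ^ m * (h (m - 1) - h (j - 1)) + h (m - j)) * (uu x j * uu x m))
     + (\<Sum>m=1..N. \<Sum>j=1..<m. vv j * (s ^ j * (h N - h m) - h (N - j) + h (m - j - 1)) * (uu x j * uu x m))
    = (\<Sum>m=1..N. \<Sum>j=1..<m. GC N j m * (uu x j * uu x m))"
    unfolding sum.distrib[symmetric]
  proof (intro sum.cong refl)
    fix m j assume mj: "m \<in> {1..N}" "j \<in> {1..<m}"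
    have "h m = h (m - 1) + s ^ m * vv m" using h_Suc[of "m - 1"] mj by (simp add: f_def vv1 del: power_Suc)
    then have "s ^ m * h m = s ^ m * h (m - 1) + s ^ m * s ^ m * vv m" by (simp add: algebra_simps)
    then have "s ^ m * h m = s ^ m * h (m - 1) + vv m" by simp
    then have "- D m + (s ^ m * (h (m - 1) - h (j - 1)) + h (m - j)) = s ^ m * (h N - h (j - 1)) - h (N - m) + h (m - j) - vv m"
      by (simp add: D_def algebra_simps)
    then have g: "GC N j m = vv m * (- D m + (s ^ m * (h (m - 1) - h (j - 1)) + h (m - j))) + vv j * (s ^ j * (h N - h m) - h (N - j) + h (m - j - 1))"
      unfolding GC_def by simp
    show "- vv m * D m * (uu x j * uu x m) + vv m * (s ^ m * (h (m - 1) - h (j - 1)) + h (m - j)) * (uu x j * uu x m)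
       + vv j * (s ^ j * (h N - h m) - h (N - j) + h (m - j - 1)) * (uu x j * uu x m) = GC N j m * (uu x j * uu x m)"
      unfolding g by (simp add: algebra_simps)
  qed
  then show ?thesis using C unfolding D_def by simp
qed

lemma TN_pf: "TN x N = (\<Sum>p=1..N. (uu x p) ^ 4 / 2 + 2 * ph p * (uu x p) ^ 3 + dd p N * (uu x p)\<^sup>2 + pfc (Gt N) p N * uu x p)"
proof -
  have g: "(\<Sum>m=1..N. \<Sum>j=1..<m. (- 2 / (real m - real j)\<^sup>2 + 2 * (ph j - ph m) / (real m - real j) + 4 * ph j * ph m) * (uu x j * uu x m))
     + 2 * ((\<Sum>m=1..N. \<Sum>j=1..<m. (H (m - 1) - H j) / (real m - real j) * (uu x j * uu x m)) + (\<Sum>m=1..N. \<Sum>j=1..<m. ph m * (H (m - 1) - H j) * (uu x j * uu x m)))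
     - (\<Sum>m=1..N. \<Sum>j=1..<m. 2 * (H2 N - H2 m) * (uu x j * uu x m)) + 2 * (\<Sum>m=1..N. \<Sum>j=1..<m. GC N j m * (uu x j * uu x m))
     = (\<Sum>p=1..N. uu x p * pfc (Gt N) p N)"
    unfolding pf_pairs[symmetric] sum_distrib_left sum.distrib[symmetric] sum_subtractf[symmetric]
    by (intro sum.cong refl) (simp add: Gt_def algebra_simps)
  have d: "(\<Sum>p=1..N. (uu x p) ^ 4 / 2 + 2 * ph p * (uu x p) ^ 3 + 2 * (ph p)\<^sup>2 * (uu x p)\<^sup>2)
    + (\<Sum>p=1..N. (uu x p)\<^sup>2 * ((\<Sum>m=Suc p..N. od m / (real m - real p)\<^sup>2) + (\<Sum>j=1..<p. od j / (real p - real j)\<^sup>2)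
        - 2 * (\<Sum>j=1..<p. od j * ph j / (real p - real j)) + 2 * (\<Sum>m=Suc p..N. od m * ph m / (real m - real p))))
    - 2 * (\<Sum>p=1..N. (uu x p)\<^sup>2 * (\<Sum>j=1..<p. od j * (H (p - 1) - H j) / (real p - real j)))
    - (\<Sum>p=1..N. (uu x p)\<^sup>2 * (H2 N - H2 p)) - 2 * (\<Sum>p=1..N. (uu x p)\<^sup>2 * (vv p * (h (N - p) - s ^ p * (h N - h p))))
    + (\<Sum>p=1..N. uu x p * pfc (Gt N) p N)
    = (\<Sum>p=1..N. (uu x p) ^ 4 / 2 + 2 * ph p * (uu x p) ^ 3 + dd p N * (uu x p)\<^sup>2 + pfc (Gt N) p N * uu x p)"
  proof -
    have comb: "(\<Sum>p=1..N. a p) + (\<Sum>p=1..N. b p) - 2 * (\<Sum>p=1..N. c p) - (\<Sum>p=1..N. d p) - 2 * (\<Sum>p=1..N. e' p) + (\<Sum>p=1..N. f' p) =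
      (\<Sum>p=1..N. a p + b p - 2 * c p - d p - 2 * e' p + f' p)" for a b c d e' f' :: "nat \<Rightarrow> real"
      by (simp only: sum.distrib sum_subtractf sum_distrib_left)
    show ?thesis unfolding comb by (intro sum.cong refl) (simp add: dd_def algebra_simps)
  qed
  have gen: "t = rr" if "t = kk + 2 * (w1 + w2) - w3 + 2 * c" "kk = a1 + a2 + a3" "w1 = b1 - b2" "w2 = b3" "w3 = c1 + c2" "c = - d1 + d2"
    "a3 + 2 * (b1 + b3) - c2 + 2 * d2 = G" "a1 + a2 - 2 * b2 - c1 - 2 * d1 + G = rr" for t kk w1 w2 w3 c a1 a2 a3 b1 b2 b3 c1 c2 d1 d2 G rr :: real
    unfolding that(1-6) that(7,8)[symmetric] by (simp add: algebra_simps)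
  show ?thesis by (rule gen[OF TN_def K2o_sq W1 W2 W3 Cc_pf g d])
qed

end
end

section \<open>Boundary terms\<close>

definition hs :: "nat \<Rightarrow> real" where "hs n = (\<Sum>k=1..n. 1 / real k)"

lemma hs_0 [simp]: "hs 0 = 0" and hs_Suc: "hs (Suc n) = hs n + 1 / real (Suc n)"
  by (simp_all add: hs_def)

lemma hs_nonneg: "0 \<le> hs n" by (auto simp: hs_def intro: sum_nonneg)
lemma hs_mono: "m \<le> n \<Longrightarrow> hs m \<le> hs n" by (auto simp: hs_def intro: sum_mono2)

lemma hs_le: "1 \<le> n \<Longrightarrow> hs n \<le> 1 + ln (real n)"
proof (induction n rule: nat_induct_at_least)
  case (Suc n)
  have "ln (real n / real (Suc n)) \<le> real n / real (Suc n) - 1"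
    using Suc by (intro ln_le_minus_one) auto
  then have "ln (real n) - ln (real (Suc n)) \<le> - 1 / real (Suc n)"
    using Suc by (subst (asm) ln_div) (auto simp: field_simps)
  then show ?case using Suc by (simp add: hs_Suc)
qed (simp add: hs_def)

lemma inv_sq_tail:
  assumes "1 \<le> n" "n \<le> m"
  shows "(\<Sum>q=Suc n..m. 1 / (real q)\<^sup>2) \<le> 1 / real n - 1 / real m"
  using assms(2)
proof (induction m rule: dec_induct)
  case (step m)
  have "1 / (real (Suc m))\<^sup>2 \<le> 1 / real m - 1 / real (Suc m)"
    using step assms by (simp add: divide_simps power2_eq_square)
  then show ?case using step by simp
qed auto

text \<open>An upper bound for the harmonic numbers from 1 on; all errors are measured as powers of
  \<open>lg N\<close> divided by \<open>N\<close>.\<close>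

definition lg :: "nat \<Rightarrow> real" where "lg n = 1 + ln (real n)"

lemma lg_ge1: "1 \<le> n \<Longrightarrow> 1 \<le> lg n" by (simp add: lg_def)
lemma hs_le_lg: "1 \<le> n \<Longrightarrow> hs n \<le> lg n" using hs_le by (simp add: lg_def)

lemma sum_inv_conv: "(\<Sum>l<N. 1 / ((real l + 1) * (real N - real l))) = 2 * hs N / (real N + 1)"
proof -
  have "(\<Sum>l<N. 1 / ((real l + 1) * (real N - real l))) = (\<Sum>l<N. 1 / (real N + 1) * (1 / (real l + 1) + 1 / (real N - real l)))"
    by (intro sum.cong refl) (auto simp: divide_simps)
  also have "\<dots> = 1 / (real N + 1) * ((\<Sum>l<N. 1 / (real l + 1)) + (\<Sum>l<N. 1 / (real N - real l)))"
    by (simp only: sum_distrib_left[symmetric] sum.distrib)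
  also have "(\<Sum>l<N. 1 / (real l + 1)) = hs N" unfolding hs_def
    by (intro sum.reindex_bij_witness[of _ "\<lambda>k. k - 1" Suc]) (auto simp: of_nat_diff)
  also have "(\<Sum>l<N. 1 / (real N - real l)) = hs N" unfolding hs_def
    by (intro sum.reindex_bij_witness[of _ "\<lambda>k. N - k" "\<lambda>l. N - l"]) (auto simp: of_nat_diff)
  finally show ?thesis by simp
qed

lemma sum_inv_conv_le: "1 \<le> N \<Longrightarrow> (\<Sum>l<N. 1 / ((real l + 1) * (real N - real l))) \<le> 2 * lg N / real N"
  unfolding sum_inv_conv using hs_le_lg[of N] lg_ge1[of N] hs_nonneg[of N] by (intro frac_le) auto

lemma small_tendsto_0: "(\<lambda>N. K * lg N ^ m / real N) \<longlonglongrightarrow> 0"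
proof -
  have "(\<lambda>N. (1 + ln (real N)) ^ m / real N) \<longlonglongrightarrow> 0" by real_asymp
  from tendsto_mult_left[OF this, of K] show ?thesis by (simp add: lg_def)
qed

text \<open>Summation kernels \<open>\<theta>\<^sub>N\<close> that are negligible away from \<open>k \<approx> N\<close>.\<close>

locale end_kernel =
  fixes \<theta> :: "nat \<Rightarrow> nat \<Rightarrow> real"
  assumes th0: "\<theta> N 0 = 0"
    and dth: "k < N \<Longrightarrow> \<bar>\<theta> N (Suc k) - \<theta> N k\<bar> \<le> 2 / (real N - real k)"
begin

text \<open>The factor \<open>l\<close> matters: it turns a summand of size 1/l^2 into the
  convolution 1/(l(N - l + 1)), whose sum is of order log N / N.\<close>

lemma th_le: "l \<le> N \<Longrightarrow> \<bar>\<theta> N l\<bar> \<le> 2 * real l / (real N - real l + 1)"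
proof (induction l)
  case (Suc l)
  have "\<bar>\<theta> N (Suc l)\<bar> \<le> \<bar>\<theta> N l\<bar> + \<bar>\<theta> N (Suc l) - \<theta> N l\<bar>" by linarith
  also have "\<dots> \<le> 2 * real l / (real N - real l + 1) + 2 / (real N - real l)"
    using Suc dth[of l N] by auto
  also have "\<dots> \<le> 2 * real l / (real N - real l) + 2 / (real N - real l)"
    using Suc by (intro add_right_mono frac_le) auto
  also have "\<dots> = 2 * real (Suc l) / (real N - real (Suc l) + 1)" by (simp add: add_divide_distrib)
  finally show ?case .
qed (simp add: th0)

lemma th_le_hs: "\<bar>\<theta> N l\<bar> \<le> 2 * hs N" if "l \<le> N"
proof -
  have "\<bar>\<theta> N l\<bar> \<le> 2 * (hs N - hs (N - l))" using that
  proof (induction l)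
    case (Suc l)
    have e: "N - l = Suc (N - Suc l)" using Suc by auto
    have "hs (N - l) = hs (N - Suc l) + 1 / (real N - real l)"
      unfolding e hs_Suc using Suc e by (simp add: of_nat_diff)
    then show ?case using Suc dth[of l N] by auto
  qed (simp add: th0)
  then show ?thesis using hs_nonneg[of "N - l"] by simp
qed

lemma th_sum_le:
  assumes N: "1 \<le> N" and F: "\<And>l. 1 \<le> l \<Longrightarrow> l \<le> N \<Longrightarrow> \<bar>F l\<bar> \<le> M / (real l)\<^sup>2" and M: "0 \<le> M"
  shows "\<bar>\<Sum>l=1..N. \<theta> N l * F l\<bar> \<le> 4 * M * lg N / real N"
proof -
  have "\<bar>\<Sum>l=1..N. \<theta> N l * F l\<bar> \<le> (\<Sum>l=1..N. \<bar>\<theta> N l * F l\<bar>)" by (rule sum_abs)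
  also have "\<dots> \<le> (\<Sum>l=1..N. 2 * M * (1 / (real l * (real N - real l + 1))))"
  proof (intro sum_mono)
    fix l assume l: "l \<in> {1..N}"
    have "\<bar>\<theta> N l * F l\<bar> \<le> 2 * real l / (real N - real l + 1) * (M / (real l)\<^sup>2)"
      unfolding abs_mult using l M by (intro mult_mono th_le F) auto
    also have "\<dots> = 2 * M * (1 / (real l * (real N - real l + 1)))" using l by (simp add: power2_eq_square field_simps)
    finally show "\<bar>\<theta> N l * F l\<bar> \<le> 2 * M * (1 / (real l * (real N - real l + 1)))" .
  qed
  also have "\<dots> = 2 * M * (\<Sum>l<N. 1 / ((real l + 1) * (real N - real l)))"
    unfolding sum_distrib_left[symmetric]
    by (intro arg_cong2[of _ _ _ _ "(*)"] refl sum.reindex_bij_witness[of _ "\<lambda>l. Suc l" "\<lambda>l. l - 1"]) (auto simp: of_nat_diff)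
  also have "\<dots> \<le> 2 * M * (2 * lg N / real N)" using M sum_inv_conv_le[OF N] by (intro mult_left_mono) auto
  finally show ?thesis by simp
qed

text \<open>The difference \<open>r l - r (l - 1)\<close> may be as large as a multiple of
  \<open>1 / l\<close>, as for \<open>g = 2\<close>, where \<open>uu\<close> and \<open>vv\<close>
  have disjoint supports. Summation by parts uses the bound on \<open>r\<close> itself and shifts
  the difference to \<open>\<theta> * F\<close>, whose increments are controlled.\<close>

lemma abel_le:
  assumes N: "1 \<le> N" and r: "\<And>k. \<bar>r k\<bar> \<le> C / (real k + 1)"
    and F: "\<And>l. 1 \<le> l \<Longrightarrow> l \<le> N \<Longrightarrow> \<bar>F l\<bar> \<le> M"
    and dF: "\<And>l. 1 \<le> l \<Longrightarrow> l < N \<Longrightarrow> \<bar>F (Suc l) - F l\<bar> \<le> M / real l"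
  shows "\<bar>\<Sum>l=1..N. \<theta> N l * ((r l - r (l - 1)) * F l)\<bar> \<le> 10 * C * M * lg N / real N"
proof -
  have C: "0 \<le> C" using r[of 0] by simp
  have M: "0 \<le> M" using F[of 1] N by simp
  define G where "G l = \<theta> N l * F l" for l
  have G0: "G 0 = 0" by (simp add: G_def th0)
  have ab: "(\<Sum>l=1..n. (r l - r (l - 1)) * G l) = r n * G n - (\<Sum>l<n. r l * (G (Suc l) - G l))" for n
    by (induction n) (auto simp: G0 algebra_simps)
  have dG: "\<bar>G (Suc l) - G l\<bar> \<le> 4 * M / (real N - real l)" if l: "l < N" for l
  proof -
    have "\<bar>G (Suc l) - G l\<bar> = \<bar>(\<theta> N (Suc l) - \<theta> N l) * F (Suc l) + \<theta> N l * (F (Suc l) - F l)\<bar>"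
      by (simp add: G_def algebra_simps)
    also have "\<dots> \<le> \<bar>\<theta> N (Suc l) - \<theta> N l\<bar> * \<bar>F (Suc l)\<bar> + \<bar>\<theta> N l\<bar> * \<bar>F (Suc l) - F l\<bar>"
      unfolding abs_mult[symmetric] by (rule abs_triangle_ineq)
    also have "\<dots> \<le> 2 / (real N - real l) * M + 2 * M / (real N - real l)"
    proof (rule add_mono)
      show "\<bar>\<theta> N (Suc l) - \<theta> N l\<bar> * \<bar>F (Suc l)\<bar> \<le> 2 / (real N - real l) * M"
        using l by (intro mult_mono dth F) auto
      show "\<bar>\<theta> N l\<bar> * \<bar>F (Suc l) - F l\<bar> \<le> 2 * M / (real N - real l)"
      proof (cases "l = 0")
        case True
        then show ?thesis using M l by (simp add: th0)
      next
        case False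
        have "\<bar>\<theta> N l\<bar> * \<bar>F (Suc l) - F l\<bar> \<le> 2 * real l / (real N - real l + 1) * (M / real l)"
          using False l by (intro mult_mono th_le dF) auto
        also have "\<dots> = 2 * M / (real N - real l + 1)" using False by simp
        also have "\<dots> \<le> 2 * M / (real N - real l)" using M l by (intro frac_le) auto
        finally show ?thesis .
      qed
    qed
    finally show ?thesis by simp
  qed
  have "\<bar>\<Sum>l<N. r l * (G (Suc l) - G l)\<bar> \<le> (\<Sum>l<N. \<bar>r l * (G (Suc l) - G l)\<bar>)" by (rule sum_abs)
  also have "\<dots> \<le> (\<Sum>l<N. 4 * C * M * (1 / ((real l + 1) * (real N - real l))))"
  proof (intro sum_mono)
    fix l assume l: "l \<in> {..<N}"
    have "\<bar>r l * (G (Suc l) - G l)\<bar> \<le> C / (real l + 1) * (4 * M / (real N - real l))"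
      unfolding abs_mult using l C by (intro mult_mono r dG) auto
    then show "\<bar>r l * (G (Suc l) - G l)\<bar> \<le> 4 * C * M * (1 / ((real l + 1) * (real N - real l)))" by (simp add: mult_ac)
  qed
  also have "\<dots> \<le> 4 * C * M * (2 * lg N / real N)"
    unfolding sum_distrib_left[symmetric] using C M sum_inv_conv_le[OF N] by (intro mult_left_mono) auto
  finally have 1: "\<bar>\<Sum>l<N. r l * (G (Suc l) - G l)\<bar> \<le> 8 * C * M * lg N / real N" by simp
  have "\<bar>r N * G N\<bar> \<le> C / (real N + 1) * (2 * hs N * M)"
    unfolding abs_mult G_def using N C hs_nonneg[of N] by (intro mult_mono r th_le_hs F) auto
  also have "\<dots> \<le> C / real N * (2 * lg N * M)"
    using N C M hs_le_lg[OF N] hs_nonneg[of N] lg_ge1[OF N] by (intro mult_mono frac_le) auto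
  finally have 2: "\<bar>r N * G N\<bar> \<le> 2 * C * M * lg N / real N" by (simp add: mult_ac)
  have "(\<Sum>l=1..N. \<theta> N l * ((r l - r (l - 1)) * F l)) = (\<Sum>l=1..N. (r l - r (l - 1)) * G l)"
    by (simp add: G_def mult_ac)
  then have "\<bar>\<Sum>l=1..N. \<theta> N l * ((r l - r (l - 1)) * F l)\<bar> \<le> 2 * C * M * lg N / real N + 8 * C * M * lg N / real N"
    unfolding ab using 1 2 by linarith
  then show ?thesis by (simp add: add_divide_distrib[symmetric])
qed

end

text \<open>\<open>v\<close> and \<open>u\<close> stand for \<open>vv\<close> and
  \<open>uu x\<close>: their partial sums diverge, but differ by the convergent
  \<open>a + r n\<close>. The value \<open>r 0 = - a\<close> makes \<open>U 0 = V 0\<close>.\<close>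

locale perturbed_sums =
  fixes v u r :: "nat \<Rightarrow> real" and a C :: real
  assumes v_le: "\<bar>v q\<bar> \<le> 1 / real q"
    and u_eq: "1 \<le> k \<Longrightarrow> u k = v k + (r k - r (k - 1))"
    and r_le: "\<bar>r k\<bar> \<le> C / (real k + 1)" and r0: "r 0 = - a"
begin

definition V where "V n = (\<Sum>k=1..n. v k)"
definition U where "U n = (\<Sum>k=1..n. u k)"
definition B where "B n = (\<Sum>q=1..n. v q * U (q - 1))"
definition G where "G n = (\<Sum>q=1..n. v q * V (q - 1))"
definition rhos where "rhos n = (\<Sum>q=1..n. v q * r (q - 1))"
text \<open>The limit of \<open>B n - G n - a * V n\<close>, by \<open>B_eq\<close> and
  \<open>rho_sums\<close>.\<close>

definition rho where "rho = (\<Sum>q. v (Suc q) * r q)"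

lemma C_nonneg: "0 \<le> C" using r_le[of 0] by simp
lemma a_le: "\<bar>a\<bar> \<le> C" using r_le[of 0] r0 by simp

lemma U_eq: "U n = V n + a + r n"
  by (induction n) (auto simp: U_def V_def r0 u_eq)

lemma B_eq: "B n = G n + a * V n + rhos n"
proof -
  have "B n = (\<Sum>q=1..n. v q * V (q - 1) + a * v q + v q * r (q - 1))"
    unfolding B_def by (intro sum.cong refl) (simp add: U_eq algebra_simps)
  then show ?thesis by (simp add: G_def V_def[of n] rhos_def sum.distrib sum_distrib_left)
qed

lemma V_le: "\<bar>V n\<bar> \<le> hs n"
proof -
  have "\<bar>V n\<bar> \<le> (\<Sum>k=1..n. \<bar>v k\<bar>)" unfolding V_def by (rule sum_abs)
  also have "\<dots> \<le> hs n" unfolding hs_def by (intro sum_mono v_le)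
  finally show ?thesis .
qed

lemma U_le: "1 \<le> N \<Longrightarrow> n \<le> N \<Longrightarrow> \<bar>U n\<bar> \<le> (1 + 2 * C) * lg N"
proof -
  assume N: "1 \<le> N" "n \<le> N"
  have "\<bar>U n\<bar> \<le> hs n + C + C / (real n + 1)" unfolding U_eq using V_le[of n] a_le r_le[of n] by linarith
  also have "\<dots> \<le> hs N + C + C" using N hs_mono[of n N] C_nonneg by (intro add_mono) (auto simp: divide_simps mult_left_mono mult_le_cancel_left1)
  also have "\<dots> \<le> lg N + 2 * C * lg N" using hs_le_lg[OF N(1)] lg_ge1[OF N(1)] C_nonneg mult_left_mono[of 1 "lg N" C] by linarith
  finally show ?thesis by (simp add: algebra_simps)
qed

lemma B_le: "1 \<le> N \<Longrightarrow> n \<le> N \<Longrightarrow> \<bar>B n\<bar> \<le> (1 + 2 * C) * lg N ^ 2"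
proof -
  assume N: "1 \<le> N" "n \<le> N"
  have "\<bar>B n\<bar> \<le> (\<Sum>q=1..n. \<bar>v q * U (q - 1)\<bar>)" unfolding B_def by (rule sum_abs)
  also have "\<dots> \<le> (\<Sum>q=1..n. 1 / real q * ((1 + 2 * C) * lg N))"
  proof (intro sum_mono)
    fix q assume "q \<in> {1..n}"
    then show "\<bar>v q * U (q - 1)\<bar> \<le> 1 / real q * ((1 + 2 * C) * lg N)"
      unfolding abs_mult using N by (intro mult_mono v_le U_le) auto
  qed
  also have "\<dots> = hs n * ((1 + 2 * C) * lg N)" unfolding hs_def sum_distrib_right ..
  also have "\<dots> \<le> lg N * ((1 + 2 * C) * lg N)"
    using N hs_mono[of n N] hs_le_lg[OF N(1)] lg_ge1[OF N(1)] C_nonneg by (intro mult_right_mono) auto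
  finally show ?thesis by (simp add: power2_eq_square mult_ac)
qed

lemma vr_le: "\<bar>v (Suc q) * r q\<bar> \<le> C / (real (Suc q))\<^sup>2"
proof -
  have "\<bar>v (Suc q) * r q\<bar> \<le> 1 / real (Suc q) * (C / (real q + 1))"
    unfolding abs_mult by (intro mult_mono v_le r_le) auto
  then show ?thesis by (simp add: power2_eq_square add.commute)
qed

lemma rho_sums: "rhos \<longlonglongrightarrow> rho" and rhos_le: "\<bar>rhos n - rho\<bar> \<le> 2 * C / (real n + 1)"
proof -
  have s: "summable (\<lambda>q. v (Suc q) * r q)"
  proof (rule summable_comparison_test')
    show "summable (\<lambda>q. C / (real (Suc q))\<^sup>2)"
      using summable_mult[OF summable_Suc_iff[THEN iffD2, OF inverse_power_summable[of 2, where 'a = real]], of C]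
      by (simp add: divide_inverse)
    show "norm (v (Suc q) * r q) \<le> C / (real (Suc q))\<^sup>2" for q using vr_le by simp
  qed
  have e: "rhos n = (\<Sum>q<n. v (Suc q) * r q)" for n
    unfolding rhos_def by (intro sum.reindex_bij_witness[of _ Suc "\<lambda>q. q - 1"]) auto
  show lim: "rhos \<longlonglongrightarrow> rho" unfolding e rho_def using s by (rule summable_LIMSEQ)
  have d: "\<bar>rhos m - rhos n\<bar> \<le> C * (\<Sum>q=Suc n..m. 1 / (real q)\<^sup>2)" if "n \<le> m" for m
    using that
  proof (induction m rule: dec_induct)
    case (step m)
    have "rhos (Suc m) = rhos m + v (Suc m) * r m" by (simp add: rhos_def)
    then show ?case using step vr_le[of m] by (simp add: algebra_simps)
  qed simp
  have b: "\<bar>rhos m - rhos n\<bar> \<le> 2 * C / (real n + 1)" if "n < m" for m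
  proof (cases "n = 0")
    case True
    have "(\<Sum>q=Suc 0..m. 1 / (real q)\<^sup>2) = 1 + (\<Sum>q=Suc 1..m. 1 / (real q)\<^sup>2)"
      using that True by (subst sum.atLeast_Suc_atMost) auto
    also have "\<dots> \<le> 1 + (1 / real 1 - 1 / real m)" using inv_sq_tail[of 1 m] that True by auto
    also have "\<dots> \<le> 2" by simp
    finally have "C * (\<Sum>q=Suc 0..m. 1 / (real q)\<^sup>2) \<le> C * 2" using C_nonneg by (intro mult_left_mono)
    then show ?thesis using d[of m] True that by simp
  next
    case False
    have "C * (\<Sum>q=Suc n..m. 1 / (real q)\<^sup>2) \<le> C * (1 / real n)"
      using inv_sq_tail[of n m] that False C_nonneg by (intro mult_left_mono) (auto intro: order_trans)
    also have "\<dots> \<le> C * (2 / (real n + 1))" using False C_nonneg by (intro mult_left_mono) (auto simp: divide_simps)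
    finally have "C * (\<Sum>q=Suc n..m. 1 / (real q)\<^sup>2) \<le> 2 * C / (real n + 1)" by (simp add: mult.commute)
    then show ?thesis using d[of m] that by linarith
  qed
  have "(\<lambda>m. \<bar>rhos m - rhos n\<bar>) \<longlonglongrightarrow> \<bar>rho - rhos n\<bar>" by (intro tendsto_intros lim)
  then have "\<bar>rho - rhos n\<bar> \<le> 2 * C / (real n + 1)"
    by (rule tendsto_upperbound) (auto intro: eventually_mono[OF eventually_gt_at_top[of n]] b)
  then show "\<bar>rhos n - rho\<bar> \<le> 2 * C / (real n + 1)" by linarith
qed

end

locale perturbed_kernel = perturbed_sums + end_kernel
begin

lemma theta_uv: "(\<lambda>N. (\<Sum>k=1..N. \<theta> N k * u k) - (\<Sum>k=1..N. \<theta> N k * v k)) \<longlonglongrightarrow> 0"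
proof (rule tendsto_rabs_zero_cancel, rule tendsto_0_le[where K = 1])
  show "(\<lambda>N. (10 * C) * lg N ^ 1 / real N) \<longlonglongrightarrow> 0" by (rule small_tendsto_0)
  show "\<forall>\<^sub>F N in sequentially. norm \<bar>(\<Sum>k=1..N. \<theta> N k * u k) - (\<Sum>k=1..N. \<theta> N k * v k)\<bar> \<le> norm ((10 * C) * lg N ^ 1 / real N) * 1"
  proof (rule eventually_mono[OF eventually_ge_at_top[of 1]])
    fix N :: nat assume N: "1 \<le> N"
    have "(\<Sum>k=1..N. \<theta> N k * u k) - (\<Sum>k=1..N. \<theta> N k * v k) = (\<Sum>l=1..N. \<theta> N l * ((r l - r (l - 1)) * 1))"
      unfolding sum_subtractf[symmetric] by (intro sum.cong refl) (simp add: u_eq algebra_simps)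
    then show "norm \<bar>(\<Sum>k=1..N. \<theta> N k * u k) - (\<Sum>k=1..N. \<theta> N k * v k)\<bar> \<le> norm ((10 * C) * lg N ^ 1 / real N) * 1"
      using abel_le[OF N r_le, of "\<lambda>_. 1" 1] N C_nonneg lg_ge1[OF N] by simp
  qed
qed

text \<open>Insert \<open>U = V + a + r\<close> and \<open>B = G + a * V + rhos\<close>. The terms
  linear in \<open>a\<close> cancel, between the first and third sum and between the second and
  third; the third sum leaves \<open>a\<^sup>2\<close>, and \<open>rho\<close> comes once from each
  of the first two. Every other term contains \<open>r\<close>, \<open>rhos - rho\<close> or a
  difference of values of \<open>r\<close>, and tends to 0.\<close>

lemma boundary:
  "(\<lambda>N. (- (\<Sum>l=1..N. \<theta> N l * (u l * B (l - 1))) - B N * (\<Sum>k=1..N. \<theta> N k * u k) + U N * (\<Sum>q=1..N. \<theta> N q * (v q * U (q - 1))))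
     - (- (\<Sum>l=1..N. \<theta> N l * (v l * G (l - 1))) - G N * (\<Sum>k=1..N. \<theta> N k * v k) + V N * (\<Sum>q=1..N. \<theta> N q * (v q * V (q - 1))))
     - (a\<^sup>2 - 2 * rho) * (\<Sum>k=1..N. \<theta> N k * v k)) \<longlonglongrightarrow> 0" (is "(\<lambda>N. ?E N) \<longlonglongrightarrow> 0")
proof -
  define K where "K = 1 + 2 * C"
  have K1: "1 \<le> K" "C \<le> K" "0 \<le> K" using C_nonneg by (auto simp: K_def)
  define e1 where "e1 N = (\<Sum>l=1..N. \<theta> N l * ((r l - r (l - 1)) * 1))" for N
  define e2 where "e2 N = (\<Sum>l=1..N. \<theta> N l * ((r l - r (l - 1)) * B (l - 1)))" for N
  define e3 where "e3 N = (\<Sum>l=1..N. \<theta> N l * (v l * r (l - 1)))" for N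
  define e4 where "e4 N = (\<Sum>l=1..N. \<theta> N l * (v l * (rhos (l - 1) - rho)))" for N
  define P where "P N = (\<Sum>k=1..N. \<theta> N k * v k)" for N
  define T3 where "T3 N = (\<Sum>q=1..N. \<theta> N q * (v q * U (q - 1)))" for N
  have E: "?E N = - ((rhos N - rho) * P N) - e4 N - e2 N - B N * e1 N + (V N + a) * e3 N + r N * T3 N" for N
  proof -
    define P1 where "P1 = (\<Sum>q=1..N. \<theta> N q * (v q * V (q - 1)))"
    define PG where "PG = (\<Sum>l=1..N. \<theta> N l * (v l * G (l - 1)))"
    have "(\<Sum>k=1..N. \<theta> N k * u k) = P N + e1 N"
      unfolding P_def e1_def sum.distrib[symmetric] by (intro sum.cong refl) (simp add: u_eq algebra_simps)
    moreover have "(\<Sum>l=1..N. \<theta> N l * (u l * B (l - 1))) = PG + a * P1 + (rho * P N + e4 N) + e2 N"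
      unfolding P_def e2_def e4_def PG_def P1_def sum_distrib_left sum.distrib[symmetric]
    proof (rule sum.cong[OF refl])
      fix l assume "l \<in> {1..N}"
      then show "\<theta> N l * (u l * B (l - 1)) = \<theta> N l * (v l * G (l - 1)) + a * (\<theta> N l * (v l * V (l - 1))) +
         (rho * (\<theta> N l * v l) + \<theta> N l * (v l * (rhos (l - 1) - rho))) + \<theta> N l * ((r l - r (l - 1)) * B (l - 1))"
        using u_eq[of l] unfolding B_eq[of "l - 1"] by (simp add: right_diff_distrib) (simp add: algebra_simps)
    qed
    moreover have t: "T3 N = P1 + a * P N + e3 N"
      unfolding P_def T3_def e3_def P1_def sum_distrib_left sum.distrib[symmetric]
      by (intro sum.cong refl) (simp add: U_eq algebra_simps)
    ultimately show ?thesis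
      unfolding P_def[symmetric] PG_def[symmetric] P1_def[symmetric] T3_def[symmetric] t B_eq[of N] U_eq[of N]
      by (simp add: power2_eq_square algebra_simps)
  qed
  \<comment> \<open>\<open>E\<close> exhibits six error terms. Their constants add up to 38, and
    their powers are at most \<open>K ^ 2\<close> and \<open>lg N ^ 3\<close>, so the stated bound
    leaves room.\<close>
  have bnd: "\<bar>?E N\<bar> \<le> 100 * K ^ 3 * lg N ^ 4 / real N" if N: "1 \<le> N" for N
  proof -
    have lg: "1 \<le> lg N" using lg_ge1[OF N] .
    have lp: "lg N ^ i \<le> lg N ^ j" if "i \<le> j" for i j using lg that by (rule power_increasing[rotated])
    have kp: "K ^ i \<le> K ^ j" if "i \<le> j" for i j using K1(1) that by (rule power_increasing[rotated])
    have up: "c * K ^ i * lg N ^ j / real N \<le> c * K ^ 3 * lg N ^ 4 / real N" if "0 \<le> c" "i \<le> 3" "j \<le> 4" for c i j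
    proof -
      have "K ^ i * lg N ^ j \<le> K ^ 3 * lg N ^ 4" using kp[OF that(2)] lp[OF that(3)] K1 lg by (intro mult_mono) auto
      then show ?thesis using that(1) by (intro divide_right_mono) (auto simp: mult.assoc intro: mult_left_mono)
    qed
    have e1: "\<bar>e1 N\<bar> \<le> 10 * K * lg N / real N"
    proof -
      have "\<bar>e1 N\<bar> \<le> 10 * C * 1 * lg N / real N" unfolding e1_def using N by (intro abel_le r_le) auto
      also have "\<dots> \<le> 10 * K * lg N / real N" using K1 lg by (intro divide_right_mono mult_right_mono) auto
      finally show ?thesis .
    qed
    have e2: "\<bar>e2 N\<bar> \<le> 10 * K ^ 2 * lg N ^ 3 / real N"
    proof -
      have "\<bar>e2 N\<bar> \<le> 10 * C * (K * lg N ^ 2) * lg N / real N" unfolding e2_def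
      proof (intro abel_le[OF N r_le])
        fix l :: nat assume l: "1 \<le> l" "l \<le> N"
        then show "\<bar>B (l - 1)\<bar> \<le> K * lg N ^ 2" unfolding K_def using N by (intro B_le) auto
      next
        fix l :: nat assume l: "1 \<le> l" "l < N"
        have "B (Suc l - 1) - B (l - 1) = v l * U (l - 1)" using l by (cases l) (auto simp: B_def)
        then have "\<bar>B (Suc l - 1) - B (l - 1)\<bar> = \<bar>v l\<bar> * \<bar>U (l - 1)\<bar>" by (simp add: abs_mult)
        also have "\<dots> \<le> 1 / real l * (K * lg N)"
          unfolding K_def using l N by (intro mult_mono v_le U_le) auto
        also have "\<dots> \<le> 1 / real l * (K * lg N ^ 2)" using lp[of 1 2] K1 by (intro mult_left_mono) auto
        finally show "\<bar>B (Suc l - 1) - B (l - 1)\<bar> \<le> K * lg N ^ 2 / real l" by simp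
      qed
      also have "\<dots> \<le> 10 * K * (K * lg N ^ 2) * lg N / real N" using K1 lg by (intro divide_right_mono mult_right_mono) auto
      finally show ?thesis by (simp add: power2_eq_square power3_eq_cube mult_ac)
    qed
    have e3: "\<bar>e3 N\<bar> \<le> 4 * K * lg N / real N"
    proof -
      have "\<bar>e3 N\<bar> \<le> 4 * C * lg N / real N" unfolding e3_def
      proof (intro th_sum_le N C_nonneg)
        fix l :: nat assume "1 \<le> l"
        then show "\<bar>v l * r (l - 1)\<bar> \<le> C / (real l)\<^sup>2" using vr_le[of "l - 1"] by simp
      qed
      also have "\<dots> \<le> 4 * K * lg N / real N" using K1 lg by (intro divide_right_mono mult_right_mono) auto
      finally show ?thesis .
    qed
    have e4: "\<bar>e4 N\<bar> \<le> 8 * K * lg N / real N"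
    proof -
      have "\<bar>e4 N\<bar> \<le> 4 * (2 * C) * lg N / real N" unfolding e4_def
      proof (intro th_sum_le N)
        fix l :: nat assume l: "1 \<le> l"
        have "\<bar>v l * (rhos (l - 1) - rho)\<bar> \<le> 1 / real l * (2 * C / (real (l - 1) + 1))"
          unfolding abs_mult by (intro mult_mono v_le rhos_le) auto
        then show "\<bar>v l * (rhos (l - 1) - rho)\<bar> \<le> 2 * C / (real l)\<^sup>2" using l by (simp add: power2_eq_square of_nat_diff)
      qed (use C_nonneg in auto)
      also have "\<dots> \<le> 8 * K * lg N / real N" using K1 lg by (auto intro!: divide_right_mono mult_right_mono)
      finally show ?thesis .
    qed
    have P: "\<bar>P N\<bar> \<le> 2 * lg N ^ 2"
    proof -
      have "\<bar>P N\<bar> \<le> (\<Sum>k=1..N. \<bar>\<theta> N k * v k\<bar>)" unfolding P_def by (rule sum_abs)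
      also have "\<dots> \<le> (\<Sum>k=1..N. 2 * hs N * (1 / real k))" unfolding abs_mult
        using hs_nonneg[of N] by (intro sum_mono mult_mono th_le_hs v_le) auto
      also have "\<dots> = 2 * hs N * hs N" unfolding hs_def sum_distrib_left ..
      also have "\<dots> \<le> 2 * lg N * lg N" using hs_le_lg[OF N] hs_nonneg[of N] lg by (intro mult_mono) auto
      finally show ?thesis by (simp add: power2_eq_square)
    qed
    have T3: "\<bar>T3 N\<bar> \<le> 2 * K * lg N ^ 3"
    proof -
      have "\<bar>T3 N\<bar> \<le> (\<Sum>k=1..N. \<bar>\<theta> N k * (v k * U (k - 1))\<bar>)" unfolding T3_def by (rule sum_abs)
      also have "\<dots> \<le> (\<Sum>k=1..N. 2 * hs N * (1 / real k * (K * lg N)))" unfolding abs_mult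
        using hs_nonneg[of N] K1 lg N unfolding K_def by (intro sum_mono mult_mono th_le_hs v_le U_le) auto
      also have "\<dots> = 2 * hs N * (hs N * (K * lg N))" unfolding hs_def sum_distrib_left sum_distrib_right ..
      also have "\<dots> \<le> 2 * lg N * (lg N * (K * lg N))" using hs_le_lg[OF N] hs_nonneg[of N] lg K1 by (intro mult_mono) auto
      finally show ?thesis by (simp add: power3_eq_cube mult_ac)
    qed
    have A: "\<bar>(rhos N - rho) * P N\<bar> \<le> 4 * K ^ 1 * lg N ^ 2 / real N"
    proof -
      have "\<bar>(rhos N - rho) * P N\<bar> \<le> 2 * C / (real N + 1) * (2 * lg N ^ 2)"
        unfolding abs_mult using C_nonneg by (intro mult_mono rhos_le P) auto
      also have "\<dots> \<le> 2 * K / real N * (2 * lg N ^ 2)" using K1 N C_nonneg by (intro mult_right_mono frac_le) auto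
      finally show ?thesis by simp
    qed
    have Bb: "\<bar>B N * e1 N\<bar> \<le> 10 * K ^ 2 * lg N ^ 3 / real N"
    proof -
      have "\<bar>B N * e1 N\<bar> \<le> (K * lg N ^ 2) * (10 * K * lg N / real N)"
        unfolding abs_mult using N K1 lg by (intro mult_mono e1) (auto simp: K_def intro: B_le)
      then show ?thesis by (simp add: power2_eq_square power3_eq_cube mult_ac)
    qed
    have Cb: "\<bar>(V N + a) * e3 N\<bar> \<le> 4 * K ^ 2 * lg N ^ 2 / real N"
    proof -
      have "\<bar>V N + a\<bar> \<le> hs N + C" using V_le[of N] a_le by linarith
      also have "\<dots> \<le> lg N + 2 * C * lg N" using hs_le_lg[OF N] lg C_nonneg mult_left_mono[of 1 "lg N" C] by linarith
      finally have "\<bar>V N + a\<bar> \<le> K * lg N" by (simp add: K_def algebra_simps)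
      then have "\<bar>(V N + a) * e3 N\<bar> \<le> (K * lg N) * (4 * K * lg N / real N)"
        unfolding abs_mult using K1 lg by (intro mult_mono e3) auto
      then show ?thesis by (simp add: power2_eq_square mult_ac)
    qed
    have Db: "\<bar>r N * T3 N\<bar> \<le> 2 * K ^ 2 * lg N ^ 3 / real N"
    proof -
      have "\<bar>r N * T3 N\<bar> \<le> C / (real N + 1) * (2 * K * lg N ^ 3)"
        unfolding abs_mult using C_nonneg by (intro mult_mono r_le T3) auto
      also have "\<dots> \<le> K / real N * (2 * K * lg N ^ 3)" using K1 N C_nonneg lg by (intro mult_right_mono frac_le) auto
      finally show ?thesis by (simp add: power2_eq_square mult_ac)
    qed
    define X where "X = K ^ 3 * lg N ^ 4 / real N"
    have X0: "0 \<le> X" using K1 lg by (auto simp: X_def)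
    have uX: "c * K ^ i * lg N ^ j / real N \<le> c * X" if "0 \<le> c" "i \<le> 3" "j \<le> 4" for c i j
      using up[OF that] by (simp add: X_def mult_ac)
    have "\<bar>?E N\<bar> \<le> 4 * X + 8 * X + 10 * X + 10 * X + 4 * X + 2 * X"
    proof -
      have tri: "\<bar>- y1 - y2 - y3 - y4 + y5 + y6\<bar> \<le> z1 + z2 + z3 + z4 + z5 + z6"
        if "\<bar>y1\<bar> \<le> z1" "\<bar>y2\<bar> \<le> z2" "\<bar>y3\<bar> \<le> z3" "\<bar>y4\<bar> \<le> z4" "\<bar>y5\<bar> \<le> z5" "\<bar>y6\<bar> \<le> z6"
        for y1 y2 y3 y4 y5 y6 z1 z2 z3 z4 z5 z6 :: real using that by linarith
      have e4': "\<bar>e4 N\<bar> \<le> 8 * K ^ 1 * lg N ^ 1 / real N" using e4 by simp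
      show ?thesis unfolding E
        by (rule tri[OF order_trans[OF A uX] order_trans[OF e4' uX] order_trans[OF e2 uX] order_trans[OF Bb uX] order_trans[OF Cb uX] order_trans[OF Db uX]]) auto
    qed
    also have "\<dots> \<le> 100 * X" using X0 by simp
    finally show ?thesis by (simp add: X_def mult_ac)
  qed
  show ?thesis
  proof (rule tendsto_rabs_zero_cancel, rule tendsto_0_le[where K = 1])
    show "(\<lambda>N. (100 * K ^ 3) * lg N ^ 4 / real N) \<longlonglongrightarrow> 0" by (rule small_tendsto_0)
    show "\<forall>\<^sub>F N in sequentially. norm \<bar>?E N\<bar> \<le> norm ((100 * K ^ 3) * lg N ^ 4 / real N) * 1"
    proof (rule eventually_mono[OF eventually_ge_at_top[of 1]])
      fix N :: nat assume "1 \<le> N"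
      from bnd[OF this] have "\<bar>?E N\<bar> \<le> \<bar>100 * K ^ 3 * lg N ^ 4 / real N\<bar>" by linarith
      then show "norm \<bar>?E N\<bar> \<le> norm ((100 * K ^ 3) * lg N ^ 4 / real N) * 1" by simp
    qed
  qed
qed

end

lemma alternating_tail_le: "\<bar>\<Sum>i=Suc n..m. (-1) ^ i / real i\<bar> \<le> 1 / (real n + 1)"
proof -
  have "0 \<le> (-1) ^ Suc n * (\<Sum>i=Suc n..n + d. (-1) ^ i / real i) \<and> (-1) ^ Suc n * (\<Sum>i=Suc n..n + d. (-1) ^ i / real i) \<le> 1 / (real n + 1)" for d n
  proof (induction d arbitrary: n)
    case (Suc d)
    define S where "S = (\<Sum>i=Suc (Suc n)..Suc n + d. (-1) ^ i / real i :: real)"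
    have "(\<Sum>i=Suc n..n + Suc d. (-1) ^ i / real i) = (-1) ^ Suc n / real (Suc n) + S"
      unfolding S_def by (subst sum.atLeast_Suc_atMost) auto
    then have "(-1) ^ Suc n * (\<Sum>i=Suc n..n + Suc d. (-1) ^ i / real i) = ((-1) ^ Suc n * (-1) ^ Suc n) / real (Suc n) + (-1) ^ Suc n * S"
      by (simp only: distrib_left times_divide_eq_right)
    then have e: "(-1) ^ Suc n * (\<Sum>i=Suc n..n + Suc d. (-1) ^ i / real i) = 1 / (real n + 1) - (-1) ^ Suc (Suc n) * S"
      unfolding minus_one_mult_self by (simp add: add.commute)
    have "0 \<le> (-1) ^ Suc (Suc n) * S" "(-1) ^ Suc (Suc n) * S \<le> 1 / (real (Suc n) + 1)"
      using Suc[of "Suc n"] unfolding S_def by blast+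
    moreover have "1 / (real (Suc n) + 1) \<le> 1 / (real n + 1)" by (simp add: frac_le)
    ultimately show ?case unfolding e by linarith
  qed simp
  note key = this
  show ?thesis
  proof (cases "n \<le> m")
    case True
    then obtain d where m: "m = n + d" using le_iff_add by auto
    have "\<bar>\<Sum>i=Suc n..m. (-1) ^ i / real i\<bar> = \<bar>(-1) ^ Suc n * (\<Sum>i=Suc n..m. (-1) ^ i / real i)\<bar>"
      by (simp add: abs_mult)
    then show ?thesis using key[where n=n and d=d] m by simp
  qed simp
qed

section \<open>Boundary terms of the two double sums, and the limit of \<open>TN\<close>\<close>

context sgn_grading
begin

text \<open>The boundary kernel of \<open>sq_minus_bb\<close>. Only differences of indices occur
  there, so that the constant \<open>h N\<close> takes the place of \<open>h (N + k)\<close> in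
  \<open>th\<close>.\<close>

definition et :: "nat \<Rightarrow> nat \<Rightarrow> real" where "et N k = h N - h (N - k)"
definition al :: "real \<Rightarrow> nat \<Rightarrow> real" where "al x n = UU x n - H n"
text \<open>The regularised sum of all \<open>uu x k\<close>; for \<open>g = 1\<close> it is the
  digamma expression -psi(1 - x) - gamma.\<close>

definition ax :: "real \<Rightarrow> real" where "ax x = lim (al x)"
text \<open>The terms of \<open>double_kernel\<close> and \<open>rotation\<close> that contain
  \<open>th\<close>. \<open>Wp\<close> gathers the others, so that \<open>RN\<close> is
  \<open>Wp + Bd\<close>.\<close>

definition Bd :: "real \<Rightarrow> nat \<Rightarrow> real" where
  "Bd x N = - (\<Sum>l=1..N. be x l * uu x l * th N l) - (\<Sum>q=1..N. bb x q) * (\<Sum>k=1..N. th N k * uu x k) + UU x N * (\<Sum>q=1..N. bb x q * th N q)"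
definition PN :: "nat \<Rightarrow> real" where "PN N = (\<Sum>k=1..N. th N k * vv k)"
definition Wp :: "real \<Rightarrow> nat \<Rightarrow> real" where
  "Wp x N = (\<Sum>l=1..N. be x l * (uu x l)\<^sup>2) + (\<Sum>l=1..N. be x l * uu x l * ph l) - (\<Sum>q=1..N. (bb x q)\<^sup>2) / 2 + Cc x N"
definition RN :: "real \<Rightarrow> nat \<Rightarrow> real" where
  "RN x N = (\<Sum>k=1..N. \<Sum>l=1..N. be x l * (s ^ (k + l) * (2 * x) * uu x k * uu x l / (real k + real l)))"
definition K2N :: "real \<Rightarrow> nat \<Rightarrow> real" where
  "K2N x N = (\<Sum>k=1..N. \<Sum>l=1..N. s ^ (k + l) * (2 * x) * uu x k * uu x l / (real k + real l))"

lemma e_le: "\<bar>e k\<bar> \<le> 1" "0 \<le> e k" and od_le: "\<bar>od k\<bar> \<le> 1" "0 \<le> od k" by (auto simp: e_def od_def)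
lemma s_pow_abs [simp]: "\<bar>s ^ k\<bar> = 1" by (simp add: power_abs)
lemma f_le: "\<bar>f k\<bar> \<le> 1" using e_le[of k] by (simp add: f_def abs_mult)
lemma vv_le: "\<bar>vv q\<bar> \<le> 1 / real q" using e_le[of q] by (cases "q = 0") (auto simp: vv_def divide_simps)
lemma vv_nonneg: "0 \<le> vv q" using e_le[of q] by (simp add: vv_def)
lemma ph_le: "\<bar>ph q\<bar> \<le> 1 / real q" unfolding ph_def abs_divide using f_le[of q] by (cases "q = 0") (auto simp: divide_simps)

lemma nz_half: "\<bar>x\<bar> \<le> 1 / 2 \<Longrightarrow> 1 \<le> k \<Longrightarrow> real k \<noteq> x" by auto

lemma TN_eq: "TN x N = (K2o x N)\<^sup>2 / 2 + 2 * Wp x N" by (simp add: TN_def Wp_def)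

lemma RN_eq:
  assumes "\<And>k. 1 \<le> k \<Longrightarrow> real k \<noteq> x"
  shows "RN x N = Wp x N + Bd x N"
proof -
  have gen: "a1 + a2 - a3 - a4 + (- b / 2 + u + c) = (a1 + a2 - b / 2 + c) + (- a3 - a4 + u)" for a1 a2 a3 a4 b u c :: real by simp
  have "RN x N = (\<Sum>l=1..N. be x l * (uu x l)\<^sup>2) + (\<Sum>l=1..N. be x l * uu x l * ph l)
      - (\<Sum>l=1..N. be x l * uu x l * th N l) - (\<Sum>q=1..N. bb x q) * (\<Sum>k=1..N. th N k * uu x k)
      + (- (\<Sum>q=1..N. (bb x q)\<^sup>2) / 2 + UU x N * (\<Sum>q=1..N. bb x q * th N q) + Cc x N)"
  proof -
    have rot: "(\<Sum>k=1..N. \<Sum>q=1..N. uu x k * bb x q * (h (q + k) - hh q k)) =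
      - (\<Sum>q=1..N. (bb x q)\<^sup>2) / 2 + UU x N * (\<Sum>q=1..N. bb x q * th N q) + Cc x N"
      by (rule rotation[OF assms])
    show ?thesis unfolding rot[symmetric] RN_def by (rule double_kernel[OF assms])
  qed
  then show ?thesis unfolding Wp_def Bd_def gen .
qed

lemma sq_kernel:
  assumes nz: "\<And>k. 1 \<le> k \<Longrightarrow> real k \<noteq> x"
  shows "(\<Sum>k=1..N. s ^ k * uu x k)\<^sup>2 = (\<Sum>k=1..N. (uu x k)\<^sup>2) + 2 * (\<Sum>l=1..N. uu x l * (h (N - l) - h (l - 1)))"
proof -
  have "(\<Sum>k=1..N. s ^ k * uu x k)\<^sup>2 = (\<Sum>k=1..N. (s ^ k * uu x k)\<^sup>2) + 2 * (\<Sum>t=1..N. \<Sum>q=Suc t..N. s ^ t * uu x t * (s ^ q * uu x q))"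
    unfolding sum_sq_expand sum_distrib_left ..
  also have "(\<Sum>t=1..N. \<Sum>q=Suc t..N. s ^ t * uu x t * (s ^ q * uu x q)) = (\<Sum>m=1..N. \<Sum>j=1..<m. s ^ j * uu x j * (s ^ m * uu x m))"
    by (rule sum_pairs_swap[symmetric])
  also have "\<dots> = (\<Sum>m=1..N. \<Sum>j=1..<m. s ^ (j + m) * (uu x j * uu x m))"
    by (intro sum.cong refl) (simp add: power_add mult_ac)
  also have "\<dots> = (\<Sum>p=1..N. uu x p * pfc (\<lambda>j m. s ^ (j + m)) p N)" by (rule pf_pairs[OF nz])
  also have "\<dots> = (\<Sum>l=1..N. uu x l * (h (N - l) - h (l - 1)))"
  proof (rule sum.cong[OF refl])
    fix p assume p: "p \<in> {1..N}"
    have "{Suc 0..N} - {p} = {1..<p} \<union> {Suc p..N}" using p by auto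
    then have "(\<Sum>l\<in>{Suc 0..N} - {p}. s ^ (p + l) * od l / (real l - real p)) =
       (\<Sum>l=1..<p. s ^ (p + l) * od l / (real l - real p)) + (\<Sum>l=Suc p..N. s ^ (p + l) * od l / (real l - real p))"
      by (simp add: sum.union_disjoint disjoint_iff)
    also have "(\<Sum>l=1..<p. s ^ (p + l) * od l / (real l - real p)) = - (\<Sum>j=1..<p. od j * s ^ (j + p) / (real p - real j))"
      unfolding sum_negf[symmetric] by (intro sum.cong refl) (metis add.commute minus_diff_eq minus_divide_right mult.commute)
    also have "(\<Sum>l=Suc p..N. s ^ (p + l) * od l / (real l - real p)) = (\<Sum>m=Suc p..N. od m * s ^ (p + m) / (real m - real p))"
      by (simp only: mult.commute)
    finally have "pfc (\<lambda>j m. s ^ (j + m)) p N = (\<Sum>l\<in>{Suc 0..N} - {p}. s ^ (p + l) * od l / (real l - real p))"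
      by (simp add: pfc_def)
    then show "uu x p * pfc (\<lambda>j m. s ^ (j + m)) p N = uu x p * (h (N - p) - h (p - 1))"
      using uu_ker[of p N 0 x] p by (auto simp: hh_def)
  qed
  finally show ?thesis by (simp add: power_mult_distrib power2_eq_square[of "s ^ _"])
qed

lemma h_pred: "1 \<le> l \<Longrightarrow> h l = h (l - 1) + ph l"
  using h_Suc[of "l - 1"] by (simp add: ph_def)

text \<open>The splitting of \<open>double_kernel\<close> with the constant weight 1 in place of
  \<open>be\<close>; without an inner index there is no coupling term.\<close>

lemma K2N_eq:
  assumes nz: "\<And>k. 1 \<le> k \<Longrightarrow> real k \<noteq> x"
  shows "K2N x N = K2o x N - 2 * (\<Sum>k=1..N. th N k * uu x k)"
proof -
  have A: "s ^ (k + l) * (2 * x) * uu x k * uu x l / (real k + real l) =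
      s ^ k * uu x k * (s ^ l * uu x l) - uu x k * (s ^ (k + l) * od l / (real k + real l)) - uu x l * (s ^ (l + k) * od k / (real l + real k))"
    if "1 \<le> k" "1 \<le> l" for k l
  proof -
    have p: "real k + real l \<noteq> 0" using that by auto
    have n: "real k - x \<noteq> 0" "real l - x \<noteq> 0" using nz that by auto
    have pf: "(2 * x) / ((real k - x) * (real l - x) * (real k + real l)) =
       1 / ((real k - x) * (real l - x)) - 1 / ((real k - x) * (real k + real l)) - 1 / ((real l - x) * (real k + real l))"
      using p n by (simp add: divide_simps)
    have c: "s ^ (l + k) = s ^ (k + l)" "real l + real k = real k + real l" by (simp_all add: add.commute)
    have "s ^ (k + l) * (2 * x) * uu x k * uu x l / (real k + real l) =
        s ^ (k + l) * od k * od l * ((2 * x) / ((real k - x) * (real l - x) * (real k + real l)))" by (simp add: uu_def)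
    also have "\<dots> = s ^ (k + l) * (uu x k * uu x l) - uu x k * (s ^ (k + l) * od l / (real k + real l)) - uu x l * (s ^ (k + l) * od k / (real k + real l))"
      unfolding pf by (simp add: uu_def right_diff_distrib mult_ac)
    finally show ?thesis unfolding c by (simp add: power_add mult_ac)
  qed
  have 1: "(\<Sum>k=1..N. \<Sum>l=1..N. uu x k * (s ^ (k + l) * od l / (real k + real l))) = (\<Sum>k=1..N. uu x k * (h (N + k) - h k))"
  proof (rule sum.cong[OF refl])
    fix k
    show "(\<Sum>l=1..N. uu x k * (s ^ (k + l) * od l / (real k + real l))) = uu x k * (h (N + k) - h k)"
      using uu_ker_add[OF le0[of N], of x k, unfolded add_0] by (simp only: sum_distrib_left One_nat_def)
  qed
  have 2: "(\<Sum>k=1..N. \<Sum>l=1..N. uu x l * (s ^ (l + k) * od k / (real l + real k))) = (\<Sum>k=1..N. uu x k * (h (N + k) - h k))"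
    by (subst sum.swap) (rule 1)
  have "K2N x N = (\<Sum>k=1..N. \<Sum>l=1..N. s ^ k * uu x k * (s ^ l * uu x l) - uu x k * (s ^ (k + l) * od l / (real k + real l)) - uu x l * (s ^ (l + k) * od k / (real l + real k)))"
    unfolding K2N_def by (intro sum.cong refl A) auto
  also have "\<dots> = (\<Sum>k=1..N. s ^ k * uu x k)\<^sup>2 - (\<Sum>k=1..N. uu x k * (h (N + k) - h k)) - (\<Sum>k=1..N. uu x k * (h (N + k) - h k))"
    unfolding sum_subtractf 1 2 by (simp only: power2_eq_square sum_product)
  also have "(\<Sum>k=1..N. s ^ k * uu x k)\<^sup>2 = (\<Sum>k=1..N. (uu x k)\<^sup>2) + 2 * (\<Sum>l=1..N. uu x l * (h (N - l) - h (l - 1)))"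
    by (rule sq_kernel[OF nz])
  also have "\<dots> - (\<Sum>k=1..N. uu x k * (h (N + k) - h k)) - (\<Sum>k=1..N. uu x k * (h (N + k) - h k)) =
     (\<Sum>k=1..N. (uu x k)\<^sup>2 + 2 * (uu x k * (h (N - k) - h (k - 1))) - 2 * (uu x k * (h (N + k) - h k)))"
    by (simp add: sum.distrib sum_subtractf sum_distrib_left sum_negf)
  also have "\<dots> = (\<Sum>k=1..N. ((uu x k)\<^sup>2 + 2 * ph k * uu x k) - 2 * (th N k * uu x k))"
    by (intro sum.cong refl) (simp add: th_def h_pred[of "_::nat"] algebra_simps)
  finally show ?thesis by (simp only: K2o_def sum_subtractf sum_distrib_left)
qed

text \<open>A second source of \<open>K2o\<close>: for \<open>s = 1\<close> this combination has the
  same one-pole form as \<open>K2N\<close>, with another boundary kernel. Its left side is what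
  \<open>ax\<close> and \<open>rh\<close> regularise, and comparing the two leads to
  \<open>ax_rh\<close>.\<close>

lemma sq_minus_bb:
  assumes nz: "\<And>k. 1 \<le> k \<Longrightarrow> real k \<noteq> x" and s1: "s = 1"
  shows "(UU x N)\<^sup>2 - 2 * (\<Sum>q=1..N. bb x q) = K2o x N - 2 * (\<Sum>k=1..N. et N k * uu x k)"
proof -
  have hH: "h n = H n" for n unfolding h_def H_def f_def vv_def by (simp add: s1)
  have "(\<Sum>q=1..N. bb x q) = (\<Sum>q=1..N. UU x (q - 1) * vv q)" by (simp only: bb_def mult.commute)
  also have "\<dots> = (\<Sum>k=1..N. uu x k * (\<Sum>q=Suc k..N. vv q))" by (rule UU_swap)
  also have "\<dots> = (\<Sum>k=1..N. uu x k * (h N - h k))" by (intro sum.cong refl) (simp add: H_diff hH)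
  finally have b: "(\<Sum>q=1..N. bb x q) = (\<Sum>k=1..N. uu x k * (h N - h k))" .
  have "(UU x N)\<^sup>2 = (\<Sum>k=1..N. (uu x k)\<^sup>2) + 2 * (\<Sum>l=1..N. uu x l * (h (N - l) - h (l - 1)))"
    using sq_kernel[OF nz, of N] s1 by (simp add: UU_def)
  then have "(UU x N)\<^sup>2 - 2 * (\<Sum>q=1..N. bb x q) = (\<Sum>k=1..N. (uu x k)\<^sup>2 + 2 * (uu x k * (h (N - k) - h (k - 1))) - 2 * (uu x k * (h N - h k)))"
    unfolding b by (simp add: sum.distrib sum_subtractf sum_distrib_left)
  also have "\<dots> = (\<Sum>k=1..N. ((uu x k)\<^sup>2 + 2 * ph k * uu x k) - 2 * (et N k * uu x k))"
    by (intro sum.cong refl) (simp add: et_def h_pred[of "_::nat"] algebra_simps)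
  finally show ?thesis by (simp only: K2o_def sum_subtractf sum_distrib_left)
qed

lemma end_kernel_th: "end_kernel th"
proof
  fix N k :: nat
  show "th N 0 = 0" by (simp add: th_def)
  assume k: "k < N"
  then have e: "N - k = Suc (N - Suc k)" by auto
  have "th N (Suc k) - th N k = f (N + Suc k) / real (N + Suc k) + f (N - k) / real (N - k)"
    using h_Suc[of "N + k"] h_Suc[of "N - Suc k"] unfolding th_def e[symmetric] by simp
  moreover have "\<bar>f (N + Suc k) / real (N + Suc k)\<bar> \<le> 1 / (real N - real k)"
    unfolding abs_divide using f_le[of "N + Suc k"] k by (intro frac_le) auto
  moreover have "\<bar>f (N - k) / real (N - k)\<bar> \<le> 1 / (real N - real k)"
    unfolding abs_divide using f_le[of "N - k"] k by (intro frac_le) (auto simp: of_nat_diff)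
  ultimately have "\<bar>th N (Suc k) - th N k\<bar> \<le> 1 / (real N - real k) + 1 / (real N - real k)"
    by (simp only:) (rule order_trans[OF abs_triangle_ineq add_mono])
  then show "\<bar>th N (Suc k) - th N k\<bar> \<le> 2 / (real N - real k)" by simp
qed

lemma end_kernel_et: "end_kernel et"
proof
  fix N k :: nat
  show "et N 0 = 0" by (simp add: et_def)
  assume k: "k < N"
  then have e: "N - k = Suc (N - Suc k)" by auto
  have "et N (Suc k) - et N k = f (N - k) / real (N - k)"
    using h_Suc[of "N - Suc k"] unfolding et_def e[symmetric] by simp
  moreover have "\<bar>f (N - k) / real (N - k)\<bar> \<le> 1 / (real N - real k)"
    unfolding abs_divide using f_le[of "N - k"] k by (intro frac_le) (auto simp: of_nat_diff)
  ultimately show "\<bar>et N (Suc k) - et N k\<bar> \<le> 2 / (real N - real k)"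
    using divide_right_mono[of 1 2 "real N - real k"] k by linarith
qed

lemma uu_diff_le:
  assumes "\<bar>x\<bar> \<le> 1 / 2" "1 \<le> k"
  shows "\<bar>uu x k - od k / real k\<bar> \<le> 1 / (real k)\<^sup>2" and "\<bar>uu x k\<bar> \<le> 2 / real k"
proof -
  have k: "real k \<ge> 1" "real k - x \<ge> real k / 2" using assms by auto
  have "\<bar>uu x k\<bar> \<le> 1 / (real k / 2)" unfolding uu_def abs_divide using od_le[of k] k by (intro frac_le) auto
  then show "\<bar>uu x k\<bar> \<le> 2 / real k" by simp
  have "uu x k - od k / real k = od k * x / (real k * (real k - x))"
    using k by (simp add: uu_def field_simps)
  moreover have "\<bar>od k * x / (real k * (real k - x))\<bar> \<le> (1 / 2) / (real k * (real k / 2))"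
  proof -
    have "\<bar>od k * x\<bar> \<le> 1 * (1 / 2)" unfolding abs_mult using od_le[of k] assms by (intro mult_mono) auto
    moreover have "real k * (real k / 2) \<le> \<bar>real k * (real k - x)\<bar>"
      using k by (auto simp: abs_mult intro!: mult_mono)
    ultimately show ?thesis unfolding abs_divide using k by (intro frac_le) auto
  qed
  ultimately show "\<bar>uu x k - od k / real k\<bar> \<le> 1 / (real k)\<^sup>2" by (simp add: power2_eq_square)
qed

text \<open>For \<open>g = 2\<close> the supports of \<open>od\<close> and \<open>e\<close> are
  disjoint, but \<open>od k - e k\<close> alternates in sign; hence the sums of \<open>uu\<close>
  and of \<open>vv\<close> differ by a convergent series in this case too.\<close>

lemma od_e_tail: "\<bar>\<Sum>k=Suc n..m. (od k - e k) / real k\<bar> \<le> 1 / (real n + 1)"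
proof (cases "g = 1")
  case True
  then have "od k - e k = 0" for k unfolding od_def e_def by simp
  then show ?thesis by simp
next
  case False
  then have g: "g = 2" using gs by auto
  have gg: "k mod g = k mod 2" "1 mod g = (1 :: nat)" for k using g by simp_all
  have "od k - e k = - ((-1) ^ k)" for k
    unfolding od_def e_def gg by (cases "even k") (auto simp: odd_iff_mod_2_eq_one)
  then have "(\<Sum>k=Suc n..m. (od k - e k) / real k) = - (\<Sum>k=Suc n..m. (-1) ^ k / real k)"
    by (simp add: sum_negf)
  then show ?thesis using alternating_tail_le[of n m] by simp
qed

lemma al_diff:
  assumes x: "\<bar>x\<bar> \<le> 1 / 2" and "n \<le> m"
  shows "\<bar>al x m - al x n\<bar> \<le> 3 / (real n + 1)"
proof -
  have "al x m - al x n = (\<Sum>k=Suc n..m. uu x k - vv k)"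
    using \<open>n \<le> m\<close> UU_split[of n m x] H_diff[of n m] by (simp add: al_def sum_subtractf)
  also have "\<dots> = (\<Sum>k=Suc n..m. uu x k - od k / real k) + (\<Sum>k=Suc n..m. (od k - e k) / real k)"
    unfolding sum.distrib[symmetric] by (intro sum.cong refl) (simp add: vv_def diff_divide_distrib)
  finally have 1: "al x m - al x n = \<dots>" .
  have "\<bar>\<Sum>k=Suc n..m. uu x k - od k / real k\<bar> \<le> (\<Sum>k=Suc n..m. 1 / (real k)\<^sup>2)"
    by (rule order_trans[OF sum_abs sum_mono]) (use uu_diff_le(1)[OF x] in auto)
  also have "\<dots> \<le> 2 / (real n + 1)"
  proof (cases "n = 0")
    case True
    show ?thesis
    proof (cases "m = 0")
      case False
      have "(\<Sum>k=Suc n..m. 1 / (real k)\<^sup>2) = 1 + (\<Sum>k=Suc 1..m. 1 / (real k)\<^sup>2)"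
        using True False by (simp add: sum.atLeast_Suc_atMost)
      also have "\<dots> \<le> 1 + (1 / real 1 - 1 / real m)" using inv_sq_tail[of 1 m] False by auto
      also have "\<dots> \<le> 2" by simp
      finally show ?thesis using True by simp
    qed (use True in auto)
  next
    case False
    have "(\<Sum>k=Suc n..m. 1 / (real k)\<^sup>2) \<le> 1 / real n - 1 / real m" using False \<open>n \<le> m\<close> by (intro inv_sq_tail) auto
    also have "\<dots> \<le> 1 / real n" by simp
    also have "\<dots> \<le> 2 / (real n + 1)" using False by (auto simp: divide_simps)
    finally show ?thesis .
  qed
  finally have "\<bar>\<Sum>k=Suc n..m. uu x k - od k / real k\<bar> \<le> 2 / (real n + 1)" .
  moreover have "2 / (real n + 1) + 1 / (real n + 1) = 3 / (real n + 1)" by (simp add: add_divide_distrib[symmetric])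
  ultimately show ?thesis unfolding 1 using od_e_tail[of n m] by linarith
qed

lemma al_lim:
  assumes x: "\<bar>x\<bar> \<le> 1 / 2"
  shows "al x \<longlonglongrightarrow> ax x" and "\<bar>al x n - ax x\<bar> \<le> 3 / (real n + 1)"
proof -
  have "Cauchy (al x)"
    unfolding Cauchy_altdef
  proof (intro allI impI)
    fix e' :: real assume e': "0 < e'"
    obtain M :: nat where M: "3 / e' < real M" using reals_Archimedean2 by blast
    show "\<exists>M. \<forall>m\<ge>M. \<forall>n>m. dist (al x m) (al x n) < e'"
    proof (intro exI[of _ M] allI impI)
      fix m n assume mn: "M \<le> m" "m < n"
      have "\<bar>al x n - al x m\<bar> \<le> 3 / (real m + 1)" using al_diff[OF x] mn by simp
      also have "\<dots> \<le> 3 / (real M + 1)" using mn by (intro frac_le) auto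
      also have "\<dots> < e'" using M e' by (simp add: field_simps)
      finally show "dist (al x m) (al x n) < e'" by (simp add: dist_real_def abs_minus_commute)
    qed
  qed
  then have "convergent (al x)" by (rule real_Cauchy_convergent)
  then show l: "al x \<longlonglongrightarrow> ax x" unfolding ax_def convergent_LIMSEQ_iff .
  have "(\<lambda>m. \<bar>al x m - al x n\<bar>) \<longlonglongrightarrow> \<bar>ax x - al x n\<bar>" by (intro tendsto_intros l)
  then have "\<bar>ax x - al x n\<bar> \<le> 3 / (real n + 1)"
    by (rule tendsto_upperbound) (auto intro!: eventually_mono[OF eventually_ge_at_top[of n]] al_diff[OF x])
  then show "\<bar>al x n - ax x\<bar> \<le> 3 / (real n + 1)" by linarith
qed

lemma pert: "\<bar>x\<bar> \<le> 1 / 2 \<Longrightarrow> perturbed_sums vv (uu x) (\<lambda>k. al x k - ax x) (ax x) 3"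
proof
  assume x: "\<bar>x\<bar> \<le> 1 / 2"
  show "\<bar>vv q\<bar> \<le> 1 / real q" for q by (rule vv_le)
  show "uu x k = vv k + (al x k - ax x - (al x (k - 1) - ax x))" if "1 \<le> k" for k
    using UU_step[OF that, of x] H_Suc[of "k - 1"] that by (simp add: al_def)
  show "\<bar>al x k - ax x\<bar> \<le> 3 / (real k + 1)" for k by (rule al_lim(2)[OF x])
  show "al x 0 - ax x = - ax x" by (simp add: al_def UU_def)
qed

definition rh :: "real \<Rightarrow> real" where "rh x = perturbed_sums.rho vv (\<lambda>k. al x k - ax x)"
definition GH :: "nat \<Rightarrow> real" where "GH n = (\<Sum>q=1..n. vv q * H (q - 1))"
definition BdV :: "nat \<Rightarrow> real" where
  "BdV N = - (\<Sum>l=1..N. th N l * (vv l * GH (l - 1))) - GH N * PN N + H N * (\<Sum>q=1..N. th N q * (vv q * H (q - 1)))"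

lemma Bd_lim:
  assumes x: "\<bar>x\<bar> \<le> 1 / 2"
  shows "(\<lambda>N. Bd x N - BdV N - ((ax x)\<^sup>2 - 2 * rh x) * PN N) \<longlonglongrightarrow> 0"
    and "(\<lambda>N. (\<Sum>k=1..N. th N k * uu x k) - PN N) \<longlonglongrightarrow> 0"
proof -
  interpret P: perturbed_sums vv "uu x" "\<lambda>k. al x k - ax x" "ax x" 3 by (rule pert[OF x])
  interpret T: end_kernel th by (rule end_kernel_th)
  interpret K: perturbed_kernel vv "uu x" "\<lambda>k. al x k - ax x" "ax x" 3 th by unfold_locales
  have V: "P.V n = H n" for n by (simp add: P.V_def H_def)
  have U: "P.U n = UU x n" for n by (simp add: P.U_def UU_def)
  have B: "P.B n = (\<Sum>q=1..n. bb x q)" for n by (simp add: P.B_def U bb_def)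
  have G: "P.G n = GH n" for n by (simp add: P.G_def V GH_def)
  have be: "be x l = P.B (l - 1)" if "1 \<le> l" for l
    using that unfolding be_def B by (intro sum.cong) auto
  have b: "Bd x N = - (\<Sum>l=1..N. th N l * (uu x l * P.B (l - 1))) - P.B N * (\<Sum>k=1..N. th N k * uu x k) + P.U N * (\<Sum>q=1..N. th N q * (vv q * P.U (q - 1)))" for N
  proof -
    have "(\<Sum>l=1..N. be x l * uu x l * th N l) = (\<Sum>l=1..N. th N l * (uu x l * P.B (l - 1)))"
      by (intro sum.cong refl) (simp add: be mult_ac)
    moreover have "(\<Sum>q=1..N. bb x q * th N q) = (\<Sum>q=1..N. th N q * (vv q * P.U (q - 1)))"
      unfolding U bb_def by (intro sum.cong refl) (simp add: mult_ac)
    ultimately show ?thesis unfolding Bd_def B[of N, symmetric] U by simp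
  qed
  show "(\<lambda>N. Bd x N - BdV N - ((ax x)\<^sup>2 - 2 * rh x) * PN N) \<longlonglongrightarrow> 0"
    using K.boundary unfolding b[symmetric] V G PN_def[symmetric] BdV_def[symmetric] rh_def[symmetric] .
  show "(\<lambda>N. (\<Sum>k=1..N. th N k * uu x k) - PN N) \<longlonglongrightarrow> 0"
    using K.theta_uv unfolding PN_def .
qed

definition K2oL :: "real \<Rightarrow> real" where "K2oL x = lim (K2o x)"

lemma K2o_lim:
  assumes x: "\<bar>x\<bar> \<le> 1 / 2"
  shows "K2o x \<longlonglongrightarrow> K2oL x"
proof -
  have "summable (\<lambda>k. (uu x (Suc k))\<^sup>2 + 2 * ph (Suc k) * uu x (Suc k))"
  proof (rule summable_comparison_test')
    show "summable (\<lambda>k. 8 * (1 / (real (Suc k))\<^sup>2))"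
      using summable_mult[OF summable_Suc_iff[THEN iffD2, OF inverse_power_summable[of 2, where 'a = real]], of 8]
      by (simp add: divide_inverse)
    fix k
    have u: "\<bar>uu x (Suc k)\<bar> \<le> 2 / real (Suc k)" using uu_diff_le(2)[OF x, of "Suc k"] by simp
    have "\<bar>(uu x (Suc k))\<^sup>2\<bar> \<le> (2 / real (Suc k))\<^sup>2" using power_mono[OF u, of 2] by simp
    moreover have "\<bar>2 * ph (Suc k) * uu x (Suc k)\<bar> \<le> 2 * (1 / real (Suc k)) * (2 / real (Suc k))"
      unfolding abs_mult using u ph_le[of "Suc k"] by (intro mult_mono) auto
    ultimately have "\<bar>(uu x (Suc k))\<^sup>2 + 2 * ph (Suc k) * uu x (Suc k)\<bar> \<le> (2 / real (Suc k))\<^sup>2 + 2 * (1 / real (Suc k)) * (2 / real (Suc k))"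
      by linarith
    then show "norm ((uu x (Suc k))\<^sup>2 + 2 * ph (Suc k) * uu x (Suc k)) \<le> 8 * (1 / (real (Suc k))\<^sup>2)"
      by (simp add: power2_eq_square)
  qed
  then have "convergent (\<lambda>n. \<Sum>k<n. (uu x (Suc k))\<^sup>2 + 2 * ph (Suc k) * uu x (Suc k))"
    by (simp add: summable_iff_convergent)
  moreover have "(\<lambda>n. \<Sum>k<n. (uu x (Suc k))\<^sup>2 + 2 * ph (Suc k) * uu x (Suc k)) = K2o x"
    unfolding K2o_def by (intro ext sum.reindex_bij_witness[of _ "\<lambda>q. q - 1" Suc]) auto
  ultimately show ?thesis unfolding K2oL_def convergent_LIMSEQ_iff by simp
qed

definition pc :: real where "pc = K2oL 0 / 2"

text \<open>The kernel is not estimated directly: at \<open>x = 0\<close> the factor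
  \<open>2 * x\<close> annihilates \<open>K2N\<close>, so that \<open>K2N_eq\<close> evaluates the
  boundary sum as half of \<open>K2o 0\<close>, and \<open>Bd_lim\<close> replaces
  \<open>uu 0\<close> by \<open>vv\<close>.\<close>

lemma PN_lim: "PN \<longlonglongrightarrow> pc"
proof -
  have "K2N 0 N = 0" for N by (simp add: K2N_def)
  then have "(\<Sum>k=1..N. th N k * uu 0 k) = K2o 0 N / 2" for N using K2N_eq[of 0 N] nz_half[of 0] by simp
  then have "(\<lambda>N. (\<Sum>k=1..N. th N k * uu 0 k)) = (\<lambda>N. K2o 0 N / 2)" by blast
  moreover have "(\<lambda>N. K2o 0 N / 2) \<longlonglongrightarrow> pc"
    unfolding pc_def by (intro tendsto_divide K2o_lim tendsto_const) auto
  ultimately have "(\<lambda>N. (\<Sum>k=1..N. th N k * uu 0 k)) \<longlonglongrightarrow> pc" by simp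
  from tendsto_diff[OF this Bd_lim(2)[of 0]] show ?thesis by simp
qed

lemma K2N_lim:
  assumes x: "\<bar>x\<bar> \<le> 1 / 2"
  shows "K2N x \<longlonglongrightarrow> K2oL x - 2 * pc"
proof -
  have "(\<lambda>N. \<Sum>k=1..N. th N k * uu x k) \<longlonglongrightarrow> 0 + pc"
    using tendsto_add[OF Bd_lim(2)[OF x] PN_lim] by simp
  then have "(\<lambda>N. K2o x N - 2 * (\<Sum>k=1..N. th N k * uu x k)) \<longlonglongrightarrow> K2oL x - 2 * (0 + pc)"
    by (intro tendsto_intros K2o_lim[OF x])
  moreover have "K2N x = (\<lambda>N. K2o x N - 2 * (\<Sum>k=1..N. th N k * uu x k))"
    by (intro ext K2N_eq nz_half[OF x])
  ultimately show ?thesis by simp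
qed

text \<open>For \<open>s = -1\<close> the value \<open>th N k\<close> is a stretch of the
  alternating harmonic series, at most 1/(N - k + 1) in absolute value; with the weights 1/k this
  leaves a sum of order log N / N.\<close>

lemma pc_zero: "s = -1 \<Longrightarrow> pc = 0"
proof -
  assume s: "s = -1"
  then have g: "g = 1" using gs by auto
  have f: "f i = (-1) ^ i" for i unfolding f_def e_def using s g by simp
  have "\<bar>PN N\<bar> \<le> 2 * lg N ^ 1 / real N" if N: "1 \<le> N" for N
  proof -
    have th: "\<bar>th N k\<bar> \<le> 1 / (real N - real k + 1)" if "k \<le> N" for k
    proof -
      have "th N k = (\<Sum>i=Suc (N - k)..N + k. (-1) ^ i / real i)"
        using h_diff[of "N - k" "N + k"] by (simp add: th_def f)
      then show ?thesis using alternating_tail_le[of "N - k" "N + k"] that by (simp add: of_nat_diff)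
    qed
    have "\<bar>PN N\<bar> \<le> (\<Sum>k=1..N. \<bar>th N k * vv k\<bar>)" unfolding PN_def by (rule sum_abs)
    also have "\<dots> \<le> (\<Sum>k=1..N. 1 / (real N - real k + 1) * (1 / real k))"
      unfolding abs_mult by (intro sum_mono mult_mono th vv_le) auto
    also have "\<dots> = (\<Sum>l<N. 1 / ((real l + 1) * (real N - real l)))"
      by (intro sum.reindex_bij_witness[of _ "\<lambda>l. Suc l" "\<lambda>l. l - 1"]) (auto simp: of_nat_diff mult.commute)
    also have "\<dots> \<le> 2 * lg N / real N" by (rule sum_inv_conv_le[OF N])
    finally show ?thesis by simp
  qed
  then have "(\<lambda>N. \<bar>PN N\<bar>) \<longlonglongrightarrow> 0"
    by (intro tendsto_sandwich[OF _ _ tendsto_const small_tendsto_0[of 2 1]] eventually_mono[OF eventually_ge_at_top[of 1]]) auto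
  then have "PN \<longlonglongrightarrow> 0" by (rule tendsto_rabs_zero_cancel)
  then show ?thesis using LIMSEQ_unique PN_lim by blast
qed

text \<open>The sequence \<open>c\<close> is built from \<open>vv\<close> and \<open>et\<close>
  alone and does not know the point at which \<open>uu\<close> is taken. By
  \<open>sq_minus_bb\<close> its limit is \<open>(ax y)\<^sup>2 - 2 * rh y - K2oL y\<close> for
  every \<open>y\<close> in the range, in particular for \<open>x\<close> and for 0.\<close>

lemma ax_rh:
  assumes s1: "s = 1" and x: "\<bar>x\<bar> \<le> 1 / 2"
  shows "(ax x)\<^sup>2 - 2 * rh x - K2oL x = (ax 0)\<^sup>2 - 2 * rh 0 - K2oL 0"
proof -
  define c where "c N = - (H N)\<^sup>2 + 2 * GH N - 2 * (\<Sum>k=1..N. et N k * vv k)" for N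
  have "c \<longlonglongrightarrow> (ax y)\<^sup>2 - 2 * rh y - K2oL y" if y: "\<bar>y\<bar> \<le> 1 / 2" for y
  proof -
    interpret P: perturbed_sums vv "uu y" "\<lambda>k. al y k - ax y" "ax y" 3 by (rule pert[OF y])
    interpret T: end_kernel et by (rule end_kernel_et)
    interpret K: perturbed_kernel vv "uu y" "\<lambda>k. al y k - ax y" "ax y" 3 et by unfold_locales
    have V: "P.V n = H n" for n by (simp add: P.V_def H_def)
    have U: "P.U n = UU y n" for n by (simp add: P.U_def UU_def)
    have B: "P.B n = (\<Sum>q=1..n. bb y q)" for n by (simp add: P.B_def U bb_def)
    have G: "P.G n = GH n" for n by (simp add: P.G_def V GH_def)
    define r where "r N = al y N - ax y" for N
    have "c N = (ax y)\<^sup>2 - 2 * P.rhos N - K2o y N + 2 * ((\<Sum>k=1..N. et N k * uu y k) - (\<Sum>k=1..N. et N k * vv k)) + (2 * r N * (H N + ax y) + (r N)\<^sup>2)" for N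
    proof -
      have "UU y N = H N + ax y + r N" using P.U_eq[of N] unfolding U V r_def by simp
      moreover have "(\<Sum>q=1..N. bb y q) = GH N + ax y * H N + P.rhos N" using P.B_eq[of N] unfolding B V G .
      ultimately show ?thesis using sq_minus_bb[OF nz_half[OF y] s1, of N] unfolding c_def
        by (simp add: power2_eq_square algebra_simps)
    qed
    then have ce: "c = (\<lambda>N. (ax y)\<^sup>2 - 2 * P.rhos N - K2o y N + 2 * ((\<Sum>k=1..N. et N k * uu y k) - (\<Sum>k=1..N. et N k * vv k)) + (2 * r N * (H N + ax y) + (r N)\<^sup>2))" by blast
    have r0: "r \<longlonglongrightarrow> 0" unfolding r_def using tendsto_diff[OF al_lim(1)[OF y] tendsto_const[of "ax y"]] by simp
    have rH: "(\<lambda>N. r N * H N) \<longlonglongrightarrow> 0"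
    proof (rule tendsto_rabs_zero_cancel, rule tendsto_sandwich[OF _ _ tendsto_const small_tendsto_0[of 3 1]])
      show "\<forall>\<^sub>F N in sequentially. \<bar>r N * H N\<bar> \<le> 3 * lg N ^ 1 / real N"
      proof (rule eventually_mono[OF eventually_ge_at_top[of 1]])
        fix N :: nat assume N: "1 \<le> N"
        have "\<bar>r N * H N\<bar> \<le> 3 / (real N + 1) * hs N"
          unfolding abs_mult r_def using al_lim(2)[OF y, of N] P.V_le[of N] by (intro mult_mono) (auto simp: V)
        also have "\<dots> \<le> 3 / real N * lg N" using N hs_le_lg[OF N] hs_nonneg[of N] by (intro mult_mono frac_le) auto
        finally show "\<bar>r N * H N\<bar> \<le> 3 * lg N ^ 1 / real N" by simp
      qed
    qed auto
    have "(\<lambda>N. 2 * (r N * H N) + 2 * r N * ax y + (r N)\<^sup>2) \<longlonglongrightarrow> 2 * 0 + 2 * 0 * ax y + 0\<^sup>2"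
      by (intro tendsto_intros r0 rH)
    moreover have "(\<lambda>N. 2 * (r N * H N) + 2 * r N * ax y + (r N)\<^sup>2) = (\<lambda>N. 2 * r N * (H N + ax y) + (r N)\<^sup>2)" by (simp add: algebra_simps)
    ultimately have r': "(\<lambda>N. 2 * r N * (H N + ax y) + (r N)\<^sup>2) \<longlonglongrightarrow> 0" by simp
    have "c \<longlonglongrightarrow> (ax y)\<^sup>2 - 2 * P.rho - K2oL y + 2 * 0 + 0"
      unfolding ce by (intro tendsto_intros P.rho_sums K2o_lim[OF y] K.theta_uv r')
    then show ?thesis by (simp add: rh_def)
  qed
  from this[OF x] this[of 0] show ?thesis using LIMSEQ_unique by auto
qed

text \<open>The boundary part contributes \<open>(q x - q 0) * pc\<close>. This equals
  \<open>(K2oL x - 2 * pc) * pc\<close>, by \<open>ax_rh\<close> if \<open>s = 1\<close>, and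
  because \<open>pc = 0\<close> if \<open>s = -1\<close>. As \<open>K2oL 0 = 2 * pc\<close>, it
  completes the difference of the squares of \<open>K2oL x\<close> and \<open>K2oL 0\<close> to the
  square of \<open>K2oL x - 2 * pc\<close>, which is the limit of \<open>K2N x\<close>.\<close>

theorem TN_lim:
  assumes x: "\<bar>x\<bar> \<le> 1 / 2" and R: "RN x \<longlonglongrightarrow> \<rho>"
  shows "(\<lambda>N. TN x N - TN 0 N) \<longlonglongrightarrow> (K2oL x - 2 * pc)\<^sup>2 / 2 + 2 * \<rho>"
proof -
  define q where "q y = (ax y)\<^sup>2 - 2 * rh y" for y
  have R0: "RN 0 N = 0" for N by (simp add: RN_def)
  have W: "Wp x N - Wp 0 N = RN x N - ((Bd x N - BdV N - q x * PN N) - (Bd 0 N - BdV N - q 0 * PN N) + (q x - q 0) * PN N)" for N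
    using RN_eq[OF nz_half[OF x], of N] RN_eq[OF nz_half[of 0], of N] R0[of N] by (simp add: algebra_simps)
  have "(\<lambda>N. Wp x N - Wp 0 N) \<longlonglongrightarrow> \<rho> - (0 - 0 + (q x - q 0) * pc)"
    unfolding W using Bd_lim(1)[OF x] Bd_lim(1)[of 0] by (intro tendsto_intros R PN_lim) (simp_all add: q_def)
  moreover have "(q x - q 0) * pc = (K2oL x - 2 * pc) * pc"
  proof (cases "s = 1")
    case True
    have "2 * pc = K2oL 0" by (simp add: pc_def)
    then have "q x - q 0 = K2oL x - 2 * pc" using ax_rh[OF True x] unfolding q_def by linarith
    then show ?thesis by simp
  next
    case False
    then have "s = -1" using gs by auto
    then show ?thesis using pc_zero by simp
  qed
  ultimately have w: "(\<lambda>N. Wp x N - Wp 0 N) \<longlonglongrightarrow> \<rho> - (K2oL x - 2 * pc) * pc" by simp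
  have "(\<lambda>N. (K2o x N)\<^sup>2 / 2 - (K2o 0 N)\<^sup>2 / 2) \<longlonglongrightarrow> (K2oL x)\<^sup>2 / 2 - (K2oL 0)\<^sup>2 / 2"
    by (intro tendsto_intros K2o_lim x) auto
  from tendsto_add[OF this tendsto_mult_left[OF w, of 2]] have "(\<lambda>N. (K2o x N)\<^sup>2 / 2 - (K2o 0 N)\<^sup>2 / 2 + 2 * (Wp x N - Wp 0 N)) \<longlonglongrightarrow> (K2oL x)\<^sup>2 / 2 - (K2oL 0)\<^sup>2 / 2 + 2 * (\<rho> - (K2oL x - 2 * pc) * pc)"
    .
  moreover have "TN x N - TN 0 N = (K2o x N)\<^sup>2 / 2 - (K2o 0 N)\<^sup>2 / 2 + 2 * (Wp x N - Wp 0 N)" for N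
    by (simp add: TN_eq)
  moreover have "(K2oL x)\<^sup>2 / 2 - (K2oL 0)\<^sup>2 / 2 + 2 * (\<rho> - (K2oL x - 2 * pc) * pc) = (K2oL x - 2 * pc)\<^sup>2 / 2 + 2 * \<rho>"
    by (simp add: pc_def power2_eq_square field_simps)
  ultimately show ?thesis by (simp only:)
qed

end

section \<open>Symmetrisation of the generating function\<close>

lemma has_sum_mult_Times:
  fixes f :: "'a \<Rightarrow> real" and g :: "'b \<Rightarrow> real"
  assumes f: "(f has_sum a) A" and g: "(g has_sum b) B"
  shows "((\<lambda>(x, y). f x * g y) has_sum a * b) (A \<times> B)"
proof -
  have fa: "(\<lambda>x. norm (f x)) summable_on A" and ga: "(\<lambda>x. norm (g x)) summable_on B"
    using f g summable_on_iff_abs_summable_on_real has_sum_imp_summable by blast+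
  have "(\<lambda>z. norm ((\<lambda>(x, y). f x * g y) z)) summable_on A \<times> B"
  proof (subst Infinite_Sum.abs_summable_on_Sigma_iff, intro conjI ballI)
    fix x
    show "(\<lambda>y. norm (case (x, y) of (x, y) \<Rightarrow> f x * g y)) summable_on B"
      using summable_on_cmult_right[OF ga, of "\<bar>f x\<bar>"] by (simp add: abs_mult)
  next
    have "(\<lambda>x. norm (\<bar>f x\<bar> * infsum (\<lambda>y. \<bar>g y\<bar>) B)) summable_on A"
      using summable_on_cmult_left[OF fa, of "\<bar>infsum (\<lambda>y. \<bar>g y\<bar>) B\<bar>"] by (simp add: abs_mult)
    then show "(\<lambda>x. norm (infsum (\<lambda>y. norm (case (x, y) of (x, y) \<Rightarrow> f x * g y)) B)) summable_on A"
      by (simp add: abs_mult infsum_cmult_right')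
  qed
  then have "(\<lambda>(x, y). f x * g y) summable_on A \<times> B" by (rule Infinite_Sum.abs_summable_summable)
  then obtain c where c: "((\<lambda>(x, y). f x * g y) has_sum c) (A \<times> B)" by (auto simp: summable_on_def)
  have "((\<lambda>x. f x * b) has_sum c) A"
    using has_sum_Sigma'[OF c, of "\<lambda>x. f x * b"] has_sum_cmult_right[OF g] by simp
  moreover have "((\<lambda>x. f x * b) has_sum a * b) A" by (rule has_sum_cmult_left[OF f])
  ultimately show ?thesis using c has_sum_unique by blast
qed

text \<open>One absolutely convergent sum over gaps is evaluated along finite sets of different
  shapes: boxes for the square of \<open>K2N\<close>, the range \<open>k, l \<le> N\<close> for
  \<open>RN\<close>, and k1 \<le> N for Euler sums and T-values.\<close>

lemma has_sum_exhaust: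
  assumes f: "(f has_sum S) A" and D: "\<And>N. finite (D N)" "\<And>N. D N \<subseteq> A" "\<And>m n. m \<le> n \<Longrightarrow> D m \<subseteq> D n"
    and cover: "\<And>a. a \<in> A \<Longrightarrow> \<exists>N::nat. a \<in> D N"
  shows "(\<lambda>N. sum f (D N)) \<longlonglongrightarrow> S"
proof -
  have "filterlim D (finite_subsets_at_top A) sequentially"
    unfolding filterlim_iff eventually_finite_subsets_at_top
  proof (intro allI impI, elim exE conjE)
    fix P X assume X: "finite X" "X \<subseteq> A" "\<forall>Y. finite Y \<and> X \<subseteq> Y \<and> Y \<subseteq> A \<longrightarrow> P Y"
    have "\<exists>N. X \<subseteq> D N" using X(1,2)
    proof induction
      case (insert y F)
      then obtain M K where "F \<subseteq> D M" "y \<in> D K" using cover by (meson insert_subset)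
      then have "insert y F \<subseteq> D (max M K)" using D(3)[of M "max M K"] D(3)[of K "max M K"] by auto
      then show ?case by blast
    qed simp
    then obtain N where "X \<subseteq> D N" by blast
    then have "P (D M)" if "N \<le> M" for M using X(3) D(1,2)[of M] D(3)[OF that] by (meson order_trans)
    then show "eventually (\<lambda>N. P (D N)) sequentially" by (intro eventually_sequentiallyI[of N])
  qed
  then show ?thesis using f unfolding has_sum_def by (rule filterlim_compose[rotated])
qed

text \<open>Quadruples are the gaps \<open>(k\<^sub>1 - k\<^sub>2, k\<^sub>2 - k\<^sub>3, k\<^sub>3 - k\<^sub>4, k\<^sub>4)\<close> of an index tuple, so that \<open>qT, qS, qq, n4\<close> are
  \<open>k\<^sub>1, k\<^sub>2, k\<^sub>3, k\<^sub>4\<close>. The weight factorises over the gaps, which makes it invariant under permutations.\<close>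

type_synonym quad = "nat \<times> nat \<times> nat \<times> nat"

definition posq :: "quad set" where "posq = {1..} \<times> {1..} \<times> {1..} \<times> {1..}"
definition n1 :: "quad \<Rightarrow> real" where "n1 n = real (fst n)"
definition n2 :: "quad \<Rightarrow> real" where "n2 n = real (fst (snd n))"
definition n3 :: "quad \<Rightarrow> real" where "n3 n = real (fst (snd (snd n)))"
definition n4 :: "quad \<Rightarrow> real" where "n4 n = real (snd (snd (snd n)))"
definition qq :: "quad \<Rightarrow> real" where "qq n = n3 n + n4 n"
definition qS :: "quad \<Rightarrow> real" where "qS n = n2 n + n3 n + n4 n"
definition qT :: "quad \<Rightarrow> real" where "qT n = n1 n + n2 n + n3 n + n4 n"
definition sw34 :: "quad \<Rightarrow> quad" where "sw34 = (\<lambda>(a, b, c, d). (a, b, d, c))"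
definition swp :: "quad \<Rightarrow> quad" where "swp = (\<lambda>(a, b, c, d). (c, d, a, b))"
definition cyc3 :: "quad \<Rightarrow> quad" where "cyc3 = (\<lambda>(a, b, c, d). (a, c, d, b))"
definition cyc4 :: "quad \<Rightarrow> quad" where "cyc4 = (\<lambda>(a, b, c, d). (b, c, d, a))"
definition bdd :: "(quad \<Rightarrow> real) \<Rightarrow> bool" where "bdd r \<longleftrightarrow> (\<exists>C. \<forall>n\<in>posq. \<bar>r n\<bar> \<le> C)"

lemmas qdefs = n1_def n2_def n3_def n4_def qq_def qS_def qT_def

lemma posq_ge: "n \<in> posq \<Longrightarrow> 1 \<le> n1 n" "n \<in> posq \<Longrightarrow> 1 \<le> n2 n" "n \<in> posq \<Longrightarrow> 1 \<le> n3 n" "n \<in> posq \<Longrightarrow> 1 \<le> n4 n"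
  by (auto simp: posq_def qdefs)

lemma bddI: "(\<And>n. n \<in> posq \<Longrightarrow> \<bar>r n\<bar> \<le> C) \<Longrightarrow> bdd r" unfolding bdd_def by blast
lemma bdd_const [simp, intro]: "bdd (\<lambda>n. c)" by (auto simp: bdd_def)
lemma bdd_mult [intro]:
  assumes "bdd r" "bdd t"
  shows "bdd (\<lambda>n. r n * t n)"
proof -
  obtain C D where "\<forall>n\<in>posq. \<bar>r n\<bar> \<le> C" "\<forall>n\<in>posq. \<bar>t n\<bar> \<le> D" using assms by (auto simp: bdd_def)
  then have "\<bar>r n * t n\<bar> \<le> C * D" if "n \<in> posq" for n
    unfolding abs_mult using that by (meson abs_ge_zero mult_mono order_trans)
  then show ?thesis by (rule bddI)
qed
lemma bdd_add [intro]:
  assumes "bdd r" "bdd t"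
  shows "bdd (\<lambda>n. r n + t n)"
proof -
  obtain C D where "\<forall>n\<in>posq. \<bar>r n\<bar> \<le> C" "\<forall>n\<in>posq. \<bar>t n\<bar> \<le> D" using assms by (auto simp: bdd_def)
  then have "\<bar>r n + t n\<bar> \<le> C + D" if "n \<in> posq" for n
    using that abs_triangle_ineq[of "r n" "t n"] by fastforce
  then show ?thesis by (rule bddI)
qed
lemma bdd_diff [intro]: "bdd r \<Longrightarrow> bdd t \<Longrightarrow> bdd (\<lambda>n. r n - t n)"
  using bdd_add[of r "\<lambda>n. (-1) * t n"] bdd_mult[of "\<lambda>n. -1" t] by simp

lemma bdd_ratio:
  assumes "\<And>n. n \<in> posq \<Longrightarrow> \<bar>r n\<bar> \<le> C * \<bar>t n\<bar>" "0 \<le> C"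
  shows "bdd (\<lambda>n. r n / t n)"
proof (rule bddI)
  fix n assume n: "n \<in> posq"
  show "\<bar>r n / t n\<bar> \<le> C" using assms(1)[OF n] assms(2)
    by (cases "t n = 0") (auto simp: abs_divide divide_le_eq)
qed

text \<open>The hypotheses are tailored to quotients of linear forms in the gaps, which then need
  only linear arithmetic; for |x| \<le> 1/8 the constant 4 serves all the quotients below.\<close>

lemma bdd_ratio4:
  assumes "\<And>n. 1 \<le> n1 n \<Longrightarrow> 1 \<le> n2 n \<Longrightarrow> 1 \<le> n3 n \<Longrightarrow> 1 \<le> n4 n \<Longrightarrow> r n \<le> 4 * t n"
    and "\<And>n. 1 \<le> n1 n \<Longrightarrow> 1 \<le> n2 n \<Longrightarrow> 1 \<le> n3 n \<Longrightarrow> 1 \<le> n4 n \<Longrightarrow> - r n \<le> 4 * t n"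
  shows "bdd (\<lambda>n. r n / t n)"
proof (rule bdd_ratio[where C = 4])
  fix n assume "n \<in> posq"
  then show "\<bar>r n\<bar> \<le> 4 * \<bar>t n\<bar>" using assms[OF posq_ge[of n]] by linarith
qed simp

text \<open>Every gap is at most T = \<open>qT n\<close>, so T is at least the fourth root of the
  product of the gaps, and the summand is dominated by the product of the four powers of the gaps
  with exponent -5/4.\<close>

lemma posq_summable: "(\<lambda>n. norm (1 / (qT n * (n1 n * n2 n * n3 n * n4 n)))) summable_on posq"
proof (rule Infinite_Sum.abs_summable_on_comparison_test')
  define z where "z k = real k powr (- 5 / 4)" for k :: nat
  have "summable z" unfolding z_def by (subst summable_real_powr_iff) simp
  then have "z summable_on UNIV" by (subst summable_on_UNIV_nonneg_real_iff) (auto simp: z_def)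
  then have "z summable_on {1..}" by (rule summable_on_subset_banach) auto
  then obtain Z where Z: "(z has_sum Z) {1..}" by (auto simp: summable_on_def)
  show "(\<lambda>(a, b, c, d). z a * (z b * (z c * z d))) summable_on posq"
    unfolding posq_def summable_on_def
    using has_sum_mult_Times[OF Z has_sum_mult_Times[OF Z has_sum_mult_Times[OF Z Z]]]
    by (auto simp: case_prod_unfold)
  fix n assume n: "n \<in> posq"
  obtain a b c d where nn: "n = (a, b, c, d)" by (cases n)
  have p: "1 \<le> real a" "1 \<le> real b" "1 \<le> real c" "1 \<le> real d" using n by (auto simp: nn posq_def)
  define T where "T = real a + real b + real c + real d"
  have T0: "0 < T" using p by (simp add: T_def)
  have le: "y powr (1 / 4) \<le> T powr (1 / 4)" if "0 \<le> y" "y \<le> T" for y using that by (intro powr_mono2) auto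
  have sp: "real k powr (5 / 4) = real k * real k powr (1 / 4)" if "1 \<le> real k" for k
    using powr_add[of "real k" 1 "1 / 4"] that by simp
  have z: "z k = 1 / (real k * real k powr (1 / 4))" if "1 \<le> real k" for k
    unfolding z_def sp[OF that, symmetric] using powr_minus[of "real k" "5 / 4"] by (simp add: inverse_eq_divide)
  have "real a powr (1 / 4) * real b powr (1 / 4) * real c powr (1 / 4) * real d powr (1 / 4)
      \<le> T powr (1 / 4) * T powr (1 / 4) * T powr (1 / 4) * T powr (1 / 4)"
    using p by (intro mult_mono le) (auto simp: T_def)
  also have "\<dots> = T" using p by (simp add: T_def flip: powr_add)
  finally have "real a * real b * real c * real d * (real a powr (1 / 4) * real b powr (1 / 4) * real c powr (1 / 4) * real d powr (1 / 4))
      \<le> real a * real b * real c * real d * T" using p by (intro mult_left_mono) auto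
  then have "1 / (T * (real a * real b * real c * real d)) \<le> 1 / (real a * real b * real c * real d * (real a powr (1 / 4) * real b powr (1 / 4) * real c powr (1 / 4) * real d powr (1 / 4)))"
    using p T0 by (intro divide_left_mono mult_pos_pos) (simp_all add: mult_ac)
  moreover have "0 \<le> T" using p by (simp add: T_def)
  ultimately show "norm (1 / (qT n * (n1 n * n2 n * n3 n * n4 n))) \<le> (case n of (a, b, c, d) \<Rightarrow> z a * (z b * (z c * z d)))"
    using p by (simp add: nn qdefs z T_def mult_ac)
qed

lemma perm_bij: "bij_betw sw34 posq posq" "bij_betw swp posq posq" "bij_betw cyc3 posq posq" "bij_betw cyc4 posq posq"
proof -
  show "bij_betw sw34 posq posq" by (rule bij_betwI[where g = sw34]) (auto simp: posq_def sw34_def)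
  show "bij_betw swp posq posq" by (rule bij_betwI[where g = swp]) (auto simp: posq_def swp_def)
  show "bij_betw cyc3 posq posq"
    by (rule bij_betwI[where g = "\<lambda>(a, b, c, d). (a, d, b, c)"]) (auto simp: posq_def cyc3_def)
  show "bij_betw cyc4 posq posq"
    by (rule bij_betwI[where g = "\<lambda>(a, b, c, d). (d, a, b, c)"]) (auto simp: posq_def cyc4_def)
qed

context sgn_grading
begin

definition ww :: "real \<Rightarrow> quad \<Rightarrow> real" where
  "ww x = (\<lambda>(a, b, c, d). s ^ (a + b + c + d) * (uu x a * uu x b * uu x c * uu x d))"

lemma ww_perm: "ww x (sw34 n) = ww x n" "ww x (swp n) = ww x n" "ww x (cyc3 n) = ww x n" "ww x (cyc4 n) = ww x n"
  by (cases n; simp add: ww_def sw34_def swp_def cyc3_def cyc4_def mult_ac add_ac)+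

lemma ww_summable:
  assumes x: "\<bar>x\<bar> \<le> 1 / 2" and r: "bdd r"
  shows "(\<lambda>n. ww x n * (r n / qT n)) summable_on posq"
proof -
  obtain C where C: "\<And>n. n \<in> posq \<Longrightarrow> \<bar>r n\<bar> \<le> C" using r by (auto simp: bdd_def)
  have uu: "\<bar>uu x k\<bar> \<le> 2 / real k" if "1 \<le> k" for k using uu_diff_le[OF x that] by simp
  show ?thesis
  proof (rule Infinite_Sum.abs_summable_summable, rule Infinite_Sum.abs_summable_on_comparison_test')
    show "(\<lambda>n. 16 * C * (1 / (qT n * (n1 n * n2 n * n3 n * n4 n)))) summable_on posq"
      by (rule summable_on_cmult_right[OF Infinite_Sum.abs_summable_summable[OF posq_summable]])
    fix n assume n: "n \<in> posq"
    obtain a b c d where nn: "n = (a, b, c, d)" by (cases n)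
    have p: "1 \<le> a" "1 \<le> b" "1 \<le> c" "1 \<le> d" using n by (auto simp: nn posq_def)
    have "\<bar>ww x n\<bar> = \<bar>uu x a\<bar> * \<bar>uu x b\<bar> * \<bar>uu x c\<bar> * \<bar>uu x d\<bar>" by (simp add: nn ww_def abs_mult)
    also have "\<dots> \<le> (2 / real a) * (2 / real b) * (2 / real c) * (2 / real d)"
      using p by (intro mult_mono uu) auto
    finally have w: "\<bar>ww x n\<bar> \<le> 16 / (n1 n * n2 n * n3 n * n4 n)" by (simp add: nn qdefs)
    have "\<bar>ww x n * (r n / qT n)\<bar> \<le> 16 / (n1 n * n2 n * n3 n * n4 n) * (C / qT n)"
      unfolding abs_mult abs_divide using posq_ge[OF n] C[OF n] by (intro mult_mono w frac_le) (auto simp: qT_def)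
    then show "norm (ww x n * (r n / qT n)) \<le> 16 * C * (1 / (qT n * (n1 n * n2 n * n3 n * n4 n)))"
      by (simp add: mult_ac)
  qed
qed

text \<open>Along every orbit of \<open>\<sigma>\<close> the difference of the two summands is an
  invariant factor times values of \<open>\<phi>\<close> that add up to 0; as
  \<open>\<sigma>\<close> is a bijection of the gaps, both sums agree. Thus one factor at a time is
  replaced by its average under a cyclic permutation, and no expression with all 24 orders ever
  appears.\<close>

lemma sym_step:
  assumes x: "\<bar>x\<bar> \<le> 1 / 2" and h: "((\<lambda>n. ww x n * (r n / qT n)) has_sum D) posq"
    and \<sigma>: "bij_betw \<sigma> posq posq" "\<And>n. ww x (\<sigma> n) = ww x n" "\<And>n. n \<in> posq \<Longrightarrow> \<psi> (\<sigma> n) = \<psi> n" "\<And>n. qT (\<sigma> n) = qT n"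
    and k: "0 < k" and \<phi>: "\<And>n. n \<in> posq \<Longrightarrow> (\<Sum>i<k. \<phi> ((\<sigma> ^^ i) n)) = 0"
    and e: "\<And>n. n \<in> posq \<Longrightarrow> r n - r' n = \<psi> n * \<phi> n" and b: "bdd r'"
  shows "((\<lambda>n. ww x n * (r' n / qT n)) has_sum D) posq"
proof -
  obtain D' where h': "((\<lambda>n. ww x n * (r' n / qT n)) has_sum D') posq"
    using ww_summable[OF x b] by (auto simp: summable_on_def)
  define \<Delta> where "\<Delta> n = ww x n * (\<psi> n * \<phi> n / qT n)" for n
  have eq: "\<Delta> n = ww x n * (r n / qT n) - ww x n * (r' n / qT n)" if "n \<in> posq" for n
    unfolding \<Delta>_def e[OF that, symmetric] by (simp add: diff_divide_distrib right_diff_distrib)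
  have "((\<lambda>n. ww x n * (r n / qT n) - ww x n * (r' n / qT n)) has_sum (D - D')) posq"
    using has_sum_add[OF h has_sum_uminusI[OF h']] by simp
  then have d: "(\<Delta> has_sum (D - D')) posq" by (subst has_sum_cong[OF eq])
  have inv: "(\<sigma> ^^ i) n \<in> posq" if "n \<in> posq" for i n using that \<sigma>(1) by (induction i) (auto simp: bij_betw_def)
  have w: "\<Delta> ((\<sigma> ^^ i) n) = ww x n * (\<psi> n / qT n) * \<phi> ((\<sigma> ^^ i) n)" if n: "n \<in> posq" for i n
  proof -
    have "ww x ((\<sigma> ^^ i) n) = ww x n \<and> \<psi> ((\<sigma> ^^ i) n) = \<psi> n \<and> qT ((\<sigma> ^^ i) n) = qT n"
      using inv[OF n] by (induction i) (auto simp: \<sigma>)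
    then show ?thesis by (simp add: \<Delta>_def)
  qed
  have "((\<lambda>n. \<Delta> ((\<sigma> ^^ i) n)) has_sum (D - D')) posq" for i
  proof -
    have "bij_betw (\<sigma> ^^ i) posq posq" using \<sigma>(1) bij_betw_funpow by blast
    then show ?thesis using d by (subst has_sum_reindex_bij_betw)
  qed
  then have "((\<lambda>n. \<Sum>i<k. \<Delta> ((\<sigma> ^^ i) n)) has_sum (\<Sum>i<k. D - D')) posq"
  proof (induction k)
    case (Suc k)
    then show ?case using has_sum_add[OF Suc(1) Suc(2)[of k]] by (simp only: sum.lessThan_Suc)
  qed simp
  moreover have "(\<Sum>i<k. \<Delta> ((\<sigma> ^^ i) n)) = 0" if "n \<in> posq" for n
    using \<phi>[OF that] unfolding w[OF that] sum_distrib_left[symmetric] by simp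
  ultimately have "((\<lambda>n. 0) has_sum (\<Sum>i<k. D - D')) posq" by (subst (asm) has_sum_cong)
  then have "(\<Sum>i<k. D - D') = 0" by (rule has_sum_unique) simp
  then have "D = D'" using k by simp
  then show ?thesis using h' by simp
qed

text \<open>Averaging cannot be undone, so both sides are averaged until they meet in
  \<open>r5\<close>. From \<open>K\<close>: (n3 - x)/(k3 - 2x) has mean 1/2 over the last two gaps,
  (n2 - x)/(k2 - 3x) has mean 1/3 over the last three, and (n1 - x)/(k1 - 4x) has mean 1/4 over all
  four; the term with (n2 - x)/(k2 - x) is then treated likewise. On the other side
  \<open>D1\<close> is the part 2 R, and \<open>D2\<close> is half the square of K2.\<close>

theorem symmetrised:
  assumes x: "\<bar>x\<bar> \<le> 1 / 8"
    and R: "((\<lambda>n. ww x n * (4 * x * ((n2 n - x) / (qS n - x)) * ((n3 n - x) / qq n) / qT n)) has_sum D1) posq"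
    and K: "((\<lambda>n. ww x n * (2 * x\<^sup>2 * (qT n / ((n1 n + n2 n) * qq n)) / qT n)) has_sum D2) posq"
  shows "((\<lambda>n. ww x n * (x * (qT n / (qT n - 2 * x)) * (24 * ((n1 n - x) / (qT n - 4 * x)) * ((n2 n - x) / (qS n - 3 * x)) * ((n3 n - x) / (qq n - 2 * x))
     - 8 * ((n1 n - x) / qT n) * ((n2 n - x) / (qS n - x)) * ((n3 n - x) / (qq n - 2 * x))) / qT n)) has_sum D1 + D2) posq"
proof -
  note ge = posq_ge
  have x2: "\<bar>x\<bar> \<le> 1 / 2" using x by simp
  have xx: "- 1 \<le> 8 * x" "8 * x \<le> 1" using x by auto
  have pos: "0 < qT n - 2 * x" "0 < qT n - 4 * x" "0 < qS n - 3 * x" "0 < qS n - x" "0 < qq n - 2 * x" "0 < qq n" "0 < qT n" "0 < n1 n + n2 n" "0 < qS n" if "n \<in> posq" for n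
    using ge[OF that] xx by (auto simp: qq_def qS_def qT_def)
  have bd0: "bdd (\<lambda>n. qT n / (qT n - 2 * x))" by (rule bdd_ratio4; use xx in \<open>simp add: qq_def qS_def qT_def\<close>)
  have bd1: "bdd (\<lambda>n. (n1 n - x) / (qT n - 4 * x))" by (rule bdd_ratio4; use xx in \<open>simp add: qq_def qS_def qT_def\<close>)
  have bd2: "bdd (\<lambda>n. (n2 n - x) / (qS n - 3 * x))" by (rule bdd_ratio4; use xx in \<open>simp add: qq_def qS_def qT_def\<close>)
  have bd3: "bdd (\<lambda>n. (n3 n - x) / (qq n - 2 * x))" by (rule bdd_ratio4; use xx in \<open>simp add: qq_def qS_def qT_def\<close>)
  have bd4: "bdd (\<lambda>n. (n1 n - x) / qT n)" by (rule bdd_ratio4; use xx in \<open>simp add: qq_def qS_def qT_def\<close>)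
  have bd5: "bdd (\<lambda>n. (n2 n - x) / (qS n - x))" by (rule bdd_ratio4; use xx in \<open>simp add: qq_def qS_def qT_def\<close>)
  have bd6: "bdd (\<lambda>n. (qS n - 3 * x) / (qS n - x))" by (rule bdd_ratio4; use xx in \<open>simp add: qq_def qS_def qT_def\<close>)
  have bd7: "bdd (\<lambda>n. (qS n + 3 * x) / (qS n - x))" by (rule bdd_ratio4; use xx in \<open>simp add: qq_def qS_def qT_def\<close>)
  have bd8: "bdd (\<lambda>n. (qq n - 2 * x) / qq n)" by (rule bdd_ratio4; use xx in \<open>simp add: qq_def qS_def qT_def\<close>)
  have bd9: "bdd (\<lambda>n. 1 / qq n)" by (rule bdd_ratio4; use xx in \<open>simp add: qq_def qS_def qT_def\<close>)
  have bd10: "bdd (\<lambda>n. (qq n - 2 * x) / (qS n - x))" by (rule bdd_ratio4; use xx in \<open>simp add: qq_def qS_def qT_def\<close>)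
  note bd = bd0 bd1 bd2 bd3 bd4 bd5 bd6 bd7 bd8 bd9 bd10
  define r0 where "r0 n = x * (qT n / (qT n - 2 * x)) * (24 * ((n1 n - x) / (qT n - 4 * x)) * ((n2 n - x) / (qS n - 3 * x)) * ((n3 n - x) / (qq n - 2 * x))
     - 8 * ((n1 n - x) / qT n) * ((n2 n - x) / (qS n - x)) * ((n3 n - x) / (qq n - 2 * x)))" for n
  define r1 where "r1 n = x * (qT n / (qT n - 2 * x)) * (12 * ((n1 n - x) / (qT n - 4 * x)) * ((n2 n - x) / (qS n - 3 * x)) - 4 * ((n1 n - x) / qT n) * ((n2 n - x) / (qS n - x)))" for n
  define r2 where "r2 n = x * (qT n / (qT n - 2 * x)) * (4 * ((n1 n - x) / (qT n - 4 * x)) - 4 * ((n1 n - x) / qT n) * ((n2 n - x) / (qS n - x)))" for n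
  define r3 where "r3 n = x * (qT n / (qT n - 2 * x)) * (1 - 4 * ((n1 n - x) / qT n) * ((n2 n - x) / (qS n - x)))" for n
  define r4 where "r4 n = x * (qT n / (qT n - 2 * x)) * (1 - 4 / 3 * ((n1 n - x) / qT n) * ((qS n - 3 * x) / (qS n - x)))" for n
  define r5 where "r5 n = 2 * x / 3 * ((qS n + 3 * x) / (qS n - x))" for n
  define p1 where "p1 n = 2 * x * ((n2 n - x) / (qS n - x)) * ((qq n - 2 * x) / qq n)" for n
  define k1 where "k1 n = 4 * x\<^sup>2 * (1 / qq n)" for n
  define t where "t n = 2 * x * (1 - (qq n - 2 * x) / (qS n - x))" for n
  have b: "bdd r0" "bdd r1" "bdd r2" "bdd r3" "bdd r4" "bdd r5" "bdd p1" "bdd k1" "bdd t"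
    unfolding r0_def r1_def r2_def r3_def r4_def r5_def p1_def k1_def t_def by (intro bdd_mult bdd_diff bdd_add bdd_const bd)+
  have qTp: "qT (sw34 n) = qT n" "qT (swp n) = qT n" "qT (cyc3 n) = qT n" "qT (cyc4 n) = qT n" for n
    by (cases n; simp add: qdefs sw34_def swp_def cyc3_def cyc4_def)+
  have Sp: "qS (sw34 n) = qS n" "qS (cyc3 n) = qS n" "qq (sw34 n) = qq n" "qq (swp n) = n1 n + n2 n" "n1 (swp n) + n2 (swp n) = qq n"
      "n1 (cyc3 n) = n1 n" "n1 (sw34 n) = n1 n" "n2 (sw34 n) = n2 n" "n3 (sw34 n) = n4 n" for n
    by (cases n; simp add: qdefs sw34_def swp_def cyc3_def)+
  note perms = qTp Sp
  have it: "(\<Sum>i<2. F ((\<sigma> ^^ i) n)) = F n + F (\<sigma> n)" "(\<Sum>i<3. F ((\<sigma> ^^ i) n)) = F n + F (\<sigma> n) + F (\<sigma> (\<sigma> n))"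
      "(\<Sum>i<4. F ((\<sigma> ^^ i) n)) = F n + F (\<sigma> n) + F (\<sigma> (\<sigma> n)) + F (\<sigma> (\<sigma> (\<sigma> n)))" for F :: "quad \<Rightarrow> real" and \<sigma> n
    by (simp_all add: numeral_eq_Suc)
  have cc: "n2 n + n2 (cyc3 n) + n2 (cyc3 (cyc3 n)) = qS n" "qq n + qq (cyc3 n) + qq (cyc3 (cyc3 n)) = 2 * qS n"
     "n1 n + n1 (cyc4 n) + n1 (cyc4 (cyc4 n)) + n1 (cyc4 (cyc4 (cyc4 n))) = qT n"
     "qS n + qS (cyc4 n) + qS (cyc4 (cyc4 n)) + qS (cyc4 (cyc4 (cyc4 n))) = 3 * qT n" for n
    by (cases n; simp add: qdefs cyc3_def cyc4_def)+
  have s1: "((\<lambda>n. ww x n * (r1 n / qT n)) has_sum D) posq" if "((\<lambda>n. ww x n * (r0 n / qT n)) has_sum D) posq" for D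
  proof (rule sym_step[OF x2 that perm_bij(1) ww_perm(1), where k = 2 and \<phi> = "\<lambda>n. (n3 n - x) / (qq n - 2 * x) - 1 / 2"
       and \<psi> = "\<lambda>n. x * (qT n / (qT n - 2 * x)) * (24 * ((n1 n - x) / (qT n - 4 * x)) * ((n2 n - x) / (qS n - 3 * x)) - 8 * ((n1 n - x) / qT n) * ((n2 n - x) / (qS n - x)))"])
    fix n assume n: "n \<in> posq"
    show "(\<Sum>i<2. (n3 ((sw34 ^^ i) n) - x) / (qq ((sw34 ^^ i) n) - 2 * x) - 1 / 2) = 0"
      using pos[OF n] unfolding it[of "\<lambda>n. (n3 n - x) / (qq n - 2 * x) - 1 / 2"] perms by (simp add: field_simps qq_def)
    have al: "P * (24 * A * B * Z - 8 * C * E * Z) - P * (12 * A * B - 4 * C * E) = P * (24 * A * B - 8 * C * E) * (Z - 1 / 2)" for P A B C E Z :: real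
      by (simp add: algebra_simps)
    show "r0 n - r1 n = x * (qT n / (qT n - 2 * x)) * (24 * ((n1 n - x) / (qT n - 4 * x)) * ((n2 n - x) / (qS n - 3 * x)) - 8 * ((n1 n - x) / qT n) * ((n2 n - x) / (qS n - x))) * ((n3 n - x) / (qq n - 2 * x) - 1 / 2)"
      unfolding r0_def r1_def by (rule al)
  qed (simp_all add: perms b)
  have s2: "((\<lambda>n. ww x n * (r2 n / qT n)) has_sum D) posq" if "((\<lambda>n. ww x n * (r1 n / qT n)) has_sum D) posq" for D
  proof (rule sym_step[OF x2 that perm_bij(3) ww_perm(3), where k = 3 and \<phi> = "\<lambda>n. (n2 n - x) / (qS n - 3 * x) - 1 / 3"
       and \<psi> = "\<lambda>n. x * (qT n / (qT n - 2 * x)) * (12 * ((n1 n - x) / (qT n - 4 * x)))"])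
    fix n assume n: "n \<in> posq"
    have "(n2 n - x) / (qS n - 3 * x) + (n2 (cyc3 n) - x) / (qS n - 3 * x) + (n2 (cyc3 (cyc3 n)) - x) / (qS n - 3 * x) = 1"
      using pos[OF n] cc(1)[of n] by (simp add: add_divide_distrib[symmetric] algebra_simps)
    then show "(\<Sum>i<3. (n2 ((cyc3 ^^ i) n) - x) / (qS ((cyc3 ^^ i) n) - 3 * x) - 1 / 3) = 0"
      unfolding it[of "\<lambda>n. (n2 n - x) / (qS n - 3 * x) - 1 / 3"] perms by simp
    have al: "P * (12 * A * B - 4 * C * E) - P * (4 * A - 4 * C * E) = P * (12 * A) * (B - 1 / 3)" for P A B C E :: real by (simp add: algebra_simps)
    show "r1 n - r2 n = x * (qT n / (qT n - 2 * x)) * (12 * ((n1 n - x) / (qT n - 4 * x))) * ((n2 n - x) / (qS n - 3 * x) - 1 / 3)"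
      unfolding r1_def r2_def by (rule al)
  qed (simp_all add: perms b)
  have s3: "((\<lambda>n. ww x n * (r3 n / qT n)) has_sum D) posq" if "((\<lambda>n. ww x n * (r2 n / qT n)) has_sum D) posq" for D
  proof (rule sym_step[OF x2 that perm_bij(4) ww_perm(4), where k = 4 and \<phi> = "\<lambda>n. (n1 n - x) / (qT n - 4 * x) - 1 / 4"
       and \<psi> = "\<lambda>n. 4 * x * (qT n / (qT n - 2 * x))"])
    fix n assume n: "n \<in> posq"
    have "(n1 n - x) / (qT n - 4 * x) + (n1 (cyc4 n) - x) / (qT n - 4 * x) + (n1 (cyc4 (cyc4 n)) - x) / (qT n - 4 * x) + (n1 (cyc4 (cyc4 (cyc4 n))) - x) / (qT n - 4 * x) = 1"
      using pos[OF n] cc(3)[of n] by (simp add: add_divide_distrib[symmetric] algebra_simps)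
    then show "(\<Sum>i<4. (n1 ((cyc4 ^^ i) n) - x) / (qT ((cyc4 ^^ i) n) - 4 * x) - 1 / 4) = 0"
      unfolding it[of "\<lambda>n. (n1 n - x) / (qT n - 4 * x) - 1 / 4"] perms by simp
    have al: "y * P * (4 * A - 4 * C * E) - y * P * (1 - 4 * C * E) = 4 * y * P * (A - 1 / 4)" for y P A C E :: real by (simp add: algebra_simps)
    show "r2 n - r3 n = 4 * x * (qT n / (qT n - 2 * x)) * ((n1 n - x) / (qT n - 4 * x) - 1 / 4)"
      unfolding r2_def r3_def by (rule al)
  qed (simp_all add: perms b)
  have s4: "((\<lambda>n. ww x n * (r4 n / qT n)) has_sum D) posq" if "((\<lambda>n. ww x n * (r3 n / qT n)) has_sum D) posq" for D
  proof (rule sym_step[OF x2 that perm_bij(3) ww_perm(3), where k = 3 and \<phi> = "\<lambda>n. (n2 n - x) / (qS n - x) - 1 / 3 * ((qS n - 3 * x) / (qS n - x))"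
       and \<psi> = "\<lambda>n. - 4 * (x * (qT n / (qT n - 2 * x))) * ((n1 n - x) / qT n)"])
    fix n assume n: "n \<in> posq"
    have "(n2 n - x) / (qS n - x) + (n2 (cyc3 n) - x) / (qS n - x) + (n2 (cyc3 (cyc3 n)) - x) / (qS n - x) = (qS n - 3 * x) / (qS n - x)"
      using cc(1)[of n] by (simp add: add_divide_distrib[symmetric] algebra_simps)
    moreover have "A + B + C = Z \<Longrightarrow> (A - 1 / 3 * Z) + (B - 1 / 3 * Z) + (C - 1 / 3 * Z) = 0" for A B C Z :: real by simp
    ultimately show "(\<Sum>i<3. (n2 ((cyc3 ^^ i) n) - x) / (qS ((cyc3 ^^ i) n) - x) - 1 / 3 * ((qS ((cyc3 ^^ i) n) - 3 * x) / (qS ((cyc3 ^^ i) n) - x))) = 0"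
      unfolding it[of "\<lambda>n. (n2 n - x) / (qS n - x) - 1 / 3 * ((qS n - 3 * x) / (qS n - x))"] perms by blast
    have al: "P * (1 - 4 * A * B) - P * (1 - 4 / 3 * A * C) = - 4 * P * A * (B - 1 / 3 * C)" for P A B C :: real by (simp add: algebra_simps)
    show "r3 n - r4 n = - 4 * (x * (qT n / (qT n - 2 * x))) * ((n1 n - x) / qT n) * ((n2 n - x) / (qS n - x) - 1 / 3 * ((qS n - 3 * x) / (qS n - x)))"
      unfolding r3_def r4_def by (rule al)
  qed (simp_all add: perms b)
  \<comment> \<open>As n1 = T - S, the remaining asymmetry is linear in S/T. Its mean over the four
    cyclic shifts is 3/4, since every gap is missing from S exactly once.\<close>
  have s5: "((\<lambda>n. ww x n * (r5 n / qT n)) has_sum D) posq" if "((\<lambda>n. ww x n * (r4 n / qT n)) has_sum D) posq" for D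
  proof (rule sym_step[OF x2 that perm_bij(4) ww_perm(4), where k = 4 and \<phi> = "\<lambda>n. qS n / qT n - 3 / 4"
       and \<psi> = "\<lambda>n. 4 * x / 3 * (qT n / (qT n - 2 * x))"])
    fix n assume n: "n \<in> posq"
    have "qS n / qT n + qS (cyc4 n) / qT n + qS (cyc4 (cyc4 n)) / qT n + qS (cyc4 (cyc4 (cyc4 n))) / qT n = 3"
      using pos[OF n] cc(4)[of n] by (simp add: add_divide_distrib[symmetric])
    then show "(\<Sum>i<4. qS ((cyc4 ^^ i) n) / qT ((cyc4 ^^ i) n) - 3 / 4) = 0"
      unfolding it[of "\<lambda>n. qS n / qT n - 3 / 4"] perms by simp
    have n1: "n1 n = qT n - qS n" by (simp add: qdefs)
    show "r4 n - r5 n = 4 * x / 3 * (qT n / (qT n - 2 * x)) * (qS n / qT n - 3 / 4)"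
      using pos[OF n] unfolding r4_def r5_def n1 by (simp add: divide_simps) (simp add: algebra_simps)
  qed (simp_all add: perms b)
  have q1: "((\<lambda>n. ww x n * (p1 n / qT n)) has_sum D1) posq"
  proof (rule sym_step[OF x2 R perm_bij(1) ww_perm(1), where k = 2 and \<phi> = "\<lambda>n. (n3 n - x) / qq n - 1 / 2 * ((qq n - 2 * x) / qq n)"
       and \<psi> = "\<lambda>n. 4 * x * ((n2 n - x) / (qS n - x))"])
    fix n assume n: "n \<in> posq"
    have "(n3 n - x) / qq n + (n4 n - x) / qq n = (qq n - 2 * x) / qq n" by (simp add: add_divide_distrib[symmetric] qq_def)
    moreover have "A + B = Z \<Longrightarrow> (A - 1 / 2 * Z) + (B - 1 / 2 * Z) = 0" for A B Z :: real by simp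
    ultimately show "(\<Sum>i<2. (n3 ((sw34 ^^ i) n) - x) / qq ((sw34 ^^ i) n) - 1 / 2 * ((qq ((sw34 ^^ i) n) - 2 * x) / qq ((sw34 ^^ i) n))) = 0"
      unfolding it[of "\<lambda>n. (n3 n - x) / qq n - 1 / 2 * ((qq n - 2 * x) / qq n)"] perms by blast
    have al: "4 * P * A * B - 2 * P * A * C = 4 * P * A * (B - 1 / 2 * C)" for P A B C :: real by (simp add: algebra_simps)
    show "4 * x * ((n2 n - x) / (qS n - x)) * ((n3 n - x) / qq n) - p1 n = 4 * x * ((n2 n - x) / (qS n - x)) * ((n3 n - x) / qq n - 1 / 2 * ((qq n - 2 * x) / qq n))"
      unfolding p1_def by (rule al)
  qed (simp_all add: perms b)
  have q2: "((\<lambda>n. ww x n * (k1 n / qT n)) has_sum D2) posq"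
  proof (rule sym_step[OF x2 K perm_bij(2) ww_perm(2), where k = 2 and \<phi> = "\<lambda>n. 1 / (n1 n + n2 n) - 1 / qq n" and \<psi> = "\<lambda>n. 2 * x\<^sup>2"])
    fix n assume n: "n \<in> posq"
    show "(\<Sum>i<2. 1 / (n1 ((swp ^^ i) n) + n2 ((swp ^^ i) n)) - 1 / qq ((swp ^^ i) n)) = 0"
      unfolding it[of "\<lambda>n. 1 / (n1 n + n2 n) - 1 / qq n"] perms by simp
    have "qT n / ((n1 n + n2 n) * qq n) = 1 / (n1 n + n2 n) + 1 / qq n"
      using pos[OF n] by (simp add: qT_def qq_def divide_simps)
    then show "2 * x\<^sup>2 * (qT n / ((n1 n + n2 n) * qq n)) - k1 n = 2 * x\<^sup>2 * (1 / (n1 n + n2 n) - 1 / qq n)"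
      unfolding k1_def by (simp add: algebra_simps)
  qed (simp_all add: perms b)
  \<comment> \<open>Writing n2 as the difference of \<open>qS n\<close> and \<open>qq n\<close>
    makes the sum of both contributions a function of these two alone. What is left to average is
    \<open>qq n\<close>, whose mean over the cyclic shifts of the last three gaps is 2/3 of
    \<open>qS n\<close>.\<close>
  have tt: "((\<lambda>n. ww x n * (t n / qT n)) has_sum D1 + D2) posq"
  proof (subst has_sum_cong)
    show "((\<lambda>n. ww x n * (p1 n / qT n) + ww x n * (k1 n / qT n)) has_sum D1 + D2) posq" by (rule has_sum_add[OF q1 q2])
    fix n assume n: "n \<in> posq"
    have n2: "n2 n = qS n - qq n" by (simp add: qdefs)
    have "p1 n + k1 n = t n" using pos[OF n] unfolding p1_def k1_def t_def n2
      by (simp add: divide_simps) (simp add: algebra_simps power2_eq_square)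
    then show "ww x n * (t n / qT n) = ww x n * (p1 n / qT n) + ww x n * (k1 n / qT n)"
      by (simp add: distrib_left[symmetric] add_divide_distrib[symmetric])
  qed
  have "((\<lambda>n. ww x n * (r5 n / qT n)) has_sum D1 + D2) posq"
  proof (rule sym_step[OF x2 tt perm_bij(3) ww_perm(3), where k = 3 and \<phi> = "\<lambda>n. 2 / 3 * qS n - qq n" and \<psi> = "\<lambda>n. 2 * x / (qS n - x)"])
    fix n assume n: "n \<in> posq"
    show "(\<Sum>i<3. 2 / 3 * qS ((cyc3 ^^ i) n) - qq ((cyc3 ^^ i) n)) = 0"
      unfolding it[of "\<lambda>n. 2 / 3 * qS n - qq n"] perms using cc(2)[of n] by simp
    show "t n - r5 n = 2 * x / (qS n - x) * (2 / 3 * qS n - qq n)"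
      using pos[OF n] unfolding t_def r5_def by (simp add: divide_simps) (simp add: algebra_simps)
  qed (simp_all add: perms b)
  moreover obtain D where D: "((\<lambda>n. ww x n * (r0 n / qT n)) has_sum D) posq"
    using ww_summable[OF x2 b(1)] by (auto simp: summable_on_def)
  ultimately have "D = D1 + D2" by (intro has_sum_unique[OF s5[OF s4[OF s3[OF s2[OF s1[OF D]]]]]])
  then show ?thesis using D unfolding r0_def by simp
qed

end

section \<open>Gaps versus the indices of the truncated double sums\<close>

lemma sum_SIGMA: "finite A \<Longrightarrow> (\<And>x. finite (B x)) \<Longrightarrow> sum G (Sigma A B) = (\<Sum>x\<in>A. \<Sum>y\<in>B x. G (x, y))"
  by (simp add: sum.Sigma)

context sgn_grading
begin

lemma od_mult_e: "od c * od d = e (c + d) * od d" "e q * od b = e q * od (b + q)"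
  using gs by (auto simp: od_def e_def of_bool_def; presburger)+

definition cw :: "quad \<Rightarrow> real" where
  "cw = (\<lambda>(a, b, c, d). s ^ (a + b + c + d) * (od a * od b * od c * od d))"

text \<open>Trades the parities of the gaps for those of partial sums, as they occur in
  \<open>RN\<close>: poles at \<open>a\<close>, \<open>b + c + d\<close> and \<open>d\<close>, and
  the factor \<open>vv\<close> at \<open>c + d\<close>.\<close>

lemma cw_eq: "cw (a, b, c, d) = s ^ (a + b + c + d) * (od a * od (b + c + d) * e (c + d) * od d)"
proof -
  have "od a * od b * od c * od d = od a * od b * (od c * od d)" by (simp only: mult.assoc)
  also have "\<dots> = od a * (e (c + d) * od b) * od d" unfolding od_mult_e(1)[of c d] by (simp only: mult_ac)
  also have "\<dots> = od a * (e (c + d) * od (b + (c + d))) * od d" unfolding od_mult_e(2)[of "c + d" b] ..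
  finally show ?thesis by (simp add: cw_def add.assoc mult_ac)
qed

lemma ww_cw:
  assumes "\<bar>x\<bar> \<le> 1 / 2" "n \<in> posq"
  shows "ww x n = cw n / ((n1 n - x) * (n2 n - x) * (n3 n - x) * (n4 n - x))"
  by (cases n) (simp add: ww_def cw_def uu_def qdefs)

text \<open>The summand carries \<open>4 * x\<close> where the kernel of \<open>RN\<close> has
  \<open>2 * x\<close>: \<open>D\<close> is the part 2 R of \<open>K\<close>.\<close>

lemma RN_has_sum:
  assumes x: "\<bar>x\<bar> \<le> 1 / 8"
    and R: "((\<lambda>n. ww x n * (4 * x * ((n2 n - x) / (qS n - x)) * ((n3 n - x) / qq n) / qT n)) has_sum D) posq"
  shows "RN x \<longlonglongrightarrow> D / 2"
proof -
  define F where "F n = ww x n * (4 * x * ((n2 n - x) / (qS n - x)) * ((n3 n - x) / qq n) / qT n)" for n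
  \<comment> \<open>The truncation \<open>k, l \<le> N\<close> of \<open>RN\<close> expressed by
    gaps, with \<open>k = a\<close> and \<open>l = b + c + d\<close>.\<close>
  define B where "B N = {(a, b, c, d). 1 \<le> a \<and> 1 \<le> b \<and> 1 \<le> c \<and> 1 \<le> d \<and> a \<le> N \<and> b + c + d \<le> N}" for N :: nat
  have fin: "finite (B N)" for N
    by (rule finite_subset[of _ "{..N} \<times> {..N} \<times> {..N} \<times> {..N}"]) (auto simp: B_def)
  have "(\<lambda>N. sum F (B N)) \<longlonglongrightarrow> D"
  proof (rule has_sum_exhaust[where f = F and D = B and A = posq])
    show "(F has_sum D) posq" using R unfolding F_def .
    fix n assume "n \<in> posq"
    then show "\<exists>N. n \<in> B N"
      by (cases n) (auto simp: B_def posq_def intro!: exI[of _ "fst n + fst (snd n) + fst (snd (snd n)) + snd (snd (snd n))"])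
  qed (use fin in \<open>auto simp: B_def posq_def\<close>)
  then have "(\<lambda>N. sum F (B N) / 2) \<longlonglongrightarrow> D / 2" by (intro tendsto_divide) auto
  moreover have "RN x N = sum F (B N) / 2" for N
  proof -
    define G where "G = (\<lambda>(k, l, q, j). vv q * uu x j * (s ^ (k + l) * (2 * x) * uu x k * uu x l / (real k + real l)))"
    have "RN x N = (\<Sum>k=1..N. \<Sum>l=1..N. \<Sum>q=1..<l. \<Sum>j=1..<q. G (k, l, q, j))"
      unfolding RN_def be_def bb_def G_def
    proof (intro sum.cong refl, unfold sum_distrib_right, intro sum.cong refl)
      fix k l q :: nat assume "q \<in> {1..<l}"
      then have "UU x (q - 1) = (\<Sum>j=1..<q. uu x j)" by (intro UU_lt) simp
      then show "vv q * UU x (q - 1) * (s ^ (k + l) * (2 * x) * uu x k * uu x l / (real k + real l)) =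
         (\<Sum>j=1..<q. case (k, l, q, j) of (k, l, q, j) \<Rightarrow> vv q * uu x j * (s ^ (k + l) * (2 * x) * uu x k * uu x l / (real k + real l)))"
        by (simp only: sum_distrib_left sum_distrib_right prod.case)
    qed
    also have "\<dots> = (\<Sum>n\<in>(SIGMA k:{1..N}. SIGMA l:{1..N}. SIGMA q:{1..<l}. {1..<q}). G n)"
      by (simp add: sum_SIGMA)
    also have "\<dots> = (\<Sum>n\<in>B N. F n / 2)"
    proof (rule sum.reindex_bij_witness[where j = "\<lambda>(k, l, q, j). (k, l - q, q - j, j)" and i = "\<lambda>(a, b, c, d). (a, b + c + d, c + d, d)"])
      fix n assume "n \<in> (SIGMA k:{1..N}. SIGMA l:{1..N}. SIGMA q:{1..<l}. {1..<q})"
      then obtain a l q d where n: "n = (a, l, q, d)" "1 \<le> a" "a \<le> N" "1 \<le> d" "d < q" "q < l" "l \<le> N" by auto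
      define b c where "b = l - q" and "c = q - d"
      have q: "q = c + d" and l: "l = b + c + d" and p: "1 \<le> b" "1 \<le> c" using n by (auto simp: b_def c_def)
      have nz: "real b - x \<noteq> 0" "real c - x \<noteq> 0" "real d - x \<noteq> 0" "real a - x \<noteq> 0" using n p x by auto
      have "F (a, b, c, d) = cw (a, b, c, d) * (4 * x) / ((real a - x) * (real d - x) * (real l - x) * real q * (real a + real l))"
      proof -
        have al: "C / (A * b * c * d) * (4 * x * (b / S) * (c / q) / T) = C * (4 * x) / (A * d * S * q * T)" if "b \<noteq> 0" "c \<noteq> 0" for C A b c d S q T :: real
          using that by (simp add: mult_ac)
        have "(a, b, c, d) \<in> posq" using p n by (simp add: posq_def)
        then have "F (a, b, c, d) = cw (a, b, c, d) / ((real a - x) * (real b - x) * (real c - x) * (real d - x)) * (4 * x * ((real b - x) / (real l - x)) * ((real c - x) / real q) / (real a + real l))"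
          unfolding F_def using ww_cw[of x "(a, b, c, d)"] x by (simp only: n1_def n2_def n3_def n4_def qq_def qS_def qT_def l q fst_conv snd_conv of_nat_add add.assoc)
        then show ?thesis unfolding al[OF nz(1,2)] .
      qed
      also have "\<dots> = 2 * G n"
        unfolding cw_eq G_def n(1) prod.case uu_def vv_def by (simp add: l q add.assoc mult_ac)
      finally show "F (case n of (k, l, q, j) \<Rightarrow> (k, l - q, q - j, j)) / 2 = G n"
        unfolding n(1) prod.case b_def c_def by simp
    qed (auto simp: B_def)
    finally show ?thesis by (simp add: sum_divide_distrib)
  qed
  ultimately show ?thesis by presburger
qed

text \<open>With \<open>qT\<close> cancelled, the summand is half the product of two kernels of
  \<open>K2N\<close>, one in the first two gaps and one in the last two.\<close>

lemma K2N_has_sum: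
  assumes x: "\<bar>x\<bar> \<le> 1 / 8"
    and K: "((\<lambda>n. ww x n * (2 * x\<^sup>2 * (qT n / ((n1 n + n2 n) * qq n)) / qT n)) has_sum D) posq"
  shows "(\<lambda>N. (K2N x N)\<^sup>2 / 2) \<longlonglongrightarrow> D"
proof -
  define F where "F n = ww x n * (2 * x\<^sup>2 * (qT n / ((n1 n + n2 n) * qq n)) / qT n)" for n
  define B where "B N = {1..N} \<times> {1..N} \<times> {1..N} \<times> {1..N}" for N :: nat
  have "(\<lambda>N. sum F (B N)) \<longlonglongrightarrow> D"
  proof (rule has_sum_exhaust[where f = F and D = B and A = posq])
    show "(F has_sum D) posq" using K unfolding F_def .
    fix n assume "n \<in> posq"
    then show "\<exists>N. n \<in> B N"
      by (cases n) (auto simp: B_def posq_def intro!: exI[of _ "fst n + fst (snd n) + fst (snd (snd n)) + snd (snd (snd n))"])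
  qed (auto simp: B_def posq_def)
  moreover have "sum F (B N) = (K2N x N)\<^sup>2 / 2" for N
  proof -
    define \<kappa> where "\<kappa> k l = s ^ (k + l) * (2 * x) * uu x k * uu x l / (real k + real l)" for k l
    have F: "F (a, b, c, d) = \<kappa> a b * \<kappa> c d / 2" if "1 \<le> a" for a b c d
      using that by (simp add: F_def \<kappa>_def ww_def qdefs power_add power2_eq_square)
    have "sum F (B N) = (\<Sum>a=1..N. \<Sum>b=1..N. \<Sum>c=1..N. \<Sum>d=1..N. F (a, b, c, d))"
      unfolding B_def by (simp add: sum.cartesian_product)
    also have "\<dots> = (\<Sum>a=1..N. \<Sum>b=1..N. \<Sum>c=1..N. \<Sum>d=1..N. \<kappa> a b * \<kappa> c d / 2)"
      by (intro sum.cong refl F) auto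
    also have "\<dots> = (\<Sum>a=1..N. \<Sum>b=1..N. \<kappa> a b) * (\<Sum>c=1..N. \<Sum>d=1..N. \<kappa> c d) / 2"
      unfolding sum_distrib_left[symmetric] sum_divide_distrib[symmetric] sum_distrib_right[symmetric] ..
    finally show ?thesis by (simp add: K2N_def \<kappa>_def power2_eq_square)
  qed
  ultimately show ?thesis by simp
qed

text \<open>The summand of \<open>K\<close> in closed form. The factors T - 4x and T - 2x stand
  together because 2/(T(T - 4x)) - 1/(T(T - 2x)) = 1/((T - 4x)(T - 2x)), which merges the first two
  geometric families of \<open>tm_eq\<close>.\<close>

definition FF :: "real \<Rightarrow> quad \<Rightarrow> real" where
  "FF x n = cw n * (24 * x / ((qT n - 4 * x) * (qT n - 2 * x) * (qS n - 3 * x) * (qq n - 2 * x) * (n4 n - x))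
     - 8 * x / (qT n * (qT n - 2 * x) * (qS n - x) * (qq n - 2 * x) * (n4 n - x)))"

text \<open>The common value is \<open>D1 + D2\<close>: \<open>symmetrised\<close> identifies it
  with the sum of \<open>FF\<close>, and \<open>RN_has_sum\<close> and \<open>K2N_has_sum\<close>
  identify it with the limit found in \<open>TN_lim\<close>.\<close>

theorem FF_lim:
  assumes x: "\<bar>x\<bar> \<le> 1 / 8"
  obtains G where "(FF x has_sum G) posq" "(\<lambda>N. TN x N - TN 0 N) \<longlonglongrightarrow> G"
proof -
  have x2: "\<bar>x\<bar> \<le> 1 / 2" and xx: "- 1 \<le> 8 * x" "8 * x \<le> 1" using x by auto
  have b2: "bdd (\<lambda>n. (n2 n - x) / (qS n - x))" and b3: "bdd (\<lambda>n. (n3 n - x) / qq n)"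
    by (rule bdd_ratio4; use xx in \<open>simp add: qq_def qS_def qT_def\<close>)+
  have b4: "bdd (\<lambda>n. qT n / ((n1 n + n2 n) * qq n))"
  proof (rule bdd_ratio4)
    fix n assume p: "1 \<le> n1 n" "1 \<le> n2 n" "1 \<le> n3 n" "1 \<le> n4 n"
    define P where "P = (n1 n + n2 n) * qq n"
    have "1 * qq n \<le> P" "(n1 n + n2 n) * 1 \<le> P"
      unfolding P_def using p by (intro mult_mono; simp add: qq_def)+
    moreover have "qT n = n1 n + n2 n + qq n" "0 \<le> qq n" by (use p in \<open>simp_all add: qT_def qq_def\<close>)
    ultimately have "qT n \<le> 4 * P \<and> - qT n \<le> 4 * P" using p by auto
    then show "qT n \<le> 4 * ((n1 n + n2 n) * qq n)" "- qT n \<le> 4 * ((n1 n + n2 n) * qq n)" unfolding P_def by blast+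
  qed
  have "bdd (\<lambda>n. 4 * x * ((n2 n - x) / (qS n - x)) * ((n3 n - x) / qq n))" by (intro bdd_mult bdd_const b2 b3)
  from ww_summable[OF x2 this] obtain D1 where
    D1: "((\<lambda>n. ww x n * (4 * x * ((n2 n - x) / (qS n - x)) * ((n3 n - x) / qq n) / qT n)) has_sum D1) posq"
    by (auto simp: summable_on_def)
  have "bdd (\<lambda>n. 2 * x\<^sup>2 * (qT n / ((n1 n + n2 n) * qq n)))" by (intro bdd_mult bdd_const b4)
  from ww_summable[OF x2 this] obtain D2 where
    D2: "((\<lambda>n. ww x n * (2 * x\<^sup>2 * (qT n / ((n1 n + n2 n) * qq n)) / qT n)) has_sum D2) posq"
    by (auto simp: summable_on_def)
  have "(\<lambda>N. (K2N x N)\<^sup>2 / 2) \<longlonglongrightarrow> (K2oL x - 2 * pc)\<^sup>2 / 2" by (intro tendsto_intros K2N_lim[OF x2]) auto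
  then have "(K2oL x - 2 * pc)\<^sup>2 / 2 = D2" by (rule LIMSEQ_unique[OF _ K2N_has_sum[OF x D2]])
  then have "(\<lambda>N. TN x N - TN 0 N) \<longlonglongrightarrow> D1 + D2"
    using TN_lim[OF x2 RN_has_sum[OF x D1]] by (simp add: add.commute)
  moreover have "(FF x has_sum D1 + D2) posq"
  proof (subst has_sum_cong)
    show "((\<lambda>n. ww x n * (x * (qT n / (qT n - 2 * x)) * (24 * ((n1 n - x) / (qT n - 4 * x)) * ((n2 n - x) / (qS n - 3 * x)) * ((n3 n - x) / (qq n - 2 * x))
     - 8 * ((n1 n - x) / qT n) * ((n2 n - x) / (qS n - x)) * ((n3 n - x) / (qq n - 2 * x))) / qT n)) has_sum D1 + D2) posq"
      by (rule symmetrised[OF x D1 D2])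
    fix n assume n: "n \<in> posq"
    have nz: "n1 n - x \<noteq> 0" "n2 n - x \<noteq> 0" "n3 n - x \<noteq> 0" "n4 n - x \<noteq> 0" "qT n \<noteq> 0"
      using posq_ge[OF n] xx by (auto simp: qT_def)
    have al: "c * (24 * x / (A4 * A2 * B3 * C * N4) - 8 * x / (T * A2 * B1 * C * N4)) =
       c / (N1 * N2 * N3 * N4) * (x * (T / A2) * (24 * (N1 / A4) * (N2 / B3) * (N3 / C) - 8 * (N1 / T) * (N2 / B1) * (N3 / C)) / T)"
      if "N1 \<noteq> 0" "N2 \<noteq> 0" "N3 \<noteq> 0" "N4 \<noteq> 0" "T \<noteq> 0" for c A4 A2 B3 C N4 N1 N2 N3 T B1 :: real
      using that by (simp add: right_diff_distrib diff_divide_distrib mult_ac)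
    show "FF x n = ww x n * (x * (qT n / (qT n - 2 * x)) * (24 * ((n1 n - x) / (qT n - 4 * x)) * ((n2 n - x) / (qS n - 3 * x)) * ((n3 n - x) / (qq n - 2 * x))
     - 8 * ((n1 n - x) / qT n) * ((n2 n - x) / (qS n - x)) * ((n3 n - x) / (qq n - 2 * x))) / qT n)"
      unfolding FF_def ww_cw[OF x2 n] by (rule al[OF nz])
  qed
  ultimately show ?thesis using that by blast
qed

end

section \<open>Expansion of the generating function in powers of x\<close>

definition cof :: "quad \<Rightarrow> real" where "cof = (\<lambda>(a, b, c, d). 2 ^ (a + c) * (2 ^ (a - 1) * 3 ^ b - 3 ^ b - 1))"
text \<open>The exponents of the geometric series start at 0, the arguments of the sums at (2, 1, 1,
  1).\<close>

definition upq :: "quad \<Rightarrow> quad" where "upq = (\<lambda>(a, b, c, d). (a + 2, b + 1, c + 1, d + 1))"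
definition sz :: "quad \<Rightarrow> nat" where "sz = (\<lambda>(a, b, c, d). a + b + c + d)"

lemma has_sum_geometric:
  fixes A y :: real
  assumes "\<bar>y\<bar> < 1"
  shows "((\<lambda>k. A * y ^ k) has_sum A / (1 - y)) UNIV"
proof (rule norm_summable_imp_has_sum)
  show "(\<lambda>k. A * y ^ k) sums (A / (1 - y))" using sums_mult[OF geometric_sums[of y], of A] assms by simp
  show "summable (\<lambda>k. norm (A * y ^ k))" using assms by (simp add: abs_mult power_abs summable_mult summable_geometric)
qed

context sgn_grading
begin

definition D4 :: "quad \<Rightarrow> real" where
  "D4 = (\<lambda>(a, b, c, d). infsum (\<lambda>n. cw n / (qT n ^ a * qS n ^ b * qq n ^ c * n4 n ^ d)) posq)"
definition tm :: "real \<Rightarrow> quad \<Rightarrow> quad \<Rightarrow> real" where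
  "tm x n = (\<lambda>(a, b, c, d). cof (upq (a, b, c, d)) * x ^ (a + b + c + d + 1) * (cw n / (qT n ^ (a + 2) * qS n ^ (b + 1) * qq n ^ (c + 1) * n4 n ^ (d + 1))))"

lemma cw_le: "\<bar>cw n\<bar> \<le> 1"
proof (cases n)
  case (fields a b c d)
  have "\<bar>od a\<bar> * \<bar>od b\<bar> * \<bar>od c\<bar> * \<bar>od d\<bar> \<le> 1 * 1 * 1 * 1" by (intro mult_mono od_le) auto
  then show ?thesis by (simp add: fields cw_def abs_mult)
qed

lemma den_le:
  assumes n: "n \<in> posq"
  shows "1 / ((qT n)\<^sup>2 * qS n * qq n * n4 n) \<le> 1 / (qT n * (n1 n * n2 n * n3 n * n4 n))"
proof -
  note p = posq_ge[OF n]
  have "qT n * (n1 n * n2 n * n3 n * n4 n) \<le> qT n * (qT n * qS n * qq n * n4 n)"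
    using p by (intro mult_mono) (auto simp: qT_def qS_def qq_def)
  moreover have "0 < qT n" using p by (simp add: qT_def)
  ultimately show ?thesis using p by (intro divide_left_mono) (auto simp: power2_eq_square mult_ac qS_def qq_def)
qed

lemma D4_has_sum:
  assumes "2 \<le> a" "1 \<le> b" "1 \<le> c" "1 \<le> d"
  shows "((\<lambda>n. cw n / (qT n ^ a * qS n ^ b * qq n ^ c * n4 n ^ d)) has_sum D4 (a, b, c, d)) posq"
proof -
  have "(\<lambda>n. cw n / (qT n ^ a * qS n ^ b * qq n ^ c * n4 n ^ d)) summable_on posq"
  proof (rule Infinite_Sum.abs_summable_summable, rule Infinite_Sum.abs_summable_on_comparison_test')
    show "(\<lambda>n. 1 / (qT n * (n1 n * n2 n * n3 n * n4 n))) summable_on posq"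
      by (rule Infinite_Sum.abs_summable_summable[OF posq_summable])
    fix n assume n: "n \<in> posq"
    note p = posq_ge[OF n]
    have q: "1 \<le> qT n" "1 \<le> qS n" "1 \<le> qq n" using p by (auto simp: qT_def qS_def qq_def)
    have "(qT n)\<^sup>2 * qS n ^ 1 * qq n ^ 1 * n4 n ^ 1 \<le> qT n ^ a * qS n ^ b * qq n ^ c * n4 n ^ d"
      using p q assms by (intro mult_mono power_increasing mult_nonneg_nonneg zero_le_power) auto
    then have "1 / (qT n ^ a * qS n ^ b * qq n ^ c * n4 n ^ d) \<le> 1 / ((qT n)\<^sup>2 * qS n * qq n * n4 n)"
      using p q by (intro divide_left_mono mult_pos_pos zero_less_power) auto
    also note den_le[OF n]
    finally have "1 / (qT n ^ a * qS n ^ b * qq n ^ c * n4 n ^ d) \<le> 1 / (qT n * (n1 n * n2 n * n3 n * n4 n))" .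
    moreover have "\<bar>cw n\<bar> / (qT n ^ a * qS n ^ b * qq n ^ c * n4 n ^ d) \<le> 1 / (qT n ^ a * qS n ^ b * qq n ^ c * n4 n ^ d)"
      using p q cw_le[of n] by (intro divide_right_mono mult_nonneg_nonneg zero_le_power) auto
    moreover have "norm (cw n / (qT n ^ a * qS n ^ b * qq n ^ c * n4 n ^ d)) = \<bar>cw n\<bar> / (qT n ^ a * qS n ^ b * qq n ^ c * n4 n ^ d)"
      using p q by (simp add: abs_divide abs_mult power_abs)
    ultimately show "norm (cw n / (qT n ^ a * qS n ^ b * qq n ^ c * n4 n ^ d)) \<le> 1 / (qT n * (n1 n * n2 n * n3 n * n4 n))"
      by linarith
  qed
  then show ?thesis unfolding D4_def prod.case by (rule has_sum_infsum)
qed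

text \<open>The coefficient is a difference of three products. As functions of the exponents they
  are geometric, with ratios 4x/k1 or 2x/k1, 3x/k2 or x/k2, then 2x/k3 and x/k4.\<close>

lemma tm_eq:
  "tm x n (a, b, c, d) = cw n * ((8 * x / (qT n)\<^sup>2 * (4 * x / qT n) ^ a) * ((3 / qS n * (3 * x / qS n) ^ b) * ((2 / qq n * (2 * x / qq n) ^ c) * (1 / n4 n * (x / n4 n) ^ d)))
     - (4 * x / (qT n)\<^sup>2 * (2 * x / qT n) ^ a) * ((3 / qS n * (3 * x / qS n) ^ b) * ((2 / qq n * (2 * x / qq n) ^ c) * (1 / n4 n * (x / n4 n) ^ d)))
     - (4 * x / (qT n)\<^sup>2 * (2 * x / qT n) ^ a) * ((1 / qS n * (x / qS n) ^ b) * ((2 / qq n * (2 * x / qq n) ^ c) * (1 / n4 n * (x / n4 n) ^ d))))"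
proof -
  have 4: "(4::real) ^ a = 2 ^ a * 2 ^ a" by (simp flip: power_mult_distrib)
  have al: "(8 * (p * t)) * (2 * p * (3 * r) - 3 * r - 1) * (xa * xb * xc * xd * x) * (C / ((Ta * T\<^sup>2) * (Sb * S) * (qc * q) * (nd * n))) =
     C * ((8 * x / T\<^sup>2 * (p * p * xa / Ta)) * ((3 / S * (r * xb / Sb)) * ((2 / q * (t * xc / qc)) * (1 / n * (xd / nd))))
     - (4 * x / T\<^sup>2 * (p * xa / Ta)) * ((3 / S * (r * xb / Sb)) * ((2 / q * (t * xc / qc)) * (1 / n * (xd / nd))))
     - (4 * x / T\<^sup>2 * (p * xa / Ta)) * ((1 / S * (xb / Sb)) * ((2 / q * (t * xc / qc)) * (1 / n * (xd / nd)))))"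
    for p t r xa xb xc xd C Ta T Sb S qc q nd n :: real
  proof -
    define D where "D = inverse ((Ta * T\<^sup>2) * (Sb * S) * (qc * q) * (nd * n))"
    have D: "D = inverse Ta * inverse (T\<^sup>2) * inverse Sb * inverse S * inverse qc * inverse q * inverse nd * inverse n"
      unfolding D_def inverse_mult_distrib by (simp only: mult_ac)
    show ?thesis unfolding divide_inverse D_def[symmetric] unfolding D by (simp add: algebra_simps)
  qed
  have c: "cof (upq (a, b, c, d)) = (8 * (2 ^ a * 2 ^ c)) * (2 * 2 ^ a * (3 * 3 ^ b) - 3 * 3 ^ b - 1)"
    by (simp add: cof_def upq_def power_add)
  show ?thesis unfolding tm_def prod.case c power_add power_one_right power_divide power_mult_distrib 4 by (rule al)
qed

lemma FF_expand:
  assumes x: "\<bar>x\<bar> \<le> 1 / 8" and n: "n \<in> posq"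
  shows "(tm x n has_sum FF x n) UNIV"
proof -
  note p = posq_ge[OF n]
  have xx: "- 1 \<le> 8 * x" "8 * x \<le> 1" using x by auto
  have q: "4 \<le> qT n" "3 \<le> qS n" "2 \<le> qq n" using p by (auto simp: qT_def qS_def qq_def)
  have lt: "\<bar>4 * x / qT n\<bar> < 1" "\<bar>2 * x / qT n\<bar> < 1" "\<bar>3 * x / qS n\<bar> < 1" "\<bar>x / qS n\<bar> < 1" "\<bar>2 * x / qq n\<bar> < 1" "\<bar>x / n4 n\<bar> < 1"
    using p q xx by (simp_all add: abs_divide)
  note A4 = has_sum_geometric[OF lt(1), of "8 * x / (qT n)\<^sup>2"]
  note A2 = has_sum_geometric[OF lt(2), of "4 * x / (qT n)\<^sup>2"]
  note B3 = has_sum_geometric[OF lt(3), of "3 / qS n"]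
  note B1 = has_sum_geometric[OF lt(4), of "1 / qS n"]
  note C2 = has_sum_geometric[OF lt(5), of "2 / qq n"]
  note Dd = has_sum_geometric[OF lt(6), of "1 / n4 n"]
  note CD = has_sum_mult_Times[OF C2 Dd]
  note P1 = has_sum_mult_Times[OF A4 has_sum_mult_Times[OF B3 CD]]
  note P2 = has_sum_mult_Times[OF A2 has_sum_mult_Times[OF B3 CD]]
  note P3 = has_sum_mult_Times[OF A2 has_sum_mult_Times[OF B1 CD]]
  note S = has_sum_cmult_right[OF has_sum_add[OF has_sum_add[OF P1 has_sum_uminusI[OF P2]] has_sum_uminusI[OF P3]], of "cw n"]
  have v: "cw n * (8 * x / (qT n)\<^sup>2 / (1 - 4 * x / qT n) * (3 / qS n / (1 - 3 * x / qS n) * (2 / qq n / (1 - 2 * x / qq n) * (1 / n4 n / (1 - x / n4 n)))) +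
       - (4 * x / (qT n)\<^sup>2 / (1 - 2 * x / qT n) * (3 / qS n / (1 - 3 * x / qS n) * (2 / qq n / (1 - 2 * x / qq n) * (1 / n4 n / (1 - x / n4 n))))) +
       - (4 * x / (qT n)\<^sup>2 / (1 - 2 * x / qT n) * (1 / qS n / (1 - x / qS n) * (2 / qq n / (1 - 2 * x / qq n) * (1 / n4 n / (1 - x / n4 n)))))) = FF x n"
  proof -
    have i: "A / y / (1 - z / y) = A / (y - z)" if "y \<noteq> 0" for A y z :: real
      using that by (simp add: diff_divide_distrib[symmetric] divide_simps)
    have i2: "A / y\<^sup>2 / (1 - z / y) = A / (y * (y - z))" if "y \<noteq> 0" for A y z :: real
      using i[OF that, of "A / y" z] that by (simp add: power2_eq_square)
    have nz: "qT n \<noteq> 0" "qS n \<noteq> 0" "qq n \<noteq> 0" "n4 n \<noteq> 0" using p q by auto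
    have d: "qT n - 4 * x \<noteq> 0" "qT n - 2 * x \<noteq> 0" using q xx by auto
    have k: "8 * x / (T * (T - 4 * x)) * (3 / B * (2 / C * (1 / D))) + - (4 * x / (T * (T - 2 * x)) * (3 / B * (2 / C * (1 / D)))) + - (4 * x / (T * (T - 2 * x)) * (1 / E * (2 / C * (1 / D))))
        = 24 * x / ((T - 4 * x) * (T - 2 * x) * B * C * D) - 8 * x / (T * (T - 2 * x) * E * C * D)"
      if t: "T \<noteq> 0" "T - 4 * x \<noteq> 0" "T - 2 * x \<noteq> 0" for T B C D E :: real
    proof -
      have "2 * (1 / (T * (T - 4 * x))) - 1 / (T * (T - 2 * x)) = 1 / ((T - 4 * x) * (T - 2 * x))"
        using t by (simp add: divide_simps)
      then have "24 * x * (1 / B * (1 / C) * (1 / D)) * (2 * (1 / (T * (T - 4 * x))) - 1 / (T * (T - 2 * x))) = 24 * x / ((T - 4 * x) * (T - 2 * x) * B * C * D)"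
        by (simp add: mult_ac)
      then show ?thesis by (simp add: right_diff_distrib mult_ac)
    qed
    show ?thesis unfolding i[OF nz(1)] i[OF nz(2)] i[OF nz(3)] i[OF nz(4)] i2[OF nz(1)] FF_def k[OF nz(1) d] ..
  qed
  have c: "(\<lambda>k. case k of (a, b, c, d) \<Rightarrow> C * (A a * (B b * (K c * D d)) - A' a * (B b * (K c * D d)) - A' a * (B' b * (K c * D d)))) =
     (\<lambda>k. C * ((case k of (a, k) \<Rightarrow> A a * (case k of (b, k) \<Rightarrow> B b * (case k of (c, d) \<Rightarrow> K c * D d))) + - (case k of (a, k) \<Rightarrow> A' a * (case k of (b, k) \<Rightarrow> B b * (case k of (c, d) \<Rightarrow> K c * D d)))
       + - (case k of (a, k) \<Rightarrow> A' a * (case k of (b, k) \<Rightarrow> B' b * (case k of (c, d) \<Rightarrow> K c * D d)))))"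
    for C and A B K D A' B' :: "nat \<Rightarrow> real" by (rule ext) (simp add: case_prod_unfold)
  have t: "tm x n = (\<lambda>(a, b, c, d). tm x n (a, b, c, d))" by (rule ext) simp
  show ?thesis
    by (subst t, unfold tm_eq, subst c[where A = "\<lambda>a. 8 * x / (qT n)\<^sup>2 * (4 * x / qT n) ^ a" and A' = "\<lambda>a. 4 * x / (qT n)\<^sup>2 * (2 * x / qT n) ^ a"
         and B = "\<lambda>b. 3 / qS n * (3 * x / qS n) ^ b" and B' = "\<lambda>b. 1 / qS n * (x / qS n) ^ b"
         and K = "\<lambda>c. 2 / qq n * (2 * x / qq n) ^ c" and D = "\<lambda>d. 1 / n4 n * (x / n4 n) ^ d"], rule S[unfolded v UNIV_Times_UNIV])
qed

text \<open>Three products, each with constants at most 3 and 2 from its middle factors, give 18.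
  The leading \<open>8 * x\<close> is at most 1 in absolute value, which is one use of |x| \<le>
  1/8.\<close>

lemma tm_le:
  assumes x: "\<bar>x\<bar> \<le> 1 / 8" and n: "n \<in> posq"
  shows "\<bar>tm x n (a, b, c, d)\<bar> \<le> 18 * (1 / (qT n * (n1 n * n2 n * n3 n * n4 n))) * (\<bar>x\<bar> ^ a * (\<bar>x\<bar> ^ b * (\<bar>x\<bar> ^ c * \<bar>x\<bar> ^ d)))"
proof -
  note p = posq_ge[OF n]
  have q: "4 \<le> qT n" "3 \<le> qS n" "2 \<le> qq n" using p by (auto simp: qT_def qS_def qq_def)
  have r: "\<bar>k * x / y\<bar> ^ m \<le> \<bar>x\<bar> ^ m" if "0 \<le> k" "k \<le> y" for k y m
  proof (rule power_mono)
    have "k * \<bar>x\<bar> \<le> y * \<bar>x\<bar>" using that by (intro mult_right_mono) auto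
    then show "\<bar>k * x / y\<bar> \<le> \<bar>x\<bar>" using that by (cases "y = 0") (auto simp: abs_divide abs_mult divide_le_eq mult.commute)
  qed simp
  have A: "\<bar>k * x / (qT n)\<^sup>2 * (j * x / qT n) ^ a\<bar> \<le> 1 / (qT n)\<^sup>2 * \<bar>x\<bar> ^ a" if "0 \<le> k" "k \<le> 8" "0 \<le> j" "j \<le> 4" for k j
  proof -
    have "k * \<bar>x\<bar> \<le> 8 * (1 / 8)" using that x by (intro mult_mono) auto
    then have "\<bar>k * x / (qT n)\<^sup>2\<bar> \<le> 1 / (qT n)\<^sup>2" using that by (simp add: abs_mult divide_right_mono)
    then show ?thesis unfolding abs_mult[of "k * x / (qT n)\<^sup>2"] power_abs using that q by (intro mult_mono r) auto
  qed
  have B: "\<bar>k / qS n * (k * x / qS n) ^ b\<bar> \<le> 3 / qS n * \<bar>x\<bar> ^ b" if "0 \<le> k" "k \<le> 3" for k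
    unfolding abs_mult[of "k / qS n"] power_abs using that q by (intro mult_mono r) (auto simp: divide_right_mono)
  have C: "\<bar>2 / qq n * (2 * x / qq n) ^ c\<bar> \<le> 2 / qq n * \<bar>x\<bar> ^ c"
    unfolding abs_mult[of "2 / qq n"] power_abs using q by (intro mult_mono r) auto
  have D: "\<bar>1 / n4 n * (x / n4 n) ^ d\<bar> \<le> 1 / n4 n * \<bar>x\<bar> ^ d"
    unfolding abs_mult[of "1 / n4 n"] power_abs using p r[of 1 "n4 n" d] by (intro mult_mono) auto
  define M where "M = 1 / (qT n)\<^sup>2 * \<bar>x\<bar> ^ a * (3 / qS n * \<bar>x\<bar> ^ b * (2 / qq n * \<bar>x\<bar> ^ c * (1 / n4 n * \<bar>x\<bar> ^ d)))"
  have P: "\<bar>k * x / (qT n)\<^sup>2 * (j * x / qT n) ^ a * (l / qS n * (l * x / qS n) ^ b * (2 / qq n * (2 * x / qq n) ^ c * (1 / n4 n * (x / n4 n) ^ d)))\<bar> \<le> M"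
    if "0 \<le> k" "k \<le> 8" "0 \<le> j" "j \<le> 4" "0 \<le> l" "l \<le> 3" for k j l
  proof -
    have m: "\<bar>A * B\<bar> \<le> A' * B'" if "\<bar>A\<bar> \<le> A'" "\<bar>B\<bar> \<le> B'" for A B A' B' :: real
      unfolding abs_mult using that by (intro mult_mono) auto
    show ?thesis unfolding M_def by (intro m A B C D that)
  qed
  have "\<bar>tm x n (a, b, c, d)\<bar> \<le> 1 * (M + M + M)"
    unfolding tm_eq abs_mult[of "cw n"]
  proof (rule mult_mono[OF cw_le])
    have t: "\<bar>A - B - C\<bar> \<le> M + M + M" if "\<bar>A\<bar> \<le> M" "\<bar>B\<bar> \<le> M" "\<bar>C\<bar> \<le> M" for A B C :: real using that by linarith
    show "\<bar>8 * x / (qT n)\<^sup>2 * (4 * x / qT n) ^ a * (3 / qS n * (3 * x / qS n) ^ b * (2 / qq n * (2 * x / qq n) ^ c * (1 / n4 n * (x / n4 n) ^ d))) -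
      4 * x / (qT n)\<^sup>2 * (2 * x / qT n) ^ a * (3 / qS n * (3 * x / qS n) ^ b * (2 / qq n * (2 * x / qq n) ^ c * (1 / n4 n * (x / n4 n) ^ d))) -
      4 * x / (qT n)\<^sup>2 * (2 * x / qT n) ^ a * (1 / qS n * (x / qS n) ^ b * (2 / qq n * (2 * x / qq n) ^ c * (1 / n4 n * (x / n4 n) ^ d)))\<bar> \<le> M + M + M"
      using P[of 8 4 3] P[of 4 2 3] P[of 4 2 1] by (intro t) simp_all
  qed auto
  also have "\<dots> = 18 * (1 / ((qT n)\<^sup>2 * qS n * qq n * n4 n)) * (\<bar>x\<bar> ^ a * (\<bar>x\<bar> ^ b * (\<bar>x\<bar> ^ c * \<bar>x\<bar> ^ d)))"
    unfolding M_def by (simp add: mult_ac)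
  also have "\<dots> \<le> 18 * (1 / (qT n * (n1 n * n2 n * n3 n * n4 n))) * (\<bar>x\<bar> ^ a * (\<bar>x\<bar> ^ b * (\<bar>x\<bar> ^ c * \<bar>x\<bar> ^ d)))"
    using den_le[OF n] by (intro mult_right_mono mult_left_mono) auto
  finally show ?thesis .
qed

text \<open>By \<open>tm_le\<close> the sum over gaps and exponents together converges absolutely.
  Summing first over the exponents gives \<open>FF\<close>, summing first over the gaps gives
  \<open>D4\<close>; exponents with total \<open>m\<close> belong to weight \<open>m + 5\<close>,
  since \<open>upq\<close> adds 5.\<close>

theorem gf_sums:
  assumes x: "\<bar>x\<bar> \<le> 1 / 8" and G: "(FF x has_sum G) posq"
  shows "(\<lambda>m. x ^ Suc m * (\<Sum>k\<in>weight_quads (m + 5). cof k * D4 k)) sums G"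
proof -
  have x1: "\<bar>\<bar>x\<bar>\<bar> < 1" using x by simp
  note ge = has_sum_geometric[OF x1, of 1, unfolded mult_1]
  obtain Z where Z: "((\<lambda>n. 18 * (1 / (qT n * (n1 n * n2 n * n3 n * n4 n)))) has_sum Z) posq"
    using summable_on_cmult_right[OF Infinite_Sum.abs_summable_summable[OF posq_summable], of 18] by (auto simp: summable_on_def)
  note ZZ = has_sum_mult_Times[OF Z has_sum_mult_Times[OF ge has_sum_mult_Times[OF ge has_sum_mult_Times[OF ge ge]]]]
  have "(\<lambda>(n, k). tm x n k) summable_on posq \<times> UNIV"
  proof (rule Infinite_Sum.abs_summable_summable, rule Infinite_Sum.abs_summable_on_comparison_test')
    show "(\<lambda>(n, k). 18 * (1 / (qT n * (n1 n * n2 n * n3 n * n4 n))) * (case k of (a, b, c, d) \<Rightarrow> \<bar>x\<bar> ^ a * (\<bar>x\<bar> ^ b * (\<bar>x\<bar> ^ c * \<bar>x\<bar> ^ d)))) summable_on posq \<times> UNIV"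
      using ZZ has_sum_imp_summable by (fastforce simp: case_prod_unfold)
    fix z :: "quad \<times> quad" assume "z \<in> posq \<times> UNIV"
    then show "norm (case z of (n, k) \<Rightarrow> tm x n k) \<le> (case z of (n, k) \<Rightarrow> 18 * (1 / (qT n * (n1 n * n2 n * n3 n * n4 n))) * (case k of (a, b, c, d) \<Rightarrow> \<bar>x\<bar> ^ a * (\<bar>x\<bar> ^ b * (\<bar>x\<bar> ^ c * \<bar>x\<bar> ^ d))))"
      using tm_le[OF x] by (cases z) (auto simp del: mult_cancel_left)
  qed
  then obtain G' where G': "((\<lambda>(n, k). tm x n k) has_sum G') (posq \<times> UNIV)" by (auto simp: summable_on_def)
  have "(FF x has_sum G') posq"
    using has_sum_Sigma'[OF G', of "FF x"] FF_expand[OF x] by simp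
  then have GG: "G' = G" by (rule has_sum_unique[OF _ G])
  have sw: "((\<lambda>(k, n). tm x n k) has_sum G) (UNIV \<times> posq)"
    using G' unfolding GG by (subst (asm) has_sum_swap) (simp add: case_prod_unfold)
  define V where "V k = cof (upq k) * x ^ Suc (sz k) * D4 (upq k)" for k
  have V: "(V has_sum G) UNIV"
  proof (rule has_sum_Sigma'[OF sw])
    fix k :: quad
    obtain a b c d where k: "k = (a, b, c, d)" by (cases k)
    show "((\<lambda>n. case (k, n) of (k, n) \<Rightarrow> tm x n k) has_sum V k) posq"
      using has_sum_cmult_right[OF D4_has_sum[of "a + 2" "b + 1" "c + 1" "d + 1"], of "cof (upq k) * x ^ Suc (sz k)"]
      by (simp only: prod.case V_def tm_def k sz_def) (simp add: upq_def)
  qed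
  have "bij_betw (\<lambda>k. (sz k, k)) UNIV (SIGMA m:UNIV. {k. sz k = m})" by (rule bij_betwI[where g = snd]) auto
  from has_sum_reindex_bij_betw[OF this, of "\<lambda>z. V (snd z)" G] V
  have "((\<lambda>z. V (snd z)) has_sum G) (SIGMA m:UNIV. {k. sz k = m})" by simp
  then have "((\<lambda>m. \<Sum>k | sz k = m. V k) has_sum G) UNIV"
  proof (rule has_sum_Sigma')
    fix m
    have "finite {k. sz k = m}"
      by (rule finite_subset[of _ "{..m} \<times> {..m} \<times> {..m} \<times> {..m}"]) (auto simp: sz_def)
    then show "((\<lambda>y. V (snd (m, y))) has_sum (\<Sum>k | sz k = m. V k)) {k. sz k = m}" by simp
  qed
  then have "(\<lambda>m. \<Sum>k | sz k = m. V k) sums G" by (rule has_sum_imp_sums)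
  moreover have "(\<Sum>k | sz k = m. V k) = x ^ Suc m * (\<Sum>k\<in>weight_quads (m + 5). cof k * D4 k)" for m
  proof -
    have "(\<Sum>k | sz k = m. V k) = (\<Sum>k\<in>weight_quads (m + 5). x ^ Suc m * (cof k * D4 k))"
    proof (rule sum.reindex_bij_witness[where j = upq and i = "\<lambda>(a, b, c, d). (a - 2, b - 1, c - 1, d - 1)"])
      fix k assume "k \<in> {k. sz k = m}"
      then show "x ^ Suc m * (cof (upq k) * D4 (upq k)) = V k" by (simp add: V_def)
    qed (auto simp: upq_def weight_quads_def sz_def)
    then show ?thesis by (simp add: sum_distrib_left)
  qed
  ultimately show ?thesis by simp
qed

end

section \<open>Series of principal parts\<close>

lemma tannery_triangle:
  fixes F :: "nat \<Rightarrow> nat \<Rightarrow> real"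
  assumes lim: "\<And>k. (\<lambda>N. F N k) \<longlonglongrightarrow> L k" and le: "\<And>N k. \<bar>F N k\<bar> \<le> B k" and B: "summable B"
    and z: "\<And>N k. N \<le> k \<Longrightarrow> F N k = 0"
  shows "summable L" "(\<lambda>N. \<Sum>k<N. F N k) \<longlonglongrightarrow> suminf L"
proof -
  have "\<forall>\<^sub>F (k, N) in at_top \<times>\<^sub>F sequentially. norm (F N k) \<le> B k" using le by (intro always_eventually) auto
  from tannerys_theorem[OF lim this B] have 1: "summable (\<lambda>k. norm (L k))" and 2: "(\<lambda>N. \<Sum>k. F N k) \<longlonglongrightarrow> suminf L" by auto
  show "summable L" using 1 by (rule summable_norm_cancel)
  have "(\<Sum>k. F N k) = (\<Sum>k<N. F N k)" for N by (rule suminf_finite) (auto intro: z)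
  then show "(\<lambda>N. \<Sum>k<N. F N k) \<longlonglongrightarrow> suminf L" using 2 by simp
qed

lemma hs_diff_le: "a \<le> b \<Longrightarrow> hs b - hs a \<le> (real b - real a) / (real a + 1)"
proof (induction b rule: dec_induct)
  case (step n)
  have "1 / real (Suc n) \<le> 1 / (real a + 1)" using step by (intro frac_le) auto
  then show ?case using step by (simp add: hs_Suc diff_divide_distrib add_divide_distrib)
qed simp

lemma hs_diff_shift: "a \<le> b \<Longrightarrow> hs b - hs a \<le> hs (b - a)"
proof (induction b rule: dec_induct)
  case (step n)
  have "1 / real (Suc n) \<le> 1 / real (Suc (n - a))" by (intro frac_le) auto
  then show ?case using step by (simp add: hs_Suc Suc_diff_le)
qed simp

lemma hs_ge1: "1 \<le> n \<Longrightarrow> 1 \<le> hs n" using hs_mono[of 1 n] by (simp add: hs_def)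

text \<open>Converts decay in the larger pole \<open>m\<close> into decay in the distance
  \<open>d \<le> m\<close> of two poles.\<close>

lemma hs_avg_antimono:
  assumes d: "1 \<le> d" and "d \<le> m"
  shows "hs m / real m \<le> hs d / real d"
  using assms(2)
proof (induction m rule: dec_induct)
  case (step m)
  have m: "1 \<le> m" using step d by simp
  have "real m / real (Suc m) \<le> 1" by simp
  also have "1 \<le> hs m" using hs_ge1[OF m] .
  finally have "real m * hs (Suc m) \<le> real (Suc m) * hs m" by (simp add: hs_Suc algebra_simps)
  then have "hs (Suc m) / real (Suc m) \<le> hs m / real m" using m by (simp add: divide_simps mult.commute)
  then show ?case using step by simp
qed simp

lemma hs_sq_summable: "summable (\<lambda>d. hs (Suc d) / (real (Suc d))\<^sup>2)"
proof (rule summable_comparison_test_ev)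
  have "summable (\<lambda>n. real n powr (- 3 / 2))" by (subst summable_real_powr_iff) simp
  then show "summable (\<lambda>d. 2 * real (Suc d) powr (- 3 / 2))" by (subst (asm) summable_Suc_iff[symmetric]) (rule summable_mult)
  show "\<forall>\<^sub>F d in sequentially. norm (hs (Suc d) / (real (Suc d))\<^sup>2) \<le> 2 * real (Suc d) powr (- 3 / 2)"
  proof (rule always_eventually, rule allI)
    fix d
    define y where "y = real (Suc d)"
    have y: "1 \<le> y" by (simp add: y_def)
    have "hs (Suc d) \<le> 1 + ln y" unfolding y_def by (rule hs_le) simp
    also have "ln y = 2 * ln (sqrt y)" using y by (simp add: ln_sqrt)
    also have "\<dots> \<le> 2 * (sqrt y - 1)" using y by (intro mult_left_mono ln_le_minus_one) auto
    finally have "hs (Suc d) \<le> 2 * y powr (1 / 2)" using y by (simp add: powr_half_sqrt)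
    then have "hs (Suc d) / y\<^sup>2 \<le> 2 * y powr (1 / 2) / y powr 2" using y by (simp add: divide_right_mono powr_numeral)
    also have "\<dots> = 2 * y powr (- 3 / 2)" unfolding times_divide_eq_right[symmetric] powr_diff[symmetric] by simp
    finally show "norm (hs (Suc d) / (real (Suc d))\<^sup>2) \<le> 2 * real (Suc d) powr (- 3 / 2)"
      using hs_nonneg[of "Suc d"] by (simp add: y_def)
  qed
qed

lemma sum_shift_le:
  fixes b :: "nat \<Rightarrow> real"
  assumes "summable (\<lambda>d. b (Suc d))" "\<And>d. 0 \<le> b d"
  shows "(\<Sum>m=Suc p..N. b (m - p)) \<le> (\<Sum>d. b (Suc d))" "(\<Sum>j=1..<p. b (p - j)) \<le> (\<Sum>d. b (Suc d))"
proof -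
  have "(\<Sum>m=Suc p..N. b (m - p)) = (\<Sum>d<N - p. b (Suc d))"
    by (rule sum.reindex_bij_witness[where i = "\<lambda>d. Suc (p + d)" and j = "\<lambda>m. m - Suc p"]) (auto simp: Suc_diff_Suc Suc_le_eq)
  then show "(\<Sum>m=Suc p..N. b (m - p)) \<le> (\<Sum>d. b (Suc d))"
    using sum_le_suminf[OF assms(1), of "{..<N - p}"] assms(2) by simp
  have "(\<Sum>j=1..<p. b (p - j)) = (\<Sum>d<p - 1. b (Suc d))"
    by (rule sum.reindex_bij_witness[where i = "\<lambda>d. p - Suc d" and j = "\<lambda>j. p - Suc j"]) (auto simp: Suc_diff_Suc Suc_le_eq)
  then show "(\<Sum>j=1..<p. b (p - j)) \<le> (\<Sum>d. b (Suc d))"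
    using sum_le_suminf[OF assms(1), of "{..<p - 1}"] assms(2) by simp
qed

context sgn_grading
begin

text \<open>For \<open>s = 1\<close> the sequence \<open>h\<close> diverges, but \<open>Lam\<close> enters only through \<open>(s ^ m - 1) * Lam\<close>, so any value would do.\<close>

definition Lam :: real where "Lam = (if s = 1 then 0 else lim h)"
definition z2 :: real where "z2 = lim H2"
definition GCL :: "nat \<Rightarrow> nat \<Rightarrow> real" where
  "GCL j m = vv m * ((s ^ m - 1) * Lam - s ^ m * h (j - 1) + h (m - j) - vv m)
     + vv j * ((s ^ j - 1) * Lam - s ^ j * h m + h (m - j - 1))"
definition GtL :: "nat \<Rightarrow> nat \<Rightarrow> real" where
  "GtL j m = - 2 / (real m - real j)\<^sup>2 + 2 * (ph j - ph m) / (real m - real j) + 4 * ph j * ph m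
     + 2 * (H (m - 1) - H j) / (real m - real j) + 2 * ph m * (H (m - 1) - H j) - 2 * (z2 - H2 m) + 2 * GCL j m"

lemma H_diff_bounds: "a \<le> b \<Longrightarrow> 0 \<le> H b - H a \<and> H b - H a \<le> hs b - hs a"
proof (induction b rule: dec_induct)
  case (step n)
  then show ?case using vv_le[of "Suc n"] vv_nonneg[of "Suc n"] by (auto simp: H_Suc hs_Suc)
qed simp

lemma H2_diff_bounds:
  assumes "1 \<le> a" "a \<le> b"
  shows "0 \<le> H2 b - H2 a" "H2 b - H2 a \<le> 1 / real a"
proof -
  have "(\<Sum>q=Suc a..b. (vv q)\<^sup>2) \<le> (\<Sum>q=Suc a..b. 1 / (real q)\<^sup>2)"
  proof (rule sum_mono)
    fix q show "(vv q)\<^sup>2 \<le> 1 / (real q)\<^sup>2" using power_mono[OF vv_le[of q], of 2] by (simp add: power_one_over)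
  qed
  also have "\<dots> \<le> 1 / real a - 1 / real b" by (rule inv_sq_tail[OF assms])
  finally show "H2 b - H2 a \<le> 1 / real a" unfolding H2_diff[OF assms(2)] by (smt (verit) divide_nonneg_nonneg of_nat_0_le_iff)
  show "0 \<le> H2 b - H2 a" unfolding H2_diff[OF assms(2), symmetric] by (simp add: sum_nonneg)
qed

lemma H2_lim: "H2 \<longlonglongrightarrow> z2"
proof -
  have "incseq H2" by (rule incseq_SucI) (simp add: H2_Suc)
  moreover have "\<forall>n. H2 n \<le> H2 1 + 1"
  proof
    fix n show "H2 n \<le> H2 1 + 1" using H2_diff_bounds[of 1 n] by (cases n) (auto simp: H2_def)
  qed
  ultimately have "convergent H2" using incseq_convergent convergentI by metis
  then show ?thesis unfolding z2_def by (simp add: convergent_LIMSEQ_iff)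
qed

lemma hH: "h n = H n" if "s = 1"
  unfolding h_def H_def f_def vv_def using that by (intro sum.cong refl) simp

lemma h_alt: "s \<noteq> 1 \<Longrightarrow> a \<le> b \<Longrightarrow> \<bar>h b - h a\<bar> \<le> 1 / (real a + 1)"
proof -
  assume s1: "s \<noteq> 1" and ab: "a \<le> b"
  then have s: "s = -1" and g: "g = 1" using gs by auto
  have "f i = (-1) ^ i" for i unfolding f_def e_def using s g by simp
  then show ?thesis using h_diff[OF ab] alternating_tail_le[of a b] by simp
qed

lemma h_alt1: "s \<noteq> 1 \<Longrightarrow> \<bar>h b\<bar> \<le> 1" using h_alt[of 0 b] by simp

lemma h_lim: "s \<noteq> 1 \<Longrightarrow> h \<longlonglongrightarrow> Lam"
proof -
  assume s: "s \<noteq> 1"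
  have "Cauchy h"
  proof (rule metric_CauchyI)
    fix \<epsilon> :: real assume "0 < \<epsilon>"
    then obtain M where M: "1 / real (Suc M) < \<epsilon>" using nat_approx_posE by blast
    have "dist (h m) (h n) < \<epsilon>" if "M \<le> m" "m \<le> n" for m n
    proof -
      have "\<bar>h n - h m\<bar> \<le> 1 / (real m + 1)" using h_alt[OF s that(2)] .
      also have "\<dots> \<le> 1 / real (Suc M)" using that by (intro frac_le) auto
      finally show ?thesis using M by (simp add: dist_real_def abs_minus_commute)
    qed
    then show "\<exists>M. \<forall>m\<ge>M. \<forall>n\<ge>M. dist (h m) (h n) < \<epsilon>" by (metis dist_commute nle_le)
  qed
  then have "convergent h" by (simp add: Cauchy_convergent_iff)
  then show ?thesis unfolding Lam_def using s by (simp add: convergent_LIMSEQ_iff)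
qed

text \<open>For \<open>s = 1\<close> the divergent \<open>h\<close> enters only through
  \<open>h M - h (M + m)\<close>, which tends to 0; for \<open>s = -1\<close> it converges. The form
  of the limit covers both cases.\<close>

lemma h_shift_lim: "(\<lambda>M. s ^ m * h M - h (M + m)) \<longlonglongrightarrow> (s ^ m - 1) * Lam"
proof (cases "s = 1")
  case True
  have "(\<lambda>M. h (M + m) - h M) \<longlonglongrightarrow> 0"
  proof (rule tendsto_sandwich[OF _ _ tendsto_const])
    show "\<forall>\<^sub>F M in sequentially. 0 \<le> h (M + m) - h M" using H_diff_bounds hH[OF True] by (intro always_eventually) auto
    show "\<forall>\<^sub>F M in sequentially. h (M + m) - h M \<le> real m / (real M + 1)"
    proof (rule always_eventually, rule allI)
      fix M show "h (M + m) - h M \<le> real m / (real M + 1)"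
        using H_diff_bounds[of M "M + m"] hs_diff_le[of M "M + m"] by (simp add: hH[OF True])
    qed
    show "(\<lambda>M. real m / (real M + 1)) \<longlonglongrightarrow> 0" by real_asymp
  qed
  from tendsto_minus[OF this] show ?thesis using True by simp
next
  case False
  have "(\<lambda>M. s ^ m * h M - h (M + m)) \<longlonglongrightarrow> s ^ m * Lam - Lam"
    by (intro tendsto_intros h_lim[OF False] LIMSEQ_ignore_initial_segment)
  then show ?thesis by (simp add: algebra_simps)
qed

lemma h_back_lim: "(\<lambda>N. s ^ m * h N - h (N - m)) \<longlonglongrightarrow> (s ^ m - 1) * Lam"
proof (rule LIMSEQ_offset[where k = m])
  have sm: "s ^ m * s ^ m = 1" using gs by (auto simp flip: power_mult_distrib)
  have "(\<lambda>M. - (s ^ m * (s ^ m * h M - h (M + m)))) \<longlonglongrightarrow> - (s ^ m * ((s ^ m - 1) * Lam))"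
    by (intro tendsto_intros h_shift_lim)
  moreover have "- (s ^ m * (s ^ m * a - b)) = s ^ m * b - a" for a b
    unfolding right_diff_distrib mult.assoc[symmetric] sm by simp
  moreover have "- (s ^ m * ((s ^ m - 1) * Lam)) = (s ^ m - 1) * Lam"
    unfolding mult.assoc[symmetric] right_diff_distrib sm by (simp add: algebra_simps)
  ultimately show "(\<lambda>N. s ^ m * h (N + m) - h (N + m - m)) \<longlonglongrightarrow> (s ^ m - 1) * Lam" by simp
qed

text \<open>The values of \<open>h\<close> near \<open>N\<close> occur only in combinations that
  stay bounded even when \<open>h\<close> diverges, so the estimate is uniform in \<open>N\<close>.
  The decay in the distance \<open>m - j\<close> is what makes the sums in \<open>pfc\<close>
  converge, with terms of size hs d / d^2.\<close>

lemma GC_le: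
  assumes "1 \<le> j" "j < m" "m \<le> N"
  shows "\<bar>GC N j m\<bar> \<le> 6 * (hs (m - j) / real (m - j))"
proof -
  define d where "d = m - j"
  define K where "K = hs d / real d"
  have d: "1 \<le> d" "d \<le> m" "real d = real m - real j" using assms by (auto simp: d_def of_nat_diff)
  have Kd: "1 / real d \<le> K" unfolding K_def using hs_ge1[OF d(1)] by (simp add: divide_right_mono)
  have m1: "1 / real m \<le> 1 / real d" using d by (intro frac_le) auto
  have hm: "hs m / real m \<le> K" unfolding K_def by (rule hs_avg_antimono[OF d(1,2)])
  have "\<bar>vv m * (s ^ m * (h N - h (j - 1)) - h (N - m) + h (m - j) - vv m)\<bar> \<le> 4 * K
    \<and> \<bar>vv j * (s ^ j * (h N - h m) - h (N - j) + h (m - j - 1))\<bar> \<le> 2 * K"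
  proof (cases "s = 1")
    case True
    have m1: "1 \<le> m" using assms by simp
    have "\<bar>(h N - h (j - 1)) - h (N - m) + h (m - j) - vv m\<bar> \<le> 4 * hs m"
    proof -
      have "0 \<le> h N - h (N - m)" "h N - h (N - m) \<le> hs m"
        using H_diff_bounds[of "N - m" N] hs_diff_shift[of "N - m" N] assms by (auto simp: hH[OF True])
      moreover have "0 \<le> h (j - 1)" "h (j - 1) \<le> hs m" "0 \<le> h (m - j)" "h (m - j) \<le> hs m"
      proof -
        have "j - 1 \<le> m" "m - j \<le> m" using assms by auto
        then show "0 \<le> h (j - 1)" "h (j - 1) \<le> hs m" "0 \<le> h (m - j)" "h (m - j) \<le> hs m"
          using H_diff_bounds[of 0 "j - 1"] H_diff_bounds[of 0 "m - j"] hs_mono[of "j - 1" m] hs_mono[of "m - j" m] unfolding hH[OF True] by auto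
      qed
      moreover have "0 \<le> vv m" "vv m \<le> hs m"
      proof -
        have "1 / real m \<le> 1" using m1 by simp
        then show "vv m \<le> hs m" using vv_le[of m] hs_ge1[OF m1] by linarith
      qed (rule vv_nonneg)
      ultimately show ?thesis by linarith
    qed
    then have "\<bar>vv m\<bar> * \<bar>(h N - h (j - 1)) - h (N - m) + h (m - j) - vv m\<bar> \<le> 1 / real m * (4 * hs m)"
      by (intro mult_mono vv_le) auto
    then have 1: "\<bar>vv m * (s ^ m * (h N - h (j - 1)) - h (N - m) + h (m - j) - vv m)\<bar> \<le> 4 * K"
      using hm True by (simp add: abs_mult)
    \<comment> \<open>Regrouped as \<open>h N - h (N - j)\<close> minus
      \<open>h m - h (m - j - 1)\<close>: both differences are nonnegative and have at most
      \<open>j + 1\<close> terms, each at most \<open>1 / d\<close>. The factor \<open>vv j\<close>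
      then absorbs \<open>j + 1\<close>.\<close>
    have "\<bar>(h N - h m) - h (N - j) + h (m - j - 1)\<bar> \<le> (real j + 1) / real d"
    proof -
      have "h N - h (N - j) \<le> real j / (real (N - j) + 1)" "0 \<le> h N - h (N - j)"
        using H_diff_bounds[of "N - j" N] hs_diff_le[of "N - j" N] assms by (auto simp: hH[OF True] of_nat_diff)
      moreover have "real j / (real (N - j) + 1) \<le> (real j + 1) / real d"
        using assms d by (intro frac_le) (auto simp: of_nat_diff)
      moreover have "h m - h (m - j - 1) \<le> (real m - real (m - j - 1)) / (real (m - j - 1) + 1)" "0 \<le> h m - h (m - j - 1)"
        using H_diff_bounds[of "m - j - 1" m] hs_diff_le[of "m - j - 1" m] assms by (auto simp: hH[OF True])
      moreover have "(real m - real (m - j - 1)) / (real (m - j - 1) + 1) = (real j + 1) / real d"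
        using assms d by (simp add: of_nat_diff)
      ultimately show ?thesis by linarith
    qed
    then have "\<bar>vv j\<bar> * \<bar>(h N - h m) - h (N - j) + h (m - j - 1)\<bar> \<le> 1 / real j * ((real j + 1) / real d)"
      by (intro mult_mono vv_le) auto
    also have "\<dots> = (1 + 1 / real j) * (1 / real d)" using assms by (simp add: field_simps)
    also have "\<dots> \<le> 2 * (1 / real d)" using assms by (intro mult_right_mono) auto
    finally show ?thesis using 1 Kd True by (simp add: abs_mult)
  next
    case False
    have "\<bar>s ^ m * (h N - h (j - 1)) - h (N - m) + h (m - j) - vv m\<bar> \<le> 4"
    proof -
      have "\<bar>s ^ m * (h N - h (j - 1))\<bar> \<le> 1 / (real (j - 1) + 1)" using h_alt[OF False, of "j - 1" N] assms by (simp add: abs_mult)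
      moreover have "1 / (real (j - 1) + 1) \<le> 1" by simp
      moreover have "\<bar>vv m\<bar> \<le> 1" using vv_le[of m] by (rule order_trans) (use assms in simp)
      ultimately show ?thesis using h_alt1[OF False, of "N - m"] h_alt1[OF False, of "m - j"] by linarith
    qed
    then have "\<bar>vv m\<bar> * \<bar>s ^ m * (h N - h (j - 1)) - h (N - m) + h (m - j) - vv m\<bar> \<le> 1 / real m * 4"
      by (intro mult_mono vv_le) auto
    then have 1: "\<bar>vv m * (s ^ m * (h N - h (j - 1)) - h (N - m) + h (m - j) - vv m)\<bar> \<le> 4 * K"
      using m1 Kd by (simp add: abs_mult)
    have "\<bar>s ^ j * (h N - h m) - h (N - j) + h (m - j - 1)\<bar> \<le> 2 * (1 / real d)"
    proof -
      have "\<bar>s ^ j * (h N - h m)\<bar> \<le> 1 / (real m + 1)" using h_alt[OF False, of m N] assms by (simp add: abs_mult)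
      moreover have "1 / (real m + 1) \<le> 1 / real d" using d by (intro frac_le) auto
      moreover have "\<bar>h (N - j) - h (m - j - 1)\<bar> \<le> 1 / (real (m - j - 1) + 1)" using h_alt[OF False, of "m - j - 1" "N - j"] assms by simp
      moreover have "real (m - j - 1) + 1 = real d" using assms d by (simp add: of_nat_diff)
      ultimately show ?thesis by simp
    qed
    then have "\<bar>vv j\<bar> * \<bar>s ^ j * (h N - h m) - h (N - j) + h (m - j - 1)\<bar> \<le> 1 * (2 * (1 / real d))"
      using vv_le[of j] assms by (intro mult_mono) (auto intro: order_trans)
    then show ?thesis using 1 Kd by (simp add: abs_mult)
  qed
  then show ?thesis unfolding GC_def d_def[symmetric] K_def[symmetric] by linarith
qed

text \<open>Each of the seven summands is at most a multiple of hs d / d with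
  \<open>d = m - j\<close>; the multiples are 2, 4, 4, 2, 2, 2 and 12.\<close>

lemma Gt_le:
  assumes "1 \<le> j" "j < m" "m \<le> N"
  shows "\<bar>Gt N j m\<bar> \<le> 28 * (hs (m - j) / real (m - j))"
proof -
  define d where "d = m - j"
  define K where "K = hs d / real d"
  have d: "1 \<le> d" "d \<le> m" "real m - real j = real d" using assms by (auto simp: d_def of_nat_diff)
  have Kd: "1 / real d \<le> K" unfolding K_def using hs_ge1[OF d(1)] by (simp add: divide_right_mono)
  have m1: "1 / real m \<le> 1 / real d" using d by (intro frac_le) auto
  have pj: "\<bar>ph j\<bar> \<le> 1" using ph_le[of j] by (rule order_trans) (use assms in simp)
  have pm: "\<bar>ph m\<bar> \<le> 1 / real d" "\<bar>ph m\<bar> \<le> 1" using ph_le[of m] m1 d by (auto intro: order_trans)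
  have "1 / (real d)\<^sup>2 \<le> 1 / real d" using d by (intro frac_le) (auto simp: power2_eq_square)
  then have 1: "\<bar>- 2 / (real d)\<^sup>2\<bar> \<le> 2 * K" using Kd by simp
  have "\<bar>ph j - ph m\<bar> \<le> 2" using pj pm by linarith
  then have "\<bar>ph j - ph m\<bar> * (1 / real d) \<le> 2 * (1 / real d)" by (intro mult_right_mono) auto
  moreover have "\<bar>2 * (ph j - ph m) / real d\<bar> = 2 * (\<bar>ph j - ph m\<bar> * (1 / real d))"
    by (simp only: abs_mult abs_divide) simp
  ultimately have 2: "\<bar>2 * (ph j - ph m) / real d\<bar> \<le> 4 * K" using Kd by linarith
  have "\<bar>ph j\<bar> * \<bar>ph m\<bar> \<le> 1 * (1 / real d)" by (intro mult_mono pj pm) auto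
  then have 3: "\<bar>4 * ph j * ph m\<bar> \<le> 4 * K" using Kd by (simp add: abs_mult)
  have jm: "j \<le> m - 1" "m - 1 - j \<le> d" using assms by (auto simp: d_def)
  have Hd: "0 \<le> H (m - 1) - H j" "H (m - 1) - H j \<le> hs d"
    using H_diff_bounds[OF jm(1)] hs_diff_shift[OF jm(1)] hs_mono[OF jm(2)] by linarith+
  then have 4: "\<bar>2 * (H (m - 1) - H j) / real d\<bar> \<le> 2 * K" by (simp add: K_def divide_right_mono)
  have "\<bar>ph m\<bar> * \<bar>H (m - 1) - H j\<bar> \<le> 1 / real d * hs d" using Hd by (intro mult_mono pm) auto
  then have 5: "\<bar>2 * ph m * (H (m - 1) - H j)\<bar> \<le> 2 * K" by (simp add: abs_mult K_def)
  have 6: "\<bar>2 * (H2 N - H2 m)\<bar> \<le> 2 * K" using H2_diff_bounds[of m N] m1 Kd assms by simp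
  have 7: "\<bar>2 * GC N j m\<bar> \<le> 12 * K" using GC_le[OF assms] unfolding d_def[symmetric] K_def[symmetric] by (simp add: abs_mult)
  have t: "\<bar>a1 + a2 + a3 + a4 + a5 - a6 + a7\<bar> \<le> 28 * K"
    if "\<bar>a1\<bar> \<le> 2 * K" "\<bar>a2\<bar> \<le> 4 * K" "\<bar>a3\<bar> \<le> 4 * K" "\<bar>a4\<bar> \<le> 2 * K" "\<bar>a5\<bar> \<le> 2 * K" "\<bar>a6\<bar> \<le> 2 * K" "\<bar>a7\<bar> \<le> 12 * K" for a1 a2 a3 a4 a5 a6 a7 :: real
    using that unfolding abs_le_iff by auto
  show ?thesis unfolding Gt_def d(3) unfolding d_def[symmetric] K_def[symmetric] by (rule t[OF 1 2 3 4 5 6 7])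
qed

section \<open>Limits of the coefficients, and the passage to the limit in the series over the
  poles\<close>

definition kp :: real where "kp = (\<Sum>d. hs (Suc d) / (real (Suc d))\<^sup>2)"

lemma Gt_term_le:
  assumes "1 \<le> j" "j < m" "m \<le> N"
  shows "\<bar>od k * Gt N j m / (real m - real j)\<bar> \<le> 28 * (hs (m - j) / (real (m - j))\<^sup>2)"
proof -
  have "\<bar>od k\<bar> * \<bar>Gt N j m\<bar> \<le> 1 * (28 * (hs (m - j) / real (m - j)))" by (intro mult_mono od_le Gt_le assms) auto
  then have "\<bar>od k\<bar> * \<bar>Gt N j m\<bar> / real (m - j) \<le> 1 * (28 * (hs (m - j) / real (m - j))) / real (m - j)" by (intro divide_right_mono) auto
  then show ?thesis using assms by (simp add: abs_mult of_nat_diff power2_eq_square)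
qed

lemma pfc_le:
  assumes "1 \<le> p" "p \<le> N"
  shows "\<bar>pfc (Gt N) p N\<bar> \<le> 56 * kp"
proof -
  note sh = sum_shift_le[of "\<lambda>d. hs d / (real d)\<^sup>2", OF hs_sq_summable]
  have nn: "\<And>d. 0 \<le> hs d / (real d)\<^sup>2" using hs_nonneg by simp
  have "\<bar>\<Sum>m=Suc p..N. od m * Gt N p m / (real m - real p)\<bar> \<le> (\<Sum>m=Suc p..N. 28 * (hs (m - p) / (real (m - p))\<^sup>2))"
    using assms by (intro order_trans[OF sum_abs sum_mono] Gt_term_le) auto
  also have "\<dots> \<le> 28 * kp" unfolding sum_distrib_left[symmetric] kp_def using sh(1)[OF nn] by (intro mult_left_mono) auto
  finally have 1: "\<bar>\<Sum>m=Suc p..N. od m * Gt N p m / (real m - real p)\<bar> \<le> 28 * kp" .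
  have "\<bar>\<Sum>j=1..<p. od j * Gt N j p / (real p - real j)\<bar> \<le> (\<Sum>j=1..<p. 28 * (hs (p - j) / (real (p - j))\<^sup>2))"
    using assms by (intro order_trans[OF sum_abs sum_mono] Gt_term_le) auto
  also have "\<dots> \<le> 28 * kp" unfolding sum_distrib_left[symmetric] kp_def using sh(2)[OF nn] by (intro mult_left_mono) auto
  finally show ?thesis using 1 unfolding pfc_def by linarith
qed

lemma Gt_lim: "(\<lambda>N. Gt N j m) \<longlonglongrightarrow> GtL j m"
proof -
  have GC: "GC N j m = vv m * ((s ^ m * h N - h (N - m)) - s ^ m * h (j - 1) + h (m - j) - vv m)
     + vv j * ((s ^ j * h N - h (N - j)) - s ^ j * h m + h (m - j - 1))" for N
    unfolding GC_def by (simp add: algebra_simps)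
  have "(\<lambda>N. GC N j m) \<longlonglongrightarrow> GCL j m"
    unfolding GC GCL_def by (intro tendsto_intros h_back_lim)
  then show ?thesis unfolding Gt_def GtL_def by (intro tendsto_intros H2_lim)
qed

lemma pfc_lim:
  assumes p: "1 \<le> p"
  shows "summable (\<lambda>k. od (p + Suc k) * GtL p (p + Suc k) / real (Suc k))" (is "summable ?a")
    and "(\<lambda>N. pfc (Gt N) p N) \<longlonglongrightarrow> (\<Sum>k. od (p + Suc k) * GtL p (p + Suc k) / real (Suc k)) - (\<Sum>j=1..<p. od j * GtL j p / (real p - real j))"
proof -
  define F where "F N k = (if p + Suc k \<le> N then od (p + Suc k) * Gt N p (p + Suc k) / real (Suc k) else 0)" for N k
  have lim: "(\<lambda>N. F N k) \<longlonglongrightarrow> ?a k" for k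
  proof (rule Lim_transform_eventually)
    show "(\<lambda>N. od (p + Suc k) * Gt N p (p + Suc k) / real (Suc k)) \<longlonglongrightarrow> ?a k"
      by (intro tendsto_divide tendsto_mult tendsto_const Gt_lim) auto
    show "\<forall>\<^sub>F N in sequentially. od (p + Suc k) * Gt N p (p + Suc k) / real (Suc k) = F N k"
      using eventually_ge_at_top[of "p + Suc k"] by eventually_elim (simp add: F_def)
  qed
  have le: "\<bar>F N k\<bar> \<le> 28 * (hs (Suc k) / (real (Suc k))\<^sup>2)" for N k
    using Gt_term_le[of p "p + Suc k" N "p + Suc k"] p hs_nonneg[of "Suc k"] by (auto simp: F_def)
  have z: "F N k = 0" if "N \<le> k" for N k using that by (simp add: F_def)
  note tn = tannery_triangle[OF lim le summable_mult[OF hs_sq_summable] z]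
  show "summable ?a" by (rule tn(1))
  have "(\<Sum>k<N. F N k) = (\<Sum>m=Suc p..N. od m * Gt N p m / (real m - real p))" for N
  proof -
    have "(\<Sum>m=Suc p..N. od m * Gt N p m / (real m - real p)) = (\<Sum>k<N - p. F N k)"
      by (rule sum.reindex_bij_witness[where i = "\<lambda>k. p + Suc k" and j = "\<lambda>m. m - Suc p"]) (auto simp: F_def of_nat_diff)
    also have "\<dots> = (\<Sum>k<N. F N k)" by (rule sum.mono_neutral_left) (auto simp: F_def)
    finally show ?thesis ..
  qed
  then have "(\<lambda>N. \<Sum>m=Suc p..N. od m * Gt N p m / (real m - real p)) \<longlonglongrightarrow> suminf ?a" using tn(2) by simp
  then show "(\<lambda>N. pfc (Gt N) p N) \<longlonglongrightarrow> suminf ?a - (\<Sum>j=1..<p. od j * GtL j p / (real p - real j))"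
    unfolding pfc_def by (intro tendsto_diff tendsto_sum tendsto_divide tendsto_mult tendsto_const Gt_lim) auto
qed

lemma inv_sq_sum_le: "(\<Sum>m=Suc p..N. 1 / (real m - real p)\<^sup>2) \<le> 2"
proof -
  have "(\<Sum>m=Suc p..N. 1 / (real m - real p)\<^sup>2) = (\<Sum>d=1..N - p. 1 / (real d)\<^sup>2)"
    by (rule sum.reindex_bij_witness[where i = "\<lambda>d. p + d" and j = "\<lambda>m. m - p"]) (auto simp: of_nat_diff)
  also have "\<dots> \<le> 2"
  proof (cases "N - p")
    case (Suc M)
    have "(\<Sum>d=1..Suc M. 1 / (real d)\<^sup>2) = 1 + (\<Sum>d=Suc 1..Suc M. 1 / (real d)\<^sup>2)" by (subst sum.atLeast_Suc_atMost) auto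
    also have "\<dots> \<le> 1 + (1 / real 1 - 1 / real (Suc M))" by (intro add_left_mono inv_sq_tail) auto
    also have "\<dots> \<le> 2" by simp
    finally show ?thesis unfolding Suc .
  qed simp
  finally show ?thesis .
qed

text \<open>Linear growth in \<open>p\<close> is affordable: the coefficient is multiplied by
  \<open>(uu x p)\<^sup>2 - (uu 0 p)\<^sup>2\<close>, which is of order p^(-3).\<close>

lemma dd_le:
  assumes p: "1 \<le> p" "p \<le> N"
  shows "\<bar>dd p N\<bar> \<le> 18 * real p"
proof -
  have p1: "1 \<le> real p" using p by simp
  have ph1: "\<bar>ph k\<bar> \<le> 1" if "1 \<le> k" for k using ph_le[of k] by (rule order_trans) (use that in simp)
  have 1: "\<bar>2 * (ph p)\<^sup>2\<bar> \<le> 2" using ph1[OF p(1)] by (simp add: abs_square_le_1)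
  have "\<bar>\<Sum>m=Suc p..N. od m / (real m - real p)\<^sup>2\<bar> \<le> (\<Sum>m=Suc p..N. 1 / (real m - real p)\<^sup>2)"
    by (rule order_trans[OF sum_abs sum_mono]) (use od_le in \<open>auto simp: abs_divide divide_right_mono\<close>)
  then have 2: "\<bar>\<Sum>m=Suc p..N. od m / (real m - real p)\<^sup>2\<bar> \<le> 2" using inv_sq_sum_le[of p N] by linarith
  have S: "\<bar>\<Sum>j=1..<p. t j\<bar> \<le> real p" if "\<And>j. 1 \<le> j \<Longrightarrow> j < p \<Longrightarrow> \<bar>t j\<bar> \<le> 1" for t :: "nat \<Rightarrow> real"
  proof -
    have "\<bar>\<Sum>j=1..<p. t j\<bar> \<le> (\<Sum>j=1..<p. 1)" by (rule order_trans[OF sum_abs sum_mono]) (use that in auto)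
    then show ?thesis using p1 by (simp add: of_nat_diff)
  qed
  have 3: "\<bar>\<Sum>j=1..<p. od j / (real p - real j)\<^sup>2\<bar> \<le> real p"
  proof (rule S)
    fix j assume "1 \<le> j" "j < p"
    then have "1 \<le> real p - real j" by linarith
    then have "1 \<le> (real p - real j)\<^sup>2" by (simp add: one_le_power)
    then show "\<bar>od j / (real p - real j)\<^sup>2\<bar> \<le> 1" using od_le(1)[of j] by (simp add: abs_divide divide_le_eq_1)
  qed
  have 4: "\<bar>\<Sum>j=1..<p. od j * ph j / (real p - real j)\<bar> \<le> real p"
  proof (rule S)
    fix j assume j: "1 \<le> j" "j < p"
    then have "1 \<le> real p - real j" by linarith
    moreover have "\<bar>od j\<bar> * \<bar>ph j\<bar> \<le> 1 * 1" by (intro mult_mono od_le ph1 j) auto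
    ultimately show "\<bar>od j * ph j / (real p - real j)\<bar> \<le> 1" by (simp add: abs_divide abs_mult divide_le_eq_1)
  qed
  have "\<bar>\<Sum>m=Suc p..N. od m * ph m / (real m - real p)\<bar> \<le> (\<Sum>m=Suc p..N. 1 / (real m - real p)\<^sup>2)"
  proof (rule order_trans[OF sum_abs sum_mono])
    fix m assume m: "m \<in> {Suc p..N}"
    have "\<bar>od m\<bar> * \<bar>ph m\<bar> \<le> 1 * (1 / real m)" by (intro mult_mono od_le ph_le) auto
    also have "\<dots> \<le> 1 / (real m - real p)" using m p by (simp add: frac_le)
    finally have "\<bar>od m\<bar> * \<bar>ph m\<bar> / (real m - real p) \<le> 1 / (real m - real p) / (real m - real p)" using m by (intro divide_right_mono) auto
    then show "\<bar>od m * ph m / (real m - real p)\<bar> \<le> 1 / (real m - real p)\<^sup>2" using m by (simp add: abs_divide abs_mult power2_eq_square)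
  qed
  then have 5: "\<bar>\<Sum>m=Suc p..N. od m * ph m / (real m - real p)\<bar> \<le> 2" using inv_sq_sum_le[of p N] by linarith
  have 6: "\<bar>\<Sum>j=1..<p. od j * (H (p - 1) - H j) / (real p - real j)\<bar> \<le> real p"
  proof (rule S)
    fix j assume j: "1 \<le> j" "j < p"
    have "hs (p - 1) - hs j \<le> (real (p - 1) - real j) / (real j + 1)" using j by (intro hs_diff_le) auto
    also have "\<dots> \<le> (real (p - 1) - real j) / 1" using j by (intro divide_left_mono) auto
    also have "\<dots> \<le> real p - real j" by simp
    finally have "hs (p - 1) - hs j \<le> real p - real j" .
    moreover have "j \<le> p - 1" using j by simp
    ultimately have "0 \<le> H (p - 1) - H j" "H (p - 1) - H j \<le> real p - real j" using H_diff_bounds[of j "p - 1"] by auto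
    moreover have "\<bar>od j\<bar> * \<bar>H (p - 1) - H j\<bar> \<le> 1 * \<bar>H (p - 1) - H j\<bar>" by (intro mult_right_mono od_le) auto
    ultimately show "\<bar>od j * (H (p - 1) - H j) / (real p - real j)\<bar> \<le> 1" using j by (simp add: abs_divide abs_mult divide_le_eq_1)
  qed
  have "1 / real p \<le> 1" using p1 by simp
  then have 7: "\<bar>H2 N - H2 p\<bar> \<le> 1" using H2_diff_bounds[OF p] by linarith
  have "\<bar>h (N - p) - s ^ p * (h N - h p)\<bar> \<le> 2 * real p"
  proof (cases "s = 1")
    case True
    have "0 \<le> h N - h (N - p)" "h N - h (N - p) \<le> hs p"
      using H_diff_bounds[of "N - p" N] hs_diff_shift[of "N - p" N] p by (auto simp: hH[OF True])
    moreover have "0 \<le> h p" "h p \<le> hs p" using H_diff_bounds[of 0 p] by (auto simp: hH[OF True])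
    moreover have "hs p \<le> real p" using hs_diff_le[of 0 p] by simp
    ultimately show ?thesis using True by simp
  next
    case False
    have "\<bar>s ^ p * (h N - h p)\<bar> \<le> 1 / (real p + 1)" using h_alt[OF False p(2)] by (simp add: abs_mult)
    moreover have "1 / (real p + 1) \<le> 1" by simp
    ultimately show ?thesis using h_alt1[OF False, of "N - p"] p1 by linarith
  qed
  then have "\<bar>vv p\<bar> * \<bar>h (N - p) - s ^ p * (h N - h p)\<bar> \<le> 1 / real p * (2 * real p)" by (intro mult_mono vv_le) auto
  then have 8: "\<bar>2 * vv p * (h (N - p) - s ^ p * (h N - h p))\<bar> \<le> 4" using p by (simp add: abs_mult)
  have t: "\<bar>a1 + a2 + a3 - 2 * a4 + 2 * a5 - 2 * a6 - a7 - a8\<bar> \<le> 18 * P"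
    if "\<bar>a1\<bar> \<le> 2" "\<bar>a2\<bar> \<le> 2" "\<bar>a3\<bar> \<le> P" "\<bar>a4\<bar> \<le> P" "\<bar>a5\<bar> \<le> 2" "\<bar>a6\<bar> \<le> P" "\<bar>a7\<bar> \<le> 1" "\<bar>a8\<bar> \<le> 4" "1 \<le> P" for a1 a2 a3 a4 a5 a6 a7 a8 P :: real
    using that unfolding abs_le_iff by auto
  show ?thesis unfolding dd_def by (rule t[OF 1 2 3 4 5 6 7 8 p1])
qed

text \<open>The value at 0 is subtracted pole by pole because the coefficients of the simple poles
  are only known to be bounded (\<open>pfc_le\<close>): the difference
  \<open>uu x p - uu 0 p\<close> is of order p^(-2), and this makes the bounds summable.\<close>

definition tt :: "(nat \<Rightarrow> real) \<Rightarrow> (nat \<Rightarrow> real) \<Rightarrow> real \<Rightarrow> nat \<Rightarrow> real" where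
  "tt c d x p = (uu x p ^ 4 - uu 0 p ^ 4) / 2 + 2 * ph p * (uu x p ^ 3 - uu 0 p ^ 3) + d p * ((uu x p)\<^sup>2 - (uu 0 p)\<^sup>2) + c p * (uu x p - uu 0 p)"

theorem TN_series:
  assumes x: "\<bar>x\<bar> \<le> 1 / 2"
    and c: "\<And>p. 1 \<le> p \<Longrightarrow> od p \<noteq> 0 \<Longrightarrow> (\<lambda>N. pfc (Gt N) p N) \<longlonglongrightarrow> c p"
    and d: "\<And>p. 1 \<le> p \<Longrightarrow> od p \<noteq> 0 \<Longrightarrow> dd p \<longlonglongrightarrow> d p"
    and G: "(\<lambda>N. TN x N - TN 0 N) \<longlonglongrightarrow> G"
  shows "(\<lambda>k. tt c d x (Suc k)) sums G"
proof -
  define F where "F N k = (if Suc k \<le> N then tt (\<lambda>p. pfc (Gt N) p N) (\<lambda>p. dd p N) x (Suc k) else 0)" for N k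
  have lim: "(\<lambda>N. F N k) \<longlonglongrightarrow> tt c d x (Suc k)" for k
  proof (cases "od (Suc k) = 0")
    case True
    then have "uu y (Suc k) = 0" for y by (simp add: uu_def)
    then have "tt c' d' x (Suc k) = 0" for c' d' by (simp add: tt_def)
    then have "tt c d x (Suc k) = 0" "tt (\<lambda>p. pfc (Gt N) p N) (\<lambda>p. dd p N) x (Suc k) = 0" for N by blast+
    then have "F N k = 0" for N unfolding F_def by (simp split: if_split)
    then show ?thesis using \<open>tt c d x (Suc k) = 0\<close> by simp
  next
    case False
    show ?thesis
    proof (rule Lim_transform_eventually)
      show "(\<lambda>N. tt (\<lambda>p. pfc (Gt N) p N) (\<lambda>p. dd p N) x (Suc k)) \<longlonglongrightarrow> tt c d x (Suc k)"
        unfolding tt_def by (intro tendsto_intros c d False) auto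
      show "\<forall>\<^sub>F N in sequentially. tt (\<lambda>p. pfc (Gt N) p N) (\<lambda>p. dd p N) x (Suc k) = F N k"
        using eventually_ge_at_top[of "Suc k"] by eventually_elim (simp add: F_def)
    qed
  qed
  have kp0: "0 \<le> kp" using pfc_le[of 1 1] by simp
  \<comment> \<open>With u and v at most 2 in absolute value and their difference at most 1/p^2, the
    first three terms contribute 16, 24 and 72, the last one \<open>56 * kp\<close>; the sum 112 is
    rounded up to 120.\<close>
  have le: "\<bar>F N k\<bar> \<le> (120 + 56 * kp) * (1 / (real (Suc k))\<^sup>2)" for N k
  proof (cases "Suc k \<le> N")
    case True
    define p where "p = Suc k"
    define u v where "u = uu x p" and "v = uu 0 p"
    have p: "1 \<le> p" "p \<le> N" "1 \<le> real p" using True by (auto simp: p_def)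
    have v: "v = od p / real p" by (simp add: v_def uu_def)
    have uv: "\<bar>u - v\<bar> \<le> 1 / (real p)\<^sup>2" unfolding u_def v by (rule uu_diff_le(1)[OF x p(1)])
    have u: "\<bar>u\<bar> \<le> 2 / real p" unfolding u_def by (rule uu_diff_le(2)[OF x p(1)])
    have v2: "\<bar>v\<bar> \<le> 2 / real p" unfolding v_def by (rule uu_diff_le(2)) (use p in auto)
    have lep: "2 / real p \<le> 2" using p(3) by (simp add: divide_le_eq)
    have u2: "\<bar>u\<bar> \<le> 2" "\<bar>v\<bar> \<le> 2" using u v2 lep by linarith+
    have m: "\<bar>(u - v) * y\<bar> \<le> 1 / (real p)\<^sup>2 * C" if "\<bar>y\<bar> \<le> C" for y C
      unfolding abs_mult using that uv by (intro mult_mono) auto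
    have q2: "\<bar>u + v\<bar> \<le> 4 / real p" using u v2 by linarith
    have uu4: "\<bar>u * u\<bar> \<le> 4" "\<bar>u * v\<bar> \<le> 4" "\<bar>v * v\<bar> \<le> 4"
      using mult_mono[OF u2(1) u2(1)] mult_mono[OF u2(1) u2(2)] mult_mono[OF u2(2) u2(2)] by (auto simp: abs_mult)
    have a4: "u ^ 4 - v ^ 4 = (u - v) * ((u + v) * (u * u + v * v))" by (simp add: power4_eq_xxxx algebra_simps)
    have a3: "u ^ 3 - v ^ 3 = (u - v) * (u * u + u * v + v * v)" by (simp add: power3_eq_cube algebra_simps)
    have a2: "u\<^sup>2 - v\<^sup>2 = (u - v) * (u + v)" by (simp add: power2_eq_square algebra_simps)
    have "\<bar>u + v\<bar> \<le> 4" using abs_triangle_ineq[of u v] u2 by linarith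
    moreover have "\<bar>u * u + v * v\<bar> \<le> 8" using abs_triangle_ineq[of "u * u" "v * v"] uu4(1,3) by linarith
    ultimately have "\<bar>u + v\<bar> * \<bar>u * u + v * v\<bar> \<le> 4 * 8" by (rule mult_mono) auto
    then have "\<bar>(u + v) * (u * u + v * v)\<bar> \<le> 32" by (simp add: abs_mult)
    then have 1: "\<bar>(u ^ 4 - v ^ 4) / 2\<bar> \<le> 1 / (real p)\<^sup>2 * 16" using m[of "(u + v) * (u * u + v * v)" 32] unfolding a4 by simp
    have "\<bar>u * u + u * v + v * v\<bar> \<le> 12"
      using abs_triangle_ineq[of "u * u + u * v" "v * v"] abs_triangle_ineq[of "u * u" "u * v"] uu4 by linarith
    from m[OF this] have 3: "\<bar>u ^ 3 - v ^ 3\<bar> \<le> 1 / (real p)\<^sup>2 * 12" unfolding a3 .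
    have php: "\<bar>ph p\<bar> \<le> 1" using ph_le[of p] by (rule order_trans) (use p in simp)
    have "\<bar>ph p\<bar> * \<bar>u ^ 3 - v ^ 3\<bar> \<le> 1 * (1 / (real p)\<^sup>2 * 12)" by (intro mult_mono 3 php) auto
    then have 2: "\<bar>2 * ph p * (u ^ 3 - v ^ 3)\<bar> \<le> 1 / (real p)\<^sup>2 * 24" by (simp add: abs_mult)
    have "\<bar>dd p N\<bar> * \<bar>u\<^sup>2 - v\<^sup>2\<bar> \<le> (18 * real p) * (1 / (real p)\<^sup>2 * (4 / real p))"
      unfolding a2 by (intro mult_mono dd_le p m q2) auto
    then have 4: "\<bar>dd p N * (u\<^sup>2 - v\<^sup>2)\<bar> \<le> 1 / (real p)\<^sup>2 * 72" using p by (simp add: abs_mult)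
    have 5: "\<bar>pfc (Gt N) p N * (u - v)\<bar> \<le> 1 / (real p)\<^sup>2 * (56 * kp)"
      using m[OF pfc_le[OF p(1,2)]] by (simp only: mult.commute)
    have "F N k = (u ^ 4 - v ^ 4) / 2 + 2 * ph p * (u ^ 3 - v ^ 3) + dd p N * (u\<^sup>2 - v\<^sup>2) + pfc (Gt N) p N * (u - v)"
      using True unfolding F_def tt_def u_def v_def p_def by simp
    moreover have "\<bar>a\<bar> \<le> A \<Longrightarrow> \<bar>b\<bar> \<le> B \<Longrightarrow> \<bar>c\<bar> \<le> C \<Longrightarrow> \<bar>d\<bar> \<le> D \<Longrightarrow> \<bar>a + b + c + d\<bar> \<le> A + B + C + D" for a b c d A B C D :: real by linarith
    ultimately have "\<bar>F N k\<bar> \<le> 1 / (real p)\<^sup>2 * 16 + 1 / (real p)\<^sup>2 * 24 + 1 / (real p)\<^sup>2 * 72 + 1 / (real p)\<^sup>2 * (56 * kp)"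
      using 1 2 4 5 by presburger
    also have "\<dots> = (112 + 56 * kp) * (1 / (real p)\<^sup>2)" by (simp add: algebra_simps)
    also have "\<dots> \<le> (120 + 56 * kp) * (1 / (real p)\<^sup>2)" by (intro mult_right_mono) auto
    finally show ?thesis unfolding p_def .
  qed (use kp0 in \<open>simp add: F_def\<close>)
  have sm: "summable (\<lambda>k. (120 + 56 * kp) * (1 / (real (Suc k))\<^sup>2))"
    using inverse_power_summable[of 2, where ?'a = real] by (intro summable_mult) (subst summable_Suc_iff, simp add: inverse_eq_divide)
  have z: "F N k = 0" if "N \<le> k" for N k using that by (simp add: F_def)
  note tn = tannery_triangle[OF lim le sm z]
  have "TN x N - TN 0 N = (\<Sum>k<N. F N k)" for N
  proof -
    have "TN x N - TN 0 N = (\<Sum>p=1..N. tt (\<lambda>p. pfc (Gt N) p N) (\<lambda>p. dd p N) x p)"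
    proof -
      have e: "TN y N = (\<Sum>p=1..N. (uu y p) ^ 4 / 2 + 2 * ph p * (uu y p) ^ 3 + dd p N * (uu y p)\<^sup>2 + pfc (Gt N) p N * uu y p)" if "\<bar>y\<bar> \<le> 1 / 2" for y
        by (rule TN_pf[OF nz_half[OF that]])
      have "\<bar>0::real\<bar> \<le> 1 / 2" by simp
      then show ?thesis unfolding e[OF x] e[of 0, OF \<open>\<bar>0::real\<bar> \<le> 1 / 2\<close>] sum_subtractf[symmetric]
        by (intro sum.cong refl) (simp add: tt_def diff_divide_distrib right_diff_distrib)
    qed
    also have "\<dots> = (\<Sum>k<N. F N k)"
      by (rule sum.reindex_bij_witness[where i = Suc and j = "\<lambda>p. p - 1"]) (auto simp: F_def)
    finally show ?thesis .
  qed
  then have "(\<lambda>N. TN x N - TN 0 N) \<longlonglongrightarrow> (\<Sum>k. tt c d x (Suc k))" using tn(2) by simp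
  then have "G = (\<Sum>k. tt c d x (Suc k))" by (rule LIMSEQ_unique[OF G])
  then show ?thesis using tn(1) by (simp add: summable_sums)
qed

end

section \<open>Harmonic sums and the residues\<close>

definition hs2 :: "nat \<Rightarrow> real" where "hs2 n = (\<Sum>k=1..n. 1 / (real k)\<^sup>2)"
definition hs3 :: "nat \<Rightarrow> real" where "hs3 n = (\<Sum>k=1..n. 1 / (real k) ^ 3)"
definition zt2 :: real where "zt2 = lim hs2"

lemma hs2_0 [simp]: "hs2 0 = 0" and hs2_Suc: "hs2 (Suc n) = hs2 n + 1 / (real (Suc n))\<^sup>2"
  by (simp_all add: hs2_def)
lemma hs3_0 [simp]: "hs3 0 = 0" and hs3_Suc: "hs3 (Suc n) = hs3 n + 1 / (real (Suc n)) ^ 3"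
  by (simp_all add: hs3_def)
lemma hs_pred: "1 \<le> n \<Longrightarrow> hs n = hs (n - 1) + 1 / real n" using hs_Suc[of "n - 1"] by simp

lemma hs2_diff_le: "1 \<le> a \<Longrightarrow> a \<le> b \<Longrightarrow> 0 \<le> hs2 b - hs2 a \<and> hs2 b - hs2 a \<le> 1 / real a"
proof -
  assume a: "1 \<le> a" "a \<le> b"
  have "hs2 b - hs2 a = (\<Sum>q=Suc a..b. 1 / (real q)\<^sup>2)"
    using a(2) by (induction b rule: dec_induct) (auto simp: hs2_Suc)
  moreover have "0 \<le> (\<Sum>q=Suc a..b. 1 / (real q)\<^sup>2)" by (simp add: sum_nonneg)
  moreover have "0 \<le> 1 / real b" by simp
  ultimately show ?thesis using inv_sq_tail[OF a] by linarith
qed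

lemma hs2_lim: "hs2 \<longlonglongrightarrow> zt2"
proof -
  have "incseq hs2" by (rule incseq_SucI) (simp add: hs2_Suc)
  moreover have "\<forall>n. hs2 n \<le> hs2 1 + 1"
  proof
    fix n show "hs2 n \<le> hs2 1 + 1" using hs2_diff_le[of 1 n] by (cases n) (auto simp: hs2_def)
  qed
  ultimately have "convergent hs2" using incseq_convergent convergentI by metis
  then show ?thesis unfolding zt2_def by (simp add: convergent_LIMSEQ_iff)
qed

lemma zt2_diff_le: "1 \<le> a \<Longrightarrow> 0 \<le> zt2 - hs2 a \<and> zt2 - hs2 a \<le> 1 / real a"
proof -
  assume a: "1 \<le> a"
  have "(\<lambda>b. hs2 b - hs2 a) \<longlonglongrightarrow> zt2 - hs2 a" by (intro tendsto_intros hs2_lim)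
  note lim = this
  have ev: "\<forall>\<^sub>F b in sequentially. 0 \<le> hs2 b - hs2 a \<and> hs2 b - hs2 a \<le> 1 / real a"
    using eventually_ge_at_top[of a] by eventually_elim (rule hs2_diff_le[OF a])
  show ?thesis
  proof
    show "0 \<le> zt2 - hs2 a" by (rule tendsto_lowerbound[OF lim]) (use ev in \<open>auto elim: eventually_mono\<close>)
    show "zt2 - hs2 a \<le> 1 / real a" by (rule tendsto_upperbound[OF lim]) (use ev in \<open>auto elim: eventually_mono\<close>)
  qed
qed

lemma hs_shift_lim: "(\<lambda>M. hs M - (hs (M + n) - hs n)) \<longlonglongrightarrow> hs n"
proof -
  have "(\<lambda>M. hs (M + n) - hs M) \<longlonglongrightarrow> 0"
  proof (rule tendsto_sandwich[OF _ _ tendsto_const])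
    show "\<forall>\<^sub>F M in sequentially. 0 \<le> hs (M + n) - hs M" using hs_mono by (intro always_eventually) auto
    show "\<forall>\<^sub>F M in sequentially. hs (M + n) - hs M \<le> real n / (real M + 1)"
    proof (rule always_eventually, rule allI)
      fix M show "hs (M + n) - hs M \<le> real n / (real M + 1)" using hs_diff_le[of M "M + n"] by simp
    qed
    show "(\<lambda>M. real n / (real M + 1)) \<longlonglongrightarrow> 0" by real_asymp
  qed
  then have "(\<lambda>M. hs n - (hs (M + n) - hs M)) \<longlonglongrightarrow> hs n - 0" by (intro tendsto_intros)
  then show ?thesis by (simp add: algebra_simps)
qed

lemma sum_rt: "(\<Sum>i=1..M. 1 / real i - 1 / (real n + real i)) = hs M - (hs (M + n) - hs n)"
  by (induction M) (auto simp: hs_Suc add_ac)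
lemma sum_tt: "(\<Sum>i=1..M. 1 / (real n + real i)\<^sup>2) = hs2 (M + n) - hs2 n"
  by (induction M) (auto simp: hs2_Suc add_ac)

lemma rt_eq:
  fixes n i :: real
  assumes "0 < n" "0 < i"
  shows "1 / (i * (n + i)) = (1 / i - 1 / (n + i)) / n" "1 / (i * (n + i)\<^sup>2) = ((1 / i - 1 / (n + i)) / n - 1 / (n + i)\<^sup>2) / n"
  using assms by (simp_all add: divide_simps power2_eq_square)

lemma sum_rev_inv: fixes n :: nat shows "(\<Sum>i=1..<n. F (n - i)) = (\<Sum>i=1..<n. F i :: real)"
  by (rule sum.reindex_bij_witness[where i = "\<lambda>i. n - i" and j = "\<lambda>i. n - i"]) auto

lemma sum_inv_lt: "(\<Sum>i=1..<n. 1 / real i) = hs (n - 1)" "(\<Sum>i=1..<n. 1 / (real i)\<^sup>2) = hs2 (n - 1)" "(\<Sum>i=1..<n. 1 / (real i) ^ 3) = hs3 (n - 1)"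
  by (cases n; simp add: hs_def hs2_def hs3_def atLeastLessThanSuc_atLeastAtMost)+

lemma sum_inv_conv_lt: "(\<Sum>i=1..<n. 1 / (real i * (real n - real i))) = 2 * hs (n - 1) / real n"
proof -
  have "(\<Sum>i=1..<n. 1 / (real i * (real n - real i))) = (\<Sum>i=1..<n. (1 / real i + 1 / real (n - i)) / real n)"
    by (intro sum.cong refl) (auto simp: field_simps of_nat_diff)
  also have "\<dots> = ((\<Sum>i=1..<n. 1 / real i) + (\<Sum>i=1..<n. 1 / real (n - i))) / real n"
    by (simp only: add_divide_distrib sum.distrib sum_divide_distrib)
  also have "(\<Sum>i=1..<n. 1 / real (n - i)) = (\<Sum>i=1..<n. 1 / real i)" by (rule sum_rev_inv[where F = "\<lambda>i. 1 / real i"])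
  finally show ?thesis by (simp only: sum_inv_lt) simp
qed

definition cP :: "nat \<Rightarrow> real" where "cP n = (\<Sum>i=1..n. (hs n - hs (n - i)) / (real i)\<^sup>2)"

lemma cP_lt: "1 \<le> n \<Longrightarrow> cP n = hs n / (real n)\<^sup>2 + (\<Sum>i=1..<n. (hs n - hs (n - i)) / (real i)\<^sup>2)"
  by (cases n) (simp_all add: cP_def atLeastLessThanSuc_atLeastAtMost)

lemma cP_Suc: "cP (Suc P) = cP P + hs (Suc P) / (real (Suc P))\<^sup>2 - 2 * hs P / (real (Suc P))\<^sup>2"
proof -
  define n where "n = Suc P"
  have t: "(hs n - hs (n - i)) / (real i)\<^sup>2 = (hs P - hs (P - i)) / (real i)\<^sup>2 - 1 / real n * (1 / (real i * (real n - real i)))" if "i \<in> {1..<n}" for i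
  proof -
    have i: "1 \<le> i" "i \<le> P" using that by (auto simp: n_def)
    then have "n - i = Suc (P - i)" by (simp add: n_def)
    then have "hs n - hs (n - i) = hs P - hs (P - i) + (1 / real n - 1 / (real n - real i))"
      using i by (simp add: n_def hs_Suc of_nat_diff)
    moreover have "(1 / real n - 1 / (real n - real i)) / (real i)\<^sup>2 = - (1 / real n * (1 / (real i * (real n - real i))))"
      using i by (simp add: n_def divide_simps power2_eq_square)
    ultimately show ?thesis by (simp add: add_divide_distrib)
  qed
  have "(\<Sum>i=1..<n. (hs n - hs (n - i)) / (real i)\<^sup>2) = (\<Sum>i=1..<n. (hs P - hs (P - i)) / (real i)\<^sup>2) - 1 / real n * (\<Sum>i=1..<n. 1 / (real i * (real n - real i)))"
    unfolding sum_distrib_left sum_subtractf[symmetric] by (rule sum.cong[OF refl t])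
  also have "(\<Sum>i=1..<n. (hs P - hs (P - i)) / (real i)\<^sup>2) = cP P" by (simp add: cP_def n_def atLeastLessThanSuc_atLeastAtMost)
  finally show ?thesis using cP_lt[of n] unfolding sum_inv_conv_lt by (simp add: n_def power2_eq_square)
qed

text \<open>\<open>hs3 M\<close> and the two sums up to \<open>M\<close> are the infinite harmonic
  sums met in a residue; the terms without \<open>M\<close> are minus the value to which their
  combination tends. Both gradings need it: \<open>upper_lim\<close> at \<open>P = p\<close>, and
  \<open>pfc_zero\<close> for the odd pole \<open>p = 2 P + 1\<close>.\<close>

definition phM :: "nat \<Rightarrow> nat \<Rightarrow> real" where
  "phM P M = hs3 P - hs3 M + (\<Sum>i=1..M. (hs (P + i) - hs P) / (real i)\<^sup>2) - (\<Sum>i=1..M. (zt2 - hs2 (P + i)) / real i) - cP P + (zt2 - hs2 P) * hs P"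

lemma zt2_hs_lim: "(\<lambda>M. (zt2 - hs2 M) * hs M) \<longlonglongrightarrow> 0"
proof (rule tendsto_sandwich[OF _ _ tendsto_const small_tendsto_0[of 1 1]])
  show "\<forall>\<^sub>F M in sequentially. 0 \<le> (zt2 - hs2 M) * hs M"
    using eventually_ge_at_top[of 1]
  proof eventually_elim
    case (elim M)
    then show ?case using zt2_diff_le[OF elim] hs_nonneg[of M] by simp
  qed
  show "\<forall>\<^sub>F M in sequentially. (zt2 - hs2 M) * hs M \<le> 1 * lg M ^ 1 / real M"
    using eventually_ge_at_top[of 1]
  proof eventually_elim
    case (elim M)
    then have "(zt2 - hs2 M) * hs M \<le> 1 / real M * lg M" using zt2_diff_le[OF elim] hs_le_lg[OF elim] hs_nonneg by (intro mult_mono) auto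
    then show ?case by simp
  qed
qed

text \<open>A relation between infinite harmonic sums of weight three; it follows by induction because the increments in \<open>P\<close> are elementary.\<close>

lemma phM_lim: "phM P \<longlonglongrightarrow> 0"
proof (induction P)
  case 0
  \<comment> \<open>Summation by parts; it makes \<open>phM 0 M\<close> equal to minus
    \<open>(zt2 - hs2 M) * hs M\<close>.\<close>
  have "hs2 M * hs M = - hs3 M + (\<Sum>i=1..M. hs i / (real i)\<^sup>2) + (\<Sum>i=1..M. hs2 i / real i)" for M
  proof (induction M)
    case (Suc M)
    have "(g + r\<^sup>2) * (h + r) = g * h - r ^ 3 + (h + r) * r\<^sup>2 + (g + r\<^sup>2) * r" for g h r :: real
      by (simp add: algebra_simps power2_eq_square power3_eq_cube)
    from this[of "hs2 M" "1 / real (Suc M)" "hs M"] show ?case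
      using Suc by (simp add: hs_Suc hs2_Suc hs3_Suc power_one_over)
  qed simp
  then have "phM 0 M = - ((zt2 - hs2 M) * hs M)" for M
    by (simp add: phM_def cP_def diff_divide_distrib sum_subtractf left_diff_distrib hs_def sum_distrib_left)
  then have "phM 0 = (\<lambda>M. - ((zt2 - hs2 M) * hs M))" by blast
  then show ?case using tendsto_minus[OF zt2_hs_lim] by simp
next
  case (Suc P)
  define n where "n = Suc P"
  \<comment> \<open>The sum of \<open>1 / i - 1 / (n + i)\<close> up to \<open>M\<close>
    (\<open>sum_rt\<close>). By partial fractions, the changes of all sums over \<open>i\<close>
    from \<open>P\<close> to \<open>n\<close> reduce to it and to \<open>hs2\<close>.\<close>
  define \<eta> where "\<eta> M = hs M - (hs (M + n) - hs n)" for M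
  have n: "0 < real n" "1 \<le> n" by (simp_all add: n_def)
  have d: "phM n M = phM P M + 1 / real n ^ 3 - 1 / real n * (\<eta> M / real n) + (\<eta> M / real n - (hs2 (M + n) - hs2 n)) / real n - (cP n - cP P) + ((zt2 - hs2 n) * hs n - (zt2 - hs2 P) * hs P)" for M
  proof -
    have 1: "(\<Sum>i=1..M. (hs (n + i) - hs n) / (real i)\<^sup>2) = (\<Sum>i=1..M. (hs (P + i) - hs P) / (real i)\<^sup>2) - 1 / real n * (\<eta> M / real n)"
    proof -
      have "(\<Sum>i=1..M. (hs (n + i) - hs n) / (real i)\<^sup>2) = (\<Sum>i=1..M. (hs (P + i) - hs P) / (real i)\<^sup>2 - 1 / real n * ((1 / real i - 1 / (real n + real i)) / real n))"
      proof (rule sum.cong[OF refl])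
        fix i assume "i \<in> {1..M}"
        then have i: "0 < real i" by simp
        have "hs (n + i) - hs n = hs (P + i) - hs P + (1 / (real n + real i) - 1 / real n)" by (simp add: n_def hs_Suc)
        moreover have "(1 / (real n + real i) - 1 / real n) / (real i)\<^sup>2 = - (1 / real n * (1 / (real i * (real n + real i))))"
          using n i by (simp add: divide_simps power2_eq_square)
        ultimately show "(hs (n + i) - hs n) / (real i)\<^sup>2 = (hs (P + i) - hs P) / (real i)\<^sup>2 - 1 / real n * ((1 / real i - 1 / (real n + real i)) / real n)"
          using rt_eq(1)[OF n(1) i] by (simp add: add_divide_distrib)
      qed
      then show ?thesis by (simp only: sum_subtractf sum_distrib_left[symmetric] sum_divide_distrib[symmetric] sum_rt[unfolded sum_subtractf] \<eta>_def)
    qed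
    have 2: "(\<Sum>i=1..M. (zt2 - hs2 (n + i)) / real i) = (\<Sum>i=1..M. (zt2 - hs2 (P + i)) / real i) - (\<eta> M / real n - (hs2 (M + n) - hs2 n)) / real n"
    proof -
      have "(\<Sum>i=1..M. (zt2 - hs2 (n + i)) / real i) = (\<Sum>i=1..M. (zt2 - hs2 (P + i)) / real i - ((1 / real i - 1 / (real n + real i)) / real n - 1 / (real n + real i)\<^sup>2) / real n)"
      proof (rule sum.cong[OF refl])
        fix i assume "i \<in> {1..M}"
        then have i: "0 < real i" by simp
        have e: "zt2 - hs2 (n + i) = zt2 - hs2 (P + i) - 1 / (real n + real i)\<^sup>2" by (simp add: n_def hs2_Suc)
        have "(zt2 - hs2 (n + i)) / real i = (zt2 - hs2 (P + i)) / real i - 1 / (real i * (real n + real i)\<^sup>2)"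
          unfolding e diff_divide_distrib[of "zt2 - hs2 (P + i)"] by (simp add: mult.commute)
        then show "(zt2 - hs2 (n + i)) / real i = (zt2 - hs2 (P + i)) / real i - ((1 / real i - 1 / (real n + real i)) / real n - 1 / (real n + real i)\<^sup>2) / real n"
          using rt_eq(2)[OF n(1) i] by simp
      qed
      then show ?thesis by (simp only: sum_subtractf sum_distrib_left[symmetric] sum_divide_distrib[symmetric] sum_rt[unfolded sum_subtractf] sum_tt \<eta>_def)
    qed
    have "hs3 n = hs3 P + 1 / real n ^ 3" by (simp add: n_def hs3_Suc)
    then show ?thesis unfolding phM_def 1 2 by linarith
  qed
  have \<eta>: "\<eta> \<longlonglongrightarrow> hs n" unfolding \<eta>_def by (rule hs_shift_lim)
  have "phM n \<longlonglongrightarrow> 0 + 1 / real n ^ 3 - 1 / real n * (hs n / real n) + (hs n / real n - (zt2 - hs2 n)) / real n - (cP n - cP P) + ((zt2 - hs2 n) * hs n - (zt2 - hs2 P) * hs P)"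
    unfolding d[abs_def] using n by (intro tendsto_intros Suc \<eta> LIMSEQ_ignore_initial_segment[OF hs2_lim]) auto
  moreover have "0 + 1 / real n ^ 3 - 1 / real n * (hs n / real n) + (hs n / real n - (zt2 - hs2 n)) / real n - (cP n - cP P) + ((zt2 - hs2 n) * hs n - (zt2 - hs2 P) * hs P) = 0"
  proof -
    have c: "cP n - cP P = hs n / (real n)\<^sup>2 - 2 * hs P / (real n)\<^sup>2" unfolding n_def cP_Suc by simp
    have h: "hs n = hs P + 1 / real n" "hs2 P = hs2 n - 1 / (real n)\<^sup>2" by (simp_all add: n_def hs_Suc hs2_Suc)
    show ?thesis unfolding c h using n by (simp add: field_simps power2_eq_square power3_eq_cube)
  qed
  ultimately show ?case by (simp add: n_def)
qed

lemma hs_conv: "(\<Sum>d=1..n. (hs n - hs (n - d)) / real d) = hs2 n"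
proof (induction n)
  case (Suc P)
  define n where "n = Suc P"
  have "(\<Sum>i=1..<n. (hs n - hs (n - i)) / real i) = (\<Sum>i=1..<n. (hs P - hs (P - i)) / real i + (1 / real n * (1 / real i) - 1 / (real i * (real n - real i))))"
  proof (rule sum.cong[OF refl])
    fix i assume i: "i \<in> {1..<n}"
    then have "n - i = Suc (P - i)" by (auto simp: n_def)
    then have "hs n - hs (n - i) = hs P - hs (P - i) + (1 / real n - 1 / (real n - real i))" using i by (simp add: n_def hs_Suc of_nat_diff)
    then show "(hs n - hs (n - i)) / real i = (hs P - hs (P - i)) / real i + (1 / real n * (1 / real i) - 1 / (real i * (real n - real i)))"
      by (simp add: add_divide_distrib diff_divide_distrib mult.commute)
  qed
  also have "\<dots> = hs2 P + (1 / real n * hs P - 2 * hs P / real n)"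
    unfolding sum.distrib sum_subtractf sum_distrib_left[symmetric] sum_inv_conv_lt sum_inv_lt
    using Suc by (simp add: n_def atLeastLessThanSuc_atLeastAtMost)
  finally have "(\<Sum>i=1..<n. (hs n - hs (n - i)) / real i) = hs2 P + (1 / real n * hs P - 2 * hs P / real n)" .
  moreover have "(\<Sum>i=1..n. (hs n - hs (n - i)) / real i) = hs n / real n + (\<Sum>i=1..<n. (hs n - hs (n - i)) / real i)"
    by (simp add: n_def atLeastLessThanSuc_atLeastAtMost)
  moreover have "hs n / real n = hs P / real n + 1 / (real n)\<^sup>2" by (simp add: n_def hs_Suc add_divide_distrib power2_eq_square)
  ultimately show ?case unfolding n_def[symmetric] by (simp add: hs2_Suc n_def)
qed simp

lemma hs_conv_lt: "(\<Sum>d=1..<n. (hs (n - 1) - hs (n - d)) / real d) = hs2 (n - 1) - 2 * hs (n - 1) / real n" if "1 \<le> n"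
proof -
  have "(\<Sum>d=1..<n. (hs (n - 1) - hs (n - d)) / real d) = (\<Sum>d=1..<n. (hs (n - 1) - hs (n - 1 - d)) / real d - 1 / (real d * (real n - real d)))"
  proof (rule sum.cong[OF refl])
    fix d assume d: "d \<in> {1..<n}"
    then have "n - d = Suc (n - 1 - d)" by auto
    then have "hs (n - d) = hs (n - 1 - d) + 1 / (real n - real d)" using d by (metis atLeastLessThan_iff hs_Suc less_imp_le of_nat_diff)
    then show "(hs (n - 1) - hs (n - d)) / real d = (hs (n - 1) - hs (n - 1 - d)) / real d - 1 / (real d * (real n - real d))"
      by (simp add: diff_divide_distrib add_divide_distrib mult.commute)
  qed
  also have "\<dots> = hs2 (n - 1) - 2 * hs (n - 1) / real n"
    unfolding sum_subtractf sum_inv_conv_lt using hs_conv[of "n - 1"] that by (cases n) (simp_all add: atLeastLessThanSuc_atLeastAtMost)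
  finally show ?thesis .
qed

text \<open>With r = 1/d, t = 1/(p + d), E = s^p and S = s^d the left side is p/2 times the d-th
  term of the sum over the poles above \<open>p\<close>. Reducing every product of \<open>r\<close>
  and \<open>t\<close> by the first hypothesis sorts it into three groups: third-order sums
  (\<open>phM\<close>), elementary sums, and those summed together in \<open>A_sum\<close>.\<close>

lemma upper_algebra:
  fixes P r t iP E S L :: real
  assumes k: "P * r * t = r - t" "P * iP = 1" "E * E = 1"
  shows "P * ((- 2 * r\<^sup>2 + 2 * (E * iP - E * S * t) * r + 4 * (E * iP) * (E * S * t) + 2 * (X - Hp) * r + 2 * (E * S * t) * (X - Hp) - 2 * Z
      + 2 * (t * ((E * S - 1) * L - E * S * h' + hx - t) + iP * ((E - 1) * L - E * K + hx'))) * r) / 2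
    = P * (- (r ^ 3) + (X + t - Hp) * r\<^sup>2 - Z * r) - (r\<^sup>2 - (r - t) * iP)
      + (E * r\<^sup>2 - E * (S * r\<^sup>2) + (1 + 2 * E) * iP * (E * S * (r - t)) + L * (E * S * (r - t)) - L * (r - t) - h' * (E * S * (r - t)) - (r - t) * iP + t\<^sup>2)
      + (E * S * (r - t) * (X - Hp) + (r - t) * hx + r * ((E - 1) * L - E * K + hx'))"
proof -
  have rt: "r * t = iP * (r - t)" using k(1,2) by algebra
  have "P * ((- 2 * r\<^sup>2 + 2 * (E * iP - E * S * t) * r + 4 * (E * iP) * (E * S * t) + 2 * (X - Hp) * r + 2 * (E * S * t) * (X - Hp) - 2 * Z
      + 2 * (t * ((E * S - 1) * L - E * S * h' + hx - t) + iP * ((E - 1) * L - E * K + hx'))) * r)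
     = 2 * (- (P * r ^ 3) + E * (P * iP) * r\<^sup>2 - E * S * (P * r * t) * r + 2 * (P * iP) * (E * E) * S * (r * t) + P * (X - Hp) * r\<^sup>2 + E * S * (P * r * t) * (X - Hp) - P * Z * r
       + (P * r * t) * ((E * S - 1) * L - E * S * h' + hx - t) + (P * iP) * r * ((E - 1) * L - E * K + hx'))"
    by (simp add: algebra_simps power2_eq_square power3_eq_cube)
  then have "P * ((- 2 * r\<^sup>2 + 2 * (E * iP - E * S * t) * r + 4 * (E * iP) * (E * S * t) + 2 * (X - Hp) * r + 2 * (E * S * t) * (X - Hp) - 2 * Z
      + 2 * (t * ((E * S - 1) * L - E * S * h' + hx - t) + iP * ((E - 1) * L - E * K + hx'))) * r) / 2
     = - (P * r ^ 3) + E * (P * iP) * r\<^sup>2 - E * S * (P * r * t) * r + 2 * (P * iP) * (E * E) * S * (r * t) + P * (X - Hp) * r\<^sup>2 + E * S * (P * r * t) * (X - Hp) - P * Z * r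
       + (P * r * t) * ((E * S - 1) * L - E * S * h' + hx - t) + (P * iP) * r * ((E - 1) * L - E * K + hx')" by simp
  also have "\<dots> = - (P * r ^ 3) + E * r\<^sup>2 - E * S * (r - t) * r + 2 * S * (r * t) + P * (X - Hp) * r\<^sup>2 + E * S * (r - t) * (X - Hp) - P * Z * r
       + (r - t) * ((E * S - 1) * L - E * S * h' + hx - t) + r * ((E - 1) * L - E * K + hx')"
    unfolding k by simp
  also have "\<dots> = - (P * r ^ 3) + P * (X - Hp) * r\<^sup>2 - P * Z * r + E * r\<^sup>2 - E * S * r\<^sup>2 + E * S * (r * t) + 2 * S * (r * t) + E * S * (r - t) * (X - Hp)
       + (r - t) * ((E * S - 1) * L - E * S * h' + hx) - r * t + t\<^sup>2 + r * ((E - 1) * L - E * K + hx')"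
    by (simp add: algebra_simps power2_eq_square)
  also have "\<dots> = - (P * r ^ 3) + P * (X - Hp) * r\<^sup>2 - P * Z * r + E * r\<^sup>2 - E * S * r\<^sup>2 + E * S * (iP * (r - t)) + 2 * ((E * E) * S) * (iP * (r - t)) + E * S * (r - t) * (X - Hp)
       + (r - t) * ((E * S - 1) * L - E * S * h' + hx) - iP * (r - t) + t\<^sup>2 + r * ((E - 1) * L - E * K + hx')"
    unfolding rt k(3) by simp
  also have "\<dots> = - (P * r ^ 3) + (P * (X - Hp) * r\<^sup>2 + (P * r * t) * r) - P * Z * r - (r\<^sup>2 - r * t)
       + (E * r\<^sup>2 - E * (S * r\<^sup>2) + (1 + 2 * E) * iP * (E * S * (r - t)) + L * (E * S * (r - t)) - L * (r - t) - h' * (E * S * (r - t)) - (r - t) * iP + t\<^sup>2)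
       + (E * S * (r - t) * (X - Hp) + (r - t) * hx + r * ((E - 1) * L - E * K + hx'))"
    unfolding k(1) by (simp add: algebra_simps power2_eq_square)
  also have "r * t = (r - t) * iP" using rt by (simp add: mult.commute)
  also have "P * (X - Hp) * r\<^sup>2 + P * r * t * r = P * (X + t - Hp) * r\<^sup>2" by (simp add: algebra_simps power2_eq_square)
  finally show ?thesis by (simp add: algebra_simps)
qed

text \<open>The counterpart for the poles below \<open>p\<close>, at distance d and with t = 1/(p -
  d); the product of \<open>r\<close> and \<open>t\<close> now reduces to their sum.\<close>

lemma lower_algebra:
  fixes P r t iP E S L :: real
  assumes k: "P * r * t = r + t" "P * iP = 1" "E * E = 1"
  shows "P * ((- 2 * r\<^sup>2 + 2 * (E * S * t - E * iP) * r + 4 * (E * S * t) * (E * iP) + 2 * X * r + 2 * (E * iP) * X - 2 * Z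
      + 2 * (iP * ((E - 1) * L - E * K + hx - iP) + t * ((E * S - 1) * L - E * S * hp + hx'))) * r) / 2
    = P * (- (r ^ 3) + X * r\<^sup>2 - Z * r)
      + (E * (S * r\<^sup>2) + (1 + 2 * E) * iP * (E * S * (r + t)) - E * r\<^sup>2 + E * (X * r)
         + (r * ((E - 1) * L - iP) - E * (K * r) + r * hx) + (L * (E * S * (r + t)) - L * (r + t) - hp * (E * S * (r + t)) + r * hx' + t * hx'))"
proof -
  have rt: "r * t = iP * (r + t)" using k(1,2) by algebra
  have "P * ((- 2 * r\<^sup>2 + 2 * (E * S * t - E * iP) * r + 4 * (E * S * t) * (E * iP) + 2 * X * r + 2 * (E * iP) * X - 2 * Z
      + 2 * (iP * ((E - 1) * L - E * K + hx - iP) + t * ((E * S - 1) * L - E * S * hp + hx'))) * r)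
     = 2 * (- (P * r ^ 3) + E * S * (P * r * t) * r - E * (P * iP) * r\<^sup>2 + 2 * (P * iP) * (E * E) * S * (r * t) + P * X * r\<^sup>2 + E * (P * iP) * X * r - P * Z * r
       + (P * iP) * r * ((E - 1) * L - E * K + hx - iP) + (P * r * t) * ((E * S - 1) * L - E * S * hp + hx'))"
    by (simp add: algebra_simps power2_eq_square power3_eq_cube)
  then have "P * ((- 2 * r\<^sup>2 + 2 * (E * S * t - E * iP) * r + 4 * (E * S * t) * (E * iP) + 2 * X * r + 2 * (E * iP) * X - 2 * Z
      + 2 * (iP * ((E - 1) * L - E * K + hx - iP) + t * ((E * S - 1) * L - E * S * hp + hx'))) * r) / 2
     = - (P * r ^ 3) + E * S * (P * r * t) * r - E * (P * iP) * r\<^sup>2 + 2 * (P * iP) * (E * E) * S * (r * t) + P * X * r\<^sup>2 + E * (P * iP) * X * r - P * Z * r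
       + (P * iP) * r * ((E - 1) * L - E * K + hx - iP) + (P * r * t) * ((E * S - 1) * L - E * S * hp + hx')" by simp
  also have "\<dots> = - (P * r ^ 3) + E * S * (r + t) * r - E * r\<^sup>2 + 2 * ((E * E) * S) * (r * t) + P * X * r\<^sup>2 + E * X * r - P * Z * r
       + r * ((E - 1) * L - E * K + hx - iP) + (r + t) * ((E * S - 1) * L - E * S * hp + hx')"
    unfolding k by simp
  also have "\<dots> = P * (- (r ^ 3) + X * r\<^sup>2 - Z * r) + E * S * r\<^sup>2 + E * S * (r * t) - E * r\<^sup>2 + 2 * ((E * E) * S) * (r * t) + E * X * r
       + r * ((E - 1) * L - E * K + hx - iP) + (r + t) * ((E * S - 1) * L - E * S * hp + hx')"
    by (simp add: algebra_simps power2_eq_square)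
  also have "\<dots> = P * (- (r ^ 3) + X * r\<^sup>2 - Z * r)
      + (E * (S * r\<^sup>2) + (1 + 2 * E) * iP * (E * S * (r + t)) - E * r\<^sup>2 + E * (X * r)
         + (r * ((E - 1) * L - iP) - E * (K * r) + r * hx) + (L * (E * S * (r + t)) - L * (r + t) - hp * (E * S * (r + t)) + r * hx' + t * hx'))"
    unfolding rt by (simp add: algebra_simps power2_eq_square)
  finally show ?thesis .
qed

section \<open>The poles above p for g = 1\<close>

context sgn_grading
begin

definition h2 :: "nat \<Rightarrow> real" where "h2 n = (\<Sum>i=1..n. s ^ i / (real i)\<^sup>2)"
definition bS :: "nat \<Rightarrow> real" where "bS n = (\<Sum>c=1..n. s ^ c * hs (c - 1) / real c)"
definition xS :: "nat \<Rightarrow> nat \<Rightarrow> real" where "xS k M = (\<Sum>d=1..M. s ^ d * hs (k + d) / real d)"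
definition yS :: "nat \<Rightarrow> nat \<Rightarrow> real" where "yS k M = (\<Sum>d=1..M. h (k + d) / real d)"
text \<open>By \<open>sum_SD\<close> this is the sum over \<open>d \<le> M\<close> of s^(p + d) (1/d
  - 1/(p + d)); it converges even when \<open>h\<close> does not (\<open>DM_lim\<close>).\<close>

definition DM :: "nat \<Rightarrow> nat \<Rightarrow> real" where "DM p M = s ^ p * h M - (h (M + p) - h p)"
definition z2b :: real where "z2b = lim h2"

lemma ss': "s ^ p * (s ^ p * y) = y" unfolding mult.assoc[symmetric] s_pow_sq by simp

lemma DM_lim: "DM p \<longlonglongrightarrow> (s ^ p - 1) * Lam + h p"
proof -
  have "(\<lambda>M. (s ^ p * h M - h (M + p)) + h p) \<longlonglongrightarrow> (s ^ p - 1) * Lam + h p" by (intro tendsto_intros h_shift_lim)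
  then show ?thesis by (simp add: DM_def[abs_def] algebra_simps)
qed

lemma h2_lim: "h2 \<longlonglongrightarrow> z2b"
proof -
  have "summable (\<lambda>n. s ^ Suc n / (real (Suc n))\<^sup>2)"
  proof (rule summable_comparison_test_ev)
    show "summable (\<lambda>n. 1 / (real (Suc n))\<^sup>2)"
      using inverse_power_summable[of 2, where ?'a = real] by (subst summable_Suc_iff) (simp add: inverse_eq_divide)
    show "\<forall>\<^sub>F n in sequentially. norm (s ^ Suc n / (real (Suc n))\<^sup>2) \<le> 1 / (real (Suc n))\<^sup>2"
      by (intro always_eventually allI) (simp only: real_norm_def abs_divide s_pow_abs, simp)
  qed
  then have "(\<lambda>n. \<Sum>i<n. s ^ Suc i / (real (Suc i))\<^sup>2) \<longlonglongrightarrow> (\<Sum>n. s ^ Suc n / (real (Suc n))\<^sup>2)" by (rule summable_LIMSEQ)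
  moreover have "(\<Sum>i<n. s ^ Suc i / (real (Suc i))\<^sup>2) = h2 n" for n
    unfolding h2_def by (rule sum.reindex_bij_witness[where i = "\<lambda>i. i - 1" and j = Suc]) auto
  ultimately have "convergent h2" by (auto simp: convergent_def)
  then show ?thesis unfolding z2b_def by (simp add: convergent_LIMSEQ_iff)
qed

context
  assumes g1: "g = 1"
begin

lemma e1: "e k = 1" unfolding e_def using g1 by simp
lemma od1: "od k = 1" unfolding od_def using g1 by simp
lemma vv1: "vv k = 1 / real k" by (simp add: vv_def e1)
lemma ph1: "ph k = s ^ k / real k" by (simp add: ph_def f_def e1)
lemma H1: "H n = hs n" by (simp add: H_def vv1 hs_def)
lemma H21: "H2 n = hs2 n" by (simp add: H2_def vv1 hs2_def power_one_over)
lemma z21: "z2 = zt2" unfolding z2_def zt2_def using H21 by (metis ext)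
lemma h1_Suc: "h (Suc n) = h n + s ^ Suc n / real (Suc n)" by (simp only: h_Suc f_def e1 mult_1_right)

lemma sum_SD: "(\<Sum>d=1..M. s ^ (p + d) * (1 / real d - 1 / (real p + real d))) = DM p M"
proof (induction M)
  case (Suc M)
  then show ?case using h1_Suc[of "M + p"] h1_Suc[of M] by (simp add: DM_def power_add algebra_simps)
qed (simp add: DM_def)

lemma rt_nat: "1 \<le> n \<Longrightarrow> 1 \<le> d \<Longrightarrow> 1 / (real d * (real n + real d)) = (1 / real d - 1 / (real n + real d)) / real n"
  by (rule rt_eq(1)) auto

text \<open>Raising \<open>k\<close> to \<open>n\<close> adds terms with 1/(d(n + d)), which sum to
  \<open>DM n M / n\<close>. So the growth in \<open>M\<close> is confined to \<open>yS 0 M\<close>,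
  and the dependence on \<open>k\<close> becomes a finite sum. \<open>xS_eq\<close> does the same
  with the sign outside the inner sum.\<close>

lemma yS_eq: "yS k M = yS 0 M + (\<Sum>c=1..k. DM c M / real c)"
proof (induction k)
  case (Suc k)
  define n where "n = Suc k"
  have n1: "1 \<le> n" by (simp add: n_def)
  have "yS n M = (\<Sum>d=1..M. h (k + d) / real d + (s ^ (n + d) * (1 / real d - 1 / (real n + real d))) / real n)"
    unfolding yS_def
  proof (rule sum.cong[OF refl])
    fix d assume "d \<in> {1..M}"
    then have d: "1 \<le> d" by simp
    have "h (n + d) = h (k + d) + s ^ (n + d) / (real n + real d)" using h1_Suc[of "k + d"] by (simp add: n_def)
    then have "h (n + d) / real d = h (k + d) / real d + s ^ (n + d) * (1 / (real d * (real n + real d)))"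
      by (simp add: add_divide_distrib mult.commute)
    then show "h (n + d) / real d = h (k + d) / real d + (s ^ (n + d) * (1 / real d - 1 / (real n + real d))) / real n"
      unfolding rt_nat[OF n1 d] times_divide_eq_right .
  qed
  also have "\<dots> = yS k M + DM n M / real n" unfolding sum.distrib sum_divide_distrib[symmetric] sum_SD yS_def ..
  finally show ?case using Suc by (simp add: n_def)
qed simp

lemma xS_eq: "xS k M = xS 0 M + (\<Sum>c=1..k. s ^ c * DM c M / real c)"
proof (induction k)
  case (Suc k)
  define n where "n = Suc k"
  have n1: "1 \<le> n" by (simp add: n_def)
  have "xS n M = (\<Sum>d=1..M. s ^ d * hs (k + d) / real d + s ^ n * (s ^ (n + d) * (1 / real d - 1 / (real n + real d))) / real n)"
    unfolding xS_def
  proof (rule sum.cong[OF refl])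
    fix d assume "d \<in> {1..M}"
    then have d: "1 \<le> d" by simp
    have "hs (n + d) = hs (k + d) + 1 / (real n + real d)" using hs_Suc[of "k + d"] by (simp add: n_def)
    then have "s ^ d * hs (n + d) / real d = s ^ d * hs (k + d) / real d + s ^ d * (1 / (real d * (real n + real d)))"
      by (simp add: add_divide_distrib distrib_left mult.commute)
    also have "\<dots> = s ^ d * hs (k + d) / real d + s ^ d * (1 / real d - 1 / (real n + real d)) / real n"
      unfolding rt_nat[OF n1 d] times_divide_eq_right ..
    also have "s ^ d * (1 / real d - 1 / (real n + real d)) = s ^ n * (s ^ (n + d) * (1 / real d - 1 / (real n + real d)))"
      unfolding power_add by (simp only: mult.assoc ss')
    finally show "s ^ d * hs (n + d) / real d = s ^ d * hs (k + d) / real d + s ^ n * (s ^ (n + d) * (1 / real d - 1 / (real n + real d))) / real n" .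
  qed
  also have "\<dots> = xS k M + s ^ n * DM n M / real n"
    unfolding sum.distrib sum_divide_distrib[symmetric] sum_distrib_left[symmetric] sum_SD xS_def ..
  finally show ?case using Suc by (simp add: n_def)
qed simp

lemma xS_0: "xS 0 M = bS M + h2 M"
  unfolding xS_def bS_def h2_def sum.distrib[symmetric]
proof (rule sum.cong[OF refl])
  fix d assume "d \<in> {1..M}"
  then show "s ^ d * hs (0 + d) / real d = s ^ d * hs (d - 1) / real d + s ^ d / (real d)\<^sup>2"
    using hs_pred[of d] by (simp add: distrib_left add_divide_distrib power2_eq_square)
qed

lemma yS_0: "yS 0 M = h M * hs M - bS M"
proof (induction M)
  case (Suc M)
  have al: "y + (a + \<sigma> * r) * r = (a + \<sigma> * r) * (b + r) - (c + \<sigma> * b * r)" if "y = a * b - c" for a b c y \<sigma> r :: real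
    unfolding that by (simp add: algebra_simps)
  have 1: "yS 0 (Suc M) = yS 0 M + h (Suc M) * (1 / real (Suc M))" by (simp add: yS_def)
  have 2: "h (Suc M) = h M + s ^ Suc M * (1 / real (Suc M))" using h1_Suc[of M] by simp
  have 3: "bS (Suc M) = bS M + s ^ Suc M * hs M * (1 / real (Suc M))" by (simp add: bS_def)
  show ?case unfolding 1 3 hs_Suc 2 by (rule al[OF Suc])
qed (simp add: yS_def bS_def)

text \<open>Some of these sums diverge as \<open>M\<close> grows, and only their combination has a
  limit. A closed form for finite \<open>M\<close> keeps the cancellations exact; induction on
  \<open>M\<close> suffices because each increment is a polynomial identity in \<open>r\<close>,
  \<open>t\<close> and the previous values.\<close>

lemma A_sum:
  "(\<Sum>d=1..M. s ^ (Suc q + d) * (1 / real d - 1 / (real (Suc q) + real d)) * (hs (q + d) - hs (Suc q)) + (1 / real d - 1 / (real (Suc q) + real d)) * h d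
      + 1 / real d * ((s ^ Suc q - 1) * L - s ^ Suc q * h (Suc q + d) + h (d - 1)))
   = (s ^ Suc q + 1) * xS q M - s ^ Suc q * yS (Suc q) M + 2 * yS 0 M - h2 M - h M * hs (Suc q + M) - hs (Suc q) * DM (Suc q) M - bS (M + Suc q) + bS (Suc q) + (s ^ Suc q - 1) * L * hs M"
proof (induction M)
  case (Suc M)
  define n r t \<sigma> E X where "n = Suc M" and "r = 1 / real n" and "t = 1 / (real (Suc q) + real n)" and "\<sigma> = s ^ n" and "E = s ^ Suc q" and "X = hs (q + n)"
  have S: "s ^ (Suc q + n) = E * \<sigma>" by (simp only: E_def \<sigma>_def power_add)
  have hn: "h n = h M + \<sigma> * r" using h1_Suc[of M] by (simp add: n_def \<sigma>_def r_def)
  have 1: "xS q n = xS q M + \<sigma> * X * r" by (simp add: xS_def n_def \<sigma>_def X_def r_def)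
  have 2: "yS k n = yS k M + h (k + n) * r" for k by (simp add: yS_def n_def r_def)
  have 3: "h2 n = h2 M + \<sigma> * r * r" by (simp add: h2_def n_def \<sigma>_def r_def power2_eq_square)
  have 4: "hs (Suc q + n) = X + t" "hs (Suc q + M) = X" using hs_Suc[of "q + n"] by (simp_all add: X_def t_def n_def)
  have 5: "DM (Suc q) n = DM (Suc q) M + E * \<sigma> * (r - t)"
    using sum_SD[of "Suc q" n] sum_SD[of "Suc q" M] unfolding S[symmetric] r_def t_def by (simp add: n_def)
  have 6: "bS (n + Suc q) = bS (M + Suc q) + E * \<sigma> * X * t"
  proof -
    have "bS (Suc (M + Suc q)) = bS (M + Suc q) + s ^ Suc (M + Suc q) * hs (M + Suc q) / real (Suc (M + Suc q))" by (simp add: bS_def)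
    moreover have "s ^ Suc (M + Suc q) = E * \<sigma>" "hs (M + Suc q) = X" "1 / real (Suc (M + Suc q)) = t" "Suc (M + Suc q) = n + Suc q"
      unfolding S[symmetric] by (simp_all add: n_def X_def t_def add_ac)
    ultimately show ?thesis by (metis times_divide_eq_right mult.right_neutral)
  qed
  have 7: "hs n = hs M + r" by (simp add: n_def r_def hs_Suc)
  have al: "V + (E * \<sigma> * (r - t) * (X - Hp) + (r - t) * (hM + \<sigma> * r) + r * ((E - 1) * L - E * K + hM)) =
     (E + 1) * (x + \<sigma> * X * r) - E * (y + K * r) + 2 * (y0 + (hM + \<sigma> * r) * r) - (hh + \<sigma> * r * r) - (hM + \<sigma> * r) * (X + t) - Hp * (D + E * \<sigma> * (r - t)) - (b + E * \<sigma> * X * t) + bq + (E - 1) * L * (HM + r)"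
    if "V = (E + 1) * x - E * y + 2 * y0 - hh - hM * X - Hp * D - b + bq + (E - 1) * L * HM" for V hM K x y y0 hh D b bq Hp HM
    unfolding that by (simp add: algebra_simps)
  have "(\<Sum>d=1..n. s ^ (Suc q + d) * (1 / real d - 1 / (real (Suc q) + real d)) * (hs (q + d) - hs (Suc q)) + (1 / real d - 1 / (real (Suc q) + real d)) * h d
      + 1 / real d * ((s ^ Suc q - 1) * L - s ^ Suc q * h (Suc q + d) + h (d - 1)))
    = (\<Sum>d=1..M. s ^ (Suc q + d) * (1 / real d - 1 / (real (Suc q) + real d)) * (hs (q + d) - hs (Suc q)) + (1 / real d - 1 / (real (Suc q) + real d)) * h d
      + 1 / real d * ((s ^ Suc q - 1) * L - s ^ Suc q * h (Suc q + d) + h (d - 1)))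
      + (E * \<sigma> * (r - t) * (X - hs (Suc q)) + (r - t) * (h M + \<sigma> * r) + r * ((E - 1) * L - E * h (Suc q + n) + h M))"
  proof -
    have "n - 1 = M" by (simp add: n_def)
    then show ?thesis unfolding S[symmetric] hn[symmetric] unfolding X_def r_def t_def E_def unfolding n_def
      by (simp only: sum.cl_ivl_Suc) simp
  qed
  also have "\<dots> = (E + 1) * xS q n - E * yS (Suc q) n + 2 * yS 0 n - h2 n - h n * hs (Suc q + n) - hs (Suc q) * DM (Suc q) n - bS (n + Suc q) + bS (Suc q) + (E - 1) * L * hs n"
    unfolding 1 2 3 4(1) 5 6 7 hn add_0 by (rule al) (use Suc in \<open>unfold E_def[symmetric] 4(2)\<close>, assumption)
  finally show ?case unfolding n_def E_def .
qed (simp add: xS_def yS_def h2_def DM_def)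

text \<open>The left side collects the pairs with \<open>i + j \<le> M\<close> in the square of
  \<open>h M\<close>. The new pairs with \<open>i + j = n\<close> all have the sign
  \<open>s ^ n\<close>, and together they give \<open>2 * hs (n - 1) / n\<close>.\<close>

lemma triangle_bS: "(\<Sum>i=1..M. s ^ i / real i * h (M - i)) = 2 * bS M"
proof (induction M)
  case (Suc M)
  define n where "n = Suc M"
  have "(\<Sum>i=1..n. s ^ i / real i * h (n - i)) = (\<Sum>i=1..<n. s ^ i / real i * h (n - i))" by (simp add: n_def atLeastLessThanSuc_atLeastAtMost)
  also have "\<dots> = (\<Sum>i=1..<n. s ^ i / real i * h (M - i) + s ^ n * (1 / (real i * (real n - real i))))"
  proof (rule sum.cong[OF refl])
    fix i assume i: "i \<in> {1..<n}"
    then have ni: "n - i = Suc (M - i)" by (auto simp: n_def)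
    have "h (n - i) = h (M - i) + s ^ (n - i) / (real n - real i)" using h1_Suc[of "M - i"] i unfolding ni[symmetric] by (simp add: of_nat_diff)
    moreover have "s ^ i * s ^ (n - i) = s ^ n" using i by (simp flip: power_add)
    ultimately show "s ^ i / real i * h (n - i) = s ^ i / real i * h (M - i) + s ^ n * (1 / (real i * (real n - real i)))"
      by (simp add: distrib_left)
  qed
  also have "\<dots> = 2 * bS M + s ^ n * (2 * hs (n - 1) / real n)"
    unfolding sum.distrib sum_distrib_left[symmetric] sum_inv_conv_lt using Suc by (simp add: n_def atLeastLessThanSuc_atLeastAtMost)
  also have "\<dots> = 2 * bS n" by (simp add: bS_def n_def)
  finally show ?case by (simp add: n_def)
qed (simp add: bS_def)

text \<open>By \<open>triangle_bS\<close>, \<open>2 * bS N\<close> is the part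
  \<open>i + j \<le> N\<close> of the square of \<open>h N\<close>. The missing part is controlled
  by the alternation of \<open>h\<close>, and the resulting convolution is of order log N /
  N.\<close>

lemma bS_lim:
  assumes s: "s \<noteq> 1"
  shows "bS \<longlonglongrightarrow> Lam\<^sup>2 / 2"
proof -
  have le: "\<bar>(h N)\<^sup>2 - 2 * bS N\<bar> \<le> 2 * lg N ^ 1 / real N" if N: "1 \<le> N" for N
  proof -
    have "(h N)\<^sup>2 - 2 * bS N = (\<Sum>i=1..N. s ^ i / real i * (h N - h (N - i)))"
      unfolding triangle_bS[symmetric] right_diff_distrib sum_subtractf sum_distrib_right[symmetric]
      by (simp add: power2_eq_square h_def f_def e1)
    also have "\<bar>\<dots>\<bar> \<le> (\<Sum>i=1..N. 1 / real i * (1 / (real N - real i + 1)))"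
    proof (rule order_trans[OF sum_abs sum_mono])
      fix i assume i: "i \<in> {1..N}"
      have "\<bar>h N - h (N - i)\<bar> \<le> 1 / (real N - real i + 1)" using h_alt[OF s, of "N - i" N] i by (simp add: of_nat_diff)
      then have "\<bar>s ^ i / real i\<bar> * \<bar>h N - h (N - i)\<bar> \<le> 1 / real i * (1 / (real N - real i + 1))" by (intro mult_mono) (auto simp: abs_divide)
      then show "\<bar>s ^ i / real i * (h N - h (N - i))\<bar> \<le> 1 / real i * (1 / (real N - real i + 1))" by (simp only: abs_mult)
    qed
    also have "\<dots> = (\<Sum>l<N. 1 / ((real l + 1) * (real N - real l)))"
      by (intro sum.reindex_bij_witness[of _ "\<lambda>l. Suc l" "\<lambda>l. l - 1"]) (auto simp: of_nat_diff mult.commute)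
    also have "\<dots> \<le> 2 * lg N / real N" by (rule sum_inv_conv_le[OF N])
    finally show ?thesis by simp
  qed
  have "(\<lambda>N. \<bar>(h N)\<^sup>2 - 2 * bS N\<bar>) \<longlonglongrightarrow> 0"
  proof (rule tendsto_sandwich[OF _ _ tendsto_const small_tendsto_0[of 2 1]])
    show "\<forall>\<^sub>F N in sequentially. \<bar>(h N)\<^sup>2 - 2 * bS N\<bar> \<le> 2 * lg N ^ 1 / real N"
      using eventually_ge_at_top[of 1] by eventually_elim (rule le)
  qed simp
  then have "(\<lambda>N. (h N)\<^sup>2 - 2 * bS N) \<longlonglongrightarrow> 0" by (rule tendsto_rabs_zero_cancel)
  then have "(\<lambda>N. ((h N)\<^sup>2 - ((h N)\<^sup>2 - 2 * bS N)) / 2) \<longlonglongrightarrow> (Lam\<^sup>2 - 0) / 2" by (intro tendsto_intros h_lim[OF s]) auto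
  then show ?thesis by simp
qed

lemma hs_over_lim: "(\<lambda>M. K * hs (M + p) / (real M + 1)) \<longlonglongrightarrow> 0"
proof (rule Lim_null_comparison)
  have "(\<lambda>M. \<bar>K\<bar> * (1 + ln (real M + real p + 1)) / (real M + 1)) \<longlonglongrightarrow> 0" by real_asymp
  then show "(\<lambda>M. \<bar>K\<bar> * (1 + ln (real M + real p + 1)) / (real M + 1)) \<longlonglongrightarrow> 0" .
  show "\<forall>\<^sub>F M in sequentially. norm (K * hs (M + p) / (real M + 1)) \<le> \<bar>K\<bar> * (1 + ln (real M + real p + 1)) / (real M + 1)"
  proof (rule always_eventually, rule allI)
    fix M
    have "hs (M + p) \<le> hs (Suc (M + p))" by (rule hs_mono) simp
    also have "\<dots> \<le> 1 + ln (real M + real p + 1)" using hs_le[of "Suc (M + p)"] by (simp add: add_ac)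
    finally show "norm (K * hs (M + p) / (real M + 1)) \<le> \<bar>K\<bar> * (1 + ln (real M + real p + 1)) / (real M + 1)"
      using hs_nonneg[of "M + p"] by (auto simp: abs_mult intro!: divide_right_mono mult_left_mono)
  qed
qed

definition AL :: "nat \<Rightarrow> real" where
  "AL q = s ^ Suc q * z2b + (s ^ Suc q - 1) * Lam\<^sup>2 + bS (Suc q) + (s ^ Suc q + 1) * (\<Sum>c=1..q. s ^ c * ((s ^ c - 1) * Lam + h c) / real c)
     - s ^ Suc q * (\<Sum>c=1..Suc q. ((s ^ c - 1) * Lam + h c) / real c) - hs (Suc q) * ((s ^ Suc q - 1) * Lam + h (Suc q))"

lemma A_lim:
  "(\<lambda>M. (s ^ Suc q + 1) * xS q M - s ^ Suc q * yS (Suc q) M + 2 * yS 0 M - h2 M - h M * hs (Suc q + M) - hs (Suc q) * DM (Suc q) M - bS (M + Suc q) + bS (Suc q) + (s ^ Suc q - 1) * Lam * hs M)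
     \<longlonglongrightarrow> AL q"
proof -
  define p E where "p = Suc q" and "E = s ^ p"
  \<comment> \<open>Regrouped so that each term has a limit: a growing \<open>bS\<close> appears
    only with the factor \<open>E - 1\<close>, which is 0 for \<open>s = 1\<close>, or as a
    difference over \<open>p\<close> steps; a growing \<open>hs M\<close> only with
    \<open>(1 - E) * (h M - Lam)\<close>, or as such a difference.\<close>
  have eq: "(E + 1) * xS q M - E * yS p M + 2 * yS 0 M - h2 M - h M * hs (p + M) - hs p * DM p M - bS (M + p) + bS p + (E - 1) * Lam * hs M
    = E * h2 M + 2 * ((E - 1) * bS M) - (bS (M + p) - bS M) + (1 - E) * (h M - Lam) * hs M - h M * (hs (M + p) - hs M) + bS p
      + (E + 1) * (\<Sum>c=1..q. s ^ c * DM c M / real c) - E * (\<Sum>c=1..p. DM c M / real c) - hs p * DM p M" for M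
    unfolding xS_eq[of q] yS_eq[of p] xS_0 yS_0 by (simp add: algebra_simps)
  have 1: "(\<lambda>M. (E - 1) * bS M) \<longlonglongrightarrow> (E - 1) * Lam\<^sup>2 / 2"
  proof (cases "s = 1")
    case False
    have "(\<lambda>M. (E - 1) * bS M) \<longlonglongrightarrow> (E - 1) * (Lam\<^sup>2 / 2)" by (intro tendsto_intros bS_lim[OF False])
    then show ?thesis by simp
  qed (simp add: E_def)
  have hle: "\<bar>h M\<bar> \<le> hs M" for M
  proof -
    have "\<bar>h M\<bar> \<le> (\<Sum>i=1..M. \<bar>f i / real i\<bar>)" unfolding h_def by (rule sum_abs)
    also have "\<dots> \<le> hs M" unfolding hs_def by (intro sum_mono) (simp add: f_def e1 abs_mult)
    finally show ?thesis .
  qed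
  have 2: "(\<lambda>M. bS (M + p) - bS M) \<longlonglongrightarrow> 0"
  proof (rule Lim_null_comparison[OF _ hs_over_lim[of "real p" p]])
    show "\<forall>\<^sub>F M in sequentially. norm (bS (M + p) - bS M) \<le> real p * hs (M + p) / (real M + 1)"
    proof (rule always_eventually, rule allI)
      fix M
      have "bS (M + p) - bS M = (\<Sum>c=Suc M..M + p. s ^ c * hs (c - 1) / real c)"
        unfolding bS_def by (induction p) auto
      also have "\<bar>\<dots>\<bar> \<le> (\<Sum>c=Suc M..M + p. hs (M + p) / (real M + 1))"
      proof (rule order_trans[OF sum_abs sum_mono])
        fix c assume c: "c \<in> {Suc M..M + p}"
        have "hs (c - 1) / real c \<le> hs (M + p) / (real M + 1)" using c hs_nonneg[of "M + p"] by (intro frac_le hs_mono) auto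
        then show "\<bar>s ^ c * hs (c - 1) / real c\<bar> \<le> hs (M + p) / (real M + 1)" using hs_nonneg[of "c - 1"] by (simp add: abs_mult)
      qed
      finally show "norm (bS (M + p) - bS M) \<le> real p * hs (M + p) / (real M + 1)" by simp
    qed
  qed
  have 3: "(\<lambda>M. (1 - E) * (h M - Lam) * hs M) \<longlonglongrightarrow> 0"
  proof (cases "s = 1")
    case False
    show ?thesis
    proof (rule Lim_null_comparison[OF _ hs_over_lim[of "\<bar>1 - E\<bar>" 0]])
      show "\<forall>\<^sub>F M in sequentially. norm ((1 - E) * (h M - Lam) * hs M) \<le> \<bar>1 - E\<bar> * hs (M + 0) / (real M + 1)"
      proof (rule always_eventually, rule allI)
        fix M
        have "\<bar>h M - Lam\<bar> \<le> 1 / (real M + 1)"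
        proof (rule tendsto_upperbound[of "\<lambda>n. \<bar>h M - h n\<bar>" _ sequentially])
          show "(\<lambda>n. \<bar>h M - h n\<bar>) \<longlonglongrightarrow> \<bar>h M - Lam\<bar>" by (intro tendsto_intros h_lim[OF False])
          show "\<forall>\<^sub>F n in sequentially. \<bar>h M - h n\<bar> \<le> 1 / (real M + 1)"
            using eventually_ge_at_top[of M] by eventually_elim (use h_alt[OF False, of M] in \<open>simp add: abs_minus_commute\<close>)
        qed simp
        then have "\<bar>1 - E\<bar> * \<bar>h M - Lam\<bar> * hs M \<le> \<bar>1 - E\<bar> * (1 / (real M + 1)) * hs M"
          using hs_nonneg[of M] by (intro mult_right_mono mult_left_mono) auto
        then show "norm ((1 - E) * (h M - Lam) * hs M) \<le> \<bar>1 - E\<bar> * hs (M + 0) / (real M + 1)"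
          using hs_nonneg[of M] by (simp add: abs_mult)
      qed
    qed
  qed (simp add: E_def)
  have 4: "(\<lambda>M. h M * (hs (M + p) - hs M)) \<longlonglongrightarrow> 0"
  proof (rule Lim_null_comparison[OF _ hs_over_lim[of "real p" 0]])
    show "\<forall>\<^sub>F M in sequentially. norm (h M * (hs (M + p) - hs M)) \<le> real p * hs (M + 0) / (real M + 1)"
    proof (rule always_eventually, rule allI)
      fix M
      have "0 \<le> hs (M + p) - hs M" "hs (M + p) - hs M \<le> real p / (real M + 1)"
        using hs_mono[of M "M + p"] hs_diff_le[of M "M + p"] by simp_all
      then have "\<bar>h M\<bar> * \<bar>hs (M + p) - hs M\<bar> \<le> hs M * (real p / (real M + 1))" using hle[of M] hs_nonneg[of M] by (intro mult_mono) auto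
      then show "norm (h M * (hs (M + p) - hs M)) \<le> real p * hs (M + 0) / (real M + 1)" by (simp add: abs_mult mult.commute)
    qed
  qed
  have "(\<lambda>M. E * h2 M + 2 * ((E - 1) * bS M) - (bS (M + p) - bS M) + (1 - E) * (h M - Lam) * hs M - h M * (hs (M + p) - hs M) + bS p
      + (E + 1) * (\<Sum>c=1..q. s ^ c * DM c M / real c) - E * (\<Sum>c=1..p. DM c M / real c) - hs p * DM p M)
    \<longlonglongrightarrow> E * z2b + 2 * ((E - 1) * Lam\<^sup>2 / 2) - 0 + 0 - 0 + bS p
      + (E + 1) * (\<Sum>c=1..q. s ^ c * ((s ^ c - 1) * Lam + h c) / real c) - E * (\<Sum>c=1..p. ((s ^ c - 1) * Lam + h c) / real c) - hs p * ((s ^ p - 1) * Lam + h p)"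
    by (intro tendsto_add tendsto_diff tendsto_mult tendsto_const tendsto_sum tendsto_divide h2_lim 1 2 3 4 DM_lim) auto
  then have "(\<lambda>M. (E + 1) * xS q M - E * yS p M + 2 * yS 0 M - h2 M - h M * hs (p + M) - hs p * DM p M - bS (M + p) + bS p + (E - 1) * Lam * hs M) \<longlonglongrightarrow> AL q"
    unfolding eq AL_def p_def[symmetric] E_def[symmetric] by simp
  then show ?thesis unfolding p_def E_def .
qed

end
end

text \<open>The sum over the poles above \<open>p\<close> minus the sum over those below, after the
  third-order sums have cancelled (\<open>key\<close> in \<open>pfc_closed\<close>). The hypotheses
  reduce \<open>bS\<close>, the square of \<open>h\<close> and the convolution of \<open>kap\<close>
  to \<open>aS\<close> and \<open>tS\<close>; the limit \<open>zb\<close> of \<open>h2\<close> drops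
  out.\<close>

lemma closing_algebra:
  fixes E iP L :: real
  assumes E: "E * E = 1"
    and b: "b = H * h - h2 - a" and t: "t = (h\<^sup>2 - H2) / 2" and k: "k = a + t"
    and D: "D = (E - 1) * L + (h + E * iP)"
    and A: "A = E * zb + (E - 1) * L\<^sup>2 + (b + E * H * iP) + (E + 1) * (L * (H - h) + (t + H2)) - E * (L * ((h + E * iP) - (H + iP)) + (a + h2 + (h + E * iP) * iP)) - (H + iP) * D"
  shows "((- (iP\<^sup>2) + (H + iP) * iP + H2 - (z - (H2 + iP\<^sup>2))) - z + (H + iP) * iP + E * z - E * zb + (1 + 2 * E) * iP * D + L * D - L * (H + iP) - h * D - (H + iP) * iP + (z - (H2 + iP\<^sup>2)) + A)
     - (E * h2 + (1 + 2 * E) * iP * ((1 + E) * h) - E * H2 + E * (H2 - 2 * H * iP) + (H * ((E - 1) * L - iP) - E * k + (a + h2)) + (L * ((1 + E) * h) - L * (2 * H) - (h + E * iP) * ((1 + E) * h) + a + k))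
   = iP\<^sup>2 + 2 * (1 + E) * ((H - h) * iP + (H2 - h2)) - (2 * L\<^sup>2 + z) * (1 - E) + 4 * (L * (H - E * h) - (a - E * t))"
proof -
  have E': "E * (E * x) = x" for x unfolding mult.assoc[symmetric] E by simp
  show ?thesis unfolding A D b k t by (simp add: algebra_simps E E' power2_eq_square add_divide_distrib diff_divide_distrib)
qed

section \<open>Closed form of the coefficients for g = 1\<close>

context sgn_grading
begin

text \<open>For \<open>s = -1\<close>, \<open>aS\<close> and \<open>tS\<close> are the truncations
  of zeta(1, bar 1) and zeta(bar 1, bar 1), the inner parts of the two depth-three sums in the third
  formula.\<close>

definition aS :: "nat \<Rightarrow> real" where "aS n = (\<Sum>c=1..n. h (c - 1) / real c)"
definition tS :: "nat \<Rightarrow> real" where "tS n = (\<Sum>c=1..n. s ^ c * h (c - 1) / real c)"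
text \<open>\<open>cF p\<close> and \<open>dF p\<close> are the coefficients of \<open>1 / (p - x)\<close> and \<open>1 / (p - x)\<^sup>2\<close> in the principal part at \<open>x = p\<close>.\<close>

definition cF :: "nat \<Rightarrow> real" where
  "cF p = 2 / real p * ((1 / real p)\<^sup>2 + 2 * (1 + s ^ p) * ((hs (p - 1) - h (p - 1)) * (1 / real p) + (hs2 (p - 1) - h2 (p - 1)))
     - (2 * Lam\<^sup>2 + zt2) * (1 - s ^ p) + 4 * (Lam * (hs (p - 1) - s ^ p * h (p - 1)) - (aS (p - 1) - s ^ p * tS (p - 1))))"
definition dF :: "nat \<Rightarrow> real" where
  "dF p = (1 + 2 * s ^ p) / (real p)\<^sup>2 + 4 / real p * (hs (p - 1) - s ^ p * h (p - 1) - (1 - s ^ p) * Lam)"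

context
  assumes g1: "g = 1"
begin

lemma s_rev: "d \<le> p \<Longrightarrow> s ^ (p - d) = s ^ p * s ^ d"
proof -
  assume "d \<le> p"
  then have "s ^ p = s ^ (p - d) * s ^ d" by (simp flip: power_add)
  then have "s ^ p * s ^ d = s ^ (p - d) * (s ^ d * s ^ d)" by simp
  then show ?thesis unfolding s_pow_sq by simp
qed

lemma h_lt: "(\<Sum>d=1..<Suc q. s ^ d / real d) = h q"
  by (simp add: h_def f_def e1[OF g1] atLeastLessThanSuc_atLeastAtMost)

lemma h_rev_lt: "(\<Sum>d=1..<Suc q. s ^ Suc q * s ^ d * (1 / real (Suc q - d))) = h q"
proof -
  have "(\<Sum>d=1..<Suc q. s ^ Suc q * s ^ d * (1 / real (Suc q - d))) = (\<Sum>d=1..<Suc q. s ^ (Suc q - d) / real (Suc q - d))"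
  proof (rule sum.cong[OF refl])
    fix d assume "d \<in> {1..<Suc q}"
    then have "s ^ (Suc q - d) = s ^ Suc q * s ^ d" by (intro s_rev) simp
    then show "s ^ Suc q * s ^ d * (1 / real (Suc q - d)) = s ^ (Suc q - d) / real (Suc q - d)" by (simp only: times_divide_eq_right mult_1_right)
  qed
  also have "\<dots> = (\<Sum>d=1..<Suc q. s ^ d / real d)" by (rule sum_rev_inv[where F = "\<lambda>d. s ^ d / real d"])
  finally show ?thesis unfolding h_lt .
qed

lemma ES_sum: "(\<Sum>d=1..<Suc q. s ^ Suc q * s ^ d * (1 / real d + 1 / real (Suc q - d))) = (1 + s ^ Suc q) * h q"
proof -
  have "(\<Sum>d=1..<Suc q. s ^ Suc q * s ^ d * (1 / real d + 1 / real (Suc q - d))) = s ^ Suc q * (\<Sum>d=1..<Suc q. s ^ d / real d) + (\<Sum>d=1..<Suc q. s ^ Suc q * s ^ d * (1 / real (Suc q - d)))"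
    unfolding sum_distrib_left sum.distrib[symmetric] by (intro sum.cong refl) (simp only: distrib_left mult.assoc times_divide_eq_right mult_1_right)
  then show ?thesis unfolding h_lt h_rev_lt by (simp add: algebra_simps)
qed

text \<open>A convolution met among the poles below \<open>p\<close>, where two indices add up to
  \<open>p\<close>. Since 1/(d(p - d)) = (1/d + 1/(p - d))/p, its increment in \<open>q\<close> is
  the sum \<open>ES_sum\<close> divided by \<open>p\<close>.\<close>

lemma kap: "(\<Sum>d=1..<Suc q. h (q - d) * (1 / real d)) = aS q + tS q"
proof (induction q)
  case (Suc q)
  define p where "p = Suc q"
  have "(\<Sum>d=1..<Suc p. h (p - d) * (1 / real d)) = (\<Sum>d=1..<p. h (p - d) * (1 / real d))" by (simp add: p_def)
  also have "\<dots> = (\<Sum>d=1..<p. h (q - d) * (1 / real d) + s ^ p * s ^ d * (1 / real d + 1 / real (p - d)) * (1 / real p))"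
  proof (rule sum.cong[OF refl])
    fix d assume d: "d \<in> {1..<p}"
    then have pd: "p - d = Suc (q - d)" by (auto simp: p_def)
    have rt: "1 / real (p - d) * (1 / real d) = (1 / real d + 1 / real (p - d)) * (1 / real p)" using d by (simp add: field_simps of_nat_diff)
    have "h (p - d) = h (q - d) + s ^ (p - d) / real (p - d)" unfolding pd using h1_Suc[OF g1, of "q - d"] .
    also have "s ^ (p - d) = s ^ p * s ^ d" using d by (intro s_rev) simp
    finally have "h (p - d) * (1 / real d) = h (q - d) * (1 / real d) + s ^ p * s ^ d * (1 / real (p - d) * (1 / real d))" by (simp add: add_divide_distrib)
    then show "h (p - d) * (1 / real d) = h (q - d) * (1 / real d) + s ^ p * s ^ d * (1 / real d + 1 / real (p - d)) * (1 / real p)"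
      unfolding rt by (simp only: mult.assoc)
  qed
  also have "\<dots> = aS q + tS q + (1 + s ^ p) * h q * (1 / real p)"
    unfolding sum.distrib sum_distrib_right[symmetric] p_def ES_sum Suc ..
  also have "\<dots> = aS p + tS p" by (simp add: aS_def tS_def p_def algebra_simps add_divide_distrib)
  finally show ?case by (simp add: p_def)
qed (simp add: aS_def tS_def)

lemma tS_eq: "tS q = ((h q)\<^sup>2 - hs2 q) / 2"
proof (induction q)
  case (Suc q)
  have "tS (Suc q) = tS q + s ^ Suc q * h q / real (Suc q)" by (simp add: tS_def)
  moreover have "(h (Suc q))\<^sup>2 = (h q)\<^sup>2 + 2 * (s ^ Suc q * h q / real (Suc q)) + 1 / (real (Suc q))\<^sup>2"
    unfolding h1_Suc[OF g1] using s_pow_sq[of "Suc q"] by (simp only: power2_sum power_divide power2_eq_square[of "s ^ Suc q"]) simp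
  moreover have "(t + y) = (H + 2 * y + z - (b + z)) / 2" if "t = (H - b) / 2" for t y H z b :: real using that by simp
  ultimately show ?case using Suc unfolding hs2_Suc by presburger
qed (simp add: tS_def)

lemma sum_h_over: "(\<Sum>c=1..q. h c / real c) = aS q + h2 q"
proof (induction q)
  case (Suc q)
  then show ?case using h1_Suc[OF g1, of q] by (simp add: aS_def h2_def add_divide_distrib power2_eq_square)
qed (simp add: aS_def h2_def)

lemma sum_sh_over: "(\<Sum>c=1..q. s ^ c * h c / real c) = tS q + hs2 q"
proof (induction q)
  case (Suc q)
  have "s ^ Suc q * h (Suc q) = s ^ Suc q * h q + 1 / real (Suc q)"
    unfolding h1_Suc[OF g1] distrib_left times_divide_eq_right s_pow_sq ..
  then have "s ^ Suc q * h (Suc q) / real (Suc q) = s ^ Suc q * h q / real (Suc q) + 1 / (real (Suc q))\<^sup>2"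
    by (simp add: add_divide_distrib power2_eq_square)
  then show ?case using Suc by (simp add: tS_def hs2_Suc)
qed (simp add: tS_def)

lemma bS_eq: "bS q = hs q * h q - h2 q - aS q"
  using yS_0[OF g1, of q] sum_h_over[of q] by (simp add: yS_def mult.commute)

lemma AL_eq:
  fixes q :: nat
  defines "p \<equiv> Suc q"
  shows "AL q = s ^ p * z2b + (s ^ p - 1) * Lam\<^sup>2 + (bS q + s ^ p * hs q * (1 / real p)) + (s ^ p + 1) * (Lam * (hs q - h q) + (tS q + hs2 q))
     - s ^ p * (Lam * ((h q + s ^ p * (1 / real p)) - (hs q + 1 / real p)) + (aS q + h2 q + (h q + s ^ p * (1 / real p)) * (1 / real p)))
     - (hs q + 1 / real p) * ((s ^ p - 1) * Lam + (h q + s ^ p * (1 / real p)))"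
proof -
  have hp: "h p = h q + s ^ p * (1 / real p)" and hsp: "hs p = hs q + 1 / real p" using h1_Suc[OF g1, of q] by (simp_all add: p_def hs_Suc)
  have bp: "bS p = bS q + s ^ p * hs q * (1 / real p)" by (simp add: bS_def p_def)
  have h': "(\<Sum>c=1..n. s ^ c / real c) = h n" for n by (simp add: h_def f_def e1[OF g1])
  have 1: "(\<Sum>c=1..q. s ^ c * ((s ^ c - 1) * Lam + h c) / real c) = Lam * (hs q - h q) + (tS q + hs2 q)"
  proof -
    have "(\<Sum>c=1..q. s ^ c * ((s ^ c - 1) * Lam + h c) / real c) = (\<Sum>c=1..q. Lam * (1 / real c) - Lam * (s ^ c / real c) + s ^ c * h c / real c)"
    proof (rule sum.cong[OF refl])
      fix c
      have "s ^ c * ((s ^ c - 1) * Lam + h c) = (s ^ c * s ^ c) * Lam - s ^ c * Lam + s ^ c * h c" by (simp add: algebra_simps)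
      then show "s ^ c * ((s ^ c - 1) * Lam + h c) / real c = Lam * (1 / real c) - Lam * (s ^ c / real c) + s ^ c * h c / real c"
        unfolding s_pow_sq by (simp add: add_divide_distrib diff_divide_distrib mult.commute)
    qed
    then show ?thesis unfolding sum.distrib sum_subtractf sum_distrib_left[symmetric] h' sum_sh_over hs_def[symmetric] by (simp add: right_diff_distrib)
  qed
  have 2: "(\<Sum>c=1..p. ((s ^ c - 1) * Lam + h c) / real c) = Lam * (h p - hs p) + (aS q + h2 q + h p * (1 / real p))"
  proof -
    have "(\<Sum>c=1..p. ((s ^ c - 1) * Lam + h c) / real c) = (\<Sum>c=1..p. Lam * (s ^ c / real c) - Lam * (1 / real c) + h c / real c)"
      by (intro sum.cong refl) (simp add: add_divide_distrib diff_divide_distrib right_diff_distrib mult.commute)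
    also have "\<dots> = Lam * h p - Lam * hs p + (\<Sum>c=1..p. h c / real c)"
      unfolding sum.distrib sum_subtractf sum_distrib_left[symmetric] h' hs_def[symmetric] ..
    also have "(\<Sum>c=1..p. h c / real c) = aS q + h2 q + h p * (1 / real p)" using sum_h_over[of q] by (simp add: p_def)
    finally show ?thesis by (simp add: right_diff_distrib)
  qed
  show ?thesis unfolding AL_def[OF g1] p_def[symmetric] 1 2 unfolding bp hp hsp ..
qed

text \<open>The poles above \<open>p\<close>: \<open>phM_lim\<close> evaluates the third-order sums,
  \<open>A_lim\<close> the coupled ones, and the elementary rest converges through \<open>DM\<close>
  and \<open>\<eta>\<close>.\<close>

lemma upper_lim:
  fixes q :: nat
  defines "p \<equiv> Suc q"
  defines "D \<equiv> (s ^ p - 1) * Lam + h p"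
  shows "(\<lambda>M. \<Sum>d=1..M. GtL p (p + d) / real d) \<longlonglongrightarrow> 2 / real p * (real p * (- hs3 p + cP p - (zt2 - hs2 p) * hs p) - zt2 + hs p * (1 / real p) + s ^ p * zt2 - s ^ p * z2b
     + (1 + 2 * s ^ p) * (1 / real p) * D + Lam * D - Lam * hs p - h q * D - hs p * (1 / real p) + (zt2 - hs2 p) + AL q)"
proof -
  define E iP where "E = s ^ p" and "iP = 1 / real p"
  define \<eta> where "\<eta> M = hs M - (hs (M + p) - hs p)" for M
  define A where "A M = (E + 1) * xS q M - E * yS p M + 2 * yS 0 M - h2 M - h M * hs (p + M) - hs p * DM p M - bS (M + p) + bS p + (E - 1) * Lam * hs M" for M
  have P0: "real p * iP = 1" by (simp add: iP_def p_def)
  have trm: "real p * (GtL p (p + d) / real d) / 2 =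
     real p * (- ((1 / real d) ^ 3) + (hs (p + d) - hs p) * (1 / real d)\<^sup>2 - (zt2 - hs2 (p + d)) * (1 / real d)) - ((1 / real d)\<^sup>2 - (1 / real d - 1 / (real p + real d)) * iP)
      + (E * (1 / real d)\<^sup>2 - E * (s ^ d * (1 / real d)\<^sup>2) + (1 + 2 * E) * iP * (s ^ (p + d) * (1 / real d - 1 / (real p + real d))) + Lam * (s ^ (p + d) * (1 / real d - 1 / (real p + real d))) - Lam * (1 / real d - 1 / (real p + real d))
         - h q * (s ^ (p + d) * (1 / real d - 1 / (real p + real d))) - (1 / real d - 1 / (real p + real d)) * iP + (1 / (real p + real d))\<^sup>2)
      + (s ^ (p + d) * (1 / real d - 1 / (real p + real d)) * (hs (q + d) - hs p) + (1 / real d - 1 / (real p + real d)) * h d + 1 / real d * ((E - 1) * Lam - E * h (p + d) + h (d - 1)))"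
    if d: "1 \<le> d" for d
  proof -
    define r t S where "r = 1 / real d" and "t = 1 / (real p + real d)" and "S = s ^ d"
    have k: "real p * r * t = r - t" using d by (simp add: r_def t_def p_def divide_simps)
    have ES: "s ^ (p + d) = E * S" by (simp add: E_def S_def power_add)
    have php: "ph p = E * iP" and phm: "ph (p + d) = E * S * t" using ph1[OF g1] ES by (simp_all add: E_def iP_def t_def)
    have X: "hs (p + d) = hs (q + d) + t" using hs_Suc[of "q + d"] by (simp add: p_def t_def)
    have m: "real (p + d) - real p = real d" "p + d - 1 = q + d" "p + d - p = d" "p - 1 = q" "p + d - p - 1 = d - 1" by (simp_all add: p_def)
    have "GtL p (p + d) = - 2 * r\<^sup>2 + 2 * (E * iP - E * S * t) * r + 4 * (E * iP) * (E * S * t) + 2 * (hs (q + d) - hs p) * r + 2 * (E * S * t) * (hs (q + d) - hs p) - 2 * (zt2 - hs2 (p + d))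
      + 2 * (t * ((E * S - 1) * Lam - E * S * h q + h d - t) + iP * ((E - 1) * Lam - E * h (p + d) + h (d - 1)))"
      unfolding GtL_def GCL_def m php phm vv1[OF g1] H1[OF g1] H21[OF g1] z21[OF g1] ES E_def[symmetric]
      by (simp add: r_def t_def iP_def power_one_over)
    then have "real p * (GtL p (p + d) / real d) / 2 = real p * ((- 2 * r\<^sup>2 + 2 * (E * iP - E * S * t) * r + 4 * (E * iP) * (E * S * t) + 2 * (hs (q + d) - hs p) * r + 2 * (E * S * t) * (hs (q + d) - hs p) - 2 * (zt2 - hs2 (p + d))
      + 2 * (t * ((E * S - 1) * Lam - E * S * h q + h d - t) + iP * ((E - 1) * Lam - E * h (p + d) + h (d - 1)))) * r) / 2"
      by (simp add: r_def)
    also note upper_algebra[OF k P0 s_pow_sq[of p, folded E_def]]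
    finally show ?thesis unfolding ES unfolding X S_def[symmetric] r_def[symmetric] t_def[symmetric] .
  qed
  have sum: "real p * (\<Sum>d=1..M. GtL p (p + d) / real d) / 2 = real p * (phM p M - hs3 p + cP p - (zt2 - hs2 p) * hs p) - (hs2 M - \<eta> M * iP)
     + (E * hs2 M - E * h2 M + (1 + 2 * E) * iP * DM p M + Lam * DM p M - Lam * \<eta> M - h q * DM p M - \<eta> M * iP + (hs2 (M + p) - hs2 p)) + A M" for M
  proof -
    have i: "(\<Sum>d=1..M. (1 / real d)\<^sup>2) = hs2 M" "(\<Sum>d=1..M. s ^ d * (1 / real d)\<^sup>2) = h2 M" "(\<Sum>d=1..M. (1 / (real p + real d))\<^sup>2) = hs2 (M + p) - hs2 p"
      using sum_tt[of p M] by (simp_all add: hs2_def h2_def power_one_over)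
    have j: "(\<Sum>d=1..M. - ((1 / real d) ^ 3) + (hs (p + d) - hs p) * (1 / real d)\<^sup>2 - (zt2 - hs2 (p + d)) * (1 / real d)) = phM p M - hs3 p + cP p - (zt2 - hs2 p) * hs p"
      unfolding phM_def hs3_def[of M] by (simp add: sum.distrib sum_subtractf sum_negf power_one_over)
    have "real p * (\<Sum>d=1..M. GtL p (p + d) / real d) / 2 = (\<Sum>d=1..M. real p * (GtL p (p + d) / real d) / 2)"
      by (simp only: sum_distrib_left sum_divide_distrib)
    also have "\<dots> = real p * (\<Sum>d=1..M. - ((1 / real d) ^ 3) + (hs (p + d) - hs p) * (1 / real d)\<^sup>2 - (zt2 - hs2 (p + d)) * (1 / real d)) - ((\<Sum>d=1..M. (1 / real d)\<^sup>2) - (\<Sum>d=1..M. 1 / real d - 1 / (real p + real d)) * iP)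
      + (E * (\<Sum>d=1..M. (1 / real d)\<^sup>2) - E * (\<Sum>d=1..M. s ^ d * (1 / real d)\<^sup>2) + (1 + 2 * E) * iP * (\<Sum>d=1..M. s ^ (p + d) * (1 / real d - 1 / (real p + real d))) + Lam * (\<Sum>d=1..M. s ^ (p + d) * (1 / real d - 1 / (real p + real d))) - Lam * (\<Sum>d=1..M. 1 / real d - 1 / (real p + real d))
         - h q * (\<Sum>d=1..M. s ^ (p + d) * (1 / real d - 1 / (real p + real d))) - (\<Sum>d=1..M. 1 / real d - 1 / (real p + real d)) * iP + (\<Sum>d=1..M. (1 / (real p + real d))\<^sup>2))
      + (\<Sum>d=1..M. s ^ (p + d) * (1 / real d - 1 / (real p + real d)) * (hs (q + d) - hs p) + (1 / real d - 1 / (real p + real d)) * h d + 1 / real d * ((E - 1) * Lam - E * h (p + d) + h (d - 1)))"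
      unfolding sum_distrib_left sum_distrib_right sum.distrib[symmetric] sum_subtractf[symmetric]
      by (rule sum.cong[OF refl]) (use trm in simp)
    also have "(\<Sum>d=1..M. s ^ (p + d) * (1 / real d - 1 / (real p + real d)) * (hs (q + d) - hs p) + (1 / real d - 1 / (real p + real d)) * h d + 1 / real d * ((E - 1) * Lam - E * h (p + d) + h (d - 1))) = A M"
      unfolding A_def E_def p_def by (rule A_sum[OF g1])
    finally show ?thesis unfolding i j sum_SD[OF g1] sum_rt \<eta>_def[symmetric] .
  qed
  have lA: "A \<longlonglongrightarrow> AL q" unfolding A_def E_def p_def by (rule A_lim[OF g1])
  have l\<eta>: "\<eta> \<longlonglongrightarrow> hs p" unfolding \<eta>_def by (rule hs_shift_lim)
  have lD: "DM p \<longlonglongrightarrow> D" unfolding D_def by (rule DM_lim)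
  have "(\<lambda>M. real p * (phM p M - hs3 p + cP p - (zt2 - hs2 p) * hs p) - (hs2 M - \<eta> M * iP)
     + (E * hs2 M - E * h2 M + (1 + 2 * E) * iP * DM p M + Lam * DM p M - Lam * \<eta> M - h q * DM p M - \<eta> M * iP + (hs2 (M + p) - hs2 p)) + A M)
     \<longlonglongrightarrow> real p * (0 - hs3 p + cP p - (zt2 - hs2 p) * hs p) - (zt2 - hs p * iP)
     + (E * zt2 - E * z2b + (1 + 2 * E) * iP * D + Lam * D - Lam * hs p - h q * D - hs p * iP + (zt2 - hs2 p)) + AL q"
    by (intro tendsto_intros phM_lim hs2_lim LIMSEQ_ignore_initial_segment[OF hs2_lim] h2_lim lA l\<eta> lD)
  then have "(\<lambda>M. real p * (\<Sum>d=1..M. GtL p (p + d) / real d) / 2) \<longlonglongrightarrow> real p * (0 - hs3 p + cP p - (zt2 - hs2 p) * hs p) - (zt2 - hs p * iP)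
     + (E * zt2 - E * z2b + (1 + 2 * E) * iP * D + Lam * D - Lam * hs p - h q * D - hs p * iP + (zt2 - hs2 p)) + AL q"
    unfolding sum .
  from tendsto_mult_left[OF this, of "2 * iP"]
  have "(\<lambda>M. 2 * iP * (real p * (\<Sum>d=1..M. GtL p (p + d) / real d) / 2)) \<longlonglongrightarrow> 2 * iP * (real p * (0 - hs3 p + cP p - (zt2 - hs2 p) * hs p) - (zt2 - hs p * iP)
     + (E * zt2 - E * z2b + (1 + 2 * E) * iP * D + Lam * D - Lam * hs p - h q * D - hs p * iP + (zt2 - hs2 p)) + AL q)" .
  moreover have "2 * iP * (real p * y / 2) = y" for y using P0 by (simp add: mult.assoc[symmetric] mult.commute)
  moreover have "2 * iP * (real p * (0 - hs3 p + cP p - (zt2 - hs2 p) * hs p) - (zt2 - hs p * iP)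
     + (E * zt2 - E * z2b + (1 + 2 * E) * iP * D + Lam * D - Lam * hs p - h q * D - hs p * iP + (zt2 - hs2 p)) + AL q) =
     2 / real p * (real p * (- hs3 p + cP p - (zt2 - hs2 p) * hs p) - zt2 + hs p * (1 / real p) + s ^ p * zt2 - s ^ p * z2b
     + (1 + 2 * s ^ p) * (1 / real p) * D + Lam * D - Lam * hs p - h q * D - hs p * (1 / real p) + (zt2 - hs2 p) + AL q)"
  proof -
    have c: "2 / real p = 2 * iP" by (simp add: iP_def)
    show ?thesis unfolding c iP_def[symmetric] E_def[symmetric] by (simp only: add_diff_eq diff_diff_eq2 diff_0 add.assoc) (simp add: algebra_simps)
  qed
  ultimately show ?thesis by (simp only:)
qed

text \<open>The poles below \<open>p\<close>, enumerated by the distance \<open>d = p - j\<close>.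
  The sums are finite, and those that mix \<open>d\<close> with \<open>p - d\<close> are
  convolutions, evaluated by \<open>hs_conv_lt\<close>, \<open>ES_sum\<close> and
  \<open>kap\<close>.\<close>

lemma lower_sum:
  fixes q :: nat
  defines "p \<equiv> Suc q"
  shows "(\<Sum>j=1..<p. GtL j p / (real p - real j)) = 2 / real p * (real p * (- hs3 q + (\<Sum>d=1..<p. (hs q - hs (p - d)) / (real d)\<^sup>2) - (zt2 - hs2 p) * hs q)
     + (s ^ p * h2 q + (1 + 2 * s ^ p) * (1 / real p) * ((1 + s ^ p) * h q) - s ^ p * hs2 q + s ^ p * (hs2 q - 2 * hs q * (1 / real p)) + (hs q * ((s ^ p - 1) * Lam - 1 / real p) - s ^ p * (aS q + tS q) + (aS q + h2 q))
        + (Lam * ((1 + s ^ p) * h q) - Lam * (2 * hs q) - h p * ((1 + s ^ p) * h q) + aS q + (aS q + tS q))))"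
proof -
  define E iP where "E = s ^ p" and "iP = 1 / real p"
  have P0: "real p * iP = 1" by (simp add: iP_def p_def)
  have trm: "real p * (GtL (p - d) p / real d) / 2 = real p * (- ((1 / real d) ^ 3) + (hs q - hs (p - d)) * (1 / real d)\<^sup>2 - (zt2 - hs2 p) * (1 / real d))
      + (E * (s ^ d * (1 / real d)\<^sup>2) + (1 + 2 * E) * iP * (E * s ^ d * (1 / real d + 1 / real (p - d))) - E * (1 / real d)\<^sup>2 + E * ((hs q - hs (p - d)) * (1 / real d))
         + (1 / real d * ((E - 1) * Lam - iP) - E * (h (q - d) * (1 / real d)) + 1 / real d * h d)
         + (Lam * (E * s ^ d * (1 / real d + 1 / real (p - d))) - Lam * (1 / real d + 1 / real (p - d)) - h p * (E * s ^ d * (1 / real d + 1 / real (p - d))) + 1 / real d * h (d - 1) + 1 / real (p - d) * h (d - 1)))"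
    if "d \<in> {1..<p}" for d
  proof -
    have d: "1 \<le> d" "d < p" using that by auto
    define r t S where "r = 1 / real d" and "t = 1 / real (p - d)" and "S = s ^ d"
    have k: "real p * r * t = r + t" using d by (simp add: r_def t_def divide_simps of_nat_diff)
    have ES: "s ^ (p - d) = E * S" using s_rev[of d p] d by (simp add: E_def S_def)
    have php: "ph p = E * iP" and phm: "ph (p - d) = E * S * t" using ph1[OF g1] ES by (simp_all add: E_def iP_def t_def)
    have m: "real p - real (p - d) = real d" "p - 1 = q" "p - (p - d) = d" "p - d - 1 = q - d" using d by (auto simp: p_def of_nat_diff)
    have "GtL (p - d) p = - 2 * r\<^sup>2 + 2 * (E * S * t - E * iP) * r + 4 * (E * S * t) * (E * iP) + 2 * (hs q - hs (p - d)) * r + 2 * (E * iP) * (hs q - hs (p - d)) - 2 * (zt2 - hs2 p)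
      + 2 * (iP * ((E - 1) * Lam - E * h (q - d) + h d - iP) + t * ((E * S - 1) * Lam - E * S * h p + h (d - 1)))"
      unfolding GtL_def GCL_def m php phm vv1[OF g1] H1[OF g1] H21[OF g1] z21[OF g1] ES E_def[symmetric]
      by (simp add: r_def t_def iP_def power_one_over)
    then have "real p * (GtL (p - d) p / real d) / 2 = real p * ((- 2 * r\<^sup>2 + 2 * (E * S * t - E * iP) * r + 4 * (E * S * t) * (E * iP) + 2 * (hs q - hs (p - d)) * r + 2 * (E * iP) * (hs q - hs (p - d)) - 2 * (zt2 - hs2 p)
      + 2 * (iP * ((E - 1) * Lam - E * h (q - d) + h d - iP) + t * ((E * S - 1) * Lam - E * S * h p + h (d - 1)))) * r) / 2"
      by (simp add: r_def)
    also note lower_algebra[OF k P0 s_pow_sq[of p, folded E_def]]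
    finally show ?thesis unfolding S_def[symmetric] r_def[symmetric] t_def[symmetric] .
  qed
  have i: "(\<Sum>d=1..<p. (1 / real d) ^ 3) = hs3 q" "(\<Sum>d=1..<p. (1 / real d)\<^sup>2) = hs2 q" "(\<Sum>d=1..<p. s ^ d * (1 / real d)\<^sup>2) = h2 q" "(\<Sum>d=1..<p. 1 / real d) = hs q"
    using sum_inv_lt[of p] by (simp_all add: p_def power_one_over h2_def atLeastLessThanSuc_atLeastAtMost)
  have j: "(\<Sum>d=1..<p. - ((1 / real d) ^ 3) + (hs q - hs (p - d)) * (1 / real d)\<^sup>2 - (zt2 - hs2 p) * (1 / real d)) = - hs3 q + (\<Sum>d=1..<p. (hs q - hs (p - d)) / (real d)\<^sup>2) - (zt2 - hs2 p) * hs q"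
    unfolding sum.distrib sum_subtractf sum_negf i sum_distrib_left[symmetric] by (simp add: power_one_over)
  have es: "(\<Sum>d=1..<p. E * s ^ d * (1 / real d + 1 / real (p - d))) = (1 + E) * h q" unfolding E_def p_def by (rule ES_sum)
  have two: "(\<Sum>d=1..<p. 1 / real d + 1 / real (p - d)) = 2 * hs q"
    unfolding sum.distrib sum_rev_inv[where F = "\<lambda>d. 1 / real d"] i by simp
  have hc: "(\<Sum>d=1..<p. (hs q - hs (p - d)) * (1 / real d)) = hs2 q - 2 * hs q * iP" using hs_conv_lt[of p] by (simp add: p_def iP_def)
  have kp: "(\<Sum>d=1..<p. h (q - d) * (1 / real d)) = aS q + tS q" unfolding p_def by (rule kap)
  have a1: "(\<Sum>d=1..<p. 1 / real d * h (d - 1)) = aS q" by (simp add: aS_def p_def atLeastLessThanSuc_atLeastAtMost)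
  have a2: "(\<Sum>d=1..<p. 1 / real d * h d) = aS q + h2 q" using sum_h_over[of q] by (simp add: p_def atLeastLessThanSuc_atLeastAtMost)
  have kp': "(\<Sum>d=1..<p. 1 / real (p - d) * h (d - 1)) = aS q + tS q"
  proof -
    have "(\<Sum>d=1..<p. 1 / real (p - d) * h (d - 1)) = (\<Sum>d=1..<p. (\<lambda>d. h (q - d) * (1 / real d)) (p - d))"
    proof (rule sum.cong[OF refl])
      fix d assume "d \<in> {1..<p}"
      then have "q - (p - d) = d - 1" by (auto simp: p_def)
      then show "1 / real (p - d) * h (d - 1) = h (q - (p - d)) * (1 / real (p - d))" by simp
    qed
    also have "\<dots> = (\<Sum>d=1..<p. h (q - d) * (1 / real d))" by (rule sum_rev_inv)
    finally show ?thesis unfolding kp .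
  qed
  have "(\<Sum>j=1..<p. GtL j p / (real p - real j)) = (\<Sum>d=1..<p. GtL (p - d) p / real d)"
    by (rule sum.reindex_bij_witness[where i = "\<lambda>d. p - d" and j = "\<lambda>j. p - j"]) (auto simp: of_nat_diff)
  also have "\<dots> = 2 / real p * (\<Sum>d=1..<p. real p * (GtL (p - d) p / real d) / 2)"
    unfolding sum_distrib_left by (intro sum.cong refl) (simp add: p_def)
  also have "(\<Sum>d=1..<p. real p * (GtL (p - d) p / real d) / 2) = real p * (\<Sum>d=1..<p. - ((1 / real d) ^ 3) + (hs q - hs (p - d)) * (1 / real d)\<^sup>2 - (zt2 - hs2 p) * (1 / real d))
      + (E * (\<Sum>d=1..<p. s ^ d * (1 / real d)\<^sup>2) + (1 + 2 * E) * iP * (\<Sum>d=1..<p. E * s ^ d * (1 / real d + 1 / real (p - d))) - E * (\<Sum>d=1..<p. (1 / real d)\<^sup>2) + E * (\<Sum>d=1..<p. (hs q - hs (p - d)) * (1 / real d))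
         + ((\<Sum>d=1..<p. 1 / real d) * ((E - 1) * Lam - iP) - E * (\<Sum>d=1..<p. h (q - d) * (1 / real d)) + (\<Sum>d=1..<p. 1 / real d * h d))
         + (Lam * (\<Sum>d=1..<p. E * s ^ d * (1 / real d + 1 / real (p - d))) - Lam * (\<Sum>d=1..<p. 1 / real d + 1 / real (p - d)) - h p * (\<Sum>d=1..<p. E * s ^ d * (1 / real d + 1 / real (p - d))) + (\<Sum>d=1..<p. 1 / real d * h (d - 1)) + (\<Sum>d=1..<p. 1 / real (p - d) * h (d - 1))))"
    unfolding sum_distrib_left sum_distrib_right sum.distrib[symmetric] sum_subtractf[symmetric]
    by (rule sum.cong[OF refl trm])
  finally show ?thesis unfolding i(2,3,4) j es two hc kp a1 a2 kp' unfolding E_def iP_def .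
qed

theorem pfc_closed:
  assumes p: "1 \<le> p"
  shows "(\<lambda>N. pfc (Gt N) p N) \<longlonglongrightarrow> cF p"
proof -
  define q where "q = p - 1"
  have pq: "p = Suc q" using p by (simp add: q_def)
  note U = upper_lim[of q, folded pq]
  have "(\<lambda>M. \<Sum>d=1..M. GtL p (p + d) / real d) = (\<lambda>M. \<Sum>k<M. od (p + Suc k) * GtL p (p + Suc k) / real (Suc k))"
  proof
    fix M
    show "(\<Sum>d=1..M. GtL p (p + d) / real d) = (\<Sum>k<M. od (p + Suc k) * GtL p (p + Suc k) / real (Suc k))"
      by (rule sum.reindex_bij_witness[where i = Suc and j = "\<lambda>d. d - 1"]) (auto simp: od1[OF g1])
  qed
  with U summable_LIMSEQ[OF pfc_lim(1)[OF p]] have e: "(\<Sum>k. od (p + Suc k) * GtL p (p + Suc k) / real (Suc k)) =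
     2 / real p * (real p * (- hs3 p + cP p - (zt2 - hs2 p) * hs p) - zt2 + hs p * (1 / real p) + s ^ p * zt2 - s ^ p * z2b
     + (1 + 2 * s ^ p) * (1 / real p) * ((s ^ p - 1) * Lam + h p) + Lam * ((s ^ p - 1) * Lam + h p) - Lam * hs p - h q * ((s ^ p - 1) * Lam + h p) - hs p * (1 / real p) + (zt2 - hs2 p) + AL q)"
    using LIMSEQ_unique by fastforce
  have l: "(\<Sum>j=1..<p. od j * GtL j p / (real p - real j)) = (\<Sum>j=1..<p. GtL j p / (real p - real j))" by (simp add: od1[OF g1])
  define E iP where "E = s ^ p" and "iP = 1 / real p"
  have P0: "real p * iP = 1" using p by (simp add: iP_def)
  have hp: "h p = h q + E * iP" and hsp: "hs p = hs q + iP" and hs2p: "hs2 p = hs2 q + iP\<^sup>2" and hs3p: "hs3 p = hs3 q + iP ^ 3"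
    using h1_Suc[OF g1, of q] hs_Suc[of q] hs2_Suc[of q] hs3_Suc[of q] by (simp_all add: pq E_def iP_def power_one_over)
  define C where "C = (\<Sum>d=1..<p. (hs q - hs (p - d)) / (real d)\<^sup>2)"
  have c: "cP p = (hs q + iP) * iP\<^sup>2 + (C + hs2 q * iP)"
  proof -
    have "(\<Sum>d=1..<p. (hs p - hs (p - d)) / (real d)\<^sup>2) = (\<Sum>d=1..<p. (hs q - hs (p - d)) / (real d)\<^sup>2 + iP * (1 / (real d)\<^sup>2))"
      unfolding hsp by (intro sum.cong refl) (simp add: add_divide_distrib diff_divide_distrib)
    also have "\<dots> = C + iP * hs2 q" unfolding sum.distrib sum_distrib_left[symmetric] sum_inv_lt C_def q_def ..
    finally show ?thesis using cP_lt[OF p] unfolding hsp by (simp add: iP_def power_one_over mult.commute)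
  qed
  note final = closing_algebra[OF s_pow_sq[of p, folded E_def] bS_eq[of q] tS_eq[of q] refl refl AL_eq[of q, folded pq, folded E_def iP_def], where z = zt2]
  \<comment> \<open>\<open>hs3\<close>, \<open>C\<close> and the multiple of \<open>hs q\<close>
    cancel between the two sides. What the passage from \<open>q\<close> to \<open>p\<close> adds
    carries a factor \<open>iP\<close>, which the factor \<open>p\<close> removes, so that only
    terms of order two remain.\<close>
  have key: "real p * (- hs3 p + cP p - (zt2 - hs2 p) * hs p) - real p * (- hs3 q + C - (zt2 - hs2 p) * hs q) = - (iP\<^sup>2) + (hs q + iP) * iP + hs2 q - (zt2 - (hs2 q + iP\<^sup>2))"
  proof -
    have "real p * (- hs3 p + cP p - (zt2 - hs2 p) * hs p) - real p * (- hs3 q + C - (zt2 - hs2 p) * hs q) = (real p * iP) * (- (iP\<^sup>2) + (hs q + iP) * iP + hs2 q - (zt2 - (hs2 q + iP\<^sup>2)))"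
      unfolding hs3p c hsp hs2p by (simp add: algebra_simps power2_eq_square power3_eq_cube)
    then show ?thesis unfolding P0 by simp
  qed
  have "(\<Sum>k. od (p + Suc k) * GtL p (p + Suc k) / real (Suc k)) - (\<Sum>j=1..<p. od j * GtL j p / (real p - real j)) = cF p"
  proof -
    have g: "2 / real p * (Y1 - z + a1 + a2 - a3 + a4 + a5 - a6 - a7 - a8 + a9 + a10) - 2 / real p * (Y2 + low) = 2 / real p * W"
      if "Y1 - Y2 = Y" "(Y - z + a1 + a2 - a3 + a4 + a5 - a6 - a7 - a8 + a9 + a10) - low = W" for Y1 Y2 Y z a1 a2 a3 a4 a5 a6 a7 a8 a9 a10 low W
      unfolding that(1)[symmetric] that(2)[symmetric] right_diff_distrib[symmetric] by (rule arg_cong[where f = "\<lambda>y. 2 / real p * y"]) simp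
    show ?thesis unfolding e l lower_sum[of q, folded pq, folded C_def] cF_def q_def[symmetric]
      by (rule g[OF key], unfold E_def[symmetric] iP_def[symmetric] hp hsp hs2p, rule final)
  qed
  then show ?thesis using pfc_lim(2)[OF p] by simp
qed

theorem dd_closed:
  assumes p: "1 \<le> p"
  shows "dd p \<longlonglongrightarrow> dF p"
\<comment> \<open>Along \<open>M + p\<close> the sums over \<open>m > p\<close> have exactly
  \<open>M\<close> terms.\<close>
proof (rule LIMSEQ_offset[where k = p])
  define q where "q = p - 1"
  have pq: "p = Suc q" using p by (simp add: q_def)
  define E iP where "E = s ^ p" and "iP = 1 / real p"
  have E: "E * E = 1" unfolding E_def by (rule s_pow_sq)
  have E': "E * (E * x) = x" for x unfolding mult.assoc[symmetric] E by simp
  have hp: "h p = h q + E * iP" and hs2p: "hs2 p = hs2 q + iP\<^sup>2"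
    using h1_Suc[OF g1, of q] hs2_Suc[of q] by (simp_all add: pq E_def iP_def power_one_over)
  have 1: "(\<Sum>m=Suc p..M + p. od m / (real m - real p)\<^sup>2) = hs2 M" for M
    unfolding hs2_def by (rule sum.reindex_bij_witness[where i = "\<lambda>d. d + p" and j = "\<lambda>m. m - p"]) (auto simp: od1[OF g1] of_nat_diff)
  have 2: "(\<Sum>j=1..<p. od j / (real p - real j)\<^sup>2) = hs2 q"
  proof -
    have "(\<Sum>j=1..<p. od j / (real p - real j)\<^sup>2) = (\<Sum>j=1..<p. (\<lambda>d. 1 / (real d)\<^sup>2) (p - j))" by (intro sum.cong refl) (auto simp: od1[OF g1] of_nat_diff)
    also have "\<dots> = (\<Sum>j=1..<p. 1 / (real j)\<^sup>2)" by (rule sum_rev_inv)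
    finally show ?thesis unfolding sum_inv_lt q_def .
  qed
  have 3: "(\<Sum>j=1..<p. od j * ph j / (real p - real j)) = (1 + E) * h q * iP"
  proof -
    have "(\<Sum>j=1..<p. od j * ph j / (real p - real j)) = (\<Sum>j=1..<p. E * (E * s ^ j * (1 / real j + 1 / real (p - j))) * iP)"
    proof (rule sum.cong[OF refl])
      fix j assume j: "j \<in> {1..<p}"
      have "1 / (real j * (real p - real j)) = (1 / real j + 1 / real (p - j)) * iP" using j by (simp add: iP_def field_simps of_nat_diff)
      then show "od j * ph j / (real p - real j) = E * (E * s ^ j * (1 / real j + 1 / real (p - j))) * iP"
        by (simp add: od1[OF g1] ph1[OF g1] mult.assoc E') (metis times_divide_eq_right mult.right_neutral)
    qed
    also have "\<dots> = E * ((1 + E) * h q) * iP" unfolding sum_distrib_left[symmetric] sum_distrib_right[symmetric] E_def pq ES_sum ..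
    also have "\<dots> = (1 + E) * h q * iP" using E' by (simp add: algebra_simps)
    finally show ?thesis .
  qed
  have 4: "(\<Sum>m=Suc p..M + p. od m * ph m / (real m - real p)) = DM p M * iP" for M
  proof -
    have "(\<Sum>m=Suc p..M + p. od m * ph m / (real m - real p)) = (\<Sum>d=1..M. s ^ (p + d) * (1 / real d - 1 / (real p + real d)) * iP)"
    proof (rule sum.reindex_bij_witness[where i = "\<lambda>d. d + p" and j = "\<lambda>m. m - p"])
      fix m assume m: "m \<in> {Suc p..M + p}"
      then have d: "1 \<le> m - p" "m = p + (m - p)" by auto
      have "s ^ m * (1 / (real (m - p) * (real p + real (m - p)))) = s ^ m * ((1 / real (m - p) - 1 / (real p + real (m - p))) * iP)"
        unfolding rt_nat[OF g1 p d(1)] by (simp add: iP_def)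
      then show "s ^ (p + (m - p)) * (1 / real (m - p) - 1 / (real p + real (m - p))) * iP = od m * ph m / (real m - real p)"
        using m by (simp add: od1[OF g1] ph1[OF g1] of_nat_diff mult.commute mult.assoc)
    qed auto
    then show ?thesis by (simp only: sum_distrib_right[symmetric] sum_SD[OF g1])
  qed
  have 5: "(\<Sum>j=1..<p. od j * (H (p - 1) - H j) / (real p - real j)) = hs2 q - 2 * hs q * iP"
  proof -
    have "(\<Sum>j=1..<p. od j * (H (p - 1) - H j) / (real p - real j)) = (\<Sum>d=1..<p. (hs (p - 1) - hs (p - d)) / real d)"
      by (rule sum.reindex_bij_witness[where i = "\<lambda>d. p - d" and j = "\<lambda>j. p - j"]) (auto simp: od1[OF g1] H1[OF g1] of_nat_diff)
    then show ?thesis using hs_conv_lt[OF p] by (simp add: q_def iP_def)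
  qed
  have "dd p (M + p) = 2 * (E * iP)\<^sup>2 + hs2 M + hs2 q - 2 * ((1 + E) * h q * iP) + 2 * (DM p M * iP) - 2 * (hs2 q - 2 * hs q * iP) - (hs2 (M + p) - hs2 p) + 2 * iP * ((E * h (M + p) - h (M + p - p)) - E * h p)" for M
  proof -
    have ph: "ph p = E * iP" and v: "vv p = iP" by (simp_all add: ph1[OF g1] vv1[OF g1] E_def iP_def)
    show ?thesis unfolding dd_def 1 2 3 4 5 ph v H21[OF g1] E_def[symmetric] by (simp add: algebra_simps)
  qed
  moreover have "(\<lambda>M. 2 * (E * iP)\<^sup>2 + hs2 M + hs2 q - 2 * ((1 + E) * h q * iP) + 2 * (DM p M * iP) - 2 * (hs2 q - 2 * hs q * iP) - (hs2 (M + p) - hs2 p) + 2 * iP * ((E * h (M + p) - h (M + p - p)) - E * h p))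
     \<longlonglongrightarrow> 2 * (E * iP)\<^sup>2 + zt2 + hs2 q - 2 * ((1 + E) * h q * iP) + 2 * (((E - 1) * Lam + h p) * iP) - 2 * (hs2 q - 2 * hs q * iP) - (zt2 - hs2 p) + 2 * iP * ((E - 1) * Lam - E * h p)"
    unfolding E_def by (intro tendsto_add tendsto_diff tendsto_mult tendsto_const hs2_lim LIMSEQ_ignore_initial_segment[OF hs2_lim] DM_lim LIMSEQ_ignore_initial_segment[OF h_back_lim])
  moreover have "2 * (E * iP)\<^sup>2 + zt2 + hs2 q - 2 * ((1 + E) * h q * iP) + 2 * (((E - 1) * Lam + h p) * iP) - 2 * (hs2 q - 2 * hs q * iP) - (zt2 - hs2 p) + 2 * iP * ((E - 1) * Lam - E * h p) = dF p"
  proof -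
    have "dF p = (1 + 2 * E) * iP\<^sup>2 + 4 * iP * (hs q - E * h q - (1 - E) * Lam)" by (simp add: dF_def E_def iP_def q_def power_one_over)
    then show ?thesis unfolding hp hs2p by (simp add: algebra_simps E E' power2_eq_square)
  qed
  ultimately show "(\<lambda>M. dd p (M + p)) \<longlonglongrightarrow> dF p" by simp
qed

end
end

section \<open>Vanishing of the coefficients for T-values\<close>

context sgn_grading
begin

context
  assumes g2: "g = 2"
begin

lemma s1: "s = 1" using gs g2 by auto
lemma e2: "e k = of_bool (even k)" unfolding e_def using g2 by (simp add: even_iff_mod_2_eq_zero)
lemma od2: "od k = of_bool (odd k)" unfolding od_def using g2 by (simp add: odd_iff_mod_2_eq_one)
lemma vv2: "vv k = (if even k then 1 / real k else 0)" by (simp add: vv_def e2)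
lemma ph2: "odd k \<Longrightarrow> ph k = 0" by (simp add: ph_def f_def e2)
lemma H_2: "H (2 * n) = hs n / 2" "H (Suc (2 * n)) = hs n / 2"
proof -
  show a: "H (2 * n) = hs n / 2" by (induction n) (auto simp: H_Suc vv2 hs_Suc field_simps)
  show "H (Suc (2 * n)) = hs n / 2" by (simp add: H_Suc vv2 a)
qed
lemma H2_2: "H2 (2 * n) = hs2 n / 4" "H2 (Suc (2 * n)) = hs2 n / 4"
proof -
  show a: "H2 (2 * n) = hs2 n / 4"
  proof (induction n)
    case (Suc n)
    have "(1 / real (Suc (Suc (2 * n))))\<^sup>2 = (1 / (real (Suc n))\<^sup>2) / 4" by (simp add: power2_eq_square divide_simps) (simp add: algebra_simps)
    then show ?case using Suc by (simp add: H2_Suc vv2 hs2_Suc del: of_nat_Suc)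
  qed simp
  show "H2 (Suc (2 * n)) = hs2 n / 4" by (simp add: H2_Suc vv2 a)
qed
lemma z2_2: "z2 = zt2 / 4"
proof -
  have "(\<lambda>n. H2 (2 * n)) \<longlonglongrightarrow> z2" using LIMSEQ_subseq_LIMSEQ[OF H2_lim, of "\<lambda>n. 2 * n"] by (simp add: strict_mono_def o_def)
  moreover have "(\<lambda>n. H2 (2 * n)) \<longlonglongrightarrow> zt2 / 4" unfolding H2_2 by (intro tendsto_intros hs2_lim) auto
  ultimately show ?thesis by (rule LIMSEQ_unique)
qed

lemma odd_sum: "(\<Sum>j=1..<Suc (2 * P). od j * F j) = (\<Sum>i=1..P. F (Suc (2 * P) - 2 * i))"
proof -
  have "(\<Sum>j=1..<Suc (2 * P). od j * F j) = (\<Sum>j\<in>{j\<in>{1..<Suc (2 * P)}. odd j}. F j)"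
  proof -
    have "(\<Sum>j\<in>{j\<in>{1..<Suc (2 * P)}. odd j}. F j) = (\<Sum>j=1..<Suc (2 * P). if odd j then F j else 0)" by (rule sum.inter_filter) simp
    also have "\<dots> = (\<Sum>j=1..<Suc (2 * P). od j * F j)" by (rule sum.cong) (simp_all add: od2)
    finally show ?thesis ..
  qed
  also have "\<dots> = (\<Sum>i=1..P. F (Suc (2 * P) - 2 * i))"
    by (rule sum.reindex_bij_witness[where i = "\<lambda>i. Suc (2 * P) - 2 * i" and j = "\<lambda>j. (Suc (2 * P) - j) div 2"]) (simp_all; presburger)+
  finally show ?thesis .
qed

lemma GtL_odd: "odd j \<Longrightarrow> odd m \<Longrightarrow> GtL j m = - 2 / (real m - real j)\<^sup>2 + 2 * (H (m - 1) - H j) / (real m - real j) - 2 * (z2 - H2 m)"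
  by (simp add: GtL_def GCL_def vv2 ph2)

lemma al2: "(- 2 / (2 * y)\<^sup>2 + 2 * (a / 2 - b / 2) / (2 * y) - 2 * (z / 4 - c / 4)) / (2 * y) = (- (1 / y ^ 3) + (a - b) / y\<^sup>2 - (z - c) / y) / 4" if "y \<noteq> 0" for y a b z c :: real
  using that by (simp add: field_simps power2_eq_square power3_eq_cube)

text \<open>The odd poles \<open>2 P + 1\<close> lie at distances \<open>2 i\<close>, and there
  \<open>H\<close> and \<open>H2\<close> are \<open>hs / 2\<close> and \<open>hs2 / 4\<close>, so
  everything scales to a quarter of the sums in \<open>phM\<close>. By \<open>phM_lim\<close> the
  infinite sum over the poles above is \<open>K / 4\<close>, which is also the finite sum over the
  poles below; the two cancel.\<close>

theorem pfc_zero: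
  assumes p: "1 \<le> p" "od p \<noteq> 0"
  shows "(\<lambda>N. pfc (Gt N) p N) \<longlonglongrightarrow> 0"
proof -
  have "odd p" using p by (simp add: od2)
  then obtain P where P: "p = Suc (2 * P)" by (auto elim: oddE)
  define a where "a = (\<lambda>k. od (p + Suc k) * GtL p (p + Suc k) / real (Suc k))"
  define K where "K = - hs3 P + cP P - (zt2 - hs2 P) * hs P"
  have up: "GtL p (p + 2 * i) / real (2 * i) = (- (1 / real i ^ 3) + (hs (P + i) - hs P) / (real i)\<^sup>2 - (zt2 - hs2 (P + i)) / real i) / 4" if i: "1 \<le> i" for i
  proof -
    have m: "p + 2 * i - 1 = 2 * (P + i)" "p + 2 * i = Suc (2 * (P + i))" by (simp_all add: P)
    have "GtL p (p + 2 * i) = - 2 / (2 * real i)\<^sup>2 + 2 * (hs (P + i) / 2 - hs P / 2) / (2 * real i) - 2 * (zt2 / 4 - hs2 (P + i) / 4)"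
    proof -
      have "real (p + 2 * i) - real p = 2 * real i" by simp
      moreover have "odd (p + 2 * i)" using \<open>odd p\<close> by simp
      moreover have "H (p + 2 * i - 1) = hs (P + i) / 2" unfolding m(1) by (rule H_2)
      moreover have "H2 (p + 2 * i) = hs2 (P + i) / 4" unfolding m(2) by (rule H2_2)
      moreover have "H p = hs P / 2" unfolding P by (rule H_2)
      ultimately show ?thesis using GtL_odd[OF \<open>odd p\<close>, of "p + 2 * i"] by (simp only: z2_2 simp_thms)
    qed
    then show ?thesis using al2[of "real i" "hs (P + i)" "hs P" zt2 "hs2 (P + i)"] i by (simp only: of_nat_mult of_nat_numeral)
  qed
  have "(\<Sum>k<2 * M. a k) = (\<Sum>i=1..M. GtL p (p + 2 * i) / real (2 * i))" for M
  proof (induction M)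
    case (Suc M)
    have "od (p + Suc (2 * M)) = 0" "od (p + Suc (Suc (2 * M))) = 1" using \<open>odd p\<close> by (simp_all add: od2)
    then have "a (2 * M) = 0" "a (Suc (2 * M)) = GtL p (p + 2 * Suc M) / real (2 * Suc M)" by (simp_all add: a_def)
    then show ?case using Suc by simp
  qed simp
  also have "(\<Sum>i=1..M. GtL p (p + 2 * i) / real (2 * i)) = (phM P M + K) / 4" for M
  proof -
    have "(\<Sum>i=1..M. GtL p (p + 2 * i) / real (2 * i)) = (\<Sum>i=1..M. (- (1 / real i ^ 3) + (hs (P + i) - hs P) / (real i)\<^sup>2 - (zt2 - hs2 (P + i)) / real i) / 4)"
      by (intro sum.cong refl up) auto
    then show ?thesis unfolding sum_divide_distrib[symmetric] sum.distrib sum_subtractf sum_negf by (simp add: phM_def K_def hs3_def[of M])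
  qed
  finally have e: "(\<Sum>k<2 * M. a k) = (phM P M + K) / 4" for M .
  have "(\<lambda>M. (phM P M + K) / 4) \<longlonglongrightarrow> (0 + K) / 4" by (intro tendsto_intros phM_lim) auto
  moreover have "(\<lambda>M. \<Sum>k<2 * M. a k) \<longlonglongrightarrow> suminf a"
  proof -
    have "summable a" unfolding a_def using pfc_lim(1)[OF p(1)] .
    from LIMSEQ_subseq_LIMSEQ[OF summable_LIMSEQ[OF this], of "\<lambda>M. 2 * M"] show ?thesis by (simp add: strict_mono_def o_def)
  qed
  ultimately have U: "suminf a = K / 4" unfolding e using LIMSEQ_unique by fastforce
  have "(\<Sum>j=1..<p. od j * GtL j p / (real p - real j)) = (\<Sum>j=1..<Suc (2 * P). od j * (GtL j p / (real p - real j)))" by (simp add: P)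
  also have "\<dots> = (\<Sum>i=1..P. (- (1 / real i ^ 3) + (hs P - hs (P - i)) / (real i)\<^sup>2 - (zt2 - hs2 P) / real i) / 4)"
    unfolding odd_sum
  proof (rule sum.cong[OF refl])
    fix i assume i: "i \<in> {1..P}"
    have j: "Suc (2 * P) - 2 * i = Suc (2 * (P - i))" using i by auto
    have "GtL (Suc (2 * P) - 2 * i) p = - 2 / (2 * real i)\<^sup>2 + 2 * (hs P / 2 - hs (P - i) / 2) / (2 * real i) - 2 * (zt2 / 4 - hs2 P / 4)"
    proof -
      have "real p - real (Suc (2 * P) - 2 * i) = 2 * real i" using i by (simp add: P of_nat_diff)
      moreover have "odd (Suc (2 * P) - 2 * i)" using i by simp
      moreover have "H (p - 1) = hs P / 2" unfolding P diff_Suc_1 by (rule H_2)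
      moreover have "H2 p = hs2 P / 4" unfolding P by (rule H2_2)
      moreover have "H (Suc (2 * P) - 2 * i) = hs (P - i) / 2" unfolding j by (rule H_2)
      ultimately show ?thesis using GtL_odd[of "Suc (2 * P) - 2 * i" p] \<open>odd p\<close> by (simp only: z2_2 simp_thms)
    qed
    moreover have "real p - real (Suc (2 * P) - 2 * i) = 2 * real i" using i by (simp add: P of_nat_diff)
    ultimately show "GtL (Suc (2 * P) - 2 * i) p / (real p - real (Suc (2 * P) - 2 * i)) = (- (1 / real i ^ 3) + (hs P - hs (P - i)) / (real i)\<^sup>2 - (zt2 - hs2 P) / real i) / 4"
      using al2[of "real i" "hs P" "hs (P - i)" zt2 "hs2 P"] i by (simp only:) simp
  qed
  also have "\<dots> = K / 4"
    unfolding sum_divide_distrib[symmetric] sum.distrib sum_subtractf sum_negf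
    by (simp add: K_def hs3_def cP_def hs_def[of P] sum_distrib_left)
  finally have L: "(\<Sum>j=1..<p. od j * GtL j p / (real p - real j)) = K / 4" .
  show ?thesis using pfc_lim(2)[OF p(1)] unfolding L a_def[symmetric] U by simp
qed

lemma div2_lim: "filterlim (\<lambda>n::nat. n div 2) at_top at_top"
  unfolding filterlim_at_top
proof
  fix Z :: nat
  show "\<forall>\<^sub>F n in at_top. Z \<le> n div 2" using eventually_ge_at_top[of "2 * Z"] by eventually_elim simp
qed

text \<open>After rescaling to even distances, the infinite sum tends to \<open>zt2 / 4\<close> and
  is cancelled by the limit of \<open>H2\<close>; the finite parts are the multiples 1, -2 and 1 of
  \<open>hs2 P / 4\<close>.\<close>

theorem dd_zero:
  assumes p: "1 \<le> p" "od p \<noteq> 0"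
  shows "dd p \<longlonglongrightarrow> 0"
proof (rule LIMSEQ_offset[where k = p])
  have "odd p" using p by (simp add: od2)
  then obtain P where P: "p = Suc (2 * P)" by (auto elim: oddE)
  have 1: "(\<Sum>m=Suc p..n + p. od m / (real m - real p)\<^sup>2) = hs2 (n div 2) / 4" for n
  proof (induction n)
    case (Suc n)
    have "(\<Sum>m=Suc p..Suc n + p. od m / (real m - real p)\<^sup>2) = hs2 (n div 2) / 4 + od (Suc (n + p)) / (real (Suc n))\<^sup>2"
      using Suc by (simp add: add_ac)
    moreover have "od (Suc (n + p)) / (real (Suc n))\<^sup>2 = hs2 (Suc n div 2) / 4 - hs2 (n div 2) / 4"
    proof (cases "even n")
      case False
      then obtain i where i: "n = Suc (2 * i)" by (auto elim: oddE)
      have "1 / (real (Suc n))\<^sup>2 = 1 / (real (Suc i))\<^sup>2 / 4" by (simp add: i power2_eq_square divide_simps) (simp add: algebra_simps)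
      moreover have "od (Suc (n + p)) = 1" using False \<open>odd p\<close> by (simp add: od2)
      ultimately show ?thesis by (simp add: i hs2_Suc add_divide_distrib del: of_nat_Suc)
    qed (use \<open>odd p\<close> in \<open>simp add: od2\<close>)
    ultimately show ?case by simp
  qed simp
  have 2: "(\<Sum>j=1..<p. od j / (real p - real j)\<^sup>2) = hs2 P / 4"
  proof -
    have "(\<Sum>j=1..<p. od j / (real p - real j)\<^sup>2) = (\<Sum>j=1..<Suc (2 * P). od j * (1 / (real p - real j)\<^sup>2))" by (simp add: P)
    also have "\<dots> = (\<Sum>i=1..P. 1 / (real i)\<^sup>2 / 4)" unfolding odd_sum by (intro sum.cong refl) (auto simp: P of_nat_diff power2_eq_square)
    finally show ?thesis by (simp add: hs2_def sum_divide_distrib)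
  qed
  have z: "(\<Sum>j\<in>A. od j * ph j / Y j) = 0" for A Y by (rule sum.neutral) (auto simp: od2 ph2)
  have 3: "(\<Sum>j=1..<p. od j * (H (p - 1) - H j) / (real p - real j)) = hs2 P / 4"
  proof -
    have "(\<Sum>j=1..<p. od j * (H (p - 1) - H j) / (real p - real j)) = (\<Sum>j=1..<Suc (2 * P). od j * ((H (p - 1) - H j) / (real p - real j)))" by (simp add: P)
    also have "\<dots> = (\<Sum>i=1..P. (hs P - hs (P - i)) / real i / 4)" unfolding odd_sum
    proof (rule sum.cong[OF refl])
      fix i assume i: "i \<in> {1..P}"
      have j: "Suc (2 * P) - 2 * i = Suc (2 * (P - i))" using i by auto
      have r: "real p - real (Suc (2 * P) - 2 * i) = 2 * real i" using i by (simp add: P of_nat_diff)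
      have "H (p - 1) = hs P / 2" unfolding P diff_Suc_1 by (rule H_2)
      moreover have "H (Suc (2 * P) - 2 * i) = hs (P - i) / 2" unfolding j by (rule H_2)
      ultimately show "(H (p - 1) - H (Suc (2 * P) - 2 * i)) / (real p - real (Suc (2 * P) - 2 * i)) = (hs P - hs (P - i)) / real i / 4"
        unfolding r by (simp only:) (simp add: field_simps)
    qed
    finally show ?thesis using hs_conv[of P] by (simp only: sum_divide_distrib[symmetric])
  qed
  have "dd p (n + p) = hs2 (n div 2) / 4 + hs2 P / 4 - 2 * (hs2 P / 4) - (H2 (n + p) - hs2 P / 4)" for n
  proof -
    have "ph p = 0" "vv p = 0" "H2 p = hs2 P / 4" using \<open>odd p\<close> by (simp_all add: ph2 vv2) (simp add: P H2_2)
    then show ?thesis unfolding dd_def 1 2 3 z by simp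
  qed
  moreover have "(\<lambda>n. hs2 (n div 2) / 4 + hs2 P / 4 - 2 * (hs2 P / 4) - (H2 (n + p) - hs2 P / 4)) \<longlonglongrightarrow> zt2 / 4 + hs2 P / 4 - 2 * (hs2 P / 4) - (zt2 / 4 - hs2 P / 4)"
    by (intro tendsto_add tendsto_diff tendsto_mult tendsto_divide tendsto_const filterlim_compose[OF hs2_lim div2_lim] LIMSEQ_ignore_initial_segment[OF H2_lim[unfolded z2_2]]) auto
  ultimately show "(\<lambda>n. dd p (n + p)) \<longlonglongrightarrow> 0" by simp
qed

end
end

section \<open>Euler sums, \<open>T\<close>-values and comparison of coefficients\<close>

text \<open>Splitting off the head, the largest index, turns sums over index lists into iterated
  sums; this gives the recursions \<open>eS_Cons\<close> and \<open>mS_Cons\<close>.\<close>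

lemma sum_decr_Suc: "(\<Sum>k\<in>decr_tuples (Suc d) N. F k) = (\<Sum>m=1..N. \<Sum>k\<in>decr_tuples d (m - 1). F (m # k) :: real)"
proof -
  have "(\<Sum>m=1..N. \<Sum>k\<in>decr_tuples d (m - 1). F (m # k)) = (\<Sum>z\<in>(SIGMA m:{1..N}. decr_tuples d (m - 1)). F (fst z # snd z))"
    by (subst sum_SIGMA) (auto simp: finite_decr_tuples)
  also have "\<dots> = (\<Sum>k\<in>decr_tuples (Suc d) N. F k)"
  proof (rule sum.reindex_bij_witness[where i = "\<lambda>k. (hd k, tl k)" and j = "\<lambda>z. fst z # snd z"])
    fix k assume "k \<in> decr_tuples (Suc d) N"
    then obtain m t where k: "k = m # t" "length t = d" "sorted_wrt (>) t" "\<forall>x\<in>set t. x < m" "m \<in> {1..N}" "set t \<subseteq> {1..N}"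
      by (cases k) (auto simp: decr_tuples_def)
    then show "(hd k, tl k) \<in> (SIGMA m:{1..N}. decr_tuples d (m - 1))" "fst (hd k, tl k) # snd (hd k, tl k) = k"
      by (fastforce simp: decr_tuples_def)+
  next
    fix z assume "z \<in> (SIGMA m:{1..N}. decr_tuples d (m - 1))"
    then show "fst z # snd z \<in> decr_tuples (Suc d) N" by (fastforce simp: decr_tuples_def)
  qed auto
  finally show ?thesis ..
qed

definition eS :: "nat list \<Rightarrow> int list \<Rightarrow> nat \<Rightarrow> real" where
  "eS s \<mu> N = (\<Sum>k\<in>decr_tuples (length s) N. \<Prod>i<length s. real_of_int (\<mu> ! i) ^ (k ! i) / real (k ! i) ^ (s ! i))"
definition mS :: "nat list \<Rightarrow> nat \<Rightarrow> real" where
  "mS s N = (\<Sum>k | k \<in> decr_tuples (length s) N \<and> (\<forall>i<length s. (k ! i) mod 2 = (length s - i) mod 2).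
     2 ^ length s / (\<Prod>i<length s. real (k ! i) ^ (s ! i)))"

lemma euler_sum_eqI: "eS s \<mu> \<longlonglongrightarrow> L \<Longrightarrow> euler_sum s \<mu> = L"
  unfolding euler_sum_def eS_def by (rule limI)
lemma mtv_eqI: "mS s \<longlonglongrightarrow> L \<Longrightarrow> mtv s = L"
  unfolding mtv_def mS_def by (rule limI)

lemma decr_tuples_0: "decr_tuples 0 N = {[]}" by (auto simp: decr_tuples_def)

lemma eS_Nil: "eS [] [] N = 1" by (simp add: eS_def decr_tuples_0)
lemma eS_Cons: "eS (a # s) (t # \<mu>) N = (\<Sum>m=1..N. real_of_int t ^ m / real m ^ a * eS s \<mu> (m - 1))"
  unfolding eS_def by (simp only: list.size add_Suc_right add_0_right sum_decr_Suc prod.lessThan_Suc_shift nth_Cons_0 nth_Cons_Suc sum_distrib_left)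

lemma mS_alt: "mS s N = (\<Sum>k\<in>decr_tuples (length s) N. of_bool (\<forall>i<length s. (k ! i) mod 2 = (length s - i) mod 2) * (2 ^ length s / (\<Prod>i<length s. real (k ! i) ^ (s ! i))))"
proof -
  have "mS s N = (\<Sum>k\<in>decr_tuples (length s) N. if \<forall>i<length s. (k ! i) mod 2 = (length s - i) mod 2 then 2 ^ length s / (\<Prod>i<length s. real (k ! i) ^ (s ! i)) else 0)"
    unfolding mS_def by (rule sum.inter_filter[OF finite_decr_tuples])
  also have "\<dots> = (\<Sum>k\<in>decr_tuples (length s) N. of_bool (\<forall>i<length s. (k ! i) mod 2 = (length s - i) mod 2) * (2 ^ length s / (\<Prod>i<length s. real (k ! i) ^ (s ! i))))"
    by (rule sum.cong[OF refl]) simp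
  finally show ?thesis .
qed

lemma mS_Nil: "mS [] N = 1" by (simp add: mS_alt decr_tuples_0)
lemma mS_Cons: "mS (a # s) N = (\<Sum>m=1..N. of_bool (m mod 2 = Suc (length s) mod 2) * (2 / real m ^ a) * mS s (m - 1))"
proof -
  have "of_bool (\<forall>i<Suc (length s). ((m # k) ! i) mod 2 = (Suc (length s) - i) mod 2) * (2 ^ Suc (length s) / (\<Prod>i<Suc (length s). real ((m # k) ! i) ^ ((a # s) ! i)))
     = of_bool (m mod 2 = Suc (length s) mod 2) * (2 / real m ^ a) * (of_bool (\<forall>i<length s. (k ! i) mod 2 = (length s - i) mod 2) * (2 ^ length s / (\<Prod>i<length s. real (k ! i) ^ (s ! i))))" for m k
    unfolding All_less_Suc2 prod.lessThan_Suc_shift nth_Cons_0 nth_Cons_Suc diff_Suc_Suc minus_nat.diff_0 of_bool_conj by simp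
  then show ?thesis unfolding mS_alt by (simp only: list.size add_Suc_right add_0_right sum_decr_Suc sum_distrib_left)
qed

lemma nested_quads:
  fixes \<Phi> :: "nat \<Rightarrow> nat \<Rightarrow> nat \<Rightarrow> nat \<Rightarrow> real"
  shows "(\<Sum>T=1..N. \<Sum>S=1..T - 1. \<Sum>q=1..S - 1. \<Sum>j=1..q - 1. \<Phi> T S q j)
     = (\<Sum>(a, b, c, d)\<in>{n \<in> posq. sz n \<le> N}. \<Phi> (a + b + c + d) (b + c + d) (c + d) d)"
proof -
  define G where "G = (\<lambda>(T, S, q, j). \<Phi> T S q j)"
  have "(\<Sum>T=1..N. \<Sum>S=1..T - 1. \<Sum>q=1..S - 1. \<Sum>j=1..q - 1. \<Phi> T S q j) = (\<Sum>z\<in>(SIGMA T:{1..N}. SIGMA S:{1..T - 1}. SIGMA q:{1..S - 1}. {1..q - 1}). G z)"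
    by (simp add: sum_SIGMA G_def)
  also have "\<dots> = (\<Sum>(a, b, c, d)\<in>{n \<in> posq. sz n \<le> N}. \<Phi> (a + b + c + d) (b + c + d) (c + d) d)"
    by (rule sum.reindex_bij_witness[where i = "\<lambda>(a, b, c, d). (a + b + c + d, b + c + d, c + d, d)" and j = "\<lambda>(T, S, q, j). (T - S, S - q, q - j, j)"])
       (auto simp: posq_def sz_def G_def)
  finally show ?thesis .
qed

context sgn_grading
begin

text \<open>For \<open>g = 2\<close> the indices k1, ..., k4 are even, odd, even, odd, which is the
  parity condition of \<open>mtv\<close> at depth four.\<close>

lemma cw_T: "cw (a, b, c, d) = s ^ (a + b + c + d) * (e (a + b + c + d) * od (b + c + d) * e (c + d) * od d)"
proof -
  have "od a * od (b + c + d) = e (a + (b + c + d)) * od (b + c + d)" by (rule od_mult_e(1))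
  then show ?thesis unfolding cw_eq by (simp add: add.assoc)
qed

lemma D4_lim:
  assumes "2 \<le> a" "1 \<le> b" "1 \<le> c" "1 \<le> d"
  shows "(\<lambda>N. \<Sum>T=1..N. \<Sum>S=1..T - 1. \<Sum>q=1..S - 1. \<Sum>j=1..q - 1. s ^ T * (e T * od S * e q * od j) / (real T ^ a * real S ^ b * real q ^ c * real j ^ d)) \<longlonglongrightarrow> D4 (a, b, c, d)"
proof -
  define F where "F n = cw n / (qT n ^ a * qS n ^ b * qq n ^ c * n4 n ^ d)" for n
  have "(\<lambda>N. sum F {n \<in> posq. sz n \<le> N}) \<longlonglongrightarrow> D4 (a, b, c, d)"
  proof (rule has_sum_exhaust[where f = F and D = "\<lambda>N. {n \<in> posq. sz n \<le> N}" and A = posq])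
    show "(F has_sum D4 (a, b, c, d)) posq" unfolding F_def by (rule D4_has_sum[OF assms])
    show "finite {n \<in> posq. sz n \<le> N}" for N
      by (rule finite_subset[of _ "{..N} \<times> {..N} \<times> {..N} \<times> {..N}"]) (auto simp: sz_def)
  qed auto
  moreover have "sum F {n \<in> posq. sz n \<le> N} = (\<Sum>T=1..N. \<Sum>S=1..T - 1. \<Sum>q=1..S - 1. \<Sum>j=1..q - 1. s ^ T * (e T * od S * e q * od j) / (real T ^ a * real S ^ b * real q ^ c * real j ^ d))" for N
    unfolding nested_quads by (intro sum.cong refl) (auto simp: F_def cw_T qdefs add_ac)
  ultimately show ?thesis by simp
qed

lemma euler_D4:
  assumes g1: "g = 1" and t: "s = real_of_int t" and a: "2 \<le> a" "1 \<le> b" "1 \<le> c" "1 \<le> d"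
  shows "euler_sum [a, b, c, d] [t, 1, 1, 1] = D4 (a, b, c, d)"
proof (rule euler_sum_eqI)
  have "eS [a, b, c, d] [t, 1, 1, 1] N = (\<Sum>T=1..N. \<Sum>S=1..T - 1. \<Sum>q=1..S - 1. \<Sum>j=1..q - 1. s ^ T * (e T * od S * e q * od j) / (real T ^ a * real S ^ b * real q ^ c * real j ^ d))" for N
    unfolding eS_Cons eS_Nil sum_distrib_left e1[OF g1] od1[OF g1] t by (intro sum.cong refl) simp
  then show "eS [a, b, c, d] [t, 1, 1, 1] \<longlonglongrightarrow> D4 (a, b, c, d)" using D4_lim[OF a] by presburger
qed

lemma mtv_D4:
  assumes g2: "g = 2" and a: "2 \<le> a" "1 \<le> b" "1 \<le> c" "1 \<le> d"
  shows "mtv [a, b, c, d] = 16 * D4 (a, b, c, d)"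
proof (rule mtv_eqI)
  have s1: "s = 1" by (rule s1[OF g2])
  have p: "(of_bool (m mod 2 = Suc (length [x]) mod 2) :: real) = e m" "(of_bool (m mod 2 = Suc (length [x, y, z]) mod 2) :: real) = e m"
     "(of_bool (m mod 2 = Suc (length ([]::nat list)) mod 2) :: real) = od m" "(of_bool (m mod 2 = Suc (length [x, y]) mod 2) :: real) = od m" for m x y z :: nat
    unfolding e2[OF g2] od2[OF g2] by (simp_all add: odd_iff_mod_2_eq_one even_iff_mod_2_eq_zero)
  have "mS [a, b, c, d] N = 16 * (\<Sum>T=1..N. \<Sum>S=1..T - 1. \<Sum>q=1..S - 1. \<Sum>j=1..q - 1. s ^ T * (e T * od S * e q * od j) / (real T ^ a * real S ^ b * real q ^ c * real j ^ d))" for N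
    unfolding mS_Cons mS_Nil p sum_distrib_left by (intro sum.cong refl) (simp only: s1, simp)
  then show "mS [a, b, c, d] \<longlonglongrightarrow> 16 * D4 (a, b, c, d)" using tendsto_mult_left[OF D4_lim[OF a], of 16] by presburger
qed

end

section \<open>Comparison of coefficients\<close>

lemma hockey_stick: "(\<Sum>i\<le>n. (i + k) choose k) = (n + Suc k) choose (Suc k)"
  by (induction n) simp_all

lemma binomial_sums:
  fixes y :: real
  assumes "\<bar>y\<bar> < 1"
  shows "(\<lambda>n. real ((n + k) choose k) * y ^ n) sums (1 / (1 - y) ^ Suc k)"
  using assms
proof (induction k arbitrary: y)
  case 0
  then show ?case using geometric_sums[of y] by simp
next
  case (Suc k)
  have y': "\<bar>\<bar>y\<bar>\<bar> < 1" using Suc by simp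
  have "summable (\<lambda>n. norm (real ((n + k) choose k) * y ^ n))" using sums_summable[OF Suc(1)[OF y']] by (simp add: abs_mult power_abs)
  moreover have "summable (\<lambda>n. norm (y ^ n))" using Suc by (simp add: power_abs summable_geometric)
  ultimately have "(\<lambda>n. \<Sum>i\<le>n. real ((i + k) choose k) * y ^ i * y ^ (n - i)) sums ((\<Sum>n. real ((n + k) choose k) * y ^ n) * (\<Sum>n. y ^ n))"
    by (rule Cauchy_product_sums)
  moreover have "(\<Sum>n. real ((n + k) choose k) * y ^ n) = 1 / (1 - y) ^ Suc k" using sums_unique[OF Suc(1)[OF Suc(2)]] by simp
  moreover have "(\<Sum>n. y ^ n) = 1 / (1 - y)" using Suc by (simp add: suminf_geometric)
  moreover have "(\<Sum>i\<le>n. real ((i + k) choose k) * y ^ i * y ^ (n - i)) = real ((n + Suc k) choose Suc k) * y ^ n" for n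
  proof -
    have "(\<Sum>i\<le>n. real ((i + k) choose k) * y ^ i * y ^ (n - i)) = (\<Sum>i\<le>n. real ((i + k) choose k) * y ^ n)"
      by (intro sum.cong refl) (simp add: mult.assoc flip: power_add)
    then show ?thesis unfolding sum_distrib_right[symmetric] of_nat_sum[symmetric] hockey_stick .
  qed
  ultimately show ?case by (simp add: mult.commute)
qed

text \<open>The point 0 is left out of the hypothesis because the series to which this is applied
  has been divided by \<open>x\<close>. The leading coefficient is the limit at 0; dividing by
  \<open>x\<close> again shifts the sequence.\<close>

lemma powser_zero_coeff:
  fixes a :: "nat \<Rightarrow> real"
  assumes "0 < r" "\<And>x. x \<noteq> 0 \<Longrightarrow> \<bar>x\<bar> < r \<Longrightarrow> (\<lambda>n. a n * x ^ n) sums 0"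
  shows "a n = 0"
  using assms(2)
proof (induction n arbitrary: a)
  case 0
  have "((\<lambda>x::real. 0::real) \<longlongrightarrow> a 0) (at 0)"
    by (rule powser_limit_0_strong[OF assms(1)]) (use 0 in auto)
  then show ?case using tendsto_unique[OF _ tendsto_const[of "0::real" "at (0::real)"]] by (metis at_neq_bot)
next
  case (Suc n)
  have "((\<lambda>x::real. 0::real) \<longlongrightarrow> a 0) (at 0)"
    by (rule powser_limit_0_strong[OF assms(1)]) (use Suc in auto)
  then have a0: "a 0 = 0" using tendsto_unique[OF _ tendsto_const[of "0::real" "at (0::real)"]] by (metis at_neq_bot)
  have "(\<lambda>n. a (Suc n) * x ^ n) sums 0" if "x \<noteq> 0" "\<bar>x\<bar> < r" for x
  proof -
    have "(\<lambda>n. a (Suc n) * x ^ Suc n) sums (0 - a 0 * x ^ 0)" using Suc(2)[OF that] by (subst sums_Suc_iff) simp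
    then have "(\<lambda>n. a (Suc n) * x ^ Suc n * (1 / x)) sums (0 * (1 / x))" unfolding a0 by (intro sums_mult2) simp
    then show ?thesis using that by simp
  qed
  then show ?case by (rule Suc(1))
qed

lemma choose_le_pow2: "real (n choose k) \<le> 2 ^ n"
proof -
  have "n choose k \<le> 2 ^ n" by (rule binomial_le_pow2)
  then show ?thesis by (metis of_nat_le_iff of_nat_numeral of_nat_power)
qed

context sgn_grading
begin

text \<open>The coefficient of \<open>x ^ (m + 1)\<close> in \<open>tt c d x p\<close>
  (\<open>tt_sums\<close>): by the binomial series, a pole of order k + 1 contributes the binomial
  coefficient of m + 1 + k over k, divided by p^(m + k + 2).\<close>

definition co :: "(nat \<Rightarrow> real) \<Rightarrow> (nat \<Rightarrow> real) \<Rightarrow> nat \<Rightarrow> nat \<Rightarrow> real" where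
  "co c d m p = od p * (real ((m + 4) choose 3) / 2 / real p ^ (m + 5) + 2 * ph p * (real ((m + 3) choose 2) / real p ^ (m + 4)) + d p * ((real m + 2) / real p ^ (m + 3)) + c p * (1 / real p ^ (m + 2)))"

lemma od_pow: "od p ^ Suc k = od p" by (simp add: od_def)

lemma uu_sums:
  assumes x: "\<bar>x\<bar> \<le> 1 / 8" and p: "1 \<le> p"
  shows "(\<lambda>m. od p * (x ^ Suc m * (real ((Suc m + k) choose k) / real p ^ (Suc m + Suc k)))) sums (uu x p ^ Suc k - uu 0 p ^ Suc k)"
proof -
  have p0: "0 < real p" using p by simp
  have y: "\<bar>x / real p\<bar> < 1" using x p by (simp add: abs_divide divide_less_eq)
  have e: "1 / real p ^ Suc k * (1 / (1 - x / real p) ^ Suc k) = (1 / (real p - x)) ^ Suc k"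
  proof -
    have "real p * (1 - x / real p) = real p - x" using p0 by (simp add: field_simps)
    then show ?thesis by (metis power_mult_distrib power_one_over times_divide_times_eq mult_1)
  qed
  have "(\<lambda>n. od p * (1 / real p ^ Suc k) * (real ((n + k) choose k) * (x / real p) ^ n)) sums (od p * (1 / real p ^ Suc k) * (1 / (1 - x / real p) ^ Suc k))"
    by (intro sums_mult binomial_sums[OF y])
  moreover have "od p * (1 / real p ^ Suc k) * (1 / (1 - x / real p) ^ Suc k) = uu x p ^ Suc k"
    unfolding mult.assoc e uu_def power_divide od_pow by (simp add: power_one_over)
  ultimately have "(\<lambda>n. od p * (1 / real p ^ Suc k) * (real ((n + k) choose k) * (x / real p) ^ n)) sums (uu x p ^ Suc k)" by (simp only:)
  then have "(\<lambda>m. od p * (1 / real p ^ Suc k) * (real ((Suc m + k) choose k) * (x / real p) ^ Suc m)) sums (uu x p ^ Suc k - od p * (1 / real p ^ Suc k) * (real ((0 + k) choose k) * (x / real p) ^ 0))"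
    by (subst sums_Suc_iff) simp
  moreover have "od p * (1 / real p ^ Suc k) * (real ((0 + k) choose k) * (x / real p) ^ 0) = uu 0 p ^ Suc k"
    unfolding uu_def power_divide od_pow by simp
  moreover have "od p * (1 / real p ^ Suc k) * (real ((Suc m + k) choose k) * (x / real p) ^ Suc m) = od p * (x ^ Suc m * (real ((Suc m + k) choose k) / real p ^ (Suc m + Suc k)))" for m
    unfolding power_divide power_add[of "real p"] by (simp add: mult_ac)
  ultimately show ?thesis by (simp only:)
qed

lemma tt_sums:
  assumes x: "\<bar>x\<bar> \<le> 1 / 8" and p: "1 \<le> p"
  shows "(\<lambda>m. x ^ Suc m * co c d m p) sums tt c d x p"
proof -
  have "(\<lambda>m. od p * (x ^ Suc m * (real ((Suc m + 3) choose 3) / real p ^ (Suc m + Suc 3))) / 2 + 2 * ph p * (od p * (x ^ Suc m * (real ((Suc m + 2) choose 2) / real p ^ (Suc m + Suc 2))))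
     + d p * (od p * (x ^ Suc m * (real ((Suc m + 1) choose 1) / real p ^ (Suc m + Suc 1)))) + c p * (od p * (x ^ Suc m * (real ((Suc m + 0) choose 0) / real p ^ (Suc m + Suc 0)))))
     sums ((uu x p ^ Suc 3 - uu 0 p ^ Suc 3) / 2 + 2 * ph p * (uu x p ^ Suc 2 - uu 0 p ^ Suc 2) + d p * (uu x p ^ Suc 1 - uu 0 p ^ Suc 1) + c p * (uu x p ^ Suc 0 - uu 0 p ^ Suc 0))"
    by (intro sums_add sums_mult sums_divide uu_sums[OF x p])
  moreover have "od p * (x ^ Suc m * (real ((Suc m + 3) choose 3) / real p ^ (Suc m + Suc 3))) / 2 + 2 * ph p * (od p * (x ^ Suc m * (real ((Suc m + 2) choose 2) / real p ^ (Suc m + Suc 2))))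
     + d p * (od p * (x ^ Suc m * (real ((Suc m + 1) choose 1) / real p ^ (Suc m + Suc 1)))) + c p * (od p * (x ^ Suc m * (real ((Suc m + 0) choose 0) / real p ^ (Suc m + Suc 0)))) = x ^ Suc m * co c d m p" for m
  proof -
    have n: "Suc m + 3 = m + 4" "Suc m + Suc 3 = m + 5" "Suc m + 2 = m + 3" "Suc m + Suc 2 = m + 4" "Suc m + Suc 1 = m + 3" "Suc m + Suc 0 = m + 2" by simp_all
    have c1: "real ((Suc m + 1) choose 1) = real m + 2" "real ((Suc m + 0) choose 0) = 1" by simp_all
    have al: "D * (y * (A / P)) / 2 + 2 * f * (D * (y * (B / Q))) + dd * (D * (y * (C / R))) + cc * (D * (y * (1 / W))) = y * (D * (A / 2 / P + 2 * f * (B / Q) + dd * (C / R) + cc * (1 / W)))" for D y A P f B Q C R W dd cc :: real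
      by (simp add: distrib_left mult_ac)
    show ?thesis unfolding co_def c1 n by (rule al)
  qed
  moreover have "Suc 3 = 4" "Suc 2 = 3" "Suc 1 = 2" by simp_all
  ultimately show ?thesis unfolding tt_def by (simp only: power_Suc0_right)
qed

text \<open>For each small \<open>x\<close> the number \<open>G\<close> of \<open>FF_lim\<close> is
  expanded twice, over the weights by \<open>gf_sums\<close> and over the poles by
  \<open>TN_series\<close>. Exchanging poles and powers in the latter gives two power series with
  the same sum.\<close>

theorem coefficients:
  assumes c: "\<And>p. 1 \<le> p \<Longrightarrow> od p \<noteq> 0 \<Longrightarrow> (\<lambda>N. pfc (Gt N) p N) \<longlonglongrightarrow> c p"
    and d: "\<And>p. 1 \<le> p \<Longrightarrow> od p \<noteq> 0 \<Longrightarrow> dd p \<longlonglongrightarrow> d p"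
  shows "(\<Sum>k\<in>weight_quads (m + 5). cof k * D4 k) = (\<Sum>k. co c d m (Suc k))"
proof -
  have cb: "\<bar>c p\<bar> \<le> 56 * kp" if p: "1 \<le> p" "od p \<noteq> 0" for p
  proof (rule tendsto_upperbound[of "\<lambda>N. \<bar>pfc (Gt N) p N\<bar>" _ sequentially])
    show "(\<lambda>N. \<bar>pfc (Gt N) p N\<bar>) \<longlonglongrightarrow> \<bar>c p\<bar>" by (intro tendsto_rabs c p)
    show "\<forall>\<^sub>F N in sequentially. \<bar>pfc (Gt N) p N\<bar> \<le> 56 * kp" using eventually_ge_at_top[of p] by eventually_elim (rule pfc_le[OF p(1)])
  qed simp
  have db: "\<bar>d p\<bar> \<le> 18 * real p" if p: "1 \<le> p" "od p \<noteq> 0" for p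
  proof (rule tendsto_upperbound[of "\<lambda>N. \<bar>dd p N\<bar>" _ sequentially])
    show "(\<lambda>N. \<bar>dd p N\<bar>) \<longlonglongrightarrow> \<bar>d p\<bar>" by (intro tendsto_rabs d p)
    show "\<forall>\<^sub>F N in sequentially. \<bar>dd p N\<bar> \<le> 18 * real p" using eventually_ge_at_top[of p] by eventually_elim (rule dd_le[OF p(1)])
  qed simp
  have kp0: "0 \<le> kp" using pfc_le[of 1 1] by simp
  \<comment> \<open>21 is 1 + 2 + 18 from the three higher poles, and \<open>2 ^ (m + 4)\<close>
    bounds the binomial coefficients. Together with |x| < 1/8 the majorant in \<open>m\<close> and
    \<open>p\<close> is of order 4^(-m) / p^2.\<close>
  have cob: "\<bar>co c d m p\<bar> \<le> 2 ^ (m + 4) * (21 + 56 * kp) * (1 / (real p)\<^sup>2)" if p: "1 \<le> p" for m p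
  proof (cases "od p = 0")
    case True
    then show ?thesis using kp0 by (simp add: co_def)
  next
    case False
    have o: "od p = 1" using False by (simp add: od_def split: if_splits)
    define B r where "B = (2::real) ^ (m + 4)" and "r = 1 / (real p)\<^sup>2"
    have B: "1 \<le> B" by (simp add: B_def)
    have r: "0 \<le> r" by (simp add: r_def)
    have ir: "1 / real p ^ n \<le> r" if "2 \<le> n" for n unfolding r_def using p that by (intro frac_le power_increasing) auto
    have ir3: "real p * (1 / real p ^ (m + 3)) \<le> r"
    proof -
      have "real p * (1 / real p ^ (m + 3)) = 1 / real p ^ (m + 2)" using p by (simp add: eval_nat_numeral)
      then show ?thesis using ir[of "m + 2"] by simp
    qed
    have php: "\<bar>ph p\<bar> \<le> 1" using ph_le[of p] by (rule order_trans) (use p in simp)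
    have C3: "real ((m + 4) choose 3) \<le> B" unfolding B_def by (rule choose_le_pow2)
    have C2: "real ((m + 3) choose 2) \<le> B" unfolding B_def by (rule order_trans[OF choose_le_pow2]) simp
    have C1: "real m + 2 \<le> B"
    proof -
      have "m + 2 < 2 ^ (m + 2)" by (rule less_exp)
      then have "real (m + 2) < 2 ^ (m + 2)" by (metis of_nat_less_iff of_nat_numeral of_nat_power)
      also have "\<dots> \<le> B" unfolding B_def by (intro power_increasing) auto
      finally show ?thesis by simp
    qed
    have "real ((m + 4) choose 3) * (1 / real p ^ (m + 5)) \<le> B * r" using C3 B by (intro mult_mono ir) auto
    moreover have "0 \<le> real ((m + 4) choose 3) * (1 / real p ^ (m + 5))" by simp
    moreover have "\<bar>real ((m + 4) choose 3) / 2 / real p ^ (m + 5)\<bar> = real ((m + 4) choose 3) * (1 / real p ^ (m + 5)) / 2" by (simp add: mult.commute)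
    moreover have "y \<le> Y \<Longrightarrow> 0 \<le> y \<Longrightarrow> z = y / 2 \<Longrightarrow> z \<le> Y" for y Y z :: real by simp
    ultimately have 1: "\<bar>real ((m + 4) choose 3) / 2 / real p ^ (m + 5)\<bar> \<le> B * r" by blast
    have "real ((m + 3) choose 2) * (1 / real p ^ (m + 4)) \<le> B * r" using C2 B by (intro mult_mono ir) auto
    then have "\<bar>ph p\<bar> * \<bar>real ((m + 3) choose 2) / real p ^ (m + 4)\<bar> \<le> 1 * (B * r)" by (intro mult_mono php) auto
    then have 2: "\<bar>2 * ph p * (real ((m + 3) choose 2) / real p ^ (m + 4))\<bar> \<le> 2 * (B * r)" by (simp add: abs_mult)
    have "\<bar>d p\<bar> * ((real m + 2) * (1 / real p ^ (m + 3))) \<le> (18 * real p) * (B * (1 / real p ^ (m + 3)))"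
      using C1 db[OF p False] by (intro mult_mono) auto
    also have "\<dots> = 18 * (B * (real p * (1 / real p ^ (m + 3))))" by simp
    also have "\<dots> \<le> 18 * (B * r)" using B ir3 by (intro mult_left_mono) auto
    finally have 3: "\<bar>d p * ((real m + 2) / real p ^ (m + 3))\<bar> \<le> 18 * (B * r)" by (simp add: abs_mult)
    have "\<bar>c p\<bar> * (1 / real p ^ (m + 2)) \<le> (56 * kp) * r" using kp0 by (intro mult_mono cb[OF p False] ir) auto
    also have "\<dots> \<le> (56 * kp) * (B * r)" using kp0 B r by (intro mult_left_mono) (auto simp: mult_le_cancel_right1)
    finally have 4: "\<bar>c p * (1 / real p ^ (m + 2))\<bar> \<le> 56 * kp * (B * r)" by (simp add: abs_mult)
    have t: "\<bar>a1 + a2 + a3 + a4\<bar> \<le> Y1 + Y2 + Y3 + Y4" if "\<bar>a1\<bar> \<le> Y1" "\<bar>a2\<bar> \<le> Y2" "\<bar>a3\<bar> \<le> Y3" "\<bar>a4\<bar> \<le> Y4" for a1 a2 a3 a4 Y1 Y2 Y3 Y4 :: real using that by linarith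
    have "\<bar>co c d m p\<bar> \<le> B * r + 2 * (B * r) + 18 * (B * r) + 56 * kp * (B * r)"
      unfolding co_def o mult_1 by (rule t[OF 1 2 3 4])
    also have "\<dots> = B * (21 + 56 * kp) * r" by (simp add: algebra_simps)
    finally show ?thesis unfolding B_def r_def .
  qed
  have sq: "(\<lambda>k. 1 / (real (Suc k))\<^sup>2) summable_on UNIV"
  proof (subst summable_on_UNIV_nonneg_real_iff)
    show "summable (\<lambda>k. 1 / (real (Suc k))\<^sup>2)"
      using inverse_power_summable[of 2, where ?'a = real] by (subst summable_Suc_iff) (simp add: inverse_eq_divide)
  qed simp
  define V where "V m = (\<Sum>k. co c d m (Suc k))" for m
  have V: "((\<lambda>k. co c d m (Suc k)) has_sum V m) UNIV" for m
  proof -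
    have "(\<lambda>k. co c d m (Suc k)) summable_on UNIV"
    proof (rule Infinite_Sum.abs_summable_summable, rule Infinite_Sum.abs_summable_on_comparison_test'[OF summable_on_cmult_right[OF sq, of "2 ^ (m + 4) * (21 + 56 * kp)"]])
      fix k show "norm (co c d m (Suc k)) \<le> 2 ^ (m + 4) * (21 + 56 * kp) * (1 / (real (Suc k))\<^sup>2)" using cob[of "Suc k" m] by simp
    qed
    then obtain y where y: "((\<lambda>k. co c d m (Suc k)) has_sum y) UNIV" by (auto simp: summable_on_def)
    then show ?thesis unfolding V_def using sums_unique[OF has_sum_imp_sums[OF y]] by simp
  qed
  define W where "W m = (\<Sum>k\<in>weight_quads (m + 5). cof k * D4 k)" for m
  have main: "(\<lambda>m. (W m - V m) * x ^ m) sums 0" if x0: "x \<noteq> 0" and xl: "\<bar>x\<bar> < 1 / 8" for x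
  proof -
    have x: "\<bar>x\<bar> \<le> 1 / 8" "\<bar>x\<bar> \<le> 1 / 2" using xl by auto
    obtain G where G: "(FF x has_sum G) posq" "(\<lambda>N. TN x N - TN 0 N) \<longlonglongrightarrow> G" using FF_lim[OF x(1)] .
    have 1: "(\<lambda>m. x ^ Suc m * W m) sums G" unfolding W_def by (rule gf_sums[OF x(1) G(1)])
    have 2: "(\<lambda>k. tt c d x (Suc k)) sums G" by (rule TN_series[OF x(2) c d G(2)])
    have g4: "((\<lambda>m. (1 / 4) ^ m :: real) has_sum 1 / (1 - 1 / 4)) UNIV" using has_sum_geometric[of "1 / 4" 1] by simp
    obtain Z where Z: "((\<lambda>k. 2 * (21 + 56 * kp) * (1 / (real (Suc k))\<^sup>2)) has_sum Z) UNIV"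
      using summable_on_cmult_right[OF sq, of "2 * (21 + 56 * kp)"] by (auto simp: summable_on_def)
    have "(\<lambda>(k, m). x ^ Suc m * co c d m (Suc k)) summable_on UNIV \<times> UNIV"
    proof (rule Infinite_Sum.abs_summable_summable, rule Infinite_Sum.abs_summable_on_comparison_test'[OF has_sum_imp_summable[OF has_sum_mult_Times[OF Z g4]]])
      fix z :: "nat \<times> nat"
      obtain k m where z: "z = (k, m)" by (cases z)
      have "\<bar>x\<bar> ^ Suc m \<le> (1 / 8) ^ Suc m" using x by (intro power_mono) auto
      then have "\<bar>x\<bar> ^ Suc m * \<bar>co c d m (Suc k)\<bar> \<le> (1 / 8) ^ Suc m * (2 ^ (m + 4) * (21 + 56 * kp) * (1 / (real (Suc k))\<^sup>2))"
        by (intro mult_mono cob) auto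
      also have "\<dots> = ((1 / 8) ^ Suc m * 2 ^ (m + 4)) * ((21 + 56 * kp) * (1 / (real (Suc k))\<^sup>2))" by (simp only: mult.assoc)
      also have "(1 / 8) ^ Suc m * 2 ^ (m + 4) = 2 * (1 / 4 :: real) ^ m"
      proof -
        have "(1 / 8 * 2) ^ m = (1 / 8) ^ m * (2::real) ^ m" by (rule power_mult_distrib)
        then show ?thesis by (simp add: power_add)
      qed
      finally show "norm (case z of (k, m) \<Rightarrow> x ^ Suc m * co c d m (Suc k)) \<le> (case z of (k, m) \<Rightarrow> 2 * (21 + 56 * kp) * (1 / (real (Suc k))\<^sup>2) * (1 / 4) ^ m)"
        by (simp only: z prod.case real_norm_def abs_mult power_abs mult_ac)
    qed
    then obtain G' where G': "((\<lambda>(k, m). x ^ Suc m * co c d m (Suc k)) has_sum G') (UNIV \<times> UNIV)" by (auto simp: summable_on_def)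
    have row: "((\<lambda>m. x ^ Suc m * co c d m (Suc k)) has_sum tt c d x (Suc k)) UNIV" for k
    proof -
      have "(\<lambda>m. x ^ Suc m * co c d m (Suc k)) summable_on UNIV"
        using summable_on_SigmaD1[of "\<lambda>k m. x ^ Suc m * co c d m (Suc k)" UNIV "\<lambda>_. UNIV" k] has_sum_imp_summable[OF G'] by simp
      then obtain y where y: "((\<lambda>m. x ^ Suc m * co c d m (Suc k)) has_sum y) UNIV" by (auto simp: summable_on_def)
      have "y = tt c d x (Suc k)" by (rule sums_unique2[OF has_sum_imp_sums[OF y] tt_sums[OF x(1)]]) simp
      then show ?thesis using y by simp
    qed
    have "((\<lambda>k. tt c d x (Suc k)) has_sum G') UNIV" using has_sum_Sigma'[OF G', of "\<lambda>k. tt c d x (Suc k)"] row by simp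
    then have "G' = G" using sums_unique2[OF has_sum_imp_sums 2] by blast
    then have "((\<lambda>(m, k). x ^ Suc m * co c d m (Suc k)) has_sum G) (UNIV \<times> UNIV)"
      using G' by (subst (asm) has_sum_swap) (simp add: case_prod_unfold)
    then have "((\<lambda>m. x ^ Suc m * V m) has_sum G) UNIV"
      by (rule has_sum_Sigma') (use has_sum_cmult_right[OF V] in simp)
    from sums_diff[OF 1 has_sum_imp_sums[OF this]] have "(\<lambda>m. x ^ Suc m * W m - x ^ Suc m * V m) sums 0" by simp
    then have "(\<lambda>m. (1 / x) * (x ^ Suc m * W m - x ^ Suc m * V m)) sums ((1 / x) * 0)" by (rule sums_mult)
    moreover have "(1 / x) * (x ^ Suc m * W m - x ^ Suc m * V m) = (W m - V m) * x ^ m" for m using x0 by (simp add: algebra_simps)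
    ultimately show ?thesis by simp
  qed
  have "W m - V m = 0" by (rule powser_zero_coeff[of "1 / 8" "\<lambda>m. W m - V m" m]) (use main in auto)
  then show ?thesis unfolding W_def V_def by simp
qed

end

section \<open>The three evaluations\<close>

lemma choose2_real: "2 * real ((m + 2) choose 2) = (real m + 2) * (real m + 1)"
proof (induction m)
  case (Suc m)
  have "(Suc m + 2) choose 2 = (m + 2) + ((m + 2) choose 2)" by (simp add: numeral_2_eq_2)
  then have "2 * real ((Suc m + 2) choose 2) = 2 * (real m + 2) + 2 * real ((m + 2) choose 2)" by simp
  then show ?case unfolding Suc by (simp add: algebra_simps)
qed (simp add: numeral_2_eq_2)

lemma choose3_real: "6 * real ((m + 3) choose 3) = (real m + 3) * (real m + 2) * (real m + 1)"
proof (induction m)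
  case (Suc m)
  have "(Suc m + 3) choose 3 = ((Suc m + 2) choose 2) + ((m + 3) choose 3)" by (simp add: numeral_2_eq_2 numeral_3_eq_3)
  then have "6 * real ((Suc m + 3) choose 3) = 3 * (2 * real ((Suc m + 2) choose 2)) + 6 * real ((m + 3) choose 3)" by simp
  then show ?case unfolding Suc choose2_real by (simp add: algebra_simps)
qed (simp add: numeral_3_eq_3)

definition Zs :: "(nat \<Rightarrow> real) \<Rightarrow> nat \<Rightarrow> real" where "Zs \<gamma> u = (\<Sum>k. \<gamma> (Suc k) / real (Suc k) ^ u)"

text \<open>All numerators that occur are bounded by a multiple of the harmonic numbers, for which
  the exponent 2 already gives convergence (\<open>hs_sq_summable\<close>).\<close>

lemma Zs_sums:
  assumes "\<And>p. 1 \<le> p \<Longrightarrow> \<bar>\<gamma> p\<bar> \<le> C * hs p" "2 \<le> u"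
  shows "(\<lambda>k. \<gamma> (Suc k) / real (Suc k) ^ u) sums Zs \<gamma> u"
proof -
  have "summable (\<lambda>k. \<gamma> (Suc k) / real (Suc k) ^ u)"
  proof (rule summable_comparison_test_ev)
    show "summable (\<lambda>k. C * (hs (Suc k) / (real (Suc k))\<^sup>2))" by (rule summable_mult[OF hs_sq_summable])
    show "\<forall>\<^sub>F k in sequentially. norm (\<gamma> (Suc k) / real (Suc k) ^ u) \<le> C * (hs (Suc k) / (real (Suc k))\<^sup>2)"
    proof (rule always_eventually, rule allI)
      fix k
      have "\<bar>\<gamma> (Suc k)\<bar> / real (Suc k) ^ u \<le> (C * hs (Suc k)) / (real (Suc k))\<^sup>2"
        using assms(1)[of "Suc k"] assms(2) by (intro frac_le power_increasing) (auto intro: order_trans[OF abs_ge_zero])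
      then show "norm (\<gamma> (Suc k) / real (Suc k) ^ u) \<le> C * (hs (Suc k) / (real (Suc k))\<^sup>2)" by simp
    qed
  qed
  then show ?thesis unfolding Zs_def by (rule summable_sums)
qed

lemma Zs_lim:
  assumes "\<And>p. 1 \<le> p \<Longrightarrow> \<bar>\<gamma> p\<bar> \<le> C * hs p" "2 \<le> u"
  shows "(\<lambda>N. \<Sum>m=1..N. \<gamma> m / real m ^ u) \<longlonglongrightarrow> Zs \<gamma> u"
proof -
  have "(\<Sum>m=1..N. \<gamma> m / real m ^ u) = (\<Sum>k<N. \<gamma> (Suc k) / real (Suc k) ^ u)" for N
    by (rule sum.reindex_bij_witness[where i = Suc and j = "\<lambda>m. m - 1"]) auto
  then show ?thesis using Zs_sums[OF assms] by (simp add: sums_def)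
qed

lemma euler_sum_depth1: "2 \<le> w \<Longrightarrow> \<bar>t\<bar> = 1 \<Longrightarrow> euler_sum [w] [t] = Zs (\<lambda>p. real_of_int t ^ p) w"
proof (rule euler_sum_eqI)
  assume w: "2 \<le> w" and t: "\<bar>t\<bar> = 1"
  have "eS [w] [t] = (\<lambda>N. \<Sum>m=1..N. real_of_int t ^ m / real m ^ w)" unfolding eS_Cons eS_Nil by (rule ext) simp
  moreover have "\<bar>real_of_int t ^ p\<bar> \<le> 1 * hs p" if "1 \<le> p" for p
  proof -
    have "\<bar>real_of_int t\<bar> = 1" using t by (metis of_int_1 of_int_abs)
    then show ?thesis using hs_ge1[OF that] by (simp add: power_abs)
  qed
  ultimately show "eS [w] [t] \<longlonglongrightarrow> Zs (\<lambda>p. real_of_int t ^ p) w" using Zs_lim[of "\<lambda>p. real_of_int t ^ p" 1 w] w by simp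
qed

context sgn_grading
begin

lemma quads_sum:
  assumes "\<And>a b c d. 2 \<le> a \<Longrightarrow> 1 \<le> b \<Longrightarrow> 1 \<le> c \<Longrightarrow> 1 \<le> d \<Longrightarrow> F a b c d = K * D4 (a, b, c, d)"
  shows "(\<Sum>(a, b, c, d)\<in>weight_quads w. 2 ^ (a + c) * (2 ^ (a - 1) * 3 ^ b - 3 ^ b - 1) * F a b c d) = K * (\<Sum>k\<in>weight_quads w. cof k * D4 k)"
  unfolding sum_distrib_left by (rule sum.cong[OF refl]) (auto simp: weight_quads_def cof_def assms)

text \<open>At odd \<open>p\<close> the number \<open>ph p\<close> is 0, and the two lower
  coefficients have limit 0, so only the fourth powers remain. The constant 4 is 16/2/2: the
  numerator 2^4 on the left, the factor 1/2 of the fourth power, and the numerator 2 of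
  \<open>mtv [m + 5]\<close>.\<close>

theorem final_mtv:
  assumes g2: "g = 2"
  shows "(\<Sum>(a, b, c, d)\<in>weight_quads (m + 5). 2 ^ (a + c) * (2 ^ (a - 1) * 3 ^ b - 3 ^ b - 1) * mtv [a, b, c, d]) = 4 * real ((m + 4) choose 3) * mtv [m + 5]"
proof -
  have "(\<Sum>(a, b, c, d)\<in>weight_quads (m + 5). 2 ^ (a + c) * (2 ^ (a - 1) * 3 ^ b - 3 ^ b - 1) * mtv [a, b, c, d]) = 16 * (\<Sum>k\<in>weight_quads (m + 5). cof k * D4 k)"
    by (rule quads_sum[OF mtv_D4[OF g2]])
  also have "(\<Sum>k\<in>weight_quads (m + 5). cof k * D4 k) = (\<Sum>k. co (\<lambda>p. 0) (\<lambda>p. 0) m (Suc k))"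
    by (rule coefficients[OF pfc_zero[OF g2] dd_zero[OF g2]])
  also have "co (\<lambda>p. 0) (\<lambda>p. 0) m = (\<lambda>p. real ((m + 4) choose 3) / 2 * (od p / real p ^ (m + 5)))"
  proof
    fix p show "co (\<lambda>p. 0) (\<lambda>p. 0) m p = real ((m + 4) choose 3) / 2 * (od p / real p ^ (m + 5))"
      by (cases "odd p") (simp_all add: co_def od2[OF g2] ph2[OF g2])
  qed
  also have "(\<Sum>k. real ((m + 4) choose 3) / 2 * (od (Suc k) / real (Suc k) ^ (m + 5))) = real ((m + 4) choose 3) / 2 * Zs od (m + 5)"
    unfolding Zs_def
  proof (rule suminf_mult[OF sums_summable[OF Zs_sums[of od 1]]])
    fix p :: nat assume "1 \<le> p"
    then show "\<bar>od p\<bar> \<le> 1 * hs p" using od_le(1)[of p] hs_ge1[of p] by linarith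
  qed simp
  also have "mtv [m + 5] = 2 * Zs od (m + 5)"
  proof (rule mtv_eqI)
    have "mS [m + 5] = (\<lambda>N. 2 * (\<Sum>p=1..N. od p / real p ^ (m + 5)))"
      unfolding mS_Cons mS_Nil od2[OF g2] sum_distrib_left by (intro ext sum.cong refl) (simp add: odd_iff_mod_2_eq_one)
    moreover have "(\<lambda>N. \<Sum>p=1..N. od p / real p ^ (m + 5)) \<longlonglongrightarrow> Zs od (m + 5)"
    proof (rule Zs_lim[of od 1])
      fix p :: nat assume "1 \<le> p"
      then show "\<bar>od p\<bar> \<le> 1 * hs p" using od_le(1)[of p] hs_ge1[of p] by linarith
    qed simp
    ultimately show "mS [m + 5] \<longlonglongrightarrow> 2 * Zs od (m + 5)" by (simp only: tendsto_mult_left)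
  qed
  then have "Zs od (m + 5) = mtv [m + 5] / 2" by simp
  finally show ?thesis by simp
qed

context
  assumes g1: "g = 1"
begin

lemma coefficients1: "(\<Sum>k\<in>weight_quads (m + 5). cof k * D4 k) = (\<Sum>k. co cF dF m (Suc k))"
  by (rule coefficients[OF pfc_closed[OF g1] dd_closed[OF g1]])

text \<open>Sorted so that, for \<open>s = -1\<close>, each group is the \<open>p\<close>-th term of
  one series in the third formula: for instance
  \<open>(1 + E) * (hs q - h q) / real p ^ (m + 4)\<close> belongs to T(v, 1), and
  \<open>(1 - E) / real p ^ (m + 3)\<close> to T(u).\<close>

lemma co_eq:
  assumes p: "1 \<le> p"
  defines "E \<equiv> s ^ p" and "q \<equiv> p - 1"
  shows "co cF dF m p = (real ((m + 4) choose 3) / 2 + (real m + 2) + 2) * (1 / real p ^ (m + 5)) + (2 * real ((m + 3) choose 2) + 2 * (real m + 2)) * (E / real p ^ (m + 5))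
    + 4 * ((1 + E) * (hs q - h q) / real p ^ (m + 4) + (1 + E) * (hs2 q - h2 q) / real p ^ (m + 3)) - (4 * Lam\<^sup>2 + 2 * zt2) * ((1 - E) / real p ^ (m + 3))
    + 4 * (real m + 2) * (hs q / real p ^ (m + 4) - E * h q / real p ^ (m + 4) - Lam * ((1 - E) / real p ^ (m + 4)))
    + 8 * (Lam * (hs q / real p ^ (m + 3) - E * h q / real p ^ (m + 3)) - aS q / real p ^ (m + 3) + E * tS q / real p ^ (m + 3))"
proof -
  define i R where "i = 1 / real p" and "R = 1 / real p ^ (m + 2)"
  have P: "1 / real p ^ (m + 3) = R * i" "1 / real p ^ (m + 4) = R * i * i" "1 / real p ^ (m + 5) = R * i * i * i"
    by (simp_all add: R_def i_def eval_nat_numeral mult_ac)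
  have d: "y / real p ^ n = y * (1 / real p ^ n)" for y n by simp
  have "co cF dF m p = real ((m + 4) choose 3) / 2 * (R * i * i * i) + 2 * (E * i) * (real ((m + 3) choose 2) * (R * i * i))
     + ((1 + 2 * E) * i\<^sup>2 + 4 * i * (hs q - E * h q - (1 - E) * Lam)) * ((real m + 2) * (R * i))
     + 2 * i * (i\<^sup>2 + 2 * (1 + E) * ((hs q - h q) * i + (hs2 q - h2 q)) - (2 * Lam\<^sup>2 + zt2) * (1 - E) + 4 * (Lam * (hs q - E * h q) - (aS q - E * tS q))) * R"
  proof -
    have 1: "ph p = E * i" by (simp add: ph1[OF g1] E_def i_def)
    have 2: "dF p = (1 + 2 * E) * i\<^sup>2 + 4 * i * (hs q - E * h q - (1 - E) * Lam)" by (simp add: dF_def E_def i_def q_def power_one_over)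
    have 3: "cF p = 2 * i * (i\<^sup>2 + 2 * (1 + E) * ((hs q - h q) * i + (hs2 q - h2 q)) - (2 * Lam\<^sup>2 + zt2) * (1 - E) + 4 * (Lam * (hs q - E * h q) - (aS q - E * tS q)))"
      unfolding cF_def E_def i_def q_def by simp
    have 4: "co c d m p = real ((m + 4) choose 3) / 2 * (1 / real p ^ (m + 5)) + 2 * ph p * (real ((m + 3) choose 2) * (1 / real p ^ (m + 4))) + d p * ((real m + 2) * (1 / real p ^ (m + 3))) + c p * (1 / real p ^ (m + 2))" for c d
      by (simp add: co_def od1[OF g1])
    show ?thesis unfolding 4 P R_def[symmetric] 1 2 3 ..
  qed
  also have "\<dots> = (real ((m + 4) choose 3) / 2 + (real m + 2) + 2) * (1 / real p ^ (m + 5)) + (2 * real ((m + 3) choose 2) + 2 * (real m + 2)) * (E * (1 / real p ^ (m + 5)))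
    + 4 * ((1 + E) * (hs q - h q) * (1 / real p ^ (m + 4)) + (1 + E) * (hs2 q - h2 q) * (1 / real p ^ (m + 3))) - (4 * Lam\<^sup>2 + 2 * zt2) * ((1 - E) * (1 / real p ^ (m + 3)))
    + 4 * (real m + 2) * (hs q * (1 / real p ^ (m + 4)) - E * h q * (1 / real p ^ (m + 4)) - Lam * ((1 - E) * (1 / real p ^ (m + 4))))
    + 8 * (Lam * (hs q * (1 / real p ^ (m + 3)) - E * h q * (1 / real p ^ (m + 3))) - aS q * (1 / real p ^ (m + 3)) + E * tS q * (1 / real p ^ (m + 3)))"
    unfolding P by (simp add: algebra_simps power2_eq_square)
  finally show ?thesis by (simp only: times_divide_eq_right mult_1_right)
qed

text \<open>For \<open>s = 1\<close> the signed sums \<open>h\<close>, \<open>h2\<close>,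
  \<open>tS\<close> coincide with \<open>hs\<close>, \<open>hs2\<close>, \<open>aS\<close>, so that
  all nested sums cancel and each pole contributes a multiple of
  \<open>1 / p ^ (m + 5)\<close>.\<close>

theorem final_zeta:
  assumes s1: "s = 1"
  shows "(\<Sum>(a, b, c, d)\<in>weight_quads (m + 5). 2 ^ (a + c) * (2 ^ (a - 1) * 3 ^ b - 3 ^ b - 1) * euler_sum [a, b, c, d] [1, 1, 1, 1])
     = (2 + (real m + 2) * (real m + 7) * (real m + 12) / 12) * euler_sum [m + 5] [1]"
proof -
  have "(\<Sum>(a, b, c, d)\<in>weight_quads (m + 5). 2 ^ (a + c) * (2 ^ (a - 1) * 3 ^ b - 3 ^ b - 1) * euler_sum [a, b, c, d] [1, 1, 1, 1]) = 1 * (\<Sum>k\<in>weight_quads (m + 5). cof k * D4 k)"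
    by (rule quads_sum) (use euler_D4[OF g1, of 1] s1 in simp)
  also have "\<dots> = (\<Sum>k. co cF dF m (Suc k))" using coefficients1 by simp
  also have "(\<lambda>k. co cF dF m (Suc k)) = (\<lambda>k. (2 + (real m + 2) * (real m + 7) * (real m + 12) / 12) * (1 / real (Suc k) ^ (m + 5)))"
  proof
    fix k
    have sp: "s ^ n = 1" for n using s1 by (metis power_one)
    have hh: "h n = hs n" for n unfolding h_def f_def e1[OF g1] sp hs_def by simp
    have hh2: "h2 n = hs2 n" for n unfolding h2_def sp hs2_def ..
    have aa: "aS n = tS n" for n unfolding aS_def tS_def sp by simp
    have L: "Lam = 0" using s1 unfolding Lam_def by presburger
    have A: "real ((m + 4) choose 3) = (real m + 4) * (real m + 3) * (real m + 2) / 6" using choose3_real[of "m + 1"] by (simp add: add_ac numeral_eq_Suc)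
    have B: "real ((m + 3) choose 2) = (real m + 3) * (real m + 2) / 2" using choose2_real[of "m + 1"] by (simp add: add_ac numeral_eq_Suc)
    have k1: "1 \<le> Suc k" by simp
    show "co cF dF m (Suc k) = (2 + (real m + 2) * (real m + 7) * (real m + 12) / 12) * (1 / real (Suc k) ^ (m + 5))"
      unfolding co_eq[OF k1] sp hh hh2 aa L A B by (simp add: field_simps del: of_nat_Suc)
  qed
  also have "(\<Sum>k. (2 + (real m + 2) * (real m + 7) * (real m + 12) / 12) * (1 / real (Suc k) ^ (m + 5))) = (2 + (real m + 2) * (real m + 7) * (real m + 12) / 12) * Zs (\<lambda>p. 1) (m + 5)"
    unfolding Zs_def by (rule suminf_mult[OF sums_summable[OF Zs_sums[of "\<lambda>p. 1" 1]]]) (use hs_ge1 in auto)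
  also have "Zs (\<lambda>p. 1) (m + 5) = euler_sum [m + 5] [1]" using euler_sum_depth1[of "m + 5" 1] by simp
  finally show ?thesis .
qed

text \<open>For \<open>s = -1\<close> the factors \<open>1 - s ^ p\<close> and
  \<open>1 + s ^ p\<close> are twice the indicators of odd and even \<open>p\<close>, and
  \<open>hs n - h n\<close> is twice the sum over the odd indices. This is how T-values, which
  belong to \<open>g = 2\<close>, enter a formula for \<open>g = 1\<close>. The constant
  \<open>Lam\<close> is zeta(bar 1).\<close>

theorem final_bar:
  assumes sm: "s = - 1"
  shows "(\<Sum>(a, b, c, d)\<in>weight_quads (m + 5). 2 ^ (a + c) * (2 ^ (a - 1) * 3 ^ b - 3 ^ b - 1) * euler_sum [a, b, c, d] [-1, 1, 1, 1])
     = (real m + 4) * ((real m + 5)\<^sup>2 - 5 * (real m + 5) + 18) / 12 * euler_sum [m + 5] [1]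
        + (real m + 5) * (real m + 2) * euler_sum [m + 5] [-1]
        + 4 * (mtv [m + 4, 1] + mtv [m + 3, 2])
        - (4 * (euler_sum [1] [-1])\<^sup>2 + 2 * euler_sum [2] [1]) * mtv [m + 3]
        + 4 * (real m + 2) * (euler_sum [m + 4, 1] [1, 1] - euler_sum [m + 4, 1] [-1, -1] - euler_sum [1] [-1] * mtv [m + 4])
        + 8 * (euler_sum [1] [-1] * (euler_sum [m + 3, 1] [1, 1] - euler_sum [m + 3, 1] [-1, -1]) - euler_sum [m + 3, 1, 1] [1, 1, -1] + euler_sum [m + 3, 1, 1] [-1, -1, -1])"
proof -
  have s1: "s \<noteq> 1" using sm by simp
  have sp: "s ^ n = real_of_int (- 1) ^ n" for n using sm by simp
  have sev: "s ^ n = (if even n then 1 else - 1)" for n unfolding sp by simp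
  have h1: "\<bar>h n\<bar> \<le> 1" for n by (rule h_alt1[OF s1])
  have E1: "\<bar>s ^ p\<bar> = 1" for p by simp
  have hsm: "0 \<le> hs (p - 1) \<and> hs (p - 1) \<le> hs p" for p using hs_mono[of "p - 1" p] hs_nonneg[of "p - 1"] by simp
  have hs2m: "0 \<le> hs2 n \<and> hs2 n \<le> hs n" for n
  proof -
    have "hs2 n \<le> hs n" unfolding hs2_def hs_def
    proof (rule sum_mono)
      fix k assume "k \<in> {1..n}"
      then show "1 / (real k)\<^sup>2 \<le> 1 / real k" by (intro frac_le) (auto simp: power2_eq_square)
    qed
    then show ?thesis unfolding hs2_def by (simp add: sum_nonneg)
  qed
  have h2m: "\<bar>h2 n\<bar> \<le> hs n" for n
  proof -
    have "\<bar>h2 n\<bar> \<le> (\<Sum>i=1..n. \<bar>s ^ i / (real i)\<^sup>2\<bar>)" unfolding h2_def by (rule sum_abs)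
    also have "\<dots> = hs2 n" unfolding hs2_def by (simp add: abs_divide)
    finally show ?thesis using hs2m[of n] by linarith
  qed
  have atm: "\<bar>\<Sum>c=1..n. t c * h (c - 1) / real c\<bar> \<le> hs n" if "\<And>c. \<bar>t c\<bar> = 1" for t :: "nat \<Rightarrow> real" and n
    unfolding hs_def
  proof (rule order_trans[OF sum_abs sum_mono])
    fix c show "\<bar>t c * h (c - 1) / real c\<bar> \<le> 1 / real c" using h1[of "c - 1"] that by (simp add: abs_mult divide_right_mono)
  qed
  have aSm: "\<bar>aS n\<bar> \<le> hs n" for n using atm[of "\<lambda>_. 1" n] by (simp add: aS_def)
  have tSm: "\<bar>tS n\<bar> \<le> hs n" for n using atm[of "\<lambda>c. s ^ c" n] by (simp add: tS_def)
  have b1: "\<bar>1::real\<bar> \<le> 1 * hs p" if "1 \<le> p" for p using hs_ge1[OF that] by simp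
  have b2: "\<bar>s ^ p\<bar> \<le> 1 * hs p" if "1 \<le> p" for p using hs_ge1[OF that] by simp
  have b3: "\<bar>hs (p - 1)\<bar> \<le> 1 * hs p" if "1 \<le> p" for p using hsm[of p] by simp
  have b4: "\<bar>s ^ p * h (p - 1)\<bar> \<le> 1 * hs p" if "1 \<le> p" for p using hs_ge1[OF that] h1[of "p - 1"] by (simp add: abs_mult)
  have b5: "\<bar>aS (p - 1)\<bar> \<le> 1 * hs p" if "1 \<le> p" for p using aSm[of "p - 1"] hsm[of p] by simp
  have b6: "\<bar>s ^ p * tS (p - 1)\<bar> \<le> 1 * hs p" if "1 \<le> p" for p using tSm[of "p - 1"] hsm[of p] by (simp add: abs_mult)
  have b7: "\<bar>1 - s ^ p\<bar> \<le> 2 * hs p" if "1 \<le> p" for p using hs_ge1[OF that] by (simp add: sev)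
  have tw: "\<bar>(1 + s ^ p) * y\<bar> \<le> 4 * hs p" if "\<bar>y\<bar> \<le> 2 * hs p" for y p
  proof -
    have "\<bar>1 + s ^ p\<bar> * \<bar>y\<bar> \<le> 2 * (2 * hs p)" using that by (intro mult_mono) (auto simp: sev)
    then show ?thesis by (simp add: abs_mult)
  qed
  have b8: "\<bar>(1 + s ^ p) * (hs (p - 1) - h (p - 1))\<bar> \<le> 4 * hs p" if "1 \<le> p" for p
    by (rule tw) (use hs_ge1[OF that] h1[of "p - 1"] hsm[of p] in linarith)
  have b9: "\<bar>(1 + s ^ p) * (hs2 (p - 1) - h2 (p - 1))\<bar> \<le> 4 * hs p" if "1 \<le> p" for p
    by (rule tw) (use h2m[of "p - 1"] hs2m[of "p - 1"] hsm[of p] in linarith)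
  have u: "2 \<le> m + 3" "2 \<le> m + 4" "2 \<le> m + 5" by simp_all
  have hE: "h n = (\<Sum>i=1..n. s ^ i / real i)" for n by (simp add: h_def f_def e1[OF g1])
  have m1: "real_of_int (-1) = s" "real_of_int 1 = 1" using sm by simp_all
  have v1: "euler_sum [m + 5] [1] = Zs (\<lambda>p. 1) (m + 5)" using euler_sum_depth1[OF u(3), of 1] by simp
  have v2: "euler_sum [m + 5] [-1] = Zs (\<lambda>p. s ^ p) (m + 5)" using euler_sum_depth1[OF u(3), of "-1"] unfolding m1 by simp
  have L: "euler_sum [1] [-1] = Lam"
  proof (rule euler_sum_eqI)
    have "eS [1] [-1] = h" unfolding eS_Cons eS_Nil m1 by (rule ext) (simp add: hE)
    then show "eS [1] [-1] \<longlonglongrightarrow> Lam" using h_lim[OF s1] by simp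
  qed
  have Z2: "euler_sum [2] [1] = zt2"
  proof (rule euler_sum_eqI)
    have "eS [2] [1] = hs2" unfolding eS_Cons eS_Nil by (rule ext) (simp add: hs2_def)
    then show "eS [2] [1] \<longlonglongrightarrow> zt2" using hs2_lim by simp
  qed
  have i1: "eS [1] [1] = hs" unfolding eS_Cons eS_Nil by (rule ext) (simp add: hs_def)
  have i2: "eS [1] [-1] = h" unfolding eS_Cons eS_Nil m1 by (rule ext) (simp add: hE)
  have i3: "eS [1, 1] [1, -1] = aS" unfolding eS_Cons[of 1 "[1]"] i2 by (rule ext) (simp add: aS_def)
  have i4: "eS [1, 1] [-1, -1] = tS" unfolding eS_Cons[of 1 "[1]"] i2 m1 by (rule ext) (simp add: tS_def)
  have d2: "euler_sum [k, 1] [1, 1] = Zs (\<lambda>p. hs (p - 1)) k" if k: "2 \<le> k" for k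
  proof (rule euler_sum_eqI)
    have "eS [k, 1] [1, 1] = (\<lambda>N. \<Sum>p=1..N. hs (p - 1) / real p ^ k)" unfolding eS_Cons[of k "[1]"] i1 by (rule ext) simp
    then show "eS [k, 1] [1, 1] \<longlonglongrightarrow> Zs (\<lambda>p. hs (p - 1)) k" using Zs_lim[of "\<lambda>p. hs (p - 1)", OF b3 k] by (simp only:)
  qed
  have d3: "euler_sum [k, 1] [-1, -1] = Zs (\<lambda>p. s ^ p * h (p - 1)) k" if k: "2 \<le> k" for k
  proof (rule euler_sum_eqI)
    have "eS [k, 1] [-1, -1] = (\<lambda>N. \<Sum>p=1..N. s ^ p * h (p - 1) / real p ^ k)" unfolding eS_Cons[of k "[1]"] i2 m1 by (rule ext) simp
    then show "eS [k, 1] [-1, -1] \<longlonglongrightarrow> Zs (\<lambda>p. s ^ p * h (p - 1)) k" using Zs_lim[of "\<lambda>p. s ^ p * h (p - 1)", OF b4 k] by (simp only:)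
  qed
  have d4: "euler_sum [m + 3, 1, 1] [1, 1, -1] = Zs (\<lambda>p. aS (p - 1)) (m + 3)"
  proof (rule euler_sum_eqI)
    have "eS [m + 3, 1, 1] [1, 1, -1] = (\<lambda>N. \<Sum>p=1..N. aS (p - 1) / real p ^ (m + 3))" unfolding eS_Cons[of "m + 3"] i3 by (rule ext) simp
    then show "eS [m + 3, 1, 1] [1, 1, -1] \<longlonglongrightarrow> Zs (\<lambda>p. aS (p - 1)) (m + 3)" using Zs_lim[of "\<lambda>p. aS (p - 1)", OF b5 u(1)] by (simp only:)
  qed
  have d5: "euler_sum [m + 3, 1, 1] [-1, -1, -1] = Zs (\<lambda>p. s ^ p * tS (p - 1)) (m + 3)"
  proof (rule euler_sum_eqI)
    have "eS [m + 3, 1, 1] [-1, -1, -1] = (\<lambda>N. \<Sum>p=1..N. s ^ p * tS (p - 1) / real p ^ (m + 3))" unfolding eS_Cons[of "m + 3"] i4 m1 by (rule ext) simp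
    then show "eS [m + 3, 1, 1] [-1, -1, -1] \<longlonglongrightarrow> Zs (\<lambda>p. s ^ p * tS (p - 1)) (m + 3)" using Zs_lim[of "\<lambda>p. s ^ p * tS (p - 1)", OF b6 u(1)] by (simp only:)
  qed
  have par: "of_bool (p mod 2 = Suc (length ([]::nat list)) mod 2) * (2::real) = 1 - s ^ p" "of_bool (p mod 2 = Suc (length [x]) mod 2) * (2::real) = 1 + s ^ p" for p x :: nat
    unfolding sev by (simp_all add: odd_iff_mod_2_eq_one even_iff_mod_2_eq_zero)
  have mC: "mS (a # t) N = (\<Sum>p=1..N. of_bool (p mod 2 = Suc (length t) mod 2) * 2 * mS t (p - 1) / real p ^ a)" for a t N
    unfolding mS_Cons by (intro sum.cong refl) simp
  have t1: "mtv [k] = Zs (\<lambda>p. 1 - s ^ p) k" if k: "2 \<le> k" for k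
  proof (rule mtv_eqI)
    have "mS [k] = (\<lambda>N. \<Sum>p=1..N. (1 - s ^ p) / real p ^ k)" unfolding mC mS_Nil par by (rule ext) simp
    then show "mS [k] \<longlonglongrightarrow> Zs (\<lambda>p. 1 - s ^ p) k" using Zs_lim[of "\<lambda>p. 1 - s ^ p", OF b7 k] by (simp only:)
  qed
  have mj: "mS [1] n = hs n - h n" "mS [2] n = hs2 n - h2 n" for n
    unfolding mC mS_Nil par hE hs_def hs2_def h2_def sum_subtractf[symmetric] by (intro sum.cong refl, simp add: diff_divide_distrib)+
  have t2: "mtv [m + 4, 1] = Zs (\<lambda>p. (1 + s ^ p) * (hs (p - 1) - h (p - 1))) (m + 4)"
  proof (rule mtv_eqI)
    have "mS [m + 4, 1] = (\<lambda>N. \<Sum>p=1..N. (1 + s ^ p) * (hs (p - 1) - h (p - 1)) / real p ^ (m + 4))" unfolding mC[of "m + 4"] mj par ..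
    then show "mS [m + 4, 1] \<longlonglongrightarrow> Zs (\<lambda>p. (1 + s ^ p) * (hs (p - 1) - h (p - 1))) (m + 4)" using Zs_lim[of "\<lambda>p. (1 + s ^ p) * (hs (p - 1) - h (p - 1))", OF b8 u(2)] by (simp only:)
  qed
  have t3: "mtv [m + 3, 2] = Zs (\<lambda>p. (1 + s ^ p) * (hs2 (p - 1) - h2 (p - 1))) (m + 3)"
  proof (rule mtv_eqI)
    have "mS [m + 3, 2] = (\<lambda>N. \<Sum>p=1..N. (1 + s ^ p) * (hs2 (p - 1) - h2 (p - 1)) / real p ^ (m + 3))" unfolding mC[of "m + 3"] mj par ..
    then show "mS [m + 3, 2] \<longlonglongrightarrow> Zs (\<lambda>p. (1 + s ^ p) * (hs2 (p - 1) - h2 (p - 1))) (m + 3)" using Zs_lim[of "\<lambda>p. (1 + s ^ p) * (hs2 (p - 1) - h2 (p - 1))", OF b9 u(1)] by (simp only:)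
  qed
  have "(\<lambda>k. (real ((m + 4) choose 3) / 2 + (real m + 2) + 2) * (1 / real (Suc k) ^ (m + 5)) + (2 * real ((m + 3) choose 2) + 2 * (real m + 2)) * (s ^ Suc k / real (Suc k) ^ (m + 5))
    + 4 * ((1 + s ^ Suc k) * (hs (Suc k - 1) - h (Suc k - 1)) / real (Suc k) ^ (m + 4) + (1 + s ^ Suc k) * (hs2 (Suc k - 1) - h2 (Suc k - 1)) / real (Suc k) ^ (m + 3)) - (4 * Lam\<^sup>2 + 2 * zt2) * ((1 - s ^ Suc k) / real (Suc k) ^ (m + 3))
    + 4 * (real m + 2) * (hs (Suc k - 1) / real (Suc k) ^ (m + 4) - s ^ Suc k * h (Suc k - 1) / real (Suc k) ^ (m + 4) - Lam * ((1 - s ^ Suc k) / real (Suc k) ^ (m + 4)))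
    + 8 * (Lam * (hs (Suc k - 1) / real (Suc k) ^ (m + 3) - s ^ Suc k * h (Suc k - 1) / real (Suc k) ^ (m + 3)) - aS (Suc k - 1) / real (Suc k) ^ (m + 3) + s ^ Suc k * tS (Suc k - 1) / real (Suc k) ^ (m + 3)))
    sums ((real ((m + 4) choose 3) / 2 + (real m + 2) + 2) * Zs (\<lambda>p. 1) (m + 5) + (2 * real ((m + 3) choose 2) + 2 * (real m + 2)) * Zs (\<lambda>p. s ^ p) (m + 5)
    + 4 * (Zs (\<lambda>p. (1 + s ^ p) * (hs (p - 1) - h (p - 1))) (m + 4) + Zs (\<lambda>p. (1 + s ^ p) * (hs2 (p - 1) - h2 (p - 1))) (m + 3)) - (4 * Lam\<^sup>2 + 2 * zt2) * Zs (\<lambda>p. 1 - s ^ p) (m + 3)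
    + 4 * (real m + 2) * (Zs (\<lambda>p. hs (p - 1)) (m + 4) - Zs (\<lambda>p. s ^ p * h (p - 1)) (m + 4) - Lam * Zs (\<lambda>p. 1 - s ^ p) (m + 4))
    + 8 * (Lam * (Zs (\<lambda>p. hs (p - 1)) (m + 3) - Zs (\<lambda>p. s ^ p * h (p - 1)) (m + 3)) - Zs (\<lambda>p. aS (p - 1)) (m + 3) + Zs (\<lambda>p. s ^ p * tS (p - 1)) (m + 3)))"
    by (intro sums_add sums_diff sums_mult Zs_sums[of "\<lambda>p. 1", OF b1 u(3)] Zs_sums[of "\<lambda>p. s ^ p", OF b2 u(3)] Zs_sums[of "\<lambda>p. (1 + s ^ p) * (hs (p - 1) - h (p - 1))", OF b8 u(2)]
        Zs_sums[of "\<lambda>p. (1 + s ^ p) * (hs2 (p - 1) - h2 (p - 1))", OF b9 u(1)] Zs_sums[of "\<lambda>p. 1 - s ^ p", OF b7 u(1)] Zs_sums[of "\<lambda>p. 1 - s ^ p", OF b7 u(2)]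
        Zs_sums[of "\<lambda>p. hs (p - 1)", OF b3 u(1)] Zs_sums[of "\<lambda>p. hs (p - 1)", OF b3 u(2)] Zs_sums[of "\<lambda>p. s ^ p * h (p - 1)", OF b4 u(1)] Zs_sums[of "\<lambda>p. s ^ p * h (p - 1)", OF b4 u(2)]
        Zs_sums[of "\<lambda>p. aS (p - 1)", OF b5 u(1)] Zs_sums[of "\<lambda>p. s ^ p * tS (p - 1)", OF b6 u(1)])
  then have S: "(\<lambda>k. co cF dF m (Suc k)) sums ((real ((m + 4) choose 3) / 2 + (real m + 2) + 2) * Zs (\<lambda>p. 1) (m + 5) + (2 * real ((m + 3) choose 2) + 2 * (real m + 2)) * Zs (\<lambda>p. s ^ p) (m + 5)
    + 4 * (Zs (\<lambda>p. (1 + s ^ p) * (hs (p - 1) - h (p - 1))) (m + 4) + Zs (\<lambda>p. (1 + s ^ p) * (hs2 (p - 1) - h2 (p - 1))) (m + 3)) - (4 * Lam\<^sup>2 + 2 * zt2) * Zs (\<lambda>p. 1 - s ^ p) (m + 3)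
    + 4 * (real m + 2) * (Zs (\<lambda>p. hs (p - 1)) (m + 4) - Zs (\<lambda>p. s ^ p * h (p - 1)) (m + 4) - Lam * Zs (\<lambda>p. 1 - s ^ p) (m + 4))
    + 8 * (Lam * (Zs (\<lambda>p. hs (p - 1)) (m + 3) - Zs (\<lambda>p. s ^ p * h (p - 1)) (m + 3)) - Zs (\<lambda>p. aS (p - 1)) (m + 3) + Zs (\<lambda>p. s ^ p * tS (p - 1)) (m + 3)))"
    by (simp only: co_eq[OF le_add1[of 1, unfolded plus_1_eq_Suc]])
  have "(\<Sum>(a, b, c, d)\<in>weight_quads (m + 5). 2 ^ (a + c) * (2 ^ (a - 1) * 3 ^ b - 3 ^ b - 1) * euler_sum [a, b, c, d] [-1, 1, 1, 1]) = 1 * (\<Sum>k\<in>weight_quads (m + 5). cof k * D4 k)"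
    by (rule quads_sum) (use euler_D4[OF g1, of "-1"] m1 in simp)
  then have W: "(\<Sum>(a, b, c, d)\<in>weight_quads (m + 5). 2 ^ (a + c) * (2 ^ (a - 1) * 3 ^ b - 3 ^ b - 1) * euler_sum [a, b, c, d] [-1, 1, 1, 1]) = (\<Sum>k. co cF dF m (Suc k))"
    using coefficients1 by simp
  have A: "real ((m + 4) choose 3) / 2 + (real m + 2) + 2 = (real m + 4) * ((real m + 5)\<^sup>2 - 5 * (real m + 5) + 18) / 12"
  proof -
    have "real ((m + 4) choose 3) = (real m + 4) * (real m + 3) * (real m + 2) / 6" using choose3_real[of "m + 1"] by (simp add: add_ac numeral_eq_Suc)
    then show ?thesis by (simp add: field_simps power2_eq_square)
  qed
  have B: "2 * real ((m + 3) choose 2) + 2 * (real m + 2) = (real m + 5) * (real m + 2)"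
    using choose2_real[of "m + 1"] by (simp add: add_ac numeral_eq_Suc algebra_simps)
  show ?thesis unfolding W sums_unique[OF S, symmetric] v1 v2 L Z2 t1[OF u(1)] t1[OF u(2)] t2 t3 d2[OF u(1)] d2[OF u(2)] d3[OF u(1)] d3[OF u(2)] d4 d5 A B ..
qed

end
end

theorem theorem5p13:
  fixes w v u q :: nat
  assumes "w \<ge> 5" and "v = w - 1" and "u = w - 2" and "q = w - 3"
  shows
    "(\<Sum>(a, b, c, d)\<in>weight_quads w.
        2 ^ (a + c) * (2 ^ (a - 1) * 3 ^ b - 3 ^ b - 1) * euler_sum [a, b, c, d] [1, 1, 1, 1])
      = (2 + (real w - 3) * (real w + 2) * (real w + 7) / 12) * euler_sum [w] [1]
     \<and>
     (\<Sum>(a, b, c, d)\<in>weight_quads w.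
        2 ^ (a + c) * (2 ^ (a - 1) * 3 ^ b - 3 ^ b - 1) * mtv [a, b, c, d])
      = 4 * real (v choose 3) * mtv [w]
     \<and>
     (\<Sum>(a, b, c, d)\<in>weight_quads w.
        2 ^ (a + c) * (2 ^ (a - 1) * 3 ^ b - 3 ^ b - 1) * euler_sum [a, b, c, d] [-1, 1, 1, 1])
      = (real w - 1) * ((real w)\<^sup>2 - 5 * real w + 18) / 12 * euler_sum [w] [1]
        + real w * (real w - 3) * euler_sum [w] [-1]
        + 4 * (mtv [v, 1] + mtv [u, 2])
        - (4 * (euler_sum [1] [-1])\<^sup>2 + 2 * euler_sum [2] [1]) * mtv [u]
        + 4 * real q * (euler_sum [v, 1] [1, 1] - euler_sum [v, 1] [-1, -1]
                        - euler_sum [1] [-1] * mtv [v])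
        + 8 * (euler_sum [1] [-1] * (euler_sum [u, 1] [1, 1] - euler_sum [u, 1] [-1, -1])
               - euler_sum [u, 1, 1] [1, 1, -1] + euler_sum [u, 1, 1] [-1, -1, -1])"
proof -
  define m where "m = w - 5"
  have w: "w = m + 5" "v = m + 4" "u = m + 3" "q = m + 2" using assms by (simp_all add: m_def)
  have r: "real (m + 5) = real m + 5" "real (m + 2) = real m + 2" "real m + 5 - 3 = real m + 2" "real m + 5 + 2 = real m + 7" "real m + 5 + 7 = real m + 12" "real m + 5 - 1 = real m + 4"
    by simp_all
  have g: "sgn_grading 1 1" "sgn_grading 1 (- 1)" "sgn_grading 2 1" unfolding sgn_grading_def by simp_all
  show ?thesis
    using sgn_grading.final_zeta[OF g(1) refl refl, of m] sgn_grading.final_mtv[OF g(3) refl, of m] sgn_grading.final_bar[OF g(2) refl refl, of m]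
    unfolding w r by blast
qed

end
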